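(* Let $\sigma>0$ and suppose that $V(x)=x^{-1}W(1/x)$ for $x\in[1,\infty)$, with $W\in G^{2,\sigma}([0,1])$. Then the scattering resolvent $$R_V(\lambda):=(P_V-\lambda^2)^{-1}:L^2_{\mathrm{comp}}([1,\infty))\to L^2_{\mathrm{loc}}([1,\infty)),\qquad \operatorname{Im}\lambda\gg 1,$$ continues to a meromorphic family of operators with poles of finite rank on $$\mathcal M_\sigma:=\{\lambda\in\mathbb C : \operatorname{Im}\lambda>-\tfrac{\sigma}{2}\}\setminus i(-\infty,0].$$ In particular, when $W\in\gamma^2([0,1])$, the resolvent continues (meromorphically, with poles of finite rank) to $\mathbb C\setminus i(-\infty,0]$.
   Context: Notation: $D_x:=-i\partial_x$. For $a\ge 1$ and $\sigma>0$, the Gevrey class is $$G^{a,\sigma}([0,1]):=\{u\in C^\infty([0,1]) : \exists\, C\ \ \forall n\in\mathbb N,\ \sup_{x\in[0,1]}|D_x^nu(x)|\le C\sigma^{-n}(n!)^a\},$$ and the Beurling--Gevrey class is $\gamma^a([0,1]):=\bigcap_{\sigma>0}G^{a,\sigma}([0,1])$. Functions may be complex valued. For $V\in L^\infty([1,\infty);\mathbb C)$, $P_V:=D_x^2+V(x)$ denotes the operator on $L^2(1,\infty)$ with Dirichlet boundary condition at $x=1$, defined by the quadratic form $Q(u,v)=\langle D_xu,D_xv\rangle_{L^2(1,\infty)}+\langle Vu,v\rangle_{L^2(1,\infty)}$ with form domain $H^1_0(1,\infty)$. For $\operatorname{Im}\lambda$ sufficiently large, $P_V-\lambda^2$ is invertible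 and $R_V(\lambda)=(P_V-\lambda^2)^{-1}:L^2\to L^2$ is the resolvent. $L^2_{\mathrm{comp}}([1,\infty))$ is the space of $L^2$ functions with compact support in $[1,\infty)$ (the support may contain the endpoint $1$), and $L^2_{\mathrm{loc}}([1,\infty))$ is the space of functions that are $L^2$ on every $[1,R]$, $R>1$. *)

theory Defs
  imports "HOL-Analysis.Analysis"
begin

section \<open>Gevrey classes on the unit interval\<close>

text \<open>At the endpoints of an interval \<open>S\<close> the derivatives are one-sided; the values
  of \<open>Dx S u\<close> outside \<open>S\<close> carry no information.\<close>

definition Dx :: "real set \<Rightarrow> (real \<Rightarrow> complex) \<Rightarrow> real \<Rightarrow> complex" where
  "Dx S u = (\<lambda>x. - \<i> * vector_derivative u (at x within S))"

definition smooth_on :: "real set \<Rightarrow> (real \<Rightarrow> complex) \<Rightarrow> bool" where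
  "smooth_on S u \<longleftrightarrow> (\<forall>n. \<forall>x\<in>S. (Dx S ^^ n) u differentiable (at x within S))"

definition gevrey :: "real \<Rightarrow> real \<Rightarrow> (real \<Rightarrow> complex) set" where
  "gevrey a \<sigma> = {u. smooth_on {0..1} u \<and>
     (\<exists>C. \<forall>n. \<forall>x\<in>{0..1}.
        norm ((Dx {0..1} ^^ n) u x) \<le> C * \<sigma> powi (- int n) * fact n powr a)}"

definition beurling_gevrey :: "real \<Rightarrow> (real \<Rightarrow> complex) set" where
  "beurling_gevrey a = (\<Inter>\<sigma>\<in>{0<..}. gevrey a \<sigma>)"


section \<open>Square integrable functions on the half-line\<close>

text \<open>Elements of the Lebesgue spaces are represented by functions, and equality in these
  spaces by equality almost everywhere. Since the point \<open>1\<close> is a null set,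
  \<open>{1..}\<close> also serves for the open half-line.\<close>

definition L2 :: "real set \<Rightarrow> (real \<Rightarrow> complex) set" where
  "L2 S = {f. f \<in> borel_measurable (lebesgue_on S) \<and>
              integrable (lebesgue_on S) (\<lambda>x. (norm (f x))\<^sup>2)}"

definition L2_inner :: "real set \<Rightarrow> (real \<Rightarrow> complex) \<Rightarrow> (real \<Rightarrow> complex) \<Rightarrow> complex" where
  "L2_inner S f g = (LINT x|lebesgue_on S. f x * cnj (g x))"

definition L2_norm :: "real set \<Rightarrow> (real \<Rightarrow> complex) \<Rightarrow> real" where
  "L2_norm S f = sqrt (LINT x|lebesgue_on S. (norm (f x))\<^sup>2)"

definition eq_ae :: "(real \<Rightarrow> complex) \<Rightarrow> (real \<Rightarrow> complex) \<Rightarrow> bool" where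
  "eq_ae f g \<longleftrightarrow> (AE x in lebesgue_on {1..}. f x = g x)"

definition L2_supp :: "real \<Rightarrow> (real \<Rightarrow> complex) set" where
  "L2_supp r = {f \<in> L2 {1..}. AE x in lebesgue_on {1..}. x > r \<longrightarrow> f x = 0}"

definition L2_comp :: "(real \<Rightarrow> complex) set" where
  "L2_comp = (\<Union>r\<in>{1<..}. L2_supp r)"

definition L2_loc :: "(real \<Rightarrow> complex) set" where
  "L2_loc = (\<Inter>r\<in>{1<..}. L2 {1..r})"


section \<open>The Dirichlet Sobolev space on the half-line\<close>

definition test_funs :: "(real \<Rightarrow> complex) set" where
  "test_funs = {\<phi>. smooth_on UNIV \<phi> \<and>
     (\<exists>K. compact K \<and> K \<subseteq> {1<..} \<and> (\<forall>x. x \<notin> K \<longrightarrow> \<phi> x = 0))}"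

text \<open>The operator \<open>Dx\<close> is formally symmetric, so no sign appears in the definition of
  the distributional \<open>Dx\<close>. It is unique up to null sets.\<close>

definition has_weak_Dx :: "(real \<Rightarrow> complex) \<Rightarrow> (real \<Rightarrow> complex) \<Rightarrow> bool" where
  "has_weak_Dx u g \<longleftrightarrow>
     g \<in> L2 {1..} \<and> (\<forall>\<phi>\<in>test_funs. L2_inner {1..} u (Dx UNIV \<phi>) = L2_inner {1..} g \<phi>)"

definition weak_Dx :: "(real \<Rightarrow> complex) \<Rightarrow> real \<Rightarrow> complex" where
  "weak_Dx u = (SOME g. has_weak_Dx u g)"

definition H1 :: "(real \<Rightarrow> complex) set" where
  "H1 = {u \<in> L2 {1..}. \<exists>g. has_weak_Dx u g}"

text \<open>The closure of the test functions in the norm of \<open>H1\<close>.\<close>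

definition H1_0 :: "(real \<Rightarrow> complex) set" where
  "H1_0 = {u \<in> H1. \<forall>\<epsilon>>0. \<exists>\<phi>\<in>test_funs.
     L2_norm {1..} (\<lambda>x. u x - \<phi> x) < \<epsilon> \<and>
     L2_norm {1..} (\<lambda>x. weak_Dx u x - Dx UNIV \<phi> x) < \<epsilon>}"


section \<open>The Dirichlet Schroedinger operator and its resolvent\<close>

definition form_Q ::
    "(real \<Rightarrow> complex) \<Rightarrow> (real \<Rightarrow> complex) \<Rightarrow> (real \<Rightarrow> complex) \<Rightarrow> complex" where
  "form_Q V u v = L2_inner {1..} (weak_Dx u) (weak_Dx v) + L2_inner {1..} (\<lambda>x. V x * u x) v"

text \<open>The graph of \<open>P\<^sub>V\<close>, the operator associated with the form: \<open>u\<close> is in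
  the domain iff \<open>form_Q V u\<close> is represented by some \<open>f\<close> in \<open>L2 {1..}\<close>,
  and then \<open>P\<^sub>V u = f\<close>.\<close>

definition P_graph :: "(real \<Rightarrow> complex) \<Rightarrow> ((real \<Rightarrow> complex) \<times> (real \<Rightarrow> complex)) set" where
  "P_graph V = {(u, f). u \<in> H1_0 \<and> f \<in> L2 {1..} \<and>
     (\<forall>v\<in>H1_0. form_Q V u v = L2_inner {1..} f v)}"

text \<open>\<open>solves V z u f\<close> states that \<open>u\<close> is in the domain of \<open>P\<^sub>V\<close>
  and \<open>(P\<^sub>V - z) u = f\<close>.\<close>

definition solves ::
    "(real \<Rightarrow> complex) \<Rightarrow> complex \<Rightarrow> (real \<Rightarrow> complex) \<Rightarrow> (real \<Rightarrow> complex) \<Rightarrow> bool" where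
  "solves V z u f \<longleftrightarrow> (u, \<lambda>x. f x + z * u x) \<in> P_graph V"

text \<open>\<open>P\<^sub>V - z\<close> is a bijection from its domain onto \<open>L2 {1..}\<close> with bounded inverse.\<close>

definition P_minus_invertible :: "(real \<Rightarrow> complex) \<Rightarrow> complex \<Rightarrow> bool" where
  "P_minus_invertible V z \<longleftrightarrow>
     (\<exists>C. \<forall>f\<in>L2 {1..}. \<exists>u. solves V z u f \<and>
        (\<forall>u'. solves V z u' f \<longrightarrow> eq_ae u' u) \<and>
        L2_norm {1..} u \<le> C * L2_norm {1..} f)"

definition resolvent ::
    "(real \<Rightarrow> complex) \<Rightarrow> complex \<Rightarrow> (real \<Rightarrow> complex) \<Rightarrow> real \<Rightarrow> complex" where
  "resolvent V \<zeta> f = (SOME u. solves V (\<zeta>\<^sup>2) u f)"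


section \<open>Families of operators from compactly supported to local functions\<close>

text \<open>Continuous linear maps \<open>L2_comp \<rightarrow> L2_loc\<close>. Compatibility with equality
  almost everywhere follows from linearity and the bounds.\<close>

definition comp_loc_op :: "((real \<Rightarrow> complex) \<Rightarrow> real \<Rightarrow> complex) \<Rightarrow> bool" where
  "comp_loc_op A \<longleftrightarrow>
     (\<forall>f\<in>L2_comp. A f \<in> L2_loc) \<and>
     (\<forall>f\<in>L2_comp. \<forall>g\<in>L2_comp. \<forall>c.
        eq_ae (A (\<lambda>x. f x + c * g x)) (\<lambda>x. A f x + c * A g x)) \<and>
     (\<forall>r>1. \<exists>C. \<forall>f\<in>L2_supp r. L2_norm {1..r} (A f) \<le> C * L2_norm {1..r} f)"

definition finite_rank :: "((real \<Rightarrow> complex) \<Rightarrow> real \<Rightarrow> complex) \<Rightarrow> bool" where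
  "finite_rank A \<longleftrightarrow>
     (\<exists>B. finite B \<and> B \<subseteq> L2_loc \<and>
        (\<forall>f\<in>L2_comp. \<exists>c. eq_ae (A f) (\<lambda>x. \<Sum>b\<in>B. c b * b x)))"

text \<open>Complex differentiability of the cut-off operators \<open>1\<^bsub>[1,r]\<^esub> A(\<zeta>) 1\<^bsub>[1,r]\<^esub>\<close>
  in the operator norm of \<open>L2 {1..r}\<close>, for every \<open>r\<close>.\<close>

definition holomorphic_family ::
    "(complex \<Rightarrow> (real \<Rightarrow> complex) \<Rightarrow> real \<Rightarrow> complex) \<Rightarrow> complex set \<Rightarrow> bool" where
  "holomorphic_family A U \<longleftrightarrow>
     (\<forall>\<zeta>\<in>U. comp_loc_op (A \<zeta>) \<and>
        (\<exists>A'. comp_loc_op A' \<and>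
           (\<forall>r>1. \<forall>\<epsilon>>0. \<forall>\<^sub>F \<mu> in at \<zeta>. \<forall>f\<in>L2_supp r.
              L2_norm {1..r} (\<lambda>x. (A \<mu> f x - A \<zeta> f x) / (\<mu> - \<zeta>) - A' f x)
                \<le> \<epsilon> * L2_norm {1..r} f)))"

text \<open>Meromorphic with poles of finite rank: around every point there is a Laurent expansion
  with finite principal part whose coefficients have finite rank. As for \<open>meromorphic_on\<close>,
  the value at the centre of the expansion is not constrained.\<close>

definition meromorphic_family ::
    "(complex \<Rightarrow> (real \<Rightarrow> complex) \<Rightarrow> real \<Rightarrow> complex) \<Rightarrow> complex set \<Rightarrow> bool" where
  "meromorphic_family A \<Omega> \<longleftrightarrow>
     (\<forall>\<zeta>\<^sub>0\<in>\<Omega>. \<exists>\<rho>>0. \<exists>J A0 B.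
        holomorphic_family A0 (ball \<zeta>\<^sub>0 \<rho>) \<and>
        (\<forall>j\<in>{1..J::nat}. comp_loc_op (B j) \<and> finite_rank (B j)) \<and>
        (\<forall>\<zeta>\<in>ball \<zeta>\<^sub>0 \<rho> - {\<zeta>\<^sub>0}. \<forall>f\<in>L2_comp.
           eq_ae (A \<zeta> f) (\<lambda>x. A0 \<zeta> f x + (\<Sum>j=1..J. B j f x / (\<zeta> - \<zeta>\<^sub>0) ^ j))))"

definition resolvent_continues_meromorphically ::
    "(real \<Rightarrow> complex) \<Rightarrow> complex set \<Rightarrow> bool" where
  "resolvent_continues_meromorphically V \<Omega> \<longleftrightarrow>
     (\<exists>R. meromorphic_family R \<Omega> \<and>
        (\<exists>b. \<forall>\<zeta>. Im \<zeta> > b \<longrightarrow>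
           \<zeta> \<in> \<Omega> \<and> P_minus_invertible V (\<zeta>\<^sup>2) \<and>
           (\<forall>f\<in>L2_comp. eq_ae (R \<zeta> f) (resolvent V \<zeta> f))))"

definition neg_imag_axis :: "complex set" where
  "neg_imag_axis = {\<zeta>. Re \<zeta> = 0 \<and> Im \<zeta> \<le> 0}"

definition M_region :: "real \<Rightarrow> complex set" where
  "M_region \<sigma> = {\<zeta>. Im \<zeta> > - \<sigma> / 2} - neg_imag_axis"

end

theory Submission
  imports Defs "HOL-Complex_Analysis.Complex_Analysis" "HOL-Real_Asymp.Real_Asymp"
begin

text \<open>Because \<open>W\<close> is of Gevrey class 2, the Borel transform \<open>b\<close> of its Taylor series at \<open>0\<close> converges
  on \<open>[0, \<sigma>)\<close>. For \<open>\<tau> < \<sigma>\<close> the potential is the Laplace transform of a truncation of \<open>b\<close>, up to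
  an error of size \<open>exp (- \<tau> x)\<close>. For a Laplace transform the outgoing solution of
  \<open>- u'' + V u = z\<^sup>2 u\<close> is, up to an explicit factor, again a Laplace transform and is holomorphic in
  \<open>z\<close> off the negative imaginary axis. The exponentially small error is a perturbation that is
  solved away from infinity as long as \<open>- 2 Im z < \<tau>\<close>. Hence the outgoing solution \<open>U\<close> continues
  holomorphically to \<open>M_region \<tau>\<close>.

  High in the upper half-plane \<open>U\<close> is square integrable, and the resolvent is an integral operator
  whose kernel is entire in \<open>z\<close> except for the term \<open>(U' 1 / U 1) s x s y\<close>, where \<open>s\<close> is the solution
  with \<open>s 1 = 0\<close> and \<open>s' 1 = 1\<close>. The quotient \<open>U' 1 / U 1\<close> is meromorphic, and the coefficients of
  the principal part have finite rank because \<open>s x s y\<close> is a product.\<close>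

text \<open>The part \<kappa>/x of the potential is not integrable at infinity and shapes the
  construction: only the factor x to the power \<open>- al z\<close>, with
  \<open>al z = \<i> * \<kappa> / (2 * z)\<close>, leaves an amplitude equation whose zeroth-order
  coefficient is O(1/x^2). The number \<sigma>/2 has another origin: integrating back from infinity
  multiplies the error by a factor of size \<open>exp (- 2 * Im z * x)\<close> up to powers of x,
  and this product has to decay. The Gevrey bounds dominate the Borel series only by a geometric
  series of ratio t/\<sigma>, so \<tau> must stay below \<sigma>; each \<tau> comes with its own
  truncation and its own U, and only the quotients \<open>U' 1 / U 1\<close> can be compared. Since
  V is complex valued, solvability high in the upper half-plane rests on an energy identity and not
  on self-adjointness. Since right-hand sides are merely square integrable, the inhomogeneous
  equation is kept in integrated form, without derivatives almost everywhere.\<close>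

type_synonym cfun = "real \<Rightarrow> complex"

lemmas lint_cong = Bochner_Integration.integral_cong
lemmas integrable_le = Bochner_Integration.integrable_bound

section \<open>Holomorphic parameter integrals and Volterra equations\<close>

text \<open>Cauchy's inequality on small circles turns the majorant \<open>k\<close> of
  \<open>F\<close> itself into the Lipschitz bound \<open>k y / d\<close>, so dominated convergence
  applies to the difference quotients without any hypothesis on the derivative.\<close>

lemma has_field_derivative_integral:
  fixes F :: "complex \<Rightarrow> 'a \<Rightarrow> complex"
  assumes "open U" "z \<in> U" and hol: "\<And>y. y \<in> space M \<Longrightarrow> (\<lambda>z. F z y) holomorphic_on U"
    and meas: "\<And>z. z \<in> U \<Longrightarrow> F z \<in> borel_measurable M"
    and k: "integrable M k" and bound: "\<And>z y. z \<in> U \<Longrightarrow> y \<in> space M \<Longrightarrow> norm (F z y) \<le> k y"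
  shows "((\<lambda>z. LINT y|M. F z y) has_field_derivative (LINT y|M. deriv (\<lambda>z. F z y) z)) (at z)"
proof -
  obtain e where e: "e > 0" "cball z e \<subseteq> U"
    using \<open>open U\<close> \<open>z \<in> U\<close> open_contains_cball by blast
  \<comment> \<open>Halving keeps every closed disc of radius \<open>d\<close> about a point of
    \<open>ball z d\<close> inside \<open>U\<close>.\<close>
  define d where "d = e / 2"
  have d: "d > 0" using e by (simp add: d_def)
  have sub: "cball w d \<subseteq> U" if "w \<in> ball z d" for w
  proof
    fix v assume "v \<in> cball w d"
    then have "dist z v \<le> e"
      using that dist_triangle[of z v w] unfolding d_def mem_ball mem_cball by linarith
    then show "v \<in> U" using e by auto
  qed
  have intF: "integrable M (F w)" if "w \<in> U" for w
    by (rule integrable_le[OF k meas[OF that]])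
      (auto intro!: AE_I2 order_trans[OF bound[OF that] abs_ge_self])
  have lip: "norm (F w y - F z y) \<le> k y / d * norm (w - z)" if w: "w \<in> ball z d" and y: "y \<in> space M" for w y
  proof (rule field_differentiable_bound[where S = "ball z d" and f' = "deriv (\<lambda>z. F z y)"])
    fix v assume v: "v \<in> ball z d"
    have "v \<in> U" using sub[OF v] d by auto
    then show "((\<lambda>z. F z y) has_field_derivative deriv (\<lambda>z. F z y) v) (at v within ball z d)"
      by (rule holomorphic_derivI[OF hol[OF y] \<open>open U\<close>])
    have "norm ((deriv ^^ 1) (\<lambda>z. F z y) v) \<le> fact 1 * k y / d ^ 1"
    proof (rule Cauchy_inequality)
      show "(\<lambda>z. F z y) holomorphic_on ball v d"
        using hol[OF y] sub[OF v] by (meson ball_subset_cball holomorphic_on_subset)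
      show "continuous_on (cball v d) (\<lambda>z. F z y)"
        using hol[OF y] sub[OF v] by (meson holomorphic_on_imp_continuous_on holomorphic_on_subset)
      show "norm (F x y) \<le> k y" if "norm (v - x) = d" for x
        using that sub[OF v] y by (intro bound) (auto simp: dist_norm)
    qed (use d in auto)
    then show "norm (deriv (\<lambda>z. F z y) v) \<le> k y / d" by simp
  qed (use w d in auto)
  have "((\<lambda>w. ((LINT y|M. F w y) - (LINT y|M. F z y)) / (w - z)) \<longlongrightarrow>
      (LINT y|M. deriv (\<lambda>z. F z y) z)) (at z within ball z d)"
    unfolding tendsto_at_iff_sequentially
  proof (intro allI impI)
    fix X assume X: "\<forall>i::nat. X i \<in> ball z d - {z}" "X \<longlonglongrightarrow> z"
    have XU: "X i \<in> U" for i using X(1) sub[of "X i"] d by auto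
    have lim: "(\<lambda>i. (F (X i) y - F z y) / (X i - z)) \<longlonglongrightarrow> deriv (\<lambda>z. F z y) z"
      if "y \<in> space M" for y
    proof -
      have "((\<lambda>z. F z y) has_field_derivative deriv (\<lambda>z. F z y) z) (at z within ball z d)"
        by (rule holomorphic_derivI[OF hol[OF that] \<open>open U\<close> \<open>z \<in> U\<close>])
      then show ?thesis
        using X unfolding has_field_derivative_iff tendsto_at_iff_sequentially
        by (auto simp: o_def)
    qed
    have measq: "(\<lambda>y. (F (X i) y - F z y) / (X i - z)) \<in> borel_measurable M" for i
      using meas[OF XU] meas[OF \<open>z \<in> U\<close>] by measurable
    have "(\<lambda>i. LINT y|M. (F (X i) y - F z y) / (X i - z)) \<longlonglongrightarrow> (LINT y|M. deriv (\<lambda>z. F z y) z)"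
    proof (rule integral_dominated_convergence[where w = "\<lambda>y. k y / d"])
      show "(\<lambda>y. deriv (\<lambda>z. F z y) z) \<in> borel_measurable M"
        by (rule borel_measurable_LIMSEQ_metric[OF measq lim])
      show "AE y in M. norm ((F (X i) y - F z y) / (X i - z)) \<le> k y / d" for i
      proof (rule AE_I2)
        fix y assume y: "y \<in> space M"
        have "norm (X i - z) > 0" using X(1) by auto
        then show "norm ((F (X i) y - F z y) / (X i - z)) \<le> k y / d"
          using lip[of "X i" y] X(1) y by (auto simp: norm_divide divide_le_eq)
      qed
    qed (use lim measq k in auto)
    moreover have "(LINT y|M. (F (X i) y - F z y) / (X i - z)) =
        ((LINT y|M. F (X i) y) - (LINT y|M. F z y)) / (X i - z)" for i
      unfolding Bochner_Integration.integral_diff[OF intF[OF XU] intF[OF \<open>z \<in> U\<close>], symmetric]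
      by (rule integral_divide_zero)
    ultimately show "((\<lambda>w. ((LINT y|M. F w y) - (LINT y|M. F z y)) / (w - z)) \<circ> X) \<longlonglongrightarrow>
        (LINT y|M. deriv (\<lambda>z. F z y) z)"
      by (simp only: o_def)
  qed
  then have "((\<lambda>z. LINT y|M. F z y) has_field_derivative (LINT y|M. deriv (\<lambda>z. F z y) z))
      (at z within ball z d)"
    by (simp add: has_field_derivative_iff)
  then show ?thesis
    unfolding at_within_open[OF centre_in_ball[THEN iffD2, OF d] open_ball] .
qed

lemma holomorphic_on_integral:
  fixes F :: "complex \<Rightarrow> 'a \<Rightarrow> complex"
  assumes "open U" and hol: "\<And>y. y \<in> space M \<Longrightarrow> (\<lambda>z. F z y) holomorphic_on U"
    and meas: "\<And>z. z \<in> U \<Longrightarrow> F z \<in> borel_measurable M"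
    and k: "integrable M k" and bound: "\<And>z y. z \<in> U \<Longrightarrow> y \<in> space M \<Longrightarrow> norm (F z y) \<le> k y"
  shows "(\<lambda>z. LINT y|M. F z y) holomorphic_on U"
  unfolding holomorphic_on_open[OF \<open>open U\<close>]
  using has_field_derivative_integral[OF \<open>open U\<close> _ hol meas k bound] by blast

section \<open>Neumann series for weighted Volterra equations\<close>

definition volterra_iter ::
    "'a measure \<Rightarrow> ('a \<Rightarrow> 'a \<Rightarrow> complex) \<Rightarrow> ('a \<Rightarrow> complex) \<Rightarrow> nat \<Rightarrow> 'a \<Rightarrow> complex" where
  "volterra_iter M K g n = ((\<lambda>f x. LINT y|M. K x y * f y) ^^ n) g"

definition volterra_sol ::
    "'a measure \<Rightarrow> ('a \<Rightarrow> 'a \<Rightarrow> complex) \<Rightarrow> ('a \<Rightarrow> complex) \<Rightarrow> 'a \<Rightarrow> complex" where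
  "volterra_sol M K g x = (\<Sum>n. volterra_iter M K g n x)"

lemma volterra_iter_0 [simp]: "volterra_iter M K g 0 = g"
  and volterra_iter_Suc: "volterra_iter M K g (Suc n) x = (LINT y|M. K x y * volterra_iter M K g n y)"
  by (simp_all add: volterra_iter_def)

text \<open>The weight \<open>w\<close> turns the integral operator into a contraction, so that the Neumann
  series converges geometrically.\<close>

locale volterra = sigma_finite_measure M for M :: "'a measure" +
  fixes K :: "'a \<Rightarrow> 'a \<Rightarrow> complex" and g :: "'a \<Rightarrow> complex"
    and k :: "'a \<Rightarrow> 'a \<Rightarrow> real" and w :: "'a \<Rightarrow> real" and G :: real
  assumes meas_K: "case_prod K \<in> borel_measurable (M \<Otimes>\<^sub>M M)"
    and meas_g: "g \<in> borel_measurable M"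
    and K_bound: "\<And>x y. x \<in> space M \<Longrightarrow> y \<in> space M \<Longrightarrow> norm (K x y) \<le> k x y"
    and k_integrable: "\<And>x. x \<in> space M \<Longrightarrow> integrable M (\<lambda>y. k x y * w y)"
    and k_half: "\<And>x. x \<in> space M \<Longrightarrow> (LINT y|M. k x y * w y) \<le> w x / 2"
    and g_bound: "\<And>x. x \<in> space M \<Longrightarrow> norm (g x) \<le> G * w x"
    and w_nonneg: "\<And>x. x \<in> space M \<Longrightarrow> 0 \<le> w x"
    and G_nonneg: "0 \<le> G"
begin

lemma K_section: "x \<in> space M \<Longrightarrow> K x \<in> borel_measurable M"
  using measurable_Pair2[OF meas_K, of x] by simp

lemma iter_meas: "volterra_iter M K g n \<in> borel_measurable M"
proof (induction n)
  case (Suc n)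
  have [measurable]: "volterra_iter M K g n \<in> borel_measurable M" "case_prod K \<in> borel_measurable (M \<Otimes>\<^sub>M M)"
    using Suc meas_K by auto
  have "(\<lambda>x. LINT y|M. K x y * volterra_iter M K g n y) \<in> borel_measurable M"
    by measurable
  then show ?case by (simp add: volterra_iter_Suc[abs_def])
qed (use meas_g in simp)

text \<open>One application of the kernel halves the constant of a weighted bound. The iterates, the
  convergence of their sum and the holomorphy proof all rest on this estimate; its last part is the
  majorant for parameter integrals.\<close>

lemma product_bound:
  assumes f: "f \<in> borel_measurable M" "\<And>y. y \<in> space M \<Longrightarrow> norm (f y) \<le> c * w y"
    and x: "x \<in> space M" and "0 \<le> c"
  shows "integrable M (\<lambda>y. K x y * f y)" "(LINT y|M. norm (K x y * f y)) \<le> c * w x / 2"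
    "norm (LINT y|M. K x y * f y) \<le> c * w x / 2"
    "\<And>y. y \<in> space M \<Longrightarrow> norm (K x y * f y) \<le> c * (k x y * w y)"
proof -
  show le: "norm (K x y * f y) \<le> c * (k x y * w y)" if "y \<in> space M" for y
  proof -
    have "norm (K x y) * norm (f y) \<le> k x y * (c * w y)"
      by (rule mult_mono[OF K_bound[OF x that] f(2)[OF that] order_trans[OF norm_ge_zero K_bound[OF x that]]
          norm_ge_zero])
    then show ?thesis by (simp add: norm_mult algebra_simps)
  qed
  have int: "integrable M (\<lambda>y. c * (k x y * w y))" using k_integrable[OF x] by simp
  show *: "integrable M (\<lambda>y. K x y * f y)"
    by (rule integrable_le[OF int])
      (use K_section[OF x] f(1) le in \<open>auto intro!: AE_I2 intro: order_trans[OF le abs_ge_self]\<close>)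
  have "(LINT y|M. norm (K x y * f y)) \<le> (LINT y|M. c * (k x y * w y))"
    by (rule integral_mono[OF integrable_norm[OF *] int le])
  also have "\<dots> = c * (LINT y|M. k x y * w y)" by simp
  also have "\<dots> \<le> c * (w x / 2)" using k_half[OF x] \<open>0 \<le> c\<close> by (intro mult_left_mono)
  finally show le2: "(LINT y|M. norm (K x y * f y)) \<le> c * w x / 2" by simp
  show "norm (LINT y|M. K x y * f y) \<le> c * w x / 2"
    using integral_norm_bound[of M "\<lambda>y. K x y * f y"] le2 by linarith
qed

lemma iter_bound: "x \<in> space M \<Longrightarrow> norm (volterra_iter M K g n x) \<le> G * (1/2) ^ n * w x"
proof (induction n arbitrary: x)
  case (Suc n)
  show ?case
    using product_bound(3)[OF iter_meas Suc.IH Suc.prems] G_nonneg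
    by (simp add: volterra_iter_Suc)
qed (use g_bound in simp)

lemma summable_iter: "x \<in> space M \<Longrightarrow> summable (\<lambda>n. norm (volterra_iter M K g n x))"
proof (rule summable_comparison_test')
  show "summable (\<lambda>n. G * (1/2) ^ n * w x)" by (intro summable_mult summable_mult2 summable_divide summable_geometric) simp
  show "norm (norm (volterra_iter M K g n x)) \<le> G * (1/2) ^ n * w x" if "x \<in> space M" "0 \<le> n" for n
    using iter_bound[OF that(1), of n] by (simp add: power_divide field_simps)
qed

lemma sol_meas: "volterra_sol M K g \<in> borel_measurable M"
  unfolding volterra_sol_def[abs_def] using iter_meas by measurable

lemma sol_bound: "x \<in> space M \<Longrightarrow> norm (volterra_sol M K g x) \<le> 2 * G * w x"
proof -
  assume x: "x \<in> space M"
  have s: "(\<lambda>n. G * (1/2) ^ n * w x) sums (G * (1 / (1 - 1/2)) * w x)"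
    by (intro sums_mult sums_mult2 geometric_sums) simp
  have "norm (volterra_sol M K g x) \<le> (\<Sum>n. norm (volterra_iter M K g n x))"
    unfolding volterra_sol_def by (rule summable_norm[OF summable_iter[OF x]])
  also have "\<dots> \<le> (\<Sum>n. G * (1/2) ^ n * w x)"
    by (rule suminf_le[OF iter_bound[OF x] summable_iter[OF x] sums_summable[OF s]])
  finally show ?thesis using sums_unique[OF s] by simp
qed

lemma sol_integrable: "x \<in> space M \<Longrightarrow> integrable M (\<lambda>y. K x y * volterra_sol M K g y)"
  using product_bound(1)[OF sol_meas sol_bound] G_nonneg by simp

text \<open>Sum the recursion of the iterates. Sum and integral may be exchanged because the halving
  bound makes the integrals of the norms summable.\<close>

lemma sol_eq: "x \<in> space M \<Longrightarrow> volterra_sol M K g x = g x + (LINT y|M. K x y * volterra_sol M K g y)"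
proof -
  assume x: "x \<in> space M"
  let ?f = "\<lambda>n y. K x y * volterra_iter M K g n y"
  have int: "integrable M (?f n)" for n
    using product_bound(1)[OF iter_meas iter_bound x] G_nonneg by simp
  have sn: "summable (\<lambda>n. norm (?f n y))" if "y \<in> space M" for y
    using summable_mult[OF summable_iter[OF that], of "norm (K x y)"] by (simp add: norm_mult)
  have "summable (\<lambda>n. LINT y|M. norm (?f n y))"
  proof (rule summable_comparison_test')
    show "summable (\<lambda>n. G * (1/2) ^ n * w x / 2)" by (intro summable_mult summable_mult2 summable_divide summable_geometric) simp
    show "norm (LINT y|M. norm (?f n y)) \<le> G * (1/2) ^ n * w x / 2" for n
      using product_bound(2)[OF iter_meas iter_bound x, of n] G_nonneg by simp
  qed
  then have "(LINT y|M. (\<Sum>n. ?f n y)) = (\<Sum>n. LINT y|M. ?f n y)"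
    using int sn by (intro integral_suminf) auto
  moreover have "(\<Sum>n. ?f n y) = K x y * volterra_sol M K g y" if "y \<in> space M" for y
    unfolding volterra_sol_def by (rule suminf_mult[OF summable_norm_cancel[OF summable_iter[OF that]]])
  then have "(LINT y|M. (\<Sum>n. ?f n y)) = (LINT y|M. K x y * volterra_sol M K g y)"
    by (intro lint_cong refl)
  ultimately have "(LINT y|M. K x y * volterra_sol M K g y) = (\<Sum>n. volterra_iter M K g (Suc n) x)"
    by (simp only: volterra_iter_Suc)
  moreover have "(\<Sum>n. volterra_iter M K g (Suc n) x) = volterra_sol M K g x - g x"
    unfolding volterra_sol_def
    using suminf_split_head[OF summable_norm_cancel[OF summable_iter[OF x]]] by simp
  ultimately show ?thesis by simp
qed

end

text \<open>Since \<open>k\<close>, \<open>w\<close> and \<open>G\<close> do not depend on z, the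
  Neumann series converges uniformly on \<open>U\<close>, and holomorphy passes from the iterates to
  the sum.\<close>

lemma volterra_sol_holomorphic:
  assumes "open U" and v: "\<And>z. z \<in> U \<Longrightarrow> volterra M (K z) (g z) k w G"
    and hK: "\<And>x y. x \<in> space M \<Longrightarrow> y \<in> space M \<Longrightarrow> (\<lambda>z. K z x y) holomorphic_on U"
    and hg: "\<And>x. x \<in> space M \<Longrightarrow> (\<lambda>z. g z x) holomorphic_on U"
    and x: "x \<in> space M"
  shows "(\<lambda>z. volterra_sol M (K z) (g z) x) holomorphic_on U"
proof (cases "U = {}")
  case False
  \<comment> \<open>Integrability of \<open>k\<close> and the sign of \<open>G\<close> are known
    only through an instance of the locale, hence through a point of \<open>U\<close>.\<close>
  then obtain z0 where z0: "z0 \<in> U" by auto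
  have G: "G \<ge> 0" using v[OF z0] by (simp add: volterra_def volterra_axioms_def)
  have iter: "(\<lambda>z. volterra_iter M (K z) (g z) n x) holomorphic_on U" if "x \<in> space M" for n x
    using that
  proof (induction n arbitrary: x)
    case (Suc n)
    have "(\<lambda>z. LINT y|M. K z x y * volterra_iter M (K z) (g z) n y) holomorphic_on U"
    proof (rule holomorphic_on_integral[OF \<open>open U\<close>, where k = "\<lambda>y. G * (1/2) ^ n * (k x y * w y)"])
      fix z assume z: "z \<in> U"
      interpret volterra M "K z" "g z" k w G by (rule v[OF z])
      show "(\<lambda>y. K z x y * volterra_iter M (K z) (g z) n y) \<in> borel_measurable M"
        by (rule borel_measurable_times[OF K_section[OF Suc.prems] iter_meas])
      show "norm (K z x y * volterra_iter M (K z) (g z) n y) \<le> G * (1/2) ^ n * (k x y * w y)"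
        if "y \<in> space M" for y
        by (rule product_bound(4)[OF iter_meas iter_bound Suc.prems _ that]) (simp_all add: G_nonneg)
    next
      interpret volterra M "K z0" "g z0" k w G by (rule v[OF z0])
      show "integrable M (\<lambda>y. G * (1/2) ^ n * (k x y * w y))"
        using k_integrable[OF Suc.prems] by simp
    next
      show "(\<lambda>z. K z x y * volterra_iter M (K z) (g z) n y) holomorphic_on U" if "y \<in> space M" for y
        by (rule holomorphic_on_mult[OF hK[OF Suc.prems that] Suc.IH[OF that]])
    qed
    then show ?case by (simp add: volterra_iter_Suc)
  qed (use hg in simp)
  show ?thesis
  proof (rule holomorphic_uniform_sequence[OF \<open>open U\<close>])
    show "(\<lambda>z. \<Sum>i<n. volterra_iter M (K z) (g z) i x) holomorphic_on U" for n
      by (intro holomorphic_intros iter x)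
    have "uniform_limit U (\<lambda>n z. \<Sum>i<n. volterra_iter M (K z) (g z) i x)
        (\<lambda>z. \<Sum>i. volterra_iter M (K z) (g z) i x) sequentially"
    proof (rule Weierstrass_m_test)
      show "summable (\<lambda>n. G * (1/2) ^ n * w x)" by (intro summable_mult summable_mult2 summable_divide summable_geometric) simp
      show "norm (volterra_iter M (K z) (g z) n x) \<le> G * (1/2) ^ n * w x" if "z \<in> U" for n z
        using volterra.iter_bound[OF v[OF that] x, of n] by simp
    qed
    note ul = this
    show "\<exists>d>0. cball z d \<subseteq> U \<and> uniform_limit (cball z d)
        (\<lambda>n z. \<Sum>i<n. volterra_iter M (K z) (g z) i x) (\<lambda>z. volterra_sol M (K z) (g z) x) sequentially"
      if z: "z \<in> U" for z
    proof -
      obtain d where "d > 0" "cball z d \<subseteq> U"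
        using \<open>open U\<close> z open_contains_cball by blast
      then show ?thesis
        unfolding volterra_sol_def using uniform_limit_on_subset[OF ul] by blast
    qed
  qed
qed (simp add: holomorphic_on_def)

section \<open>Integration on half-lines\<close>

abbreviation half_line :: "real \<Rightarrow> real measure" where
  "half_line a \<equiv> lebesgue_on {a..}"

abbreviation "half_meas \<equiv> borel_measurable (half_line 1)"
abbreviation "half_meas2 \<equiv> borel_measurable (half_line 1 \<Otimes>\<^sub>M half_line 1)"

lemma sigma_finite_lebesgue_on:
  fixes S :: "real set"
  assumes "S \<in> sets lebesgue"
  shows "sigma_finite_measure (lebesgue_on S)"
proof (rule sigma_finite_measure_restrict_space)
  show "sigma_finite_measure (lebesgue :: real measure)"
  proof (rule sigma_finite_measure.intro)
    show "\<exists>A. countable A \<and> A \<subseteq> sets lebesgue \<and> \<Union>A = space lebesgue \<and>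
        (\<forall>a\<in>A. emeasure lebesgue (a :: real set) \<noteq> \<infinity>)"
    proof (intro exI[of _ "range (\<lambda>n. {-real n..real n})"] conjI)
      have "x \<in> (\<Union>n. {-real n..real n})" for x :: real
      proof -
        obtain n where "\<bar>x\<bar> \<le> real n" using real_arch_simple by blast
        then have "x \<in> {-real n..real n}" by auto
        then show ?thesis by blast
      qed
      then show "\<Union> (range (\<lambda>n. {-real n..real n})) = space lebesgue" by auto
      show "countable (range (\<lambda>n. {-real n..real n}))" by (rule countable_image) simp
      show "range (\<lambda>n. {-real n..real n}) \<subseteq> sets lebesgue" by (rule image_subsetI) simp
      show "\<forall>a\<in>range (\<lambda>n. {-real n..real n}). emeasure lebesgue a \<noteq> \<infinity>"
        by (simp add: emeasure_completion)
    qed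
  qed
qed (rule assms)

lemma sigma_finite_half_line: "sigma_finite_measure (half_line a)"
  by (rule sigma_finite_lebesgue_on) simp

lemma borel_measurable_half_line [measurable (raw)]:
  "f \<in> borel_measurable borel \<Longrightarrow> f \<in> borel_measurable (half_line a)"
  by (intro measurable_restrict_space1 measurable_completion) simp

lemma borel_measurable_half_line_pair:
  assumes "f \<in> borel_measurable (borel \<Otimes>\<^sub>M borel)"
  shows "f \<in> borel_measurable (half_line a \<Otimes>\<^sub>M half_line b)"
proof -
  have "(\<lambda>p. (fst p, snd p)) \<in> measurable (half_line a \<Otimes>\<^sub>M half_line b) (borel \<Otimes>\<^sub>M borel)"
    by (intro measurable_Pair measurable_compose[OF measurable_fst] measurable_compose[OF measurable_snd]
        borel_measurable_half_line) auto
  from measurable_compose[OF this assms] show ?thesis by simp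
qed

lemma continuous_borel_measurable_half_line:
  fixes f :: "real \<Rightarrow> 'a::euclidean_space"
  shows "continuous_on {a..} f \<Longrightarrow> f \<in> borel_measurable (half_line a)"
  by (rule continuous_imp_measurable_on_sets_lebesgue) auto

lemma integrable_lebesgue_on_subset:
  fixes f :: "real \<Rightarrow> 'a::euclidean_space"
  assumes "integrable (lebesgue_on T) f" "S \<subseteq> T" "S \<in> sets lebesgue" "T \<in> sets lebesgue"
  shows "integrable (lebesgue_on S) f"
  using set_integrable_subset[of lebesgue T f S] assms
  by (simp add: integrable_restrict_space set_integrable_def)

text \<open>Nonnegativity lets the improper integral be computed as a nonnegative integral, so
  integrability comes out together with the value.\<close>

lemma half_line_FTC:
  fixes f F :: "real \<Rightarrow> real"
  assumes F: "\<And>x. x \<ge> a \<Longrightarrow> (F has_real_derivative f x) (at x)"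
    and f: "continuous_on {a..} f" "\<And>x. x \<ge> a \<Longrightarrow> f x \<ge> 0" and lim: "(F \<longlongrightarrow> T) at_top"
  shows "integrable (half_line a) f" "(LINT x|half_line a. f x) = T - F a"
proof -
  \<comment> \<open>\<open>f\<close> is continuous on the half-line only; extension by
    \<open>0\<close> gives the Borel function on the whole line that the theorem on nonnegative
    integrals asks for.\<close>
  define f' where "f' x = (if x \<in> {a..} then f x else 0)" for x
  have m: "f' \<in> borel_measurable borel"
    unfolding f'_def by (rule borel_measurable_continuous_on_if) (use f in auto)
  have "(\<integral>\<^sup>+x. ennreal (f' x) * indicator {a..} x \<partial>lborel) = ennreal (T - F a)"
    by (rule nn_integral_FTC_atLeast[OF m]) (use F f lim in \<open>auto simp: f'_def\<close>)
  moreover have "(\<integral>\<^sup>+x. ennreal (f x) \<partial>half_line a) = (\<integral>\<^sup>+x. ennreal (f' x) * indicator {a..} x \<partial>lborel)"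
  proof -
    have "(\<integral>\<^sup>+x. ennreal (f x) \<partial>half_line a) = (\<integral>\<^sup>+x. ennreal (f x) * indicator {a..} x \<partial>lebesgue)"
      by (rule nn_integral_restrict_space) simp
    also have "\<dots> = (\<integral>\<^sup>+x. ennreal (f' x) * indicator {a..} x \<partial>lebesgue)"
      by (intro nn_integral_cong) (auto simp: f'_def indicator_def)
    also have "\<dots> = (\<integral>\<^sup>+x. ennreal (f' x) * indicator {a..} x \<partial>lborel)"
      by (rule nn_integral_completion)
    finally show ?thesis .
  qed
  moreover have "T - F a \<ge> 0"
  proof -
    have "F a \<le> F x" if "x \<ge> a" for x
      using F f by (intro DERIV_nonneg_imp_nondecreasing[OF that]) auto
    then have "F a \<le> T"
      by (intro tendsto_lowerbound[OF lim]) (auto simp: eventually_at_top_linorder)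
    then show ?thesis by simp
  qed
  ultimately have "has_bochner_integral (half_line a) f (T - F a)"
    using f by (intro has_bochner_integral_nn_integral continuous_borel_measurable_half_line) (auto intro!: AE_I2)
  then show "integrable (half_line a) f" "(LINT x|half_line a. f x) = T - F a"
    by (auto simp: has_bochner_integral_iff)
qed

text \<open>Volterra kernels live on one fixed measure space and carry the range of integration in
  an if-condition; these equations pass to the space of the actual range.\<close>

lemma half_line_truncate:
  fixes f :: "real \<Rightarrow> 'a::euclidean_space"
  assumes "a \<le> c"
  shows "integrable (half_line a) (\<lambda>y. if c \<le> y \<and> y \<le> x then f y else 0) \<longleftrightarrow> integrable (lebesgue_on {c..x}) f"
    "(LINT y|half_line a. (if c \<le> y \<and> y \<le> x then f y else 0)) = (LINT y|lebesgue_on {c..x}. f y)"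
    "integrable (half_line a) (\<lambda>y. if c \<le> y then f y else 0) \<longleftrightarrow> integrable (half_line c) f"
    "(LINT y|half_line a. (if c \<le> y then f y else 0)) = (LINT y|half_line c. f y)"
proof -
  have 1: "(\<lambda>y. indicator {a..} y *\<^sub>R (if c \<le> y \<and> y \<le> x then f y else 0)) = (\<lambda>y. indicator {c..x} y *\<^sub>R f y)"
    "(\<lambda>y. indicator {a..} y *\<^sub>R (if c \<le> y then f y else 0)) = (\<lambda>y. indicator {c..} y *\<^sub>R f y)"
    using assms by (auto simp: indicator_def fun_eq_iff)
  have 2: "integrable (lebesgue_on S) h \<longleftrightarrow> integrable lebesgue (\<lambda>y. indicator S y *\<^sub>R h y)"
    "(LINT y|lebesgue_on S. h y) = (LINT y|lebesgue. indicator S y *\<^sub>R h y)"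
    if "S \<in> sets lebesgue" for S and h :: "real \<Rightarrow> 'a"
    using that by (auto intro!: integrable_restrict_space integral_restrict_space)
  have 3: "{a..} \<in> sets lebesgue" "{c..} \<in> sets lebesgue" "{c..x} \<in> sets lebesgue" by auto
  show "integrable (half_line a) (\<lambda>y. if c \<le> y \<and> y \<le> x then f y else 0) \<longleftrightarrow> integrable (lebesgue_on {c..x}) f"
    "(LINT y|half_line a. (if c \<le> y \<and> y \<le> x then f y else 0)) = (LINT y|lebesgue_on {c..x}. f y)"
    "integrable (half_line a) (\<lambda>y. if c \<le> y then f y else 0) \<longleftrightarrow> integrable (half_line c) f"
    "(LINT y|half_line a. (if c \<le> y then f y else 0)) = (LINT y|half_line c. f y)"
    unfolding 2[OF 3(1)] 2[OF 3(2)] 2[OF 3(3)] 1 by (rule refl)+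
qed

lemma borel_measurable_half_line_fst_snd [measurable]:
  "fst \<in> borel_measurable (half_line a \<Otimes>\<^sub>M half_line b)"
  "snd \<in> borel_measurable (half_line a \<Otimes>\<^sub>M half_line b)"
  by (rule measurable_compose[OF measurable_fst borel_measurable_half_line]
      measurable_compose[OF measurable_snd borel_measurable_half_line], simp)+

lemma at_within_half_line:
  fixes x :: real
  assumes "x < b"
  shows "at x within {a..} = at x within {a..b}"
  by (rule at_within_nhd[where S = "{..<b}"]) (use assms in auto)

lemma continuous_on_half_line:
  fixes f :: "real \<Rightarrow> 'a::topological_space"
  assumes "\<And>b. a < b \<Longrightarrow> continuous_on {a..b} f"
  shows "continuous_on {a..} f"
  unfolding continuous_on_eq_continuous_within
proof
  fix x assume "x \<in> {a..}"
  then show "continuous (at x within {a..}) f"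
    using assms[of "x + 1"] at_within_half_line[of x "x + 1" a]
    by (simp add: continuous_on_eq_continuous_within)
qed

lemma lebesgue_on_interval_integral:
  fixes f :: "real \<Rightarrow> 'a::euclidean_space"
  assumes "continuous_on {a..b} f"
  shows "integrable (lebesgue_on {a..b}) f" "(LINT x|lebesgue_on {a..b}. f x) = integral {a..b} f"
  using continuous_imp_integrable_real[OF assms] by (auto intro: lebesgue_integral_eq_integral)

lemma half_line_interval_FTC:
  fixes f F :: "real \<Rightarrow> 'a::euclidean_space"
  assumes "a \<le> c" "c \<le> x" and f: "continuous_on {c..x} f"
    and F: "\<And>y. y \<in> {c..x} \<Longrightarrow> (F has_vector_derivative f y) (at y within {c..x})"
  shows "integrable (half_line a) (\<lambda>y. if c \<le> y \<and> y \<le> x then f y else 0)"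
    "(LINT y|half_line a. (if c \<le> y \<and> y \<le> x then f y else 0)) = F x - F c"
  using half_line_truncate(1,2)[OF \<open>a \<le> c\<close>, of x f] lebesgue_on_interval_integral[OF f]
    fundamental_theorem_of_calculus[OF \<open>c \<le> x\<close> F] by (auto intro: integral_unique)

lemma integrable_half_line_bounded:
  fixes f :: cfun
  assumes f: "f \<in> borel_measurable (half_line a)" "\<And>y. a \<le> y \<Longrightarrow> y \<le> b \<Longrightarrow> norm (f y) \<le> B"
  shows "integrable (lebesgue_on {a..b}) f"
proof -
  have "integrable (lebesgue_on {a..b}) (\<lambda>_. B)" by simp
  moreover have "f \<in> borel_measurable (lebesgue_on {a..b})"
    by (rule measurable_restrict_mono[OF f(1)]) auto
  ultimately show ?thesis
    by (rule integrable_le) (use f(2) in \<open>auto intro!: AE_I2 intro: order_trans[OF _ abs_ge_self]\<close>)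
qed

section \<open>Initial value problems for the Schroedinger equation\<close>

text \<open>A Volterra solution is at first only measurable and locally bounded. Splitting
  \<open>x - y\<close> separates the variables and leaves two indefinite integrals, which are
  continuous; this begins the bootstrap to a classical solution.\<close>

lemma double_primitive_continuous:
  fixes F Y :: cfun
  assumes meas: "F \<in> half_meas"
    and bound: "\<And>b. \<exists>B. \<forall>y. 1 \<le> y \<and> y \<le> b \<longrightarrow> norm (F y) \<le> B"
    and Y: "\<And>x. x \<ge> 1 \<Longrightarrow> Y x = a + d * of_real (x - 1) +
        (LINT y|half_line 1. (if y \<le> x then of_real (x - y) * F y else 0))"
  shows "\<And>x. x \<ge> 1 \<Longrightarrow> Y x = a + d * of_real (x - 1) +
        (of_real x * integral {1..x} F - integral {1..x} (\<lambda>y. of_real y * F y))"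
    and "continuous_on {1..} Y"
proof -
  have int: "integrable (lebesgue_on {1..b}) F" "integrable (lebesgue_on {1..b}) (\<lambda>y. of_real y * F y)" for b
  proof -
    obtain B where B: "\<And>y. 1 \<le> y \<Longrightarrow> y \<le> b \<Longrightarrow> norm (F y) \<le> B" using bound by blast
    show "integrable (lebesgue_on {1..b}) F" by (rule integrable_half_line_bounded[OF meas B])
    have m: "(\<lambda>y. of_real y * F y) \<in> half_meas"
      by (intro borel_measurable_times meas borel_measurable_half_line) simp
    show "integrable (lebesgue_on {1..b}) (\<lambda>y. of_real y * F y)"
    proof (rule integrable_half_line_bounded[OF m, where B = "\<bar>b\<bar> * B"])
      fix y :: real assume y: "1 \<le> y" "y \<le> b"
      have "\<bar>y\<bar> * norm (F y) \<le> \<bar>b\<bar> * B" using y B[OF y] by (intro mult_mono) auto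
      then show "norm (of_real y * F y) \<le> \<bar>b\<bar> * B" by (simp add: norm_mult)
    qed
  qed
  show eq: "Y x = a + d * of_real (x - 1) +
        (of_real x * integral {1..x} F - integral {1..x} (\<lambda>y. of_real y * F y))" if "x \<ge> 1" for x
  proof -
    have "(LINT y|half_line 1. (if y \<le> x then of_real (x - y) * F y else 0)) =
        (LINT y|half_line 1. (if 1 \<le> y \<and> y \<le> x then of_real (x - y) * F y else 0))"
      by (intro lint_cong refl) simp
    also have "\<dots> = (LINT y|lebesgue_on {1..x}. of_real (x - y) * F y)"
      by (rule half_line_truncate) simp
    also have "\<dots> = (LINT y|lebesgue_on {1..x}. of_real x * F y - of_real y * F y)"
      by (simp add: algebra_simps)
    also have "\<dots> = of_real x * integral {1..x} F - integral {1..x} (\<lambda>y. of_real y * F y)"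
      using int[of x] by (simp add: lebesgue_integral_eq_integral)
    finally show ?thesis using Y[OF that] by simp
  qed
  have "continuous_on {1..b} Y" if "1 < b" for b
  proof -
    have hk: "F integrable_on {1..b}" "(\<lambda>y. of_real y * F y) integrable_on {1..b}"
      using int[of b] by (auto intro: integrable_on_lebesgue_on)
    have "continuous_on {1..b} (\<lambda>x. a + d * of_real (x - 1) +
        (of_real x * integral {1..x} F - integral {1..x} (\<lambda>y. of_real y * F y)))"
      by (intro continuous_intros indefinite_integral_continuous_1 hk)
    then show ?thesis by (rule continuous_on_eq) (simp add: eq)
  qed
  then show "continuous_on {1..} Y" by (rule continuous_on_half_line)
qed

lemma integral_has_vector_derivative_half_line:
  fixes F :: cfun
  assumes "continuous_on {a..} F" "x \<ge> a"
  shows "((\<lambda>x. integral {a..x} F) has_vector_derivative F x) (at x within {a..})"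
  unfolding at_within_half_line[of x "x + 1" a, simplified]
  by (rule integral_has_vector_derivative)
    (use assms in \<open>auto intro: continuous_on_subset\<close>)

text \<open>Second half of the bootstrap: with \<open>F\<close> continuous both indefinite integrals
  are differentiable, and the two terms \<open>of_real x * F x\<close> in the derivative
  cancel.\<close>

lemma double_primitive_derivatives:
  fixes F Y :: cfun
  assumes F: "continuous_on {1..} F"
    and Y: "\<And>x. x \<ge> 1 \<Longrightarrow> Y x = a + d * of_real (x - 1) +
        (of_real x * integral {1..x} F - integral {1..x} (\<lambda>y. of_real y * F y))"
    and x: "x \<ge> 1"
  shows "(Y has_vector_derivative d + integral {1..x} F) (at x within {1..})"
    and "((\<lambda>x. d + integral {1..x} F) has_vector_derivative F x) (at x within {1..})"
proof -
  have F': "continuous_on {1..} (\<lambda>y. of_real y * F y)" by (intro continuous_intros F)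
  have "((\<lambda>x. a + d * of_real (x - 1) +
        (of_real x * integral {1..x} F - integral {1..x} (\<lambda>y. of_real y * F y)))
        has_vector_derivative d + integral {1..x} F) (at x within {1..})"
    by (rule derivative_eq_intros integral_has_vector_derivative_half_line F F' x refl
        has_vector_derivative_of_real DERIV_ident | simp add: algebra_simps)+
  then show "(Y has_vector_derivative d + integral {1..x} F) (at x within {1..})"
    by (rule has_vector_derivative_transform[rotated 2]) (use x Y in auto)
  show "((\<lambda>x. d + integral {1..x} F) has_vector_derivative F x) (at x within {1..})"
    by (rule derivative_eq_intros integral_has_vector_derivative_half_line F x refl | simp)+
qed

text \<open>The equation \<open>- u'' + V u = z u\<close> as a first-order system, with a one-sided
  derivative at \<open>1\<close>. The parameter is the energy, so a frequency z enters as
  \<open>z\<^sup>2\<close>.\<close>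

definition schroedinger_sol ::
    "cfun \<Rightarrow> complex \<Rightarrow> cfun \<Rightarrow> cfun \<Rightarrow> bool" where
  "schroedinger_sol V z u u' \<longleftrightarrow>
     (\<forall>x\<ge>1. (u has_vector_derivative u' x) (at x within {1..}) \<and>
        (u' has_vector_derivative (V x - z) * u x) (at x within {1..}))"

lemma schroedinger_sol_continuous:
  assumes "schroedinger_sol V z u u'"
  shows "continuous_on {1..} u" "continuous_on {1..} u'"
  using assms unfolding schroedinger_sol_def continuous_on_eq_continuous_within
  by (auto intro: has_vector_derivative_continuous)

lemma wronskian_constant:
  assumes u: "schroedinger_sol V z u u'" and v: "schroedinger_sol V z v v'" and x: "x \<ge> 1"
  shows "u x * v' x - u' x * v x = u 1 * v' 1 - u' 1 * v 1"
proof -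
  have "((\<lambda>x. u x * v' x - u' x * v x) has_vector_derivative 0) (at y within {1..})" if "y \<in> {1..}" for y
  proof -
    have d: "(u has_vector_derivative u' y) (at y within {1..})"
      "(u' has_vector_derivative (V y - z) * u y) (at y within {1..})"
      "(v has_vector_derivative v' y) (at y within {1..})"
      "(v' has_vector_derivative (V y - z) * v y) (at y within {1..})"
      using u v that by (auto simp: schroedinger_sol_def)
    show ?thesis
      by (rule derivative_eq_intros d refl | simp add: algebra_simps)+
  qed
  then obtain c where "\<And>y. y \<in> {1..} \<Longrightarrow> u y * v' y - u' y * v y = c"
    using has_vector_derivative_zero_constant[of "{1..}" "\<lambda>x. u x * v' x - u' x * v x"]
    by (metis convex_real_interval(1))
  then show ?thesis using x by simp
qed

section \<open>Entire fundamental solutions for a bounded potential\<close>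

locale bounded_potential =
  fixes V :: cfun and Vm :: real
  assumes continuous_V: "continuous_on {1..} V" and V_bound: "x \<ge> 1 \<Longrightarrow> norm (V x) \<le> Vm"
begin

lemma Vm_nonneg: "Vm \<ge> 0" using V_bound[of 1] norm_ge_zero[of "V 1"] by linarith

lemma V_meas [measurable]: "V \<in> half_meas"
  by (rule continuous_borel_measurable_half_line[OF continuous_V])

text \<open>Integrating \<open>u'' = (V - z\<^sup>2) u\<close> twice from \<open>1\<close> and
  exchanging the integrals produces the factor \<open>x - y\<close>.\<close>

definition ivp_kernel :: "complex \<Rightarrow> real \<Rightarrow> cfun" where
  "ivp_kernel z x y = (if y \<le> x then of_real (x - y) * (V y - z\<^sup>2) else 0)"

definition ivp_sol :: "complex \<Rightarrow> complex \<Rightarrow> complex \<Rightarrow> cfun" where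
  "ivp_sol a d z = volterra_sol (half_line 1) (ivp_kernel z) (\<lambda>x. a + d * of_real (x - 1))"

definition ivp_deriv :: "complex \<Rightarrow> complex \<Rightarrow> complex \<Rightarrow> cfun" where
  "ivp_deriv a d z x = d + integral {1..x} (\<lambda>y. (V y - z\<^sup>2) * ivp_sol a d z y)"

text \<open>The inequality \<open>x - y \<le> exp (x - y)\<close> makes the majorant exponential. In
  the rate \<open>1 + 2 * Q\<close> of the weight, the \<open>1\<close> balances this exponential,
  and integrating \<open>exp (2 * Q * y)\<close> gains \<open>1 / (2 * Q)\<close>, which is the
  required factor one half. The bounds depend on z only through \<open>R\<close>, as holomorphy
  requires.\<close>

lemma ivp_volterra:
  assumes "norm z \<le> R"
  shows "volterra (half_line 1) (ivp_kernel z) (\<lambda>x. a + d * of_real (x - 1))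
    (\<lambda>x y. if 1 \<le> y \<and> y \<le> x then exp (x - y) * (Vm + R\<^sup>2 + 1) else 0)
    (\<lambda>x. exp ((1 + 2 * (Vm + R\<^sup>2 + 1)) * x)) (norm a + norm d)"
proof -
  define Q where "Q = Vm + R\<^sup>2 + 1"
  have Q: "Q > 0" using Vm_nonneg by (simp add: Q_def add_nonneg_pos)
  interpret sigma_finite_measure "half_line 1" by (rule sigma_finite_half_line)
  have exp_le: "x - y \<le> exp (x - y)" for x y :: real
    using exp_ge_add_one_self[of "x - y"] by linarith
  have "volterra_axioms (half_line 1) (ivp_kernel z) (\<lambda>x. a + d * of_real (x - 1))
    (\<lambda>x y. if 1 \<le> y \<and> y \<le> x then exp (x - y) * Q else 0)
    (\<lambda>x. exp ((1 + 2 * Q) * x)) (norm a + norm d)"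
  proof (unfold_locales, goal_cases)
    case 1
    show ?case unfolding ivp_kernel_def[abs_def] by measurable
  next
    case 2
    show ?case by (rule borel_measurable_half_line) simp
  next
    case (3 x y)
    have "norm (V y - z\<^sup>2) \<le> Q"
    proof -
      have "norm (V y - z\<^sup>2) \<le> norm (V y) + norm z ^ 2"
        by (metis norm_triangle_ineq4 norm_power)
      also have "\<dots> \<le> Vm + R\<^sup>2"
        using V_bound[of y] 3 assms by (intro add_mono power_mono) auto
      finally show ?thesis by (simp add: Q_def)
    qed
    moreover have "norm (complex_of_real (x - y)) \<le> exp (x - y)" if "y \<le> x"
      using exp_le[of x y] that unfolding norm_of_real by simp
    ultimately show ?case using 3 unfolding ivp_kernel_def
      by (auto simp: norm_mult intro!: mult_mono simp del: of_real_diff)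
  next
    case (4 x)
    have "integrable (half_line 1) (\<lambda>y. if 1 \<le> y \<and> y \<le> x then exp (x - y) * Q * exp ((1 + 2 * Q) * y) else 0)"
      unfolding half_line_truncate(1)[OF order_refl]
      by (intro lebesgue_on_interval_integral(1) continuous_intros)
    then show ?case by (rule back_subst[of "integrable _"]) auto
  next
    case (5 x)
    then have x: "1 \<le> x" by simp
    have e: "exp (x - y) * Q * exp ((1 + 2 * Q) * y) = Q * exp (x + 2 * Q * y)" for y
      by (simp add: exp_add[symmetric] algebra_simps)
    have "(LINT y|half_line 1. (if 1 \<le> y \<and> y \<le> x then exp (x - y) * Q else 0) * exp ((1 + 2 * Q) * y))
        = (LINT y|half_line 1. (if 1 \<le> y \<and> y \<le> x then Q * exp (x + 2 * Q * y) else 0))"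
      using e by (intro lint_cong refl) auto
    also have "\<dots> = exp (x + 2 * Q * x) / 2 - exp (x + 2 * Q * 1) / 2"
    proof (rule half_line_interval_FTC(2)[where F = "\<lambda>y. exp (x + 2 * Q * y) / 2"])
      fix y
      show "((\<lambda>y. exp (x + 2 * Q * y) / 2) has_vector_derivative Q * exp (x + 2 * Q * y)) (at y within {1..x})"
        unfolding has_real_derivative_iff_has_vector_derivative[symmetric]
        by (rule derivative_eq_intros refl | simp)+
    qed (auto intro!: continuous_intros x)
    also have "\<dots> \<le> exp ((1 + 2 * Q) * x) / 2" by (simp add: algebra_simps)
    finally show ?case .
  next
    case (6 x)
    then have x: "x \<ge> 1" by simp
    have "1 \<le> exp ((1 + 2 * Q) * x)" using x Q by simp
    moreover have "x - 1 \<le> exp ((1 + 2 * Q) * x)"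
    proof -
      have "x \<le> (1 + 2 * Q) * x" using x Q by simp
      then show ?thesis using exp_ge_add_one_self[of "(1 + 2 * Q) * x"] by linarith
    qed
    ultimately have "norm a * 1 + norm d * (x - 1) \<le> norm a * exp ((1 + 2 * Q) * x) + norm d * exp ((1 + 2 * Q) * x)"
      by (intro add_mono mult_left_mono) auto
    moreover have "norm (a + d * of_real (x - 1)) \<le> norm a + norm d * (x - 1)"
      using norm_triangle_ineq[of a "d * of_real (x - 1)"] x unfolding norm_mult norm_of_real by simp
    ultimately show ?case by (simp add: algebra_simps)
  qed (auto simp: add_nonneg_nonneg)
  then show ?thesis
    unfolding Q_def[symmetric] by (intro volterra.intro sigma_finite_half_line)
qed

lemma ivp_sol_bound:
  assumes "norm z \<le> R" "x \<ge> 1"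
  shows "norm (ivp_sol a d z x) \<le> 2 * (norm a + norm d) * exp ((1 + 2 * (Vm + R\<^sup>2 + 1)) * x)"
  using volterra.sol_bound[OF ivp_volterra[OF assms(1)], of x a d] assms(2)
  by (simp add: ivp_sol_def)

text \<open>The weight depends on a bound for \<open>norm z\<close>, so the general result applies
  on each disc about \<open>0\<close>; the discs exhaust the plane.\<close>

lemma ivp_sol_holomorphic:
  assumes "x \<ge> 1"
  shows "(\<lambda>z. ivp_sol a d z x) holomorphic_on U"
proof -
  have "(\<lambda>z. ivp_sol a d z x) holomorphic_on ball 0 R" for R
    unfolding ivp_sol_def
  proof (rule volterra_sol_holomorphic[OF open_ball])
    show "volterra (half_line 1) (ivp_kernel z) (\<lambda>x. a + d * of_real (x - 1))
      (\<lambda>x y. if 1 \<le> y \<and> y \<le> x then exp (x - y) * (Vm + R\<^sup>2 + 1) else 0)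
      (\<lambda>x. exp ((1 + 2 * (Vm + R\<^sup>2 + 1)) * x)) (norm a + norm d)" if "z \<in> ball 0 R" for z
      by (rule ivp_volterra) (use that in auto)
    show "(\<lambda>z. ivp_kernel z x y) holomorphic_on ball 0 R" for x y
      by (cases "y \<le> x") (auto simp: ivp_kernel_def[abs_def] intro!: holomorphic_intros)
  qed (use assms in \<open>auto intro!: holomorphic_intros\<close>)
  then have "\<exists>f'. ((\<lambda>z. ivp_sol a d z x) has_field_derivative f') (at z)" for z
    using holomorphic_on_open[OF open_ball, THEN iffD1, rule_format, of _ 0 "norm z + 1" z] by simp
  then have "(\<lambda>z. ivp_sol a d z x) holomorphic_on UNIV"
    by (simp add: holomorphic_on_open)
  then show ?thesis by (rule holomorphic_on_subset) simp
qed

lemma ivp_sol_schroedinger: "schroedinger_sol V (z\<^sup>2) (ivp_sol a d z) (ivp_deriv a d z)"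
proof -
  interpret volterra "half_line 1" "ivp_kernel z" "\<lambda>x. a + d * of_real (x - 1)"
    "\<lambda>x y. if 1 \<le> y \<and> y \<le> x then exp (x - y) * (Vm + (norm z)\<^sup>2 + 1) else 0"
    "\<lambda>x. exp ((1 + 2 * (Vm + (norm z)\<^sup>2 + 1)) * x)" "norm a + norm d"
    by (rule ivp_volterra) simp
  let ?F = "\<lambda>y. (V y - z\<^sup>2) * ivp_sol a d z y"
  have meas: "?F \<in> half_meas"
    using sol_meas unfolding ivp_sol_def[symmetric] by measurable
  have bnd: "\<exists>B. \<forall>y. 1 \<le> y \<and> y \<le> b \<longrightarrow> norm (?F y) \<le> B" for b
  proof (intro exI allI impI)
    fix y assume y: "1 \<le> y \<and> y \<le> b"
    have "norm (V y - z\<^sup>2) \<le> Vm + norm z ^ 2"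
      using norm_triangle_ineq4[of "V y" "z\<^sup>2"] V_bound[of y] y by (simp add: norm_power)
    moreover have "norm (ivp_sol a d z y) \<le> 2 * (norm a + norm d) * exp ((1 + 2 * (Vm + (norm z)\<^sup>2 + 1)) * b)"
      using y Vm_nonneg by (intro order_trans[OF ivp_sol_bound[OF order_refl]] mult_left_mono)
        (auto intro!: mult_left_mono simp: add_nonneg_nonneg)
    ultimately show "norm (?F y) \<le> (Vm + norm z ^ 2) *
        (2 * (norm a + norm d) * exp ((1 + 2 * (Vm + (norm z)\<^sup>2 + 1)) * b))"
      unfolding norm_mult using Vm_nonneg by (intro mult_mono) auto
  qed
  have eq: "ivp_sol a d z x = a + d * of_real (x - 1) +
      (LINT y|half_line 1. (if y \<le> x then of_real (x - y) * ?F y else 0))" if "x \<ge> 1" for x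
  proof -
    have "(LINT y|half_line 1. ivp_kernel z x y * ivp_sol a d z y) =
      (LINT y|half_line 1. (if y \<le> x then of_real (x - y) * ?F y else 0))"
      by (intro lint_cong refl) (simp add: ivp_kernel_def)
    then show ?thesis using sol_eq[of x] that by (simp add: ivp_sol_def)
  qed
  note * = double_primitive_continuous[OF meas bnd eq]
  have cont: "continuous_on {1..} ?F" by (intro continuous_intros continuous_V *(2))
  show ?thesis
    unfolding schroedinger_sol_def ivp_deriv_def[abs_def]
    using double_primitive_derivatives[OF cont *(1)] by blast
qed

lemma ivp_initial: "ivp_sol a d z 1 = a" "ivp_deriv a d z 1 = d"
proof -
  interpret volterra "half_line 1" "ivp_kernel z" "\<lambda>x. a + d * of_real (x - 1)"
    "\<lambda>x y. if 1 \<le> y \<and> y \<le> x then exp (x - y) * (Vm + (norm z)\<^sup>2 + 1) else 0"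
    "\<lambda>x. exp ((1 + 2 * (Vm + (norm z)\<^sup>2 + 1)) * x)" "norm a + norm d"
    by (rule ivp_volterra) simp
  \<comment> \<open>The only point of the half-line with \<open>y \<le> 1\<close> is
    \<open>1\<close>, and there the factor \<open>x - y\<close> is \<open>0\<close>.\<close>
  have "(LINT y|half_line 1. ivp_kernel z 1 y * ivp_sol a d z y) = (LINT y|half_line 1. 0)"
    by (intro lint_cong refl) (auto simp: ivp_kernel_def)
  then show "ivp_sol a d z 1 = a" using sol_eq[of 1] by (simp add: ivp_sol_def)
  show "ivp_deriv a d z 1 = d" by (simp add: ivp_deriv_def)
qed

text \<open>The fundamental system at \<open>1\<close>; for vanishing V and nonzero z these are
  \<open>sin (z * (x - 1)) / z\<close> and \<open>cos (z * (x - 1))\<close>.\<close>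

abbreviation "sine \<equiv> ivp_sol 0 1"
abbreviation "sine' \<equiv> ivp_deriv 0 1"
abbreviation "cosine \<equiv> ivp_sol 1 0"
abbreviation "cosine' \<equiv> ivp_deriv 1 0"

lemma sine_cosine_wronskian:
  "x \<ge> 1 \<Longrightarrow> sine' z x * cosine z x - sine z x * cosine' z x = 1"
  using wronskian_constant[OF ivp_sol_schroedinger[of z 1 0] ivp_sol_schroedinger[of z 0 1]]
  by (simp add: ivp_initial algebra_simps)

text \<open>Cramer's rule: the Wronskians of \<open>u\<close> with the two basis solutions are
  constant and can be read off at \<open>1\<close>, and the Wronskian of the basis is
  \<open>1\<close>.\<close>

lemma sine_cosine_span:
  assumes u: "schroedinger_sol V (z\<^sup>2) u u'" and x: "x \<ge> 1"
  shows "u x = u 1 * cosine z x + u' 1 * sine z x" "u' x = u 1 * cosine' z x + u' 1 * sine' z x"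
proof -
  have a: "u x * sine' z x - u' x * sine z x = u 1"
    using wronskian_constant[OF u ivp_sol_schroedinger[of z 0 1] x] by (simp add: ivp_initial)
  have b: "u x * cosine' z x - u' x * cosine z x = - u' 1"
    using wronskian_constant[OF u ivp_sol_schroedinger[of z 1 0] x] by (simp add: ivp_initial)
  have w: "sine' z x * cosine z x - sine z x * cosine' z x = 1" by (rule sine_cosine_wronskian[OF x])
  have "u x = u x * (sine' z x * cosine z x - sine z x * cosine' z x)" using w by simp
  also have "\<dots> = (u x * sine' z x - u' x * sine z x) * cosine z x
      - (u x * cosine' z x - u' x * cosine z x) * sine z x" by (simp add: algebra_simps)
  finally show "u x = u 1 * cosine z x + u' 1 * sine z x" unfolding a b by simp
  have "u' x = u' x * (sine' z x * cosine z x - sine z x * cosine' z x)" using w by simp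
  also have "\<dots> = (u x * sine' z x - u' x * sine z x) * cosine' z x
      - (u x * cosine' z x - u' x * cosine z x) * sine' z x" by (simp add: algebra_simps)
  finally show "u' x = u 1 * cosine' z x + u' 1 * sine' z x" unfolding a b by simp
qed

end

section \<open>Gevrey functions as truncated Laplace transforms\<close>

text \<open>A weak Stirling bound, sharp up to polynomial factors. The induction step is
  \<open>exp 1 \<le> ((m + 1) / m) ^ (m + 1)\<close>, a consequence of
  \<open>ln y \<le> y - 1\<close>. It evaluates the error of the asymptotic expansion at its best
  order.\<close>

lemma fact_upper_bound: "(fact n :: real) \<le> exp 1 * (real n + 1) * (real n / exp 1) ^ n"
proof -
  have *: "(fact (Suc n) :: real) \<le> exp 1 * real (Suc n) * (real (Suc n) / exp 1) ^ Suc n" for n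
  proof (induction n)
    case (Suc n)
    define m where "m = real (Suc n)"
    have m: "m > 0" by (simp add: m_def)
    have "ln (m / (m + 1)) \<le> m / (m + 1) - 1" by (rule ln_le_minus_one) (use m in simp)
    then have "1 / (m + 1) \<le> ln ((m + 1) / m)" using m by (simp add: ln_div field_simps)
    then have "1 \<le> real (Suc (Suc n)) * ln ((m + 1) / m)"
      using m by (simp add: m_def field_simps)
    then have "exp 1 \<le> exp (real (Suc (Suc n)) * ln ((m + 1) / m))" by simp
    also have "\<dots> = ((m + 1) / m) ^ Suc (Suc n)"
      using m by (subst exp_of_nat_mult) simp
    finally have "exp 1 * m ^ Suc (Suc n) \<le> (m + 1) ^ Suc (Suc n)"
      using m by (simp add: power_divide field_simps)
    then have "m * (m / exp 1) ^ Suc n \<le> ((m + 1) / exp 1) ^ Suc (Suc n)"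
      by (simp add: power_divide field_simps)
    then have "(m + 1) * (exp 1 * (m * (m / exp 1) ^ Suc n)) \<le>
        (m + 1) * (exp 1 * ((m + 1) / exp 1) ^ Suc (Suc n))"
      using m by (intro mult_left_mono) auto
    moreover have "(fact (Suc (Suc n)) :: real) \<le> (m + 1) * (exp 1 * m * (m / exp 1) ^ Suc n)"
      using Suc m by (subst fact_Suc) (auto simp: m_def add.commute simp del: fact_Suc intro!: mult_left_mono)
    ultimately show ?case by (simp add: m_def algebra_simps)
  qed simp
  show ?thesis
  proof (cases n)
    case (Suc k)
    have "exp 1 * real (Suc k) * (real (Suc k) / exp 1) ^ Suc k
        \<le> exp 1 * (real (Suc k) + 1) * (real (Suc k) / exp 1) ^ Suc k"
      by (intro mult_right_mono mult_left_mono) auto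
    with *[of k] show ?thesis unfolding Suc by linarith
  qed simp
qed

text \<open>Integration by parts carried out on primitives: the induction yields one that vanishes
  at infinity, so its value at \<open>0\<close> is minus the integral, and integrability comes with
  it.\<close>

lemma gamma_half_line:
  assumes x: "x > (0::real)"
  shows "integrable (half_line 0) (\<lambda>t. t ^ k * exp (- (x * t)))"
    "(LINT t|half_line 0. t ^ k * exp (- (x * t))) = fact k / x ^ (k + 1)"
proof -
  have lim: "((\<lambda>t. t ^ j * exp (- (x * t))) \<longlongrightarrow> 0) at_top" for j
  proof -
    have "filterlim (\<lambda>t. x * t) at_top at_top"
      by (rule filterlim_tendsto_pos_mult_at_top[OF tendsto_const x filterlim_ident])
    from filterlim_compose[OF tendsto_power_div_exp_0 this]
    have "((\<lambda>t. (1 / x ^ j) * ((x * t) ^ j / exp (x * t))) \<longlongrightarrow> (1 / x ^ j) * 0) at_top"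
      by (intro tendsto_mult tendsto_const)
    moreover have "(\<lambda>t. (1 / x ^ j) * ((x * t) ^ j / exp (x * t))) = (\<lambda>t. t ^ j * exp (- (x * t)))"
      using x by (simp add: power_mult_distrib exp_minus field_simps)
    ultimately show ?thesis by simp
  qed
  have "\<exists>F. (\<forall>t. (F has_real_derivative t ^ k * exp (- (x * t))) (at t)) \<and> (F \<longlongrightarrow> 0) at_top \<and>
      F 0 = - (fact k / x ^ (k + 1))"
  proof (induction k)
    case 0
    have "((\<lambda>t. - (exp (- (x * t)) / x)) has_real_derivative t ^ 0 * exp (- (x * t))) (at t)" for t
      using x by (auto intro!: derivative_eq_intros)
    moreover have "((\<lambda>t. - (exp (- (x * t)) / x)) \<longlongrightarrow> - (0 / x)) at_top"
      by (intro tendsto_minus tendsto_divide tendsto_const) (use lim[of 0] x in auto)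
    ultimately show ?case by (intro exI[of _ "\<lambda>t. - (exp (- (x * t)) / x)"]) auto
  next
    case (Suc k)
    then obtain F where F: "\<And>t. (F has_real_derivative t ^ k * exp (- (x * t))) (at t)"
      "(F \<longlongrightarrow> 0) at_top" "F 0 = - (fact k / x ^ (k + 1))" by blast
    let ?G = "\<lambda>t. - (t ^ Suc k * exp (- (x * t)) / x) + real (Suc k) / x * F t"
    have "(?G has_real_derivative t ^ Suc k * exp (- (x * t))) (at t)" for t
      using x by (auto intro!: derivative_eq_intros F(1) simp: field_simps) (cases k; simp)
    moreover have "(?G \<longlongrightarrow> - (0 / x) + real (Suc k) / x * 0) at_top"
      by (intro tendsto_add tendsto_minus tendsto_divide tendsto_mult[OF tendsto_const] tendsto_const lim F) (use x in auto)
    moreover have "?G 0 = - (fact (Suc k) / x ^ (Suc k + 1))" using F(3) by (simp add: field_simps)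
    ultimately show ?case by (intro exI[of _ ?G]) simp
  qed
  then obtain F where F: "\<And>t. (F has_real_derivative t ^ k * exp (- (x * t))) (at t)"
      "(F \<longlongrightarrow> 0) at_top" "F 0 = - (fact k / x ^ (k + 1))" by blast
  have "continuous_on {0..} (\<lambda>t. t ^ k * exp (- (x * t)))" by (intro continuous_intros)
  note * = half_line_FTC[OF F(1) this _ F(2)]
  show "integrable (half_line 0) (\<lambda>t. t ^ k * exp (- (x * t)))"
    "(LINT t|half_line 0. t ^ k * exp (- (x * t))) = fact k / x ^ (k + 1)"
    using * F(3) by auto
qed

lemma integrable_poly_exp:
  assumes x: "x > (0::real)"
  shows "integrable (half_line 0) (\<lambda>t. exp (- (x * t)) * (1 + t) ^ L)"
proof -
  have "(\<lambda>t. exp (- (x * t)) * (1 + t) ^ L) =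
      (\<lambda>t. \<Sum>k\<le>L. of_nat (L choose k) * (t ^ k * exp (- (x * t))))"
    by (simp add: add.commute[of 1] binomial_ring sum_distrib_left mult_ac)
  then show ?thesis using gamma_half_line(1)[OF x] by simp
qed

definition laplace :: "cfun \<Rightarrow> cfun" where
  "laplace f x = (LINT t|half_line 0. of_real (exp (- (x * t))) * f t)"

lemma laplace_integrable:
  assumes f: "f \<in> borel_measurable (half_line 0)" "\<And>t. t \<ge> 0 \<Longrightarrow> norm (f t) \<le> A * (1 + t) ^ L" and x: "x > 0"
  shows "integrable (half_line 0) (\<lambda>t. of_real (exp (- (x * t))) * f t)"
    "norm (laplace f x) \<le> A * (LINT t|half_line 0. exp (- (x * t)) * (1 + t) ^ L)"
proof -
  have bd: "norm (of_real (exp (- (x * t))) * f t) \<le> A * (exp (- (x * t)) * (1 + t) ^ L)" if "t \<ge> 0" for t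
    using mult_left_mono[OF f(2)[OF that], of "exp (- (x * t))"] by (simp add: norm_mult mult_ac)
  have int: "integrable (half_line 0) (\<lambda>t. A * (exp (- (x * t)) * (1 + t) ^ L))"
    using integrable_poly_exp[OF x, of L] by simp
  have "(\<lambda>t. complex_of_real (exp (- (x * t)))) \<in> borel_measurable (half_line 0)"
    by (rule borel_measurable_half_line) measurable
  from borel_measurable_times[OF this f(1)]
  show *: "integrable (half_line 0) (\<lambda>t. of_real (exp (- (x * t))) * f t)"
    by (rule integrable_le[OF int])
      (auto intro!: AE_I2 intro: order_trans[OF bd abs_ge_self])
  have "norm (laplace f x) \<le> (LINT t|half_line 0. norm (of_real (exp (- (x * t))) * f t))"
    unfolding laplace_def by (rule integral_norm_bound)
  also have "\<dots> \<le> (LINT t|half_line 0. A * (exp (- (x * t)) * (1 + t) ^ L))"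
    by (rule integral_mono[OF integrable_norm[OF *] int]) (use bd in auto)
  finally show "norm (laplace f x) \<le> A * (LINT t|half_line 0. exp (- (x * t)) * (1 + t) ^ L)"
    by simp
qed

text \<open>The factor \<open>\<i> ^ n\<close> undoes the \<open>- \<i>\<close> in each
  \<open>Dx\<close> without changing norms; what remains are ordinary derivatives, as Taylor's
  formula needs them.\<close>

lemma gevrey_derivatives:
  assumes "W \<in> gevrey 2 \<sigma>" "\<sigma> > 0"
  obtains D C where "D 0 = W" "C \<ge> 0"
    "\<And>n x. x \<in> {0..1} \<Longrightarrow> (D n has_vector_derivative D (Suc n) x) (at x within {0..1})"
    "\<And>n x. x \<in> {0..1} \<Longrightarrow> norm (D n x) \<le> C / \<sigma> ^ n * (fact n)\<^sup>2"
proof -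
  obtain C where C: "\<And>n x. x \<in> {0..1} \<Longrightarrow>
      norm ((Dx {0..1} ^^ n) W x) \<le> C * \<sigma> powi (- int n) * fact n powr 2"
    and sm: "smooth_on {0..1} W"
    using assms(1) unfolding gevrey_def by blast
  define D where "D n x = \<i> ^ n * (Dx {0..1} ^^ n) W x" for n x
  show ?thesis
  proof (rule that[of D "max C 0"])
    show "D 0 = W" by (simp add: D_def fun_eq_iff)
    fix n and x :: real assume x: "x \<in> {0..1}"
    have "((Dx {0..1} ^^ n) W has_vector_derivative vector_derivative ((Dx {0..1} ^^ n) W) (at x within {0..1}))
        (at x within {0..1})"
      using sm x by (simp add: smooth_on_def vector_derivative_works)
    then have "((\<lambda>x. \<i> ^ n * (Dx {0..1} ^^ n) W x) has_vector_derivative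
        \<i> ^ n * vector_derivative ((Dx {0..1} ^^ n) W) (at x within {0..1})) (at x within {0..1})"
      by (rule has_vector_derivative_mult_right)
    moreover have "\<i> ^ n * vector_derivative ((Dx {0..1} ^^ n) W) (at x within {0..1}) = D (Suc n) x"
      by (simp add: D_def Dx_def algebra_simps)
    ultimately show "(D n has_vector_derivative D (Suc n) x) (at x within {0..1})"
      by (simp add: D_def[abs_def])
    have "norm (D n x) \<le> C * \<sigma> powi (- int n) * fact n powr 2"
      using C[OF x, of n] by (simp add: D_def norm_mult norm_power)
    also have "\<dots> = C * ((fact n)\<^sup>2 / \<sigma> ^ n)"
      by (simp add: power_int_minus divide_inverse mult_ac)
    also have "\<dots> \<le> max C 0 * ((fact n)\<^sup>2 / \<sigma> ^ n)"
      using \<open>\<sigma> > 0\<close> by (intro mult_right_mono) auto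
    finally show "norm (D n x) \<le> max C 0 / \<sigma> ^ n * (fact n)\<^sup>2" by simp
  qed auto
qed

lemma poly_times_exp_bounded:
  assumes "\<epsilon> > (0::real)"
  shows "\<exists>B>0. \<forall>x\<ge>0. (1 + x) ^ n \<le> B * exp (\<epsilon> * x)"
proof -
  \<comment> \<open>The cap at \<open>1\<close> gives
    \<open>e * (1 + x) \<le> 1 + \<epsilon> * x\<close>, where the constant term must not exceed
    \<open>1\<close>.\<close>
  define e where "e = min \<epsilon> 1"
  have e: "e > 0" "e \<le> 1" "e \<le> \<epsilon>" using assms by (auto simp: e_def)
  have "(1 + x) ^ n \<le> (fact n * exp 1 / e ^ n) * exp (\<epsilon> * x)" if "x \<ge> 0" for x
  proof -
    have "(e * (1 + x)) ^ n / fact n \<le> exp (e * (1 + x))"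
    proof -
      have "(e * (1 + x)) ^ n /\<^sub>R fact n \<le> (\<Sum>k. (e * (1 + x)) ^ k /\<^sub>R fact k)"
        using sum_le_suminf[OF summable_exp_generic[of "e * (1 + x)"], of "{n}"] e that by simp
      then show ?thesis by (simp add: exp_def divide_inverse mult_ac)
    qed
    also have "e * (1 + x) \<le> 1 + \<epsilon> * x"
      using e that mult_right_mono[OF e(3) that] by (simp add: algebra_simps)
    then have "exp (e * (1 + x)) \<le> exp (1 + \<epsilon> * x)" by simp
    finally have "(e * (1 + x)) ^ n / fact n \<le> exp 1 * exp (\<epsilon> * x)" by (simp add: exp_add)
    then show ?thesis
      unfolding power_mult_distrib using e by (simp add: pos_divide_le_eq pos_le_divide_eq mult_ac)
  qed
  moreover have "fact n * exp 1 / e ^ n > 0" using e by simp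
  ultimately show ?thesis by blast
qed

text \<open>The series of \<open>b\<close> is the Borel transform of the Taylor series of \<open>W\<close> at \<open>0\<close>.
  Comparing both sides with the Taylor polynomial of degree about \<open>\<tau>\<^sub>0 x\<close> gives an
  exponentially small error.\<close>

proposition gevrey_decomposition:
  assumes W: "W \<in> gevrey 2 \<sigma>" and \<tau>: "0 < \<tau>" "\<tau> < \<sigma>"
    and V: "\<And>x. x \<ge> 1 \<Longrightarrow> V x = inverse (of_real x) * W (1 / x)"
  obtains b \<kappa> B R where "b \<in> borel_measurable borel" "B \<ge> 0"
    "\<And>t. t \<ge> 0 \<Longrightarrow> norm (b t) \<le> B" "\<And>t. t \<ge> 0 \<Longrightarrow> norm (b t - \<kappa>) \<le> B * t"
    "\<And>x. x \<ge> 1 \<Longrightarrow> norm (V x - laplace b x) \<le> R * exp (- (\<tau> * x))"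
proof -
  have "\<sigma> > 0" using \<tau> by simp
  obtain D C where D0: "D 0 = W" and C: "C \<ge> 0"
    and D: "\<And>n x. x \<in> {0..1} \<Longrightarrow> (D n has_vector_derivative D (Suc n) x) (at x within {0..1})"
    and Db: "\<And>n x. x \<in> {0..1} \<Longrightarrow> norm (D n x) \<le> C / \<sigma> ^ n * (fact n)\<^sup>2"
    using gevrey_derivatives[OF W \<open>\<sigma> > 0\<close>] by metis
  \<comment> \<open>\<open>T < \<sigma>\<close> makes the Borel series converge up to
    \<open>T\<close> with the uniform tail factor \<open>\<theta>\<close>; \<open>\<tau> < T\<close>
    leaves an exponential that will absorb polynomial factors.\<close>
  define T where "T = (\<tau> + \<sigma>) / 2"
  have T: "0 < T" "\<tau> < T" "T < \<sigma>" using \<tau> by (auto simp: T_def)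
  define \<theta> where "\<theta> = 1 / (1 - T / \<sigma>)"
  have \<theta>: "\<theta> \<ge> 1" using T by (simp add: \<theta>_def field_simps)
  \<comment> \<open>One factorial belongs to the Taylor coefficient of \<open>W\<close>; the other
    compensates the \<open>fact k\<close> that the Laplace transform of \<open>t ^ k\<close>
    produces.\<close>
  define a where "a k = D k 0 / fact k / fact k" for k
  have a: "norm (a k) \<le> C / \<sigma> ^ k" for k
  proof -
    have "norm (a k) = norm (D k 0) / (fact k)\<^sup>2"
      by (simp add: a_def norm_divide norm_mult power2_eq_square)
    also have "\<dots> \<le> (C / \<sigma> ^ k * (fact k)\<^sup>2) / (fact k)\<^sup>2" by (intro divide_right_mono Db) auto
    finally show ?thesis by simp
  qed
  define b where "b t = (if t \<le> T then \<Sum>k. a k * of_real t ^ k else 0)" for t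
  have term_le: "norm (a k * of_real t ^ k) \<le> C * (t / \<sigma>) ^ k" if "t \<ge> 0" for k t
  proof -
    have "norm (a k * of_real t ^ k) = norm (a k) * t ^ k" using that by (simp add: norm_mult norm_power)
    also have "\<dots> \<le> C / \<sigma> ^ k * t ^ k" using a that by (intro mult_right_mono) auto
    finally show ?thesis by (simp add: power_divide)
  qed
  have tail: "summable (\<lambda>k. a k * of_real t ^ k)"
    "norm (\<Sum>k. a (k + n) * of_real t ^ (k + n)) \<le> C * \<theta> * (t / \<sigma>) ^ n" if t: "0 \<le> t" "t \<le> T" for t n
  proof -
    have q: "norm (t / \<sigma>) < 1" "0 \<le> t / \<sigma>" using t T \<open>\<sigma> > 0\<close> by auto
    have sm: "(\<lambda>k. C * (t / \<sigma>) ^ n * (t / \<sigma>) ^ k) sums (C * (t / \<sigma>) ^ n * (1 / (1 - t / \<sigma>)))" for n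
      by (intro sums_mult geometric_sums q)
    have tn: "norm (a (k + n) * of_real t ^ (k + n)) \<le> C * (t / \<sigma>) ^ n * (t / \<sigma>) ^ k" for k n
      using term_le[OF t(1), of "k + n"] by (simp add: power_add mult_ac)
    have s: "summable (\<lambda>k. norm (a (k + n) * of_real t ^ (k + n)))" for n
      by (rule summable_comparison_test'[OF sums_summable[OF sm[of n]]]) (use tn in auto)
    from s[of 0] show "summable (\<lambda>k. a k * of_real t ^ k)" by (auto intro: summable_norm_cancel)
    have "norm (\<Sum>k. a (k + n) * of_real t ^ (k + n)) \<le> (\<Sum>k. norm (a (k + n) * of_real t ^ (k + n)))"
      by (rule summable_norm[OF s])
    also have "\<dots> \<le> (\<Sum>k. C * (t / \<sigma>) ^ n * (t / \<sigma>) ^ k)"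
      by (rule suminf_le[OF tn s sums_summable[OF sm]])
    also have "\<dots> = C * (t / \<sigma>) ^ n * (1 / (1 - t / \<sigma>))" using sums_unique[OF sm] by simp
    also have "\<dots> \<le> C * (t / \<sigma>) ^ n * \<theta>"
    proof (rule mult_left_mono)
      have "t / \<sigma> \<le> T / \<sigma>" "T / \<sigma> < 1" using t T \<open>\<sigma> > 0\<close> by (auto simp: divide_right_mono)
      then show "1 / (1 - t / \<sigma>) \<le> \<theta>" unfolding \<theta>_def by (intro divide_left_mono) auto
    qed (use C q in auto)
    finally show "norm (\<Sum>k. a (k + n) * of_real t ^ (k + n)) \<le> C * \<theta> * (t / \<sigma>) ^ n"
      by (simp add: mult_ac)
  qed
  have C\<theta>: "C \<le> C * \<theta>" "0 \<le> C * \<theta>" using C \<theta> mult_left_mono[OF \<theta> C] by auto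
  have b_bound: "norm (b t) \<le> C * \<theta>" if "t \<ge> 0" for t
    using tail(2)[of t 0] that C\<theta> by (auto simp: b_def)
  \<comment> \<open>Beyond \<open>T\<close> the function \<open>b\<close> is zero, and
    \<open>t / T > 1\<close> absorbs the constant \<open>a 0\<close>. The linear bound at
    \<open>0\<close> is what later makes the amplitude equation solvable there.\<close>
  have b_lip: "norm (b t - a 0) \<le> C * \<theta> / T * t" if t: "t \<ge> 0" for t
  proof (cases "t \<le> T")
    case True
    have "b t - a 0 = (\<Sum>k. a (k + 1) * of_real t ^ (k + 1))"
      using suminf_split_initial_segment[OF tail(1)[OF t True], of 1] True by (simp add: b_def)
    then have "norm (b t - a 0) \<le> C * \<theta> * (t / \<sigma>)" using tail(2)[OF t True, of 1] by simp
    also have "\<dots> \<le> C * \<theta> * (t / T)"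
      using T t C\<theta> by (intro mult_left_mono divide_left_mono) auto
    finally show ?thesis by simp
  next
    case False
    have "norm (b t - a 0) \<le> C" using False a[of 0] by (simp add: b_def)
    also have "C \<le> C * \<theta> * (t / T)"
      using False T C\<theta> mult_left_mono[of 1 "t / T" "C * \<theta>"] by simp
    finally show ?thesis by simp
  qed
  have b_meas: "b \<in> borel_measurable borel" unfolding b_def[abs_def] by measurable
  \<comment> \<open>Up to \<open>T\<close> the difference is a tail of the series. Beyond
    \<open>T\<close>, where \<open>b\<close> is zero, the polynomial itself is bounded by its
    \<open>N + 1\<close> terms, each at most of the size of the top power.\<close>
  have diff: "norm ((\<Sum>k<Suc N. a k * of_real t ^ k) - b t) \<le> C * \<theta> * (real N + 1) * (t / T) ^ N"
    if t: "t \<ge> 0" for t N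
  proof (cases "t \<le> T")
    case True
    have "b t - (\<Sum>k<Suc N. a k * of_real t ^ k) = (\<Sum>k. a (k + Suc N) * of_real t ^ (k + Suc N))"
      using suminf_split_initial_segment[OF tail(1)[OF t True], of "Suc N"] True by (simp add: b_def)
    then have "norm ((\<Sum>k<Suc N. a k * of_real t ^ k) - b t) \<le> C * \<theta> * (t / \<sigma>) ^ Suc N"
      using tail(2)[OF t True, of "Suc N"] by (metis norm_minus_commute)
    also have "\<dots> \<le> C * \<theta> * ((real N + 1) * (t / T) ^ N)"
    proof (rule mult_left_mono[OF _ C\<theta>(2)])
      have "(t / \<sigma>) ^ Suc N \<le> 1 * (t / T) ^ N"
        unfolding power_Suc
        by (rule mult_mono) (use t True T in \<open>auto intro!: power_mono divide_left_mono\<close>)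
      also have "\<dots> \<le> (real N + 1) * (t / T) ^ N"
        using t T by (intro mult_right_mono) auto
      finally show "(t / \<sigma>) ^ Suc N \<le> (real N + 1) * (t / T) ^ N" .
    qed
    finally show ?thesis by (simp add: mult_ac)
  next
    case False
    have "norm ((\<Sum>k<Suc N. a k * of_real t ^ k) - b t) \<le> (\<Sum>k<Suc N. norm (a k * of_real t ^ k))"
      using False by (simp add: b_def norm_sum del: sum.lessThan_Suc)
    also have "\<dots> \<le> (\<Sum>k<Suc N. C * (t / T) ^ N)"
    proof (rule sum_mono)
      fix k assume k: "k \<in> {..<Suc N}"
      have "(t / \<sigma>) ^ k \<le> (t / T) ^ k"
        using t T by (intro power_mono divide_left_mono) auto
      also have "\<dots> \<le> (t / T) ^ N" using False T k by (intro power_increasing) auto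
      finally show "norm (a k * of_real t ^ k) \<le> C * (t / T) ^ N"
        using term_le[OF t, of k] mult_left_mono[OF _ C, of "(t / \<sigma>) ^ k" "(t / T) ^ N"] by linarith
    qed
    also have "\<dots> = C * ((real N + 1) * (t / T) ^ N)" by (simp add: algebra_simps)
    also have "\<dots> \<le> C * \<theta> * ((real N + 1) * (t / T) ^ N)"
      using C\<theta>(1) t T by (intro mult_right_mono) auto
    finally show ?thesis by (simp add: mult_ac)
  qed
  \<comment> \<open>The common approximant: it is the Laplace transform of the partial sum of the
    Borel series, and also \<open>1 / x\<close> times the Taylor polynomial of \<open>W\<close> at
    \<open>1 / x\<close>.\<close>
  let ?P = "\<lambda>x N. \<Sum>k<Suc N. a k * fact k / complex_of_real x ^ (k + 1)"
  let ?m = "\<lambda>x k t. of_real (exp (- (x * t))) * (a k * of_real t ^ k) :: complex"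
  let ?b = "\<lambda>x t. of_real (exp (- (x * t))) * b t"
  have laplace_diff: "norm (?P x N - laplace b x) \<le>
      C * \<theta> * (real N + 1) * (fact N / (T ^ N * x ^ (N + 1)))" if x: "x > 0" for x N
  proof -
    have mono: "integrable (half_line 0) (?m x k)"
      "(LINT t|half_line 0. ?m x k t) = a k * fact k / of_real x ^ (k + 1)" for k
    proof -
      have *: "(?m x k) =
          (\<lambda>t. a k * complex_of_real (t ^ k * exp (- (x * t))))" by (auto simp: mult_ac)
      show "integrable (half_line 0) (?m x k)"
        unfolding * using gamma_half_line(1)[OF x, of k] by (intro integrable_mult_right integrable_of_real) auto
      show "(LINT t|half_line 0. ?m x k t) = a k * fact k / of_real x ^ (k + 1)"
        unfolding * integral_mult_right_zero integral_complex_of_real gamma_half_line(2)[OF x] by simp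
    qed
    have intb: "integrable (half_line 0) (?b x)"
      by (rule laplace_integrable(1)[where A = "C * \<theta>" and L = 0, OF borel_measurable_half_line[OF b_meas] _ x])
        (use b_bound in auto)
    have "?P x N - laplace b x =
        (LINT t|half_line 0. (\<Sum>k<Suc N. ?m x k t) - ?b x t)"
      unfolding laplace_def
      by (subst Bochner_Integration.integral_diff, intro Bochner_Integration.integrable_sum mono intb, rule intb,
          subst Bochner_Integration.integral_sum, rule mono, simp only: mono)
    also have "norm \<dots> \<le> (LINT t|half_line 0. norm ((\<Sum>k<Suc N. ?m x k t) - ?b x t))"
      by (rule integral_norm_bound)
    also have "\<dots> \<le> (LINT t|half_line 0. C * \<theta> * (real N + 1) / T ^ N * (t ^ N * exp (- (x * t))))"
    proof (rule integral_mono)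
      show "integrable (half_line 0) (\<lambda>t. norm ((\<Sum>k<Suc N. ?m x k t) - ?b x t))"
        by (intro integrable_norm Bochner_Integration.integrable_diff Bochner_Integration.integrable_sum mono intb)
      show "integrable (half_line 0) (\<lambda>t. C * \<theta> * (real N + 1) / T ^ N * (t ^ N * exp (- (x * t))))"
        by (rule integrable_mult_right) (rule gamma_half_line(1)[OF x])
      fix t assume "t \<in> space (half_line 0)"
      then have t: "t \<ge> 0" by simp
      have "norm ((\<Sum>k<Suc N. ?m x k t) - ?b x t)
          = exp (- (x * t)) * norm ((\<Sum>k<Suc N. a k * of_real t ^ k) - b t)"
        unfolding sum_distrib_left[symmetric] right_diff_distrib[symmetric] norm_mult by simp
      also have "\<dots> \<le> exp (- (x * t)) * (C * \<theta> * (real N + 1) * (t / T) ^ N)"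
        by (rule mult_left_mono[OF diff[OF t]]) simp
      finally show "norm ((\<Sum>k<Suc N. ?m x k t) - ?b x t)
          \<le> C * \<theta> * (real N + 1) / T ^ N * (t ^ N * exp (- (x * t)))"
        by (simp add: power_divide mult_ac)
    qed
    also have "\<dots> = C * \<theta> * (real N + 1) * (fact N / (T ^ N * x ^ (N + 1)))"
      by (simp only: integral_mult_right_zero gamma_half_line(2)[OF x]) simp
    finally show ?thesis .
  qed
  \<comment> \<open>The Gevrey bound contributes the square of \<open>fact (N + 1)\<close>, and
    Taylor's formula divides by \<open>fact N\<close>. This leaves \<open>fact N\<close> up to a
    polynomial factor, the same size as the error on the Laplace side.\<close>
  have taylor: "norm (V x - ?P x N) \<le>
      C / \<sigma> * ((real N + 1) ^ 2 * (fact N / (\<sigma> ^ N * x ^ (N + 2))))" if x: "x \<ge> 1" for x N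
  proof -
    have y: "0 \<le> 1 / x" "1 / x \<le> 1" using x by auto
    let ?i = "\<lambda>s. ((1 / x - s) ^ (Suc N - 1) / fact (Suc N - 1)) *\<^sub>R D (Suc N) s"
    have D': "(D m has_vector_derivative D (Suc m) t) (at t within {0..1 / x})" if "0 \<le> t" "t \<le> 1 / x" for m t
      using D[of t m] that y by (auto intro: has_vector_derivative_within_subset)
    have "W (1 / x) = (\<Sum>i<Suc N. ((1 / x - 0) ^ i / fact i) *\<^sub>R D i 0) + integral {0..1 / x} ?i"
      by (rule Taylor_integral[OF _ D0 D' y(1)]) auto
    moreover have "norm (integral {0..1 / x} ?i) \<le> (1 / x) ^ N / fact N * (C / \<sigma> ^ Suc N * (fact (Suc N))\<^sup>2) * (1 / x - 0)"
    proof (rule integral_bound[OF y(1)])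
      have "continuous_on {0..1 / x} (D (Suc N))"
        unfolding continuous_on_eq_continuous_within
        by (intro ballI has_vector_derivative_continuous[OF D']) auto
      then show "continuous_on {0..1 / x} ?i" by (intro continuous_intros) auto
      fix s assume s: "s \<in> {0..1 / x}"
      have "(1 / x - s) ^ N / fact N \<le> (1 / x) ^ N / fact N"
        using s by (intro divide_right_mono power_mono) auto
      note b1 = this
      have b2: "norm (D (Suc N) s) \<le> C / \<sigma> ^ Suc N * (fact (Suc N))\<^sup>2"
        using s y by (intro Db) auto
      show "norm (?i s) \<le> (1 / x) ^ N / fact N * (C / \<sigma> ^ Suc N * (fact (Suc N))\<^sup>2)"
      proof -
        have "norm (?i s) = (1 / x - s) ^ N / fact N * norm (D (Suc N) s)"
          using s by (simp del: power_Suc fact_Suc)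
        also have "\<dots> \<le> (1 / x) ^ N / fact N * (C / \<sigma> ^ Suc N * (fact (Suc N))\<^sup>2)"
          by (rule mult_mono[OF b1 b2]) (use y in auto)
        finally show ?thesis .
      qed
    qed
    ultimately have "norm (W (1 / x) - (\<Sum>i<Suc N. ((1 / x) ^ i / fact i) *\<^sub>R D i 0)) \<le>
        (1 / x) ^ N / fact N * (C / \<sigma> ^ Suc N * (fact (Suc N))\<^sup>2) * (1 / x)"
      by (simp del: sum.lessThan_Suc fact_Suc power_Suc)
    also have "\<dots> = x * (C / \<sigma> * ((real N + 1) ^ 2 * (fact N / (\<sigma> ^ N * x ^ (N + 2)))))"
    proof -
      have f: "fact (Suc N) = (real N + 1) * fact N" by simp
      show ?thesis using x \<open>\<sigma> > 0\<close> unfolding f by (simp add: field_simps power2_eq_square)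
    qed
    finally have 1: "norm (W (1 / x) - (\<Sum>i<Suc N. ((1 / x) ^ i / fact i) *\<^sub>R D i 0)) \<le>
        x * (C / \<sigma> * ((real N + 1) ^ 2 * (fact N / (\<sigma> ^ N * x ^ (N + 2)))))" .
    have "V x - ?P x N =
        inverse (of_real x) * (W (1 / x) - (\<Sum>i<Suc N. ((1 / x) ^ i / fact i) *\<^sub>R D i 0))"
      unfolding V[OF x] right_diff_distrib sum_distrib_left using x
      by (intro arg_cong2[where f = minus] sum.cong refl)
        (simp add: a_def scaleR_conv_of_real divide_inverse power_inverse mult_ac)
    then have "norm (V x - ?P x N) =
        norm (W (1 / x) - (\<Sum>i<Suc N. ((1 / x) ^ i / fact i) *\<^sub>R D i 0)) / x"
      using x by (simp add: norm_mult norm_inverse divide_inverse del: sum.lessThan_Suc)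
    also have "\<dots> \<le> C / \<sigma> * ((real N + 1) ^ 2 * (fact N / (\<sigma> ^ N * x ^ (N + 2))))"
      using 1 x by (simp add: divide_le_eq mult_ac del: sum.lessThan_Suc)
    finally show ?thesis .
  qed
  define A where "A = (C * \<theta> + C / \<sigma>) * exp 2"
  have A: "A \<ge> 0" using C C\<theta> \<open>\<sigma> > 0\<close> by (simp add: A_def)
  have main: "norm (V x - laplace b x) \<le> A * ((1 + T * x) ^ 3 * exp (- (T * x)))" if x: "x \<ge> 1" for x
  proof -
    \<comment> \<open>The quotient \<open>fact N / (T * x) ^ N\<close> is smallest near
      \<open>N = T * x\<close>, where it is about \<open>exp (- (T * x))\<close>.\<close>
    define N where "N = nat \<lfloor>T * x\<rfloor>"
    have \<tau>x: "T * x > 0" using T x by simp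
    have N: "real N \<le> T * x" "T * x < real N + 1"
      using \<tau>x by (auto simp: N_def)
    have key: "fact N / (T ^ N * x ^ N) \<le> exp 2 * (1 + T * x) * exp (- (T * x))"
    proof -
      have "(real N / exp 1) ^ N \<le> (T * x / exp 1) ^ N"
        using N by (intro power_mono divide_right_mono) auto
      then have "exp 1 * (real N + 1) * (real N / exp 1) ^ N \<le> exp 1 * (1 + T * x) * (T * x / exp 1) ^ N"
        using N \<tau>x by (intro mult_mono) auto
      with fact_upper_bound[of N] have "fact N \<le> exp 1 * (1 + T * x) * (T * x / exp 1) ^ N" by linarith
      also have "(T * x / exp 1) ^ N = (T ^ N * x ^ N) * exp (- real N)"
        by (simp add: power_divide power_mult_distrib exp_minus exp_of_nat_mult[of N 1, simplified] divide_inverse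
            power_inverse)
      finally have "fact N / (T ^ N * x ^ N) \<le> exp 1 * (1 + T * x) * exp (- real N)"
        using T x by (simp add: divide_le_eq mult_ac)
      also have "\<dots> \<le> exp 1 * (1 + T * x) * exp (1 - T * x)"
        using N \<tau>x by (intro mult_left_mono) auto
      also have "\<dots> = exp 2 * (1 + T * x) * exp (- (T * x))"
        by (simp add: exp_diff exp_minus divide_inverse mult_ac) (simp add: exp_add[symmetric])
      finally show ?thesis .
    qed
    define F where "F = fact N / (T ^ N * x ^ N)"
    have F0: "F \<ge> 0" using T x by (simp add: F_def)
    have N1: "real N + 1 \<le> (1 + T * x) ^ 2" "(real N + 1) ^ 2 \<le> (1 + T * x) ^ 2"
    proof -
      have "real N + 1 \<le> 1 + T * x" using N by simp
      also have "\<dots> \<le> (1 + T * x) ^ 2" using \<tau>x self_le_power[of "1 + T * x" 2] by simp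
      finally show "real N + 1 \<le> (1 + T * x) ^ 2" .
      show "(real N + 1) ^ 2 \<le> (1 + T * x) ^ 2" using N by (intro power_mono) auto
    qed
    have p1: "fact N / (T ^ N * x ^ (N + 1)) \<le> F"
      unfolding F_def using T x by (intro divide_left_mono mult_left_mono power_increasing) auto
    have p2: "fact N / (\<sigma> ^ N * x ^ (N + 2)) \<le> F"
      unfolding F_def using T x \<open>\<sigma> > 0\<close>
      by (intro divide_left_mono mult_mono power_increasing power_mono) auto
    have "norm (V x - laplace b x) \<le> norm (V x - ?P x N)
        + norm (?P x N - laplace b x)"
      using norm_triangle_ineq[of "V x - ?P x N"
          "?P x N - laplace b x"]
      by (simp del: sum.lessThan_Suc)
    also have "\<dots> \<le> C / \<sigma> * ((1 + T * x) ^ 2 * F) + C * \<theta> * (1 + T * x) ^ 2 * F"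
    proof (rule add_mono)
      show "norm (V x - ?P x N) \<le> C / \<sigma> * ((1 + T * x) ^ 2 * F)"
        using C \<open>\<sigma> > 0\<close> N1 p2 F0 x
        by (intro order_trans[OF taylor[OF x]] mult_left_mono mult_mono) auto
      show "norm (?P x N - laplace b x) \<le> C * \<theta> * (1 + T * x) ^ 2 * F"
        using C\<theta> N1 p1 F0 x T
        by (intro order_trans[OF laplace_diff] mult_mono mult_left_mono) auto
    qed
    also have "\<dots> = (C * \<theta> + C / \<sigma>) * ((1 + T * x) ^ 2 * F)" by (simp add: algebra_simps)
    also have "\<dots> \<le> (C * \<theta> + C / \<sigma>) * ((1 + T * x) ^ 2 * (exp 2 * (1 + T * x) * exp (- (T * x))))"
      using key C C\<theta> \<open>\<sigma> > 0\<close> unfolding F_def by (intro mult_left_mono) auto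
    also have "\<dots> = A * ((1 + T * x) ^ 3 * exp (- (T * x)))"
      by (simp add: A_def power3_eq_cube power2_eq_square mult_ac)
    finally show ?thesis .
  qed
  \<comment> \<open>The cubic factor is paid for by lowering the rate from \<open>T\<close> to
    \<open>\<tau>\<close>; the argument will be \<open>T * x\<close>, hence the exponent
    \<open>1 - \<tau> / T\<close>.\<close>
  obtain B where B: "B > 0" "\<And>x. x \<ge> 0 \<Longrightarrow> (1 + x) ^ 3 \<le> B * exp ((1 - \<tau> / T) * x)"
    using poly_times_exp_bounded[of "1 - \<tau> / T" 3] T \<tau> by auto
  show ?thesis
  proof (rule that[of b "max (C * \<theta>) (C * \<theta> / T)" "a 0" "A * B"])
    show "norm (V x - laplace b x) \<le> A * B * exp (- (\<tau> * x))" if x: "x \<ge> 1" for x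
    proof -
      have "(1 + T * x) ^ 3 * exp (- (T * x)) \<le> B * exp ((1 - \<tau> / T) * (T * x)) * exp (- (T * x))"
        using B(2)[of "T * x"] T x by (intro mult_right_mono) auto
      also have "\<dots> = B * exp (- (\<tau> * x))"
        using T by (simp add: mult.assoc exp_add[symmetric]) (simp add: field_simps)
      finally show ?thesis using order_trans[OF main[OF x] mult_left_mono[OF _ A]] by (simp add: mult.assoc)
    qed
    show "norm (b t) \<le> max (C * \<theta>) (C * \<theta> / T)" if "t \<ge> 0" for t using b_bound[OF that] by simp
    show "norm (b t - a 0) \<le> max (C * \<theta>) (C * \<theta> / T) * t" if "t \<ge> 0" for t
      by (rule order_trans[OF b_lip[OF that] mult_right_mono]) (use that in auto)
  qed (use b_meas C\<theta> in auto)
qed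

section \<open>Laplace transforms\<close>

lemma half_line_lborel:
  fixes f :: cfun
  assumes "f \<in> borel_measurable borel"
  shows "integrable (half_line a) f \<longleftrightarrow> integrable lborel (\<lambda>x. indicator {a..} x *\<^sub>R f x)"
    "(LINT x|half_line a. f x) = (LINT x|lborel. indicator {a..} x *\<^sub>R f x)"
proof -
  have 1: "{a..} \<inter> space lebesgue \<in> sets lebesgue" by simp
  have m: "(\<lambda>x. indicator {a..} x *\<^sub>R f x) \<in> borel_measurable lborel" using assms by measurable
  show "integrable (half_line a) f \<longleftrightarrow> integrable lborel (\<lambda>x. indicator {a..} x *\<^sub>R f x)"
    unfolding integrable_restrict_space[OF 1] integrable_completion[OF m] ..
  show "(LINT x|half_line a. f x) = (LINT x|lborel. indicator {a..} x *\<^sub>R f x)"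
    unfolding integral_restrict_space[OF 1] integral_completion[OF m] ..
qed

lemma half_line_shift:
  fixes f :: cfun
  assumes f: "f \<in> borel_measurable borel" and s: "s \<ge> 0"
  shows "integrable (half_line 0) f \<Longrightarrow> integrable (half_line 0) (\<lambda>t. if s \<le> t then f (t - s) else 0)"
    "(LINT t|half_line 0. (if s \<le> t then f (t - s) else 0)) = (LINT t|half_line 0. f t)"
proof -
  have m: "(\<lambda>t. if s \<le> t then f (t - s) else 0) \<in> borel_measurable borel" using f by measurable
  have e: "(\<lambda>t. indicator {0..} t *\<^sub>R (if s \<le> t then f (t - s) else 0)) =
      (\<lambda>t. indicator {0..} (- s + 1 * t) *\<^sub>R f (- s + 1 * t))"
    using s by (auto simp: indicator_def fun_eq_iff algebra_simps)
  show "integrable (half_line 0) f \<Longrightarrow> integrable (half_line 0) (\<lambda>t. if s \<le> t then f (t - s) else 0)"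
    unfolding half_line_lborel[OF f] half_line_lborel[OF m] e
    by (rule lborel_integrable_real_affine) auto
  show "(LINT t|half_line 0. (if s \<le> t then f (t - s) else 0)) = (LINT t|half_line 0. f t)"
    unfolding half_line_lborel[OF f] half_line_lborel[OF m] e
    using lborel_integral_real_affine[of 1 "\<lambda>t. indicator {0..} t *\<^sub>R f t" "- s"] by simp
qed

definition conv :: "cfun \<Rightarrow> cfun \<Rightarrow> cfun" where
  "conv f g t = (LINT s|half_line 0. (if s \<le> t then f (t - s) * g s else 0))"

text \<open>Fubini on the triangle \<open>s \<le> t\<close>. The hypotheses are asymmetric because
  \<open>f\<close> is translated and is taken Borel for that, while \<open>g\<close> will be a
  Volterra solution, measurable only for the completed measure.\<close>

lemma laplace_conv:
  assumes f: "f \<in> borel_measurable borel" "\<And>t. t \<ge> 0 \<Longrightarrow> norm (f t) \<le> A * (1 + t) ^ L"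
    and g: "g \<in> borel_measurable (half_line 0)" "\<And>t. t \<ge> 0 \<Longrightarrow> norm (g t) \<le> A' * (1 + t) ^ L'"
    and x: "x > 0"
  shows "laplace (conv f g) x = laplace f x * laplace g x"
    and "integrable (half_line 0) (\<lambda>t. of_real (exp (- (x * t))) * conv f g t)"
proof -
  interpret M: sigma_finite_measure "half_line 0" by (rule sigma_finite_half_line)
  interpret P: pair_sigma_finite "half_line 0" "half_line 0" ..
  note intf = laplace_integrable(1)[OF borel_measurable_half_line[OF f(1)] f(2) x]
  note intg = laplace_integrable(1)[OF g x]
  define H where "H s t = (if s \<le> t then of_real (exp (- (x * t))) * (f (t - s) * g s) else 0)" for s t
  let ?e = "\<lambda>t. of_real (exp (- (x * t))) * f t"
  have em: "?e \<in> borel_measurable borel" using f(1) by measurable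
  have nem: "(\<lambda>t. complex_of_real (norm (?e t))) \<in> borel_measurable borel" using em by measurable
  have split: "of_real (exp (- (x * t))) = of_real (exp (- (x * s))) * complex_of_real (exp (- (x * (t - s))))" for s t
    by (simp add: exp_add[symmetric] algebra_simps flip: of_real_mult)
  have H1: "H s t = of_real (exp (- (x * s))) * g s * (if s \<le> t then ?e (t - s) else 0)" for s t
    unfolding H_def using split[of t s] by simp
  have [measurable]: "g \<in> borel_measurable (half_line 0)" "f \<in> borel_measurable borel" by fact+
  have Hm: "case_prod H \<in> borel_measurable (half_line 0 \<Otimes>\<^sub>M half_line 0)"
    unfolding H_def[abs_def] by measurable
  have int_s: "integrable (half_line 0) (H s)" "(LINT t|half_line 0. H s t) = of_real (exp (- (x * s))) * g s * laplace f x"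
    if "s \<ge> 0" for s
  proof -
    show "integrable (half_line 0) (H s)"
      unfolding H1[abs_def] by (intro integrable_mult_right half_line_shift(1)[OF em that] intf)
    show "(LINT t|half_line 0. H s t) = of_real (exp (- (x * s))) * g s * laplace f x"
      unfolding H1 integral_mult_right_zero half_line_shift(2)[OF em that] laplace_def ..
  qed
  have norm_s: "(LINT t|half_line 0. norm (H s t)) = norm (of_real (exp (- (x * s))) * g s) * (LINT t|half_line 0. norm (?e t))"
    if "s \<ge> 0" for s
  proof -
    \<comment> \<open>The translation lemma is stated for complex functions, hence the detour
      through \<open>complex_of_real\<close>.\<close>
    have "complex_of_real (LINT t|half_line 0. norm (H s t)) =
        (LINT t|half_line 0. of_real (norm (of_real (exp (- (x * s))) * g s)) * (if s \<le> t then complex_of_real (norm (?e (t - s))) else 0))"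
      unfolding integral_complex_of_real[symmetric]
      by (intro lint_cong refl) (auto simp: H1 norm_mult)
    also have "\<dots> = of_real (norm (of_real (exp (- (x * s))) * g s) * (LINT t|half_line 0. norm (?e t)))"
      unfolding integral_mult_right_zero half_line_shift(2)[OF nem that] integral_complex_of_real by simp
    finally show ?thesis by (simp only: of_real_eq_iff)
  qed
  have intH: "integrable (half_line 0 \<Otimes>\<^sub>M half_line 0) (case_prod H)"
  proof (rule P.Fubini_integrable[OF Hm])
    have "integrable (half_line 0) (\<lambda>s. norm (of_real (exp (- (x * s))) * g s) * (LINT t|half_line 0. norm (?e t)))"
      by (intro integrable_mult_left integrable_norm intg)
    then show "integrable (half_line 0) (\<lambda>s. LINT t|half_line 0. norm (case_prod H (s, t)))"
      by (rule Bochner_Integration.integrable_cong[THEN iffD1, rotated 2]) (auto simp: norm_s)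
    show "AE s in half_line 0. integrable (half_line 0) (\<lambda>t. case_prod H (s, t))"
      using int_s(1) by (auto intro!: AE_I2)
  qed
  have conv_eq: "(LINT s|half_line 0. H s t) = of_real (exp (- (x * t))) * conv f g t" for t
    unfolding conv_def integral_mult_right_zero[symmetric]
    by (intro lint_cong refl) (auto simp: H_def)
  show "integrable (half_line 0) (\<lambda>t. of_real (exp (- (x * t))) * conv f g t)"
    using P.integrable_snd[OF intH] unfolding conv_eq .
  have "(LINT t|half_line 0. LINT s|half_line 0. H s t) = (LINT s|half_line 0. LINT t|half_line 0. H s t)"
    by (rule P.Fubini_integral[OF intH])
  also have "\<dots> = (LINT s|half_line 0. (of_real (exp (- (x * s))) * g s) * laplace f x)"
    by (intro lint_cong refl) (simp add: int_s)
  also have "\<dots> = laplace f x * laplace g x" by (simp add: laplace_def)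
  finally show "laplace (conv f g) x = laplace f x * laplace g x" by (simp add: conv_eq laplace_def)
qed

text \<open>The variable is made complex: on the half-plane \<open>Re z > x / 2\<close> the
  integrands are holomorphic with one common majorant, so differentiation of parameter integrals
  applies, and the real derivative is its restriction.\<close>

lemma laplace_derivative:
  assumes f: "f \<in> borel_measurable (half_line 0)" "\<And>t. t \<ge> 0 \<Longrightarrow> norm (f t) \<le> A * (1 + t) ^ L" and x: "x > 0"
  shows "(laplace f has_vector_derivative - laplace (\<lambda>t. of_real t * f t) x) (at x within S)"
proof -
  define F where "F z t = exp (- (z * of_real t)) * f t" for z t
  let ?U = "{z. x / 2 < Re z}"
  have A: "0 \<le> A" using f(2)[of 0] norm_ge_zero[of "f 0"] by (simp del: norm_ge_zero)
  have "((\<lambda>z. LINT t|half_line 0. F z t) has_field_derivative (LINT t|half_line 0. deriv (\<lambda>z. F z t) (of_real x))) (at (of_real x))"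
  proof (rule has_field_derivative_integral[where U = ?U and k = "\<lambda>t. A * (exp (- (x / 2 * t)) * (1 + t) ^ L)"])
    show "open ?U" by (rule open_halfspace_Re_gt)
    show "(\<lambda>z. F z y) holomorphic_on ?U" for y unfolding F_def by (intro holomorphic_intros)
    show "F z \<in> borel_measurable (half_line 0)" for z
      unfolding F_def[abs_def] by (intro borel_measurable_times f borel_measurable_half_line) measurable
    show "integrable (half_line 0) (\<lambda>t. A * (exp (- (x / 2 * t)) * (1 + t) ^ L))"
      using integrable_poly_exp[of "x / 2" L] x by simp
    fix z t assume z: "z \<in> ?U" and "t \<in> space (half_line 0)"
    then have t: "t \<ge> 0" by simp
    have "norm (F z t) = exp (- (Re z * t)) * norm (f t)" by (simp add: F_def norm_mult)
    also have "\<dots> \<le> exp (- (x / 2 * t)) * (A * (1 + t) ^ L)"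
      using mult_right_mono[of "x / 2" "Re z" t] z t f(2)[OF t] by (intro mult_mono) auto
    finally show "norm (F z t) \<le> A * (exp (- (x / 2 * t)) * (1 + t) ^ L)" by (simp add: mult_ac)
  qed (use x in auto)
  then have "((\<lambda>y. LINT t|half_line 0. F (of_real y) t) has_vector_derivative
      (LINT t|half_line 0. deriv (\<lambda>z. F z t) (of_real x))) (at x within S)"
    by (rule has_vector_derivative_real_field)
  moreover have "deriv (\<lambda>z. F z t) (of_real x) = - (of_real (exp (- (x * t))) * (of_real t * f t))" for t
  proof -
    have e: "exp (- (complex_of_real x * complex_of_real t)) = of_real (exp (- (x * t)))"
      by (simp flip: exp_of_real)
    show ?thesis
      unfolding F_def by (rule DERIV_imp_deriv) (auto intro!: derivative_eq_intros simp: e)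
  qed
  moreover have "(\<lambda>y. LINT t|half_line 0. F (of_real y) t) = laplace f"
    unfolding F_def laplace_def by (simp flip: of_real_mult of_real_minus exp_of_real)
  ultimately show ?thesis by (simp add: laplace_def)
qed

lemma poly_exp_integral_bound:
  "\<exists>A\<ge>0. \<forall>x\<ge>1. (LINT t|half_line 0. exp (- (x * t)) * (1 + t) ^ L) \<le> A / x"
proof (intro exI conjI allI impI)
  show "0 \<le> (\<Sum>k\<le>L. real (L choose k) * fact k)" by (intro sum_nonneg) auto
  fix x :: real assume x: "x \<ge> 1"
  have "(LINT t|half_line 0. exp (- (x * t)) * (1 + t) ^ L) =
      (LINT t|half_line 0. (\<Sum>k\<le>L. real (L choose k) * (t ^ k * exp (- (x * t)))))"
    by (simp add: add.commute[of 1] binomial_ring sum_distrib_left mult_ac)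
  also have "\<dots> = (\<Sum>k\<le>L. real (L choose k) * (fact k / x ^ (k + 1)))"
    using gamma_half_line[of x] x by (subst Bochner_Integration.integral_sum) auto
  also have "\<dots> \<le> (\<Sum>k\<le>L. real (L choose k) * (fact k / x))"
  proof (intro sum_mono mult_left_mono divide_left_mono)
    show "x \<le> x ^ (k + 1)" for k using x power_increasing[of 1 "k + 1" x] by simp
  qed (use x in auto)
  finally show "(LINT t|half_line 0. exp (- (x * t)) * (1 + t) ^ L) \<le> (\<Sum>k\<le>L. real (L choose k) * fact k) / x"
    by (simp add: sum_divide_distrib)
qed

section \<open>The amplitude of the outgoing solution for a Laplace transform potential\<close>

text \<open>A quantitative way to stay off the slit, since \<open>t - 2 * \<i> * z\<close> vanishes
  for some \<open>t \<ge> 0\<close> exactly when z lies on it. The linear growth in t makes the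
  Volterra kernel below O(1/(1+t)), and the case \<open>t = 0\<close> keeps z away from
  \<open>0\<close>.\<close>

definition slit_bound :: "complex set \<Rightarrow> real \<Rightarrow> bool" where
  "slit_bound U c \<longleftrightarrow> open U \<and> 0 < c \<and> (\<forall>z\<in>U. \<forall>t\<ge>0. c * (1 + t) \<le> norm (of_real t - 2 * \<i> * z))"

lemma slit_bound_exists:
  assumes "z0 \<notin> neg_imag_axis"
  obtains r c where "r > 0" "slit_bound (ball z0 r) c"
proof -
  let ?S = "complex_of_real ` {0..}"
  have "?S = \<real>\<^sub>\<ge>\<^sub>0" by (auto simp: nonneg_Reals_def)
  then have "closed ?S" by simp
  moreover have "2 * \<i> * z0 \<notin> ?S"
  proof
    assume "2 * \<i> * z0 \<in> ?S"
    then obtain t where t: "t \<ge> 0" "2 * \<i> * z0 = of_real t" by auto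
    have "Re (2 * \<i> * z0) = t" "Im (2 * \<i> * z0) = 0" unfolding t(2) by simp_all
    then have "Im z0 = - (t / 2)" "Re z0 = 0" by simp_all
    then show False using t(1) assms by (simp add: neg_imag_axis_def)
  qed
  ultimately have "infdist (2 * \<i> * z0) ?S > 0"
    by (intro infdist_pos_not_in_closed) auto
  define \<delta> where "\<delta> = infdist (2 * \<i> * z0) ?S"
  have \<delta>: "\<delta> > 0" unfolding \<delta>_def by fact
  have dist0: "\<delta> \<le> norm (of_real t - 2 * \<i> * z0)" if "t \<ge> 0" for t
    unfolding \<delta>_def using infdist_le[of "of_real t" ?S "2 * \<i> * z0"] that
    by (simp add: dist_norm norm_minus_commute)
  define r where "r = \<delta> / 4"
  define \<Lambda> where "\<Lambda> = 2 * (norm z0 + r)"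
  \<comment> \<open>The first entry serves \<open>t \<le> 2 * \<Lambda> + 1\<close>, where the
    distance to the ray is at least \<open>\<delta> / 2\<close>; the second serves larger t, where
    \<open>t - \<Lambda> \<ge> (1 + t) / 2\<close>.\<close>
  define c where "c = min (\<delta> / 2 / (2 + 2 * \<Lambda>)) (1 / 2)"
  have r: "r > 0" using \<delta> by (simp add: r_def)
  have \<Lambda>: "\<Lambda> \<ge> 0" using r by (simp add: \<Lambda>_def)
  have c: "c > 0" "c * (2 + 2 * \<Lambda>) \<le> \<delta> / 2" "c \<le> 1 / 2"
  proof -
    show "c > 0" using \<delta> \<Lambda> by (simp add: c_def)
    show "c \<le> 1 / 2" unfolding c_def by (rule min.cobounded2)
    have "c \<le> \<delta> / 2 / (2 + 2 * \<Lambda>)" by (simp add: c_def)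
    then show "c * (2 + 2 * \<Lambda>) \<le> \<delta> / 2"
      by (rule pos_le_divide_eq[THEN iffD1, rotated]) (use \<Lambda> in simp)
  qed
  have "c * (1 + t) \<le> norm (of_real t - 2 * \<i> * z)" if z: "z \<in> ball z0 r" and t: "t \<ge> 0" for z t
  proof (cases "t \<le> 2 * \<Lambda> + 1")
    case True
    have "norm (2 * \<i> * z0 - 2 * \<i> * z) = 2 * norm (z0 - z)"
      by (simp add: norm_mult flip: right_diff_distrib)
    also have "\<dots> \<le> \<delta> / 2" using z by (simp add: dist_norm r_def)
    finally have "\<delta> / 2 \<le> norm (of_real t - 2 * \<i> * z)"
      using dist0[OF t] norm_triangle_ineq2[of "of_real t - 2 * \<i> * z0" "of_real t - 2 * \<i> * z"]
      by (simp add: norm_minus_commute)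
    moreover have "c * (1 + t) \<le> c * (2 + 2 * \<Lambda>)" using True c by (intro mult_left_mono) auto
    ultimately show ?thesis using c by linarith
  next
    case False
    have "norm (2 * \<i> * z) \<le> \<Lambda>"
      using z norm_triangle_ineq2[of z z0] by (simp add: norm_mult \<Lambda>_def dist_norm norm_minus_commute)
    moreover have "norm (complex_of_real t) - norm (2 * \<i> * z) \<le> norm (of_real t - 2 * \<i> * z)"
      by (rule norm_triangle_ineq2)
    ultimately have "t - \<Lambda> \<le> norm (of_real t - 2 * \<i> * z)" using t by simp
    moreover have "c * (1 + t) \<le> 1 / 2 * (1 + t)" using t c by (intro mult_right_mono) auto
    ultimately show ?thesis using False by simp
  qed
  then have "slit_bound (ball z0 r) c" using c by (simp add: slit_bound_def)
  with r show ?thesis by (rule that)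
qed

section \<open>Volterra equation for the amplitude in the Laplace variable\<close>

locale laplace_potential =
  fixes b :: cfun and \<kappa> :: complex and B :: real
  assumes b_meas [measurable]: "b \<in> borel_measurable borel" and B_nonneg: "B \<ge> 0"
    and b_bound: "\<And>t. t \<ge> 0 \<Longrightarrow> norm (b t) \<le> B"
    and b_lipschitz: "\<And>t. t \<ge> 0 \<Longrightarrow> norm (b t - \<kappa>) \<le> B * t"
begin

text \<open>Chosen so that \<open>- 2 * \<i> * z * al z = \<kappa>\<close>: in the square of
  \<open>\<i> * z - al z / x\<close> the mixed term is then \<open>\<kappa> / x\<close> and cancels
  the slowly decaying part of the potential.\<close>

definition al :: "complex \<Rightarrow> complex" where "al z = \<i> * \<kappa> / (2 * z)"

text \<open>The amplitude \<open>a = 1 + laplace \<phi>\<close> of a solution \<open>exp (\<i> z x - al z ln x) a(x)\<close> for the potential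
  \<open>laplace b\<close> satisfies \<open>a'' + 2 (\<i> z - al z / x) a' + q z a = 0\<close>, where \<open>q z\<close> is the Laplace transform
  of \<open>h z\<close>. On the Laplace side this is a Volterra equation for \<open>\<phi>\<close> with the factor
  \<open>t (t - 2 \<i> z)\<close>, which vanishes for some \<open>t > 0\<close> only if \<open>z\<close> is on the slit.\<close>

definition h :: "complex \<Rightarrow> cfun" where
  "h z t = ((al z)\<^sup>2 + al z) * of_real t - (b t - \<kappa>)"

definition q :: "complex \<Rightarrow> cfun" where
  "q z x = ((al z)\<^sup>2 + al z) / of_real x ^ 2 - (laplace b x - \<kappa> / of_real x)"

text \<open>On the Laplace side a derivative becomes multiplication by \<open>- t\<close> and
  \<open>1 / x\<close> becomes integration. The term with \<open>al z / x\<close> thus gives the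
  kernel \<open>2 * al z * s\<close>, the product of \<open>q z\<close> with the transform of
  \<open>phi z\<close> gives a convolution with \<open>h z\<close>, and the division by
  \<open>t * (t - 2 * \<i> * z)\<close> solves for \<open>phi z\<close>.\<close>

definition phi_kernel :: "complex \<Rightarrow> real \<Rightarrow> cfun" where
  "phi_kernel z t s = (if s \<le> t then - (2 * al z * of_real s + h z (t - s)) / (of_real t * (of_real t - 2 * \<i> * z)) else 0)"

definition phi_source :: "complex \<Rightarrow> cfun" where
  "phi_source z t = - h z t / (of_real t * (of_real t - 2 * \<i> * z))"

definition phi :: "complex \<Rightarrow> cfun" where
  "phi z = volterra_sol (half_line 0) (phi_kernel z) (phi_source z)"

definition amp :: "complex \<Rightarrow> cfun" where "amp z x = 1 + laplace (phi z) x"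

definition amp' :: "complex \<Rightarrow> cfun" where
  "amp' z x = - laplace (\<lambda>t. of_real t * phi z t) x"

lemma h_meas [measurable]: "h z \<in> borel_measurable borel"
  unfolding h_def[abs_def] by measurable

lemma slit_bound_norm: "slit_bound U c \<Longrightarrow> z \<in> U \<Longrightarrow> c / 2 \<le> norm z"
  unfolding slit_bound_def by (force simp: norm_mult)

lemma slit_bound_nonzero: "slit_bound U c \<Longrightarrow> z \<in> U \<Longrightarrow> z \<noteq> 0"
  using slit_bound_norm[of U c z] by (auto simp: slit_bound_def)

lemma al_bound: "slit_bound U c \<Longrightarrow> z \<in> U \<Longrightarrow> norm (al z) \<le> norm \<kappa> / c"
proof -
  assume U: "slit_bound U c" "z \<in> U"
  then have c: "c > 0" by (simp add: slit_bound_def)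
  have "norm (al z) = norm \<kappa> / (2 * norm z)" by (simp add: al_def norm_divide norm_mult)
  also have "\<dots> \<le> norm \<kappa> / c"
    using slit_bound_norm[OF U] c by (intro divide_left_mono mult_pos_pos) auto
  finally show ?thesis .
qed

definition Hc :: "real \<Rightarrow> real" where "Hc c = (norm \<kappa> / c)\<^sup>2 + norm \<kappa> / c + B"

lemma Hc_nonneg: "c > 0 \<Longrightarrow> Hc c \<ge> 0" using B_nonneg by (simp add: Hc_def)

text \<open>Subtracting \<open>\<kappa>\<close> from \<open>b\<close> makes \<open>h z\<close>
  vanish linearly at \<open>0\<close>, which balances the factor \<open>t\<close> in the
  denominators of kernel and source.\<close>

lemma h_bound: "slit_bound U c \<Longrightarrow> z \<in> U \<Longrightarrow> t \<ge> 0 \<Longrightarrow> norm (h z t) \<le> Hc c * t"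
proof -
  assume U: "slit_bound U c" "z \<in> U" and t: "t \<ge> 0"
  have a: "norm (al z) \<le> norm \<kappa> / c" by (rule al_bound[OF U])
  have "norm ((al z)\<^sup>2 + al z) \<le> (norm \<kappa> / c)\<^sup>2 + norm \<kappa> / c"
    using a by (intro norm_triangle_le add_mono) (auto simp: norm_power intro!: power_mono)
  then have "norm (((al z)\<^sup>2 + al z) * of_real t) \<le> ((norm \<kappa> / c)\<^sup>2 + norm \<kappa> / c) * t"
    unfolding norm_mult using t by (auto intro!: mult_right_mono)
  then show ?thesis
    unfolding h_def Hc_def using b_lipschitz[OF t]
      norm_triangle_ineq4[of "((al z)\<^sup>2 + al z) * of_real t" "b t - \<kappa>"]
    by (simp add: algebra_simps)
qed

definition Kc :: "real \<Rightarrow> real" where "Kc c = (2 * (norm \<kappa> / c) + Hc c) / c"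

text \<open>Integrating the weight \<open>(1 + t) ^ L\<close> gains \<open>1 / (L + 1)\<close>; this
  exponent makes \<open>Kc c / (L + 1)\<close> at most one half.\<close>

definition Lc :: "real \<Rightarrow> nat" where "Lc c = nat \<lceil>2 * Kc c\<rceil>"

text \<open>Numerators are O(t) and the denominator is at least \<open>c * t * (1 + t)\<close>, so
  the kernel is O(1/(1+t)) on the triangle. Hence \<open>phi z\<close> grows only polynomially, and
  its Laplace transform exists for every \<open>x > 0\<close>.\<close>

lemma phi_volterra:
  assumes U: "slit_bound U c" "z \<in> U"
  shows "volterra (half_line 0) (phi_kernel z) (phi_source z)
    (\<lambda>t s. if 0 \<le> s \<and> s \<le> t then Kc c / (1 + t) else 0) (\<lambda>t. (1 + t) ^ Lc c) (Hc c / c)"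
proof -
  interpret sigma_finite_measure "half_line 0" by (rule sigma_finite_half_line)
  have c: "c > 0" using U by (simp add: slit_bound_def)
  have K0: "Kc c \<ge> 0" using c Hc_nonneg[OF c] by (simp add: Kc_def)
  \<comment> \<open>At \<open>t = 0\<close> the quotient is \<open>0\<close> by the convention for
    division by zero, so the estimate extends to the end point.\<close>
  have den: "norm (y / (of_real t * (of_real t - 2 * \<i> * z))) \<le> A / (c * (1 + t))"
    if "norm y \<le> A * t" "t \<ge> 0" "A \<ge> 0" for y :: complex and A t
  proof (cases "t = 0")
    case False
    have "c * (1 + t) \<le> norm (of_real t - 2 * \<i> * z)" using U that by (simp add: slit_bound_def)
    moreover have "0 < c * (1 + t)" using that c by (intro mult_pos_pos) auto
    ultimately have "norm y / (t * norm (of_real t - 2 * \<i> * z)) \<le> (A * t) / (t * (c * (1 + t)))"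
      using that False c by (intro frac_le mult_left_mono mult_pos_pos) auto
    then show ?thesis using that False by (simp add: norm_divide norm_mult)
  qed (use that c in simp)
  have "volterra_axioms (half_line 0) (phi_kernel z) (phi_source z)
    (\<lambda>t s. if 0 \<le> s \<and> s \<le> t then Kc c / (1 + t) else 0) (\<lambda>t. (1 + t) ^ Lc c) (Hc c / c)"
  proof (unfold_locales, goal_cases)
    case 1
    have "case_prod (phi_kernel z) \<in> borel_measurable (borel \<Otimes>\<^sub>M borel)"
      unfolding phi_kernel_def[abs_def] by measurable
    then show ?case by (rule borel_measurable_half_line_pair)
  next
    case 2
    show ?case unfolding phi_source_def[abs_def] by (rule borel_measurable_half_line) measurable
  next
    case (3 t s)
    show ?case
    proof (cases "s \<le> t")
      case True
      have s: "0 \<le> s" "0 \<le> t" using 3 by auto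
      have "norm (2 * al z * of_real s) \<le> 2 * (norm \<kappa> / c) * t"
        unfolding norm_mult using al_bound[OF U] s True c by (intro mult_mono) auto
      moreover have "norm (h z (t - s)) \<le> Hc c * t"
        using h_bound[OF U, of "t - s"] True s Hc_nonneg[OF c]
          mult_left_mono[of "t - s" t "Hc c"] by simp
      ultimately have "norm (- (2 * al z * of_real s + h z (t - s))) \<le> (2 * (norm \<kappa> / c) + Hc c) * t"
        using norm_triangle_ineq[of "2 * al z * of_real s" "h z (t - s)"]
        unfolding norm_minus_cancel distrib_right by linarith
      from den[OF this s(2)] show ?thesis
        using True s c Hc_nonneg[OF c] by (simp add: phi_kernel_def Kc_def)
    qed (simp add: phi_kernel_def)
  next
    case (4 t)
    then have t: "0 \<le> t" by simp
    have e: "(\<lambda>s. (if 0 \<le> s \<and> s \<le> t then Kc c / (1 + t) else 0) * (1 + s) ^ Lc c) =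
      (\<lambda>s. if 0 \<le> s \<and> s \<le> t then Kc c / (1 + t) * (1 + s) ^ Lc c else 0)" by auto
    show ?case unfolding e half_line_truncate(1)[OF order_refl]
      by (intro lebesgue_on_interval_integral(1) continuous_intros) (use t in auto)
  next
    case (5 t)
    then have t: "0 \<le> t" by simp
    have e: "(\<lambda>s. (if 0 \<le> s \<and> s \<le> t then Kc c / (1 + t) else 0) * (1 + s) ^ Lc c) =
      (\<lambda>s. if 0 \<le> s \<and> s \<le> t then Kc c / (1 + t) * (1 + s) ^ Lc c else 0)" by auto
    let ?F = "\<lambda>s. Kc c / (1 + t) * ((1 + s) ^ Suc (Lc c) / real (Suc (Lc c)))"
    have "(LINT s|half_line 0. (if 0 \<le> s \<and> s \<le> t then Kc c / (1 + t) * (1 + s) ^ Lc c else 0)) = ?F t - ?F 0"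
    proof (rule half_line_interval_FTC(2))
      show "(?F has_vector_derivative Kc c / (1 + t) * (1 + s) ^ Lc c) (at s within {0..t})" for s
        unfolding has_real_derivative_iff_has_vector_derivative[symmetric]
        by (rule derivative_eq_intros refl | simp del: power_Suc of_nat_Suc)+
    qed (auto intro!: continuous_intros t)
    also have "\<dots> \<le> ?F t" using K0 t by simp
    also have "\<dots> = Kc c / real (Suc (Lc c)) * (1 + t) ^ Lc c"
    proof -
      have "K / y * (y ^ Suc n / m) = K / m * y ^ n" if "y \<noteq> 0" for K y m :: real and n
        using that by simp
      then show ?thesis using t by (simp del: power_Suc of_nat_Suc)
    qed
    also have "\<dots> \<le> 1 / 2 * (1 + t) ^ Lc c"
    proof (rule mult_right_mono)
      have "2 * Kc c \<le> real (Lc c)" using K0 by (simp add: Lc_def real_nat_ceiling_ge)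
      then show "Kc c / real (Suc (Lc c)) \<le> 1 / 2" by (simp add: field_simps)
    qed (use t in auto)
    finally show ?case unfolding e by simp
  next
    case (6 t)
    then have t: "0 \<le> t" by simp
    have "norm (phi_source z t) \<le> Hc c / (c * (1 + t))"
      unfolding phi_source_def by (rule den) (use h_bound[OF U t] t Hc_nonneg[OF c] in auto)
    also have "\<dots> \<le> Hc c / c" using t c Hc_nonneg[OF c] by (intro divide_left_mono mult_pos_pos) auto
    also have "\<dots> \<le> Hc c / c * (1 + t) ^ Lc c"
      using mult_left_mono[of 1 "(1 + t) ^ Lc c" "Hc c / c"] t c Hc_nonneg[OF c] by simp
    finally show ?case .
  qed (use c Hc_nonneg[OF c] in auto)
  then show ?thesis by (intro volterra.intro sigma_finite_half_line)
qed

lemma phi_meas: "slit_bound U c \<Longrightarrow> z \<in> U \<Longrightarrow> phi z \<in> borel_measurable (half_line 0)"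
  unfolding phi_def by (rule volterra.sol_meas[OF phi_volterra])

lemma phi_bound: "slit_bound U c \<Longrightarrow> z \<in> U \<Longrightarrow> t \<ge> 0 \<Longrightarrow> norm (phi z t) \<le> 2 * (Hc c / c) * (1 + t) ^ Lc c"
  unfolding phi_def using volterra.sol_bound[OF phi_volterra, of U c z t] by simp

lemma times_phi:
  assumes U: "slit_bound U c" "z \<in> U"
  shows "(\<lambda>t. of_real t * phi z t) \<in> borel_measurable (half_line 0)"
    "t \<ge> 0 \<Longrightarrow> norm (of_real t * phi z t) \<le> 2 * (Hc c / c) * (1 + t) ^ Suc (Lc c)"
    "(\<lambda>t. of_real t * (of_real t * phi z t)) \<in> borel_measurable (half_line 0)"
    "t \<ge> 0 \<Longrightarrow> norm (of_real t * (of_real t * phi z t)) \<le> 2 * (Hc c / c) * (1 + t) ^ Suc (Suc (Lc c))"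
proof -
  have r: "(complex_of_real) \<in> borel_measurable (half_line 0)" by (rule borel_measurable_half_line) measurable
  show 1: "(\<lambda>t. of_real t * phi z t) \<in> borel_measurable (half_line 0)"
    by (intro borel_measurable_times r phi_meas[OF U])
  show "(\<lambda>t. of_real t * (of_real t * phi z t)) \<in> borel_measurable (half_line 0)"
    by (rule borel_measurable_times[OF r 1])
  have st: "norm (of_real t * f) \<le> A * (1 + t) ^ Suc n" if "t \<ge> 0" "norm f \<le> A * (1 + t) ^ n" for f :: complex and t A n
  proof -
    have "t * norm f \<le> (1 + t) * (A * (1 + t) ^ n)" using that by (intro mult_mono) auto
    then show ?thesis using that by (simp add: norm_mult mult_ac)
  qed
  show 2: "t \<ge> 0 \<Longrightarrow> norm (of_real t * phi z t) \<le> 2 * (Hc c / c) * (1 + t) ^ Suc (Lc c)" for t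
    by (rule st[OF _ phi_bound[OF U]])
  show "t \<ge> 0 \<Longrightarrow> norm (of_real t * (of_real t * phi z t)) \<le> 2 * (Hc c / c) * (1 + t) ^ Suc (Suc (Lc c))"
    by (rule st[OF _ 2])
qed

lemma phi_holomorphic:
  assumes U: "slit_bound U c" and t: "t \<ge> 0"
  shows "(\<lambda>z. phi z t) holomorphic_on U"
  unfolding phi_def
proof (rule volterra_sol_holomorphic[OF _ phi_volterra[OF U]])
  show "open U" using U by (simp add: slit_bound_def)
  have nz: "of_real t - 2 * \<i> * z \<noteq> 0" if "z \<in> U" "t \<ge> 0" for z t
  proof -
    have "0 < c * (1 + t)" using U that by (intro mult_pos_pos) (auto simp: slit_bound_def)
    also have "\<dots> \<le> norm (of_real t - 2 * \<i> * z)" using U that by (auto simp: slit_bound_def)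
    finally show ?thesis by auto
  qed
  show "(\<lambda>z. phi_kernel z t s) holomorphic_on U" if "t \<in> space (half_line 0)" for t s
  proof (cases "s \<le> t \<and> t \<noteq> 0")
    case True
    then show ?thesis using that nz[of _ t] slit_bound_nonzero[OF U]
      by (auto simp: phi_kernel_def h_def al_def intro!: holomorphic_intros)
  next
    case False
    then have "phi_kernel z t s = 0" for z by (auto simp: phi_kernel_def)
    then show ?thesis by simp
  qed
  show "(\<lambda>z. phi_source z t) holomorphic_on U" if "t \<in> space (half_line 0)" for t
  proof (cases "t = 0")
    case False
    then show ?thesis using that nz[of _ t] slit_bound_nonzero[OF U]
      by (auto simp: phi_source_def h_def al_def intro!: holomorphic_intros)
  next
    case True
    then have "phi_source z t = 0" for z by (auto simp: phi_source_def)
    then show ?thesis by simp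
  qed
qed (use t in auto)

lemma laplace_holomorphic:
  assumes "open U" "\<And>z. z \<in> U \<Longrightarrow> f z \<in> borel_measurable (half_line 0)"
    "\<And>z t. z \<in> U \<Longrightarrow> t \<ge> 0 \<Longrightarrow> norm (f z t) \<le> A * (1 + t) ^ L"
    "\<And>t. t \<ge> 0 \<Longrightarrow> (\<lambda>z. f z t) holomorphic_on U" and x: "x > 0"
  shows "(\<lambda>z. laplace (f z) x) holomorphic_on U"
  unfolding laplace_def
proof (rule holomorphic_on_integral[where k = "\<lambda>t. A * (exp (- (x * t)) * (1 + t) ^ L)"])
  show "integrable (half_line 0) (\<lambda>t. A * (exp (- (x * t)) * (1 + t) ^ L))"
    using integrable_poly_exp[OF x, of L] by simp
  show "norm (of_real (exp (- (x * t))) * f z t) \<le> A * (exp (- (x * t)) * (1 + t) ^ L)"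
    if "z \<in> U" "t \<in> space (half_line 0)" for z t
    using mult_left_mono[OF assms(3)[of z t], of "exp (- (x * t))"] that by (simp add: norm_mult mult_ac)
  show "(\<lambda>t. of_real (exp (- (x * t))) * f z t) \<in> borel_measurable (half_line 0)" if "z \<in> U" for z
    by (intro borel_measurable_times assms(2) that borel_measurable_half_line) measurable
qed (use assms in \<open>auto intro!: holomorphic_intros\<close>)

lemma amp_holomorphic:
  assumes U: "slit_bound U c" and x: "x > 0"
  shows "(\<lambda>z. amp z x) holomorphic_on U" "(\<lambda>z. amp' z x) holomorphic_on U"
proof -
  have o: "open U" using U by (simp add: slit_bound_def)
  show "(\<lambda>z. amp z x) holomorphic_on U" unfolding amp_def
    by (rule holomorphic_on_add[OF holomorphic_on_const
        laplace_holomorphic[OF o phi_meas[OF U] phi_bound[OF U] phi_holomorphic[OF U] x]])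
  show "(\<lambda>z. amp' z x) holomorphic_on U" unfolding amp'_def
    by (rule holomorphic_on_minus[OF laplace_holomorphic[OF o times_phi(1,2)[OF U]
        holomorphic_on_mult[OF holomorphic_on_const phi_holomorphic[OF U]] x]])
qed

lemma amp_bound:
  assumes U: "slit_bound U c"
  obtains A where "A \<ge> 0" "\<And>z x. z \<in> U \<Longrightarrow> x \<ge> 1 \<Longrightarrow> norm (amp z x - 1) \<le> A / x"
    "\<And>z x. z \<in> U \<Longrightarrow> x \<ge> 1 \<Longrightarrow> norm (amp' z x) \<le> A / x"
proof -
  have c: "c > 0" using U by (simp add: slit_bound_def)
  define G where "G = 2 * (Hc c / c)"
  have G: "G \<ge> 0" using Hc_nonneg[OF c] c by (simp add: G_def)
  obtain A1 where A1: "A1 \<ge> 0" "\<And>x. x \<ge> 1 \<Longrightarrow> (LINT t|half_line 0. exp (- (x * t)) * (1 + t) ^ Lc c) \<le> A1 / x"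
    using poly_exp_integral_bound[of "Lc c"] by blast
  obtain A2 where A2: "A2 \<ge> 0" "\<And>x. x \<ge> 1 \<Longrightarrow> (LINT t|half_line 0. exp (- (x * t)) * (1 + t) ^ Suc (Lc c)) \<le> A2 / x"
    using poly_exp_integral_bound[of "Suc (Lc c)"] by blast
  note A = A1 A2
  show ?thesis
  proof (rule that[of "G * A1 + G * A2"])
    show "0 \<le> G * A1 + G * A2" using G A by simp
    fix z and x :: real assume z: "z \<in> U" and x: "x \<ge> 1"
    have "norm (amp z x - 1) \<le> G * (LINT t|half_line 0. exp (- (x * t)) * (1 + t) ^ Lc c)"
      unfolding amp_def G_def
      using laplace_integrable(2)[OF phi_meas[OF U z] phi_bound[OF U z], of x] x by simp
    also have "\<dots> \<le> G * (A1 / x)" by (rule mult_left_mono[OF A(2)[OF x] G])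
    also have "\<dots> \<le> (G * A1 + G * A2) / x" using G A x by (simp add: divide_right_mono)
    finally show "norm (amp z x - 1) \<le> (G * A1 + G * A2) / x" .
    have "norm (amp' z x) \<le> G * (LINT t|half_line 0. exp (- (x * t)) * (1 + t) ^ Suc (Lc c))"
      unfolding amp'_def G_def norm_minus_cancel
      by (rule laplace_integrable(2)[OF times_phi(1,2)[OF U z]]) (use x in auto)
    also have "\<dots> \<le> G * (A2 / x)" by (rule mult_left_mono[OF A(4)[OF x] G])
    also have "\<dots> \<le> (G * A1 + G * A2) / x" using G A x by (simp add: divide_right_mono)
    finally show "norm (amp' z x) \<le> (G * A1 + G * A2) / x" .
  qed
qed

lemma laplace_power:
  assumes x: "x > 0"
  shows "laplace (\<lambda>t. of_real t ^ k) x = fact k / of_real x ^ (k + 1)"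
proof -
  have "laplace (\<lambda>t. of_real t ^ k) x = (LINT t|half_line 0. complex_of_real (t ^ k * exp (- (x * t))))"
    unfolding laplace_def by (simp add: mult_ac)
  then show ?thesis unfolding integral_complex_of_real gamma_half_line(2)[OF x] by simp
qed

lemma laplace_h:
  assumes x: "x > 0"
  shows "laplace (h z) x = q z x"
proof -
  have i: "integrable (half_line 0) (\<lambda>t. of_real (exp (- (x * t))) * complex_of_real t ^ k)" for k
    by (rule laplace_integrable(1)[where A = 1 and L = k, OF borel_measurable_half_line])
      (use x in \<open>auto simp: norm_power intro!: power_mono\<close>)
  have ib: "integrable (half_line 0) (\<lambda>t. of_real (exp (- (x * t))) * b t)"
    by (rule laplace_integrable(1)[where A = B and L = 0, OF borel_measurable_half_line])
      (use x b_bound in auto)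
  have "laplace (h z) x = (LINT t|half_line 0. ((al z)\<^sup>2 + al z) * (of_real (exp (- (x * t))) * of_real t ^ 1)
      - (of_real (exp (- (x * t))) * b t - \<kappa> * (of_real (exp (- (x * t))) * of_real t ^ 0)))"
    unfolding laplace_def by (simp add: h_def algebra_simps)
  also have "\<dots> = ((al z)\<^sup>2 + al z) * laplace (\<lambda>t. of_real t ^ 1) x - (laplace b x - \<kappa> * laplace (\<lambda>t. of_real t ^ 0) x)"
    unfolding laplace_def
    by (subst Bochner_Integration.integral_diff, intro integrable_mult_right i,
        intro Bochner_Integration.integrable_diff ib integrable_mult_right i,
        subst Bochner_Integration.integral_diff, rule ib, intro integrable_mult_right i,
        simp only: integral_mult_right_zero)
  also have "\<dots> = q z x"
    using laplace_power[OF x, of 1] laplace_power[OF x, of 0] by (simp add: q_def power2_eq_square)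
  finally show ?thesis .
qed

text \<open>The linear vanishing of \<open>h z\<close> at \<open>0\<close> becomes decay of order
  two; this is where subtracting \<open>\<kappa> / x\<close> pays off.\<close>

lemma q_bound:
  assumes U: "slit_bound U c" "z \<in> U" and x: "x > 0"
  shows "norm (q z x) \<le> Hc c / x\<^sup>2"
proof -
  have c: "c > 0" using U by (simp add: slit_bound_def)
  have i: "integrable (half_line 0) (\<lambda>t. Hc c * (t ^ 1 * exp (- (x * t))))"
    by (intro integrable_mult_right gamma_half_line x)
  have le: "norm (of_real (exp (- (x * t))) * h z t) \<le> Hc c * (t ^ 1 * exp (- (x * t)))" if "t \<ge> 0" for t
    using mult_left_mono[OF h_bound[OF U that], of "exp (- (x * t))"] by (simp add: norm_mult mult_ac)
  have "norm (q z x) \<le> (LINT t|half_line 0. norm (of_real (exp (- (x * t))) * h z t))"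
    unfolding laplace_h[OF x, symmetric] laplace_def by (rule integral_norm_bound)
  also have "\<dots> \<le> (LINT t|half_line 0. Hc c * (t ^ 1 * exp (- (x * t))))"
  proof (rule integral_mono_AE'[OF i])
    show "AE t in half_line 0. norm (of_real (exp (- (x * t))) * h z t) \<le> Hc c * (t ^ 1 * exp (- (x * t)))"
      using le by (intro AE_I2) auto
    show "AE t in half_line 0. 0 \<le> Hc c * (t ^ 1 * exp (- (x * t)))"
      using Hc_nonneg[OF c] by (intro AE_I2) simp
  qed
  also have "\<dots> = Hc c / x\<^sup>2"
    unfolding integral_mult_right_zero gamma_half_line(2)[OF x] by (simp add: power2_eq_square)
  finally show ?thesis .
qed

lemma laplace_b_derivative:
  "x > 0 \<Longrightarrow> (laplace b has_vector_derivative - laplace (\<lambda>t. of_real t * b t) x) (at x within S)"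
  by (rule laplace_derivative[where A = B and L = 0]) (use b_bound borel_measurable_half_line in auto)

lemma q_continuous: "continuous_on {1..} (q z)"
proof -
  have "continuous_on {1..} (laplace b)"
    unfolding continuous_on_eq_continuous_within
    by (intro ballI has_vector_derivative_continuous[OF laplace_b_derivative]) auto
  then show ?thesis unfolding q_def[abs_def] by (intro continuous_intros) auto
qed

lemma q_holomorphic: "0 \<notin> U \<Longrightarrow> (\<lambda>z. q z x) holomorphic_on U"
  unfolding q_def al_def by (intro holomorphic_intros) auto

text \<open>The Volterra equation, multiplied by its denominator, is transformed term by term:
  powers of t become derivatives of the amplitude and convolutions become products. The equation for
  the second derivative then results by solving for the transform of
  \<open>t ^ 2 * phi z t\<close>.\<close>

lemma amp_ode:
  assumes U: "slit_bound U c" "z \<in> U" and x: "x > 0"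
  shows "(amp z has_vector_derivative amp' z x) (at x within S)"
    "(amp' z has_vector_derivative
       - (2 * (\<i> * z - al z / of_real x) * amp' z x + q z x * amp z x)) (at x within S)"
proof -
  have c: "c > 0" using U by (simp add: slit_bound_def)
  have d1: "(laplace (phi z) has_vector_derivative amp' z x) (at x within S)"
    unfolding amp'_def by (rule laplace_derivative[OF phi_meas[OF U] phi_bound[OF U] x])
  show "(amp z has_vector_derivative amp' z x) (at x within S)"
    unfolding amp_def[abs_def] using has_vector_derivative_add[OF has_vector_derivative_const d1, of 1] by simp
  let ?t1 = "\<lambda>t. of_real t * phi z t" and ?t2 = "\<lambda>t. of_real t * (of_real t * phi z t)"
  have d2: "(amp' z has_vector_derivative laplace ?t2 x) (at x within S)"
    unfolding amp'_def[abs_def]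
    using has_vector_derivative_minus[OF laplace_derivative[OF times_phi(1,2)[OF U] x, of S]] by simp
  have one: "(\<lambda>t::real. 1 :: complex) \<in> borel_measurable borel" "\<And>t. t \<ge> 0 \<Longrightarrow> norm (1 :: complex) \<le> 1 * (1 + t :: real) ^ 0"
    by auto
  have hb: "norm (h z t) \<le> Hc c * (1 + t) ^ 1" if "t \<ge> 0" for t
    using h_bound[OF U that] Hc_nonneg[OF c] by (simp add: distrib_left)
  note c1 = laplace_conv[OF one times_phi(1,2)[OF U] x]
  note c2 = laplace_conv[OF h_meas hb phi_meas[OF U] phi_bound[OF U] x]
  interpret volterra "half_line 0" "phi_kernel z" "phi_source z"
    "\<lambda>t s. if 0 \<le> s \<and> s \<le> t then Kc c / (1 + t) else 0" "\<lambda>t. (1 + t) ^ Lc c" "Hc c / c"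
    by (rule phi_volterra[OF U])
  have eq: "of_real t * (of_real t - 2 * \<i> * z) * phi z t =
      - h z t - (2 * al z * conv (\<lambda>_. 1) ?t1 t + conv (h z) (phi z) t)" if t: "t > 0" for t
  proof -
    let ?d = "of_real t * (of_real t - 2 * \<i> * z)"
    have "0 < c * (1 + t)" using t c by (intro mult_pos_pos) auto
    also have "\<dots> \<le> norm (of_real t - 2 * \<i> * z)" using U t by (auto simp: slit_bound_def)
    finally have nz: "?d \<noteq> 0" using t by auto
    have m: "(\<lambda>s. if s \<le> t then f (t - s) * g s else 0) \<in> borel_measurable (half_line 0)"
      if "f \<in> borel_measurable borel" "g \<in> borel_measurable (half_line 0)" for f g :: cfun
    proof -
      have [measurable]: "f \<in> borel_measurable borel" by fact
      have "(\<lambda>s. if s \<le> t then f (t - s) else 0) \<in> borel_measurable borel" by measurable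
      then have "(\<lambda>s. if s \<le> t then f (t - s) else 0) \<in> borel_measurable (half_line 0)"
        by (rule borel_measurable_half_line)
      from borel_measurable_times[OF this that(2)] show ?thesis
        by (rule back_subst[of "\<lambda>f. f \<in> _"]) auto
    qed
    have bint: "integrable (half_line 0) (\<lambda>s. if s \<le> t then f (t - s) * g s else 0)"
      if f: "f \<in> borel_measurable borel" "\<And>s. s \<ge> 0 \<Longrightarrow> norm (f s) \<le> A * (1 + s) ^ L"
        and g: "g \<in> borel_measurable (half_line 0)" "\<And>s. s \<ge> 0 \<Longrightarrow> norm (g s) \<le> A' * (1 + s) ^ L'"
        for f g :: cfun and A L A' L'
    proof -
      have A: "A \<ge> 0" "A' \<ge> 0" using f(2)[of 0] g(2)[of 0] norm_ge_zero[of "f 0"] norm_ge_zero[of "g 0"]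
        by (simp_all del: norm_ge_zero)
      have "integrable (lebesgue_on {0..t}) (\<lambda>s. if s \<le> t then f (t - s) * g s else 0)"
      proof (rule integrable_half_line_bounded[OF m[OF f(1) g(1)]])
        fix s assume s: "0 \<le> s" "s \<le> t"
        have "norm (f (t - s)) \<le> A * (1 + t) ^ L"
          using s A by (intro order_trans[OF f(2)] mult_left_mono power_mono) auto
        moreover have "norm (g s) \<le> A' * (1 + t) ^ L'"
          using s A by (intro order_trans[OF g(2)] mult_left_mono power_mono) auto
        ultimately show "norm (if s \<le> t then f (t - s) * g s else 0) \<le> (A * (1 + t) ^ L) * (A' * (1 + t) ^ L')"
          using s A t by (auto simp: norm_mult intro!: mult_mono)
      qed
      then have "integrable (half_line 0) (\<lambda>s. if 0 \<le> s \<and> s \<le> t then (if s \<le> t then f (t - s) * g s else 0) else 0)"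
        by (simp only: half_line_truncate(1)[OF order_refl])
      then show ?thesis
        by (rule Bochner_Integration.integrable_cong[THEN iffD1, rotated 2]) auto
    qed
    have e: "phi z t = phi_source z t + (LINT s|half_line 0. phi_kernel z t s * phi z s)"
      using sol_eq[of t] t by (simp add: phi_def)
    have "?d * phi z t = ?d * phi_source z t + (LINT s|half_line 0. ?d * (phi_kernel z t s * phi z s))"
      by (subst e) (simp only: integral_mult_right_zero distrib_left)
    also have "?d * phi_source z t = - h z t" using nz by (simp add: phi_source_def)
    also have "(LINT s|half_line 0. ?d * (phi_kernel z t s * phi z s)) =
        (LINT s|half_line 0. - (2 * al z * (if s \<le> t then 1 * ?t1 s else 0) + (if s \<le> t then h z (t - s) * phi z s else 0)))"
    proof (intro lint_cong refl)
      fix s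
      have "?d * phi_kernel z t s = (if s \<le> t then - (2 * al z * of_real s + h z (t - s)) else 0)"
        using nz by (simp add: phi_kernel_def)
      then show "?d * (phi_kernel z t s * phi z s) =
          - (2 * al z * (if s \<le> t then 1 * ?t1 s else 0) + (if s \<le> t then h z (t - s) * phi z s else 0))"
        unfolding mult.assoc[symmetric] by (simp add: algebra_simps)
    qed
    also have "\<dots> = - (2 * al z * conv (\<lambda>_. 1) ?t1 t + conv (h z) (phi z) t)"
      unfolding conv_def Bochner_Integration.integral_minus integral_mult_right_zero[symmetric]
      by (subst Bochner_Integration.integral_add[OF integrable_mult_right[OF bint[OF one times_phi(1,2)[OF U]]]
        bint[OF h_meas hb phi_meas[OF U] phi_bound[OF U]]]) (assumption | rule refl)+
    finally show ?thesis by simp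
  qed
  have i1: "integrable (half_line 0) (\<lambda>t. of_real (exp (- (x * t))) * ?t1 t)"
    by (rule laplace_integrable(1)[OF times_phi(1,2)[OF U] x])
  have i2: "integrable (half_line 0) (\<lambda>t. of_real (exp (- (x * t))) * ?t2 t)"
    by (rule laplace_integrable(1)[OF times_phi(3,4)[OF U] x])
  have ih: "integrable (half_line 0) (\<lambda>t. of_real (exp (- (x * t))) * h z t)"
    by (rule laplace_integrable(1)[OF borel_measurable_half_line[OF h_meas] hb x])
  \<comment> \<open>The cleared equation was derived for \<open>t > 0\<close>, as its denominator
    vanishes at \<open>0\<close>; a single point is negligible in the integral.\<close>
  have AE: "AE t in half_line 0. t \<noteq> 0"
    by (rule AE_restrict_space_iff[THEN iffD2]) (auto intro!: AE_I'[of "{0}"] simp: null_sets_completionI)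
  have "(LINT t|half_line 0. of_real (exp (- (x * t))) * ?t2 t - 2 * \<i> * z * (of_real (exp (- (x * t))) * ?t1 t)) =
      (LINT t|half_line 0. - (of_real (exp (- (x * t))) * h z t)
        - (2 * al z * (of_real (exp (- (x * t))) * conv (\<lambda>_. 1) ?t1 t) + of_real (exp (- (x * t))) * conv (h z) (phi z) t))"
  proof (rule integral_cong_AE)
    show "(\<lambda>t. of_real (exp (- (x * t))) * ?t2 t - 2 * \<i> * z * (of_real (exp (- (x * t))) * ?t1 t)) \<in> borel_measurable (half_line 0)"
      using i1 i2 by measurable
    show "(\<lambda>t. - (of_real (exp (- (x * t))) * h z t)
        - (2 * al z * (of_real (exp (- (x * t))) * conv (\<lambda>_. 1) ?t1 t) + of_real (exp (- (x * t))) * conv (h z) (phi z) t))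
        \<in> borel_measurable (half_line 0)"
      using ih c1(2) c2(2) by measurable
    show "AE t in half_line 0. of_real (exp (- (x * t))) * ?t2 t - 2 * \<i> * z * (of_real (exp (- (x * t))) * ?t1 t) =
      - (of_real (exp (- (x * t))) * h z t)
        - (2 * al z * (of_real (exp (- (x * t))) * conv (\<lambda>_. 1) ?t1 t) + of_real (exp (- (x * t))) * conv (h z) (phi z) t)"
      using AE AE_space
    proof eventually_elim
      case (elim t)
      then have "t > 0" by simp
      from arg_cong[OF eq[OF this], of "\<lambda>v. of_real (exp (- (x * t))) * v"]
      show ?case by (simp add: algebra_simps)
    qed
  qed
  also have "\<dots> = - laplace (h z) x - (2 * al z * laplace (conv (\<lambda>_. 1) ?t1) x + laplace (conv (h z) (phi z)) x)"
    using ih c1(2) c2(2) unfolding laplace_def by simp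
  also have "\<dots> = - q z x - (2 * al z * (1 / of_real x * (- amp' z x)) + q z x * (amp z x - 1))"
    using laplace_power[OF x, of 0] by (simp add: c1 c2 laplace_h[OF x] amp_def amp'_def)
  also have "(LINT t|half_line 0. of_real (exp (- (x * t))) * ?t2 t - 2 * \<i> * z * (of_real (exp (- (x * t))) * ?t1 t)) =
      laplace ?t2 x + 2 * \<i> * z * amp' z x"
    using i1 i2 by (simp add: laplace_def amp'_def)
  finally have "laplace ?t2 x = - (2 * (\<i> * z - al z / of_real x) * amp' z x + q z x * amp z x)"
    using x by (simp add: field_simps)
  then show "(amp' z has_vector_derivative
       - (2 * (\<i> * z - al z / of_real x) * amp' z x + q z x * amp z x)) (at x within S)"
    using d2 by simp
qed

end

section \<open>The outgoing solution\<close>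

lemma half_line_tail:
  fixes F :: cfun
  assumes F: "integrable (half_line 1) F"
  shows "x \<ge> 1 \<Longrightarrow> integrable (half_line x) F"
    "x \<ge> 1 \<Longrightarrow> (LINT y|half_line x. F y) = (LINT y|half_line 1. F y) - integral {1..x} F"
    "continuous_on {1..} (\<lambda>x. LINT y|half_line x. F y)"
    "continuous_on {1..} F \<Longrightarrow> x \<ge> 1 \<Longrightarrow>
      ((\<lambda>x. LINT y|half_line x. F y) has_vector_derivative - F x) (at x within {1..})"
proof -
  have sub: "integrable (half_line x) F" "integrable (lebesgue_on {1..x}) F" if "x \<ge> 1" for x
    by (rule integrable_lebesgue_on_subset[OF F]; use that in auto)+
  show "x \<ge> 1 \<Longrightarrow> integrable (half_line x) F" for x by (rule sub)
  have eq: "(LINT y|half_line x. F y) = (LINT y|half_line 1. F y) - integral {1..x} F" if x: "x \<ge> 1" for x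
  proof -
    have i: "integrable (half_line 1) (\<lambda>y. if x \<le> y then F y else 0)"
      "integrable (half_line 1) (\<lambda>y. if 1 \<le> y \<and> y \<le> x then F y else 0)"
      using sub[OF x] x by (auto simp: half_line_truncate(1)[OF order_refl] half_line_truncate(3)[OF x])
    have "AE y in half_line 1. y \<noteq> x"
      by (rule AE_restrict_space_iff[THEN iffD2]) (auto intro!: AE_I'[of "{x}"] simp: null_sets_completionI)
    then have "AE y in half_line 1. F y = (if x \<le> y then F y else 0) + (if 1 \<le> y \<and> y \<le> x then F y else 0)"
      using AE_space by eventually_elim auto
    then have "(LINT y|half_line 1. F y) = (LINT y|half_line 1. (if x \<le> y then F y else 0) + (if 1 \<le> y \<and> y \<le> x then F y else 0))"
      using F i by (intro integral_cong_AE) auto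
    also have "\<dots> = (LINT y|half_line x. F y) + (LINT y|lebesgue_on {1..x}. F y)"
      using i by (simp add: half_line_truncate(2)[OF order_refl] half_line_truncate(4)[OF x])
    also have "(LINT y|lebesgue_on {1..x}. F y) = integral {1..x} F"
      by (rule lebesgue_integral_eq_integral[OF sub(2)[OF x]]) simp
    finally show ?thesis by simp
  qed
  show "x \<ge> 1 \<Longrightarrow> (LINT y|half_line x. F y) = (LINT y|half_line 1. F y) - integral {1..x} F" for x
    by (rule eq)
  have "continuous_on {1..b} (\<lambda>x. LINT y|half_line x. F y)" if "1 < b" for b
  proof -
    have "F integrable_on {1..b}"
      using sub(2)[of b] that by (auto intro: integrable_on_lebesgue_on)
    then have "continuous_on {1..b} (\<lambda>x. (LINT y|half_line 1. F y) - integral {1..x} F)"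
      by (intro continuous_intros indefinite_integral_continuous_1)
    then show ?thesis by (rule continuous_on_eq) (rule eq[symmetric], simp)
  qed
  then show "continuous_on {1..} (\<lambda>x. LINT y|half_line x. F y)" by (rule continuous_on_half_line)
  show "((\<lambda>x. LINT y|half_line x. F y) has_vector_derivative - F x) (at x within {1..})"
    if "continuous_on {1..} F" "x \<ge> 1" for x
  proof -
    have "((\<lambda>x. (LINT y|half_line 1. F y) - integral {1..x} F) has_vector_derivative 0 - F x) (at x within {1..})"
      by (intro has_vector_derivative_diff has_vector_derivative_const
          integral_has_vector_derivative_half_line that)
    then show ?thesis
      by (intro has_vector_derivative_transform[rotated 2, OF _ _ eq]) (use that in auto)
  qed
qed

section \<open>Correction of the amplitude for the exponentially small remainder\<close>

locale outgoing = laplace_potential b \<kappa> B + bounded_potential V Vm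
  for b :: cfun and \<kappa> B and V :: cfun and Vm +
  fixes \<tau> R :: real
  assumes remainder: "\<And>x. x \<ge> 1 \<Longrightarrow> norm (V x - laplace b x) \<le> R * exp (- (\<tau> * x))"
begin

definition r :: cfun where "r x = V x - laplace b x"

text \<open>The square of the oscillating prefactor in \<open>jost\<close>. It is the integrating
  factor for \<open>rho'' + 2 (\<i> z - al z / x) rho' = load\<close>.\<close>

definition osc :: "complex \<Rightarrow> cfun" where
  "osc z x = exp (2 * \<i> * z * of_real x - 2 * al z * of_real (ln x))"

definition osc_prim :: "complex \<Rightarrow> cfun" where
  "osc_prim z y = (LINT s|lebesgue_on {1..y}. 1 / osc z s)"

text \<open>Two integrations from infinity solve the equation for \<open>rho\<close>; exchanging
  them leaves \<open>osc z y\<close> times the integral of \<open>1 / osc z\<close> over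
  \<open>{x..y}\<close>.\<close>

definition green :: "complex \<Rightarrow> real \<Rightarrow> cfun" where
  "green z x y = osc z y * (osc_prim z y - osc_prim z x)"

definition rho_kernel :: "complex \<Rightarrow> real \<Rightarrow> cfun" where
  "rho_kernel z x y = (if x \<le> y then green z x y * (r y - q z y) else 0)"

definition rho_source :: "complex \<Rightarrow> cfun" where
  "rho_source z x = (LINT y|half_line 1. (if x \<le> y then green z x y * (r y * amp z y) else 0))"

definition rho :: "complex \<Rightarrow> cfun" where
  "rho z = volterra_sol (half_line 1) (rho_kernel z) (rho_source z)"

text \<open>The sum \<open>amp + rho\<close> has to satisfy the amplitude equation with
  \<open>q - r\<close> in place of \<open>q\<close>; subtracting the equation of \<open>amp\<close>
  leaves this right-hand side for \<open>rho\<close>.\<close>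

definition load :: "complex \<Rightarrow> cfun" where
  "load z y = (r y - q z y) * rho z y + r y * amp z y"

definition rho' :: "complex \<Rightarrow> cfun" where
  "rho' z x = - (LINT y|half_line x. osc z y * load z y) / osc z x"

definition jost :: "complex \<Rightarrow> cfun" where
  "jost z x = exp (\<i> * z * of_real x - al z * of_real (ln x)) * (amp z x + rho z x)"

definition jost' :: "complex \<Rightarrow> cfun" where
  "jost' z x = exp (\<i> * z * of_real x - al z * of_real (ln x)) *
     ((amp' z x + rho' z x) + (\<i> * z - al z / of_real x) * (amp z x + rho z x))"

lemma r_continuous: "continuous_on {1..} r"
proof -
  have "continuous_on {1..} (laplace b)"
    unfolding continuous_on_eq_continuous_within
    by (intro ballI has_vector_derivative_continuous[OF laplace_b_derivative]) auto
  then show ?thesis unfolding r_def[abs_def] by (intro continuous_intros continuous_V)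
qed

lemma osc_nonzero [simp]: "osc z x \<noteq> 0" by (simp add: osc_def)

lemma osc_continuous: "continuous_on {1..} (osc z)"
  unfolding osc_def[abs_def] by (intro continuous_intros) auto

lemma osc_derivative:
  assumes "x > 0"
  shows "(osc z has_vector_derivative (2 * \<i> * z - 2 * al z / of_real x) * osc z x) (at x within S)"
proof -
  have l: "((\<lambda>x. complex_of_real (ln x)) has_vector_derivative of_real (1 / x)) (at x within S)"
    by (intro has_vector_derivative_of_real DERIV_ln_divide[OF assms, THEN has_field_derivative_at_within])
  have i: "((\<lambda>x. complex_of_real x) has_vector_derivative of_real 1) (at x within S)"
    by (intro has_vector_derivative_of_real DERIV_ident)
  have "((\<lambda>x. 2 * \<i> * z * of_real x - 2 * al z * of_real (ln x)) has_vector_derivative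
      (2 * \<i> * z * of_real 1 - 2 * al z * of_real (1 / x))) (at x within S)"
    by (intro has_vector_derivative_diff has_vector_derivative_mult_right l i)
  from field_vector_diff_chain_within[OF this DERIV_exp[THEN has_field_derivative_at_within]]
  show ?thesis by (simp add: osc_def[abs_def] o_def algebra_simps)
qed

lemma inverse_osc_continuous: "continuous_on {1..} (\<lambda>s. 1 / osc z s)"
  by (intro continuous_intros osc_continuous) simp

lemma osc_prim_integral: "osc_prim z y = integral {1..y} (\<lambda>s. 1 / osc z s)"
  unfolding osc_prim_def
  by (rule lebesgue_on_interval_integral(2)) (rule continuous_on_subset[OF inverse_osc_continuous], auto)

lemma osc_prim_derivative:
  "x \<ge> 1 \<Longrightarrow> (osc_prim z has_vector_derivative 1 / osc z x) (at x within {1..})"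
  unfolding osc_prim_integral[abs_def]
  by (rule integral_has_vector_derivative_half_line[OF inverse_osc_continuous])

lemma osc_prim_continuous: "continuous_on {1..} (osc_prim z)"
  unfolding continuous_on_eq_continuous_within
  by (intro ballI has_vector_derivative_continuous[OF osc_prim_derivative]) auto

text \<open>Since \<open>- 2 Im z \<le> d\<close>, the function \<open>osc z\<close> grows at a rate of about \<open>d\<close>, which is smaller than the decay rate \<open>\<tau>\<close> of the remainder \<open>r\<close>.\<close>

definition admissible :: "complex set \<Rightarrow> real \<Rightarrow> real \<Rightarrow> real \<Rightarrow> bool" where
  "admissible U c d Z \<longleftrightarrow> slit_bound U c \<and> 0 < d \<and> d < \<tau> \<and>
     (\<forall>z\<in>U. - 2 * Im z \<le> d \<and> norm z \<le> Z)"

lemma admissible_slit: "admissible U c d Z \<Longrightarrow> slit_bound U c"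
  by (simp add: admissible_def)

lemma admissible_exists:
  assumes "z0 \<in> M_region \<tau>" "\<tau> > 0"
  obtains e c d Z where "e > 0" "admissible (ball z0 e) c d Z"
proof -
  obtain e0 c where e0: "e0 > 0" "slit_bound (ball z0 e0) c"
    using slit_bound_exists[of z0] assms by (auto simp: M_region_def)
  define s0 where "s0 = max 0 (- 2 * Im z0)"
  have d0: "0 \<le> s0" "s0 < \<tau>" "- 2 * Im z0 \<le> s0" using assms by (auto simp: M_region_def s0_def)
  \<comment> \<open>Within this radius \<open>- 2 * Im z\<close> exceeds \<open>s0\<close> by at
    most \<open>(\<tau> - s0) / 2\<close>, so the midpoint of \<open>s0\<close> and
    \<open>\<tau>\<close> can serve as \<open>d\<close>. Starting from \<open>s0 \<ge> 0\<close>
    keeps \<open>d\<close> positive.\<close>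
  define e where "e = min e0 ((\<tau> - s0) / 4)"
  have e: "e > 0" using e0 d0 by (simp add: e_def)
  have sub: "ball z0 e \<subseteq> ball z0 e0" by (auto simp: e_def)
  have "- 2 * Im z \<le> (\<tau> + s0) / 2 \<and> norm z \<le> norm z0 + e" if "z \<in> ball z0 e" for z
  proof
    have n: "norm (z0 - z) < e" using that by (simp add: dist_norm)
    have "Im z0 - Im z \<le> norm (z0 - z)" using abs_Im_le_cmod[of "z0 - z"] by simp
    moreover have "e \<le> (\<tau> - s0) / 4" unfolding e_def by (rule min.cobounded2)
    ultimately show "- 2 * Im z \<le> (\<tau> + s0) / 2" using n d0 by argo
    show "norm z \<le> norm z0 + e" using n norm_triangle_ineq2[of z z0] by (simp add: norm_minus_commute)
  qed
  moreover have "slit_bound (ball z0 e) c" using e0 sub by (auto simp: slit_bound_def)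
  ultimately have "admissible (ball z0 e) c ((\<tau> + s0) / 2) (norm z0 + e)"
    using d0 assms by (auto simp: admissible_def)
  with e show ?thesis by (rule that)
qed

text \<open>The exponential part has rate at most \<open>d\<close>. The remaining factor is a power
  of \<open>y / x\<close> with bounded exponent, and an arbitrarily small \<open>\<epsilon>\<close>
  in the rate absorbs it.\<close>

lemma osc_ratio_bound:
  assumes U: "admissible U c d Z" and \<epsilon>: "\<epsilon> > 0"
  obtains C where "C > 0" "\<And>z x y. z \<in> U \<Longrightarrow> 1 \<le> x \<Longrightarrow> x \<le> y \<Longrightarrow> norm (osc z y / osc z x) \<le> C * exp ((d + \<epsilon>) * (y - x))"
proof -
  have c: "c > 0" using U by (simp add: admissible_def slit_bound_def)
  define a where "a = norm \<kappa> / c"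
  have a0: "a \<ge> 0" using c by (simp add: a_def)
  define n where "n = nat \<lceil>2 * a\<rceil>"
  obtain C where C: "C > 0" "\<And>x. x \<ge> 0 \<Longrightarrow> (1 + x) ^ n \<le> C * exp (\<epsilon> * x)"
    using poly_times_exp_bounded[OF \<epsilon>, of n] by blast
  show ?thesis
  proof (rule that[OF C(1)])
    fix z and x y :: real assume z: "z \<in> U" and x: "1 \<le> x" and y: "x \<le> y"
    have al: "norm (al z) \<le> a" unfolding a_def using al_bound[of U c z] U z by (simp add: admissible_def)
    have ln0: "0 \<le> ln y - ln x" using x y by simp
    have "ln y - ln x = ln (y / x)" using x y by (simp add: ln_div)
    \<comment> \<open>For \<open>x \<ge> 1\<close> this replaces the quotient by the difference, so
      that the final bound depends on \<open>y - x\<close> alone.\<close>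
    also have "\<dots> \<le> ln (1 + (y - x))"
    proof -
      have "y / x = 1 + (y - x) / x" using x by (simp add: field_simps)
      also have "\<dots> \<le> 1 + (y - x)" using x y divide_left_mono[of 1 x "y - x"] by simp
      finally show ?thesis using x y by simp
    qed
    finally have ln1: "ln y - ln x \<le> ln (1 + (y - x))" .
    have "osc z y / osc z x = exp (2 * \<i> * z * of_real (y - x) - 2 * al z * of_real (ln y - ln x))"
      unfolding osc_def exp_diff[symmetric] by (simp add: algebra_simps)
    then have "norm (osc z y / osc z x) = exp (- 2 * Im z * (y - x) - 2 * Re (al z) * (ln y - ln x))"
      by simp
    also have "\<dots> \<le> exp (d * (y - x) + real n * ln (1 + (y - x)))"
    proof -
      have "- 2 * Im z * (y - x) \<le> d * (y - x)"
        using U z y by (intro mult_right_mono) (auto simp: admissible_def)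
      moreover have "- 2 * Re (al z) * (ln y - ln x) \<le> real n * ln (1 + (y - x))"
      proof -
        have "- 2 * Re (al z) \<le> 2 * a" using al abs_Re_le_cmod[of "al z"] by linarith
        also have "\<dots> \<le> real n" unfolding n_def by (rule real_nat_ceiling_ge)
        finally have "- 2 * Re (al z) * (ln y - ln x) \<le> real n * (ln y - ln x)"
          by (rule mult_right_mono[OF _ ln0])
        also have "\<dots> \<le> real n * ln (1 + (y - x))" by (rule mult_left_mono[OF ln1]) simp
        finally show ?thesis .
      qed
      ultimately show ?thesis by simp
    qed
    also have "\<dots> = exp (d * (y - x)) * (1 + (y - x)) ^ n"
      using y by (simp add: exp_add exp_of_nat_mult)
    also have "\<dots> \<le> exp (d * (y - x)) * (C * exp (\<epsilon> * (y - x)))"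
      by (rule mult_left_mono[OF C(2)]) (use y in auto)
    also have "\<dots> = C * exp ((d + \<epsilon>) * (y - x))" by (simp add: exp_add[symmetric] algebra_simps)
    finally show "norm (osc z y / osc z x) \<le> C * exp ((d + \<epsilon>) * (y - x))" .
  qed
qed

lemma green_integral:
  assumes "1 \<le> x" "x \<le> y"
  shows "green z x y = integral {x..y} (\<lambda>s. osc z y / osc z s)"
proof -
  have c: "continuous_on {1..y} (\<lambda>s. 1 / osc z s)"
    by (rule continuous_on_subset[OF inverse_osc_continuous]) auto
  have "integral {1..x} (\<lambda>s. 1 / osc z s) + integral {x..y} (\<lambda>s. 1 / osc z s) = integral {1..y} (\<lambda>s. 1 / osc z s)"
    by (rule Henstock_Kurzweil_Integration.integral_combine) (use assms c in \<open>auto intro: integrable_continuous_real\<close>)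
  then have "green z x y = osc z y * integral {x..y} (\<lambda>s. 1 / osc z s)"
    unfolding green_def osc_prim_integral by (metis add_diff_cancel_left')
  also have "\<dots> = integral {x..y} (\<lambda>s. osc z y * (1 / osc z s))"
    by (rule integral_mult_right[symmetric])
  finally show ?thesis by simp
qed

text \<open>The midpoint between growth and decay leaves a gap on both sides: above \<open>d\<close>
  for powers and for the length of the interval, below \<open>\<tau>\<close> for a factor
  \<open>1 / y\<^sup>2\<close>.\<close>

definition rate :: "real \<Rightarrow> real" where "rate d = (d + \<tau>) / 2"

lemma green_bound:
  assumes U: "admissible U c d Z"
  obtains C where "C > 0"
    "\<And>z x y. z \<in> U \<Longrightarrow> 1 \<le> x \<Longrightarrow> x \<le> y \<Longrightarrow> norm (green z x y) \<le> C * exp (rate d * (y - x))"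
    "\<And>z x y. z \<in> U \<Longrightarrow> 1 \<le> x \<Longrightarrow> x \<le> y \<Longrightarrow> norm (osc z y / osc z x) \<le> C * exp (rate d * (y - x))"
proof -
  \<comment> \<open>The rate is \<open>d\<close> plus two gaps of this size: one for the power in
    the ratio of \<open>osc\<close>, one for the factor \<open>y - x\<close> that integration over
    \<open>{x..y}\<close> costs.\<close>
  define \<epsilon> where "\<epsilon> = (\<tau> - d) / 4"
  have \<epsilon>: "\<epsilon> > 0" "rate d = d + \<epsilon> + \<epsilon>" "d > 0"
    using U by (auto simp: admissible_def \<epsilon>_def rate_def field_simps)
  obtain C where C: "C > 0" "\<And>z x y. z \<in> U \<Longrightarrow> 1 \<le> x \<Longrightarrow> x \<le> y \<Longrightarrow> norm (osc z y / osc z x) \<le> C * exp ((d + \<epsilon>) * (y - x))"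
    using osc_ratio_bound[OF U \<epsilon>(1)] by blast
  show ?thesis
  proof (rule that[of "C / \<epsilon> + C"])
    show "0 < C / \<epsilon> + C" using C \<epsilon> by (simp add: add_pos_pos)
    fix z and x y :: real assume z: "z \<in> U" and x: "1 \<le> x" and y: "x \<le> y"
    have le: "exp ((d + \<epsilon>) * (y - x)) \<le> exp (rate d * (y - x))"
      using y \<epsilon> by (simp add: mult_right_mono)
    have "norm (osc z y / osc z x) \<le> C * exp (rate d * (y - x))"
      using C(2)[OF z x y] mult_left_mono[OF le, of C] C(1) by linarith
    also have "\<dots> \<le> (C / \<epsilon> + C) * exp (rate d * (y - x))" using C \<epsilon> by (intro mult_right_mono) auto
    finally show "norm (osc z y / osc z x) \<le> (C / \<epsilon> + C) * exp (rate d * (y - x))" .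
    have "norm (green z x y) \<le> C * exp ((d + \<epsilon>) * (y - x)) * (y - x)"
      unfolding green_integral[OF x y]
    proof (rule integral_bound[OF y])
      show "continuous_on {x..y} (\<lambda>s. osc z y / osc z s)"
        by (intro continuous_intros continuous_on_subset[OF osc_continuous]) (use x in auto)
      fix s assume s: "s \<in> {x..y}"
      have "norm (osc z y / osc z s) \<le> C * exp ((d + \<epsilon>) * (y - s))"
        using C(2)[OF z, of s y] s x by simp
      also have "\<dots> \<le> C * exp ((d + \<epsilon>) * (y - x))"
        using s C \<epsilon> by (auto intro!: mult_left_mono)
      finally show "norm (osc z y / osc z s) \<le> C * exp ((d + \<epsilon>) * (y - x))" .
    qed
    also have "\<dots> \<le> C * exp ((d + \<epsilon>) * (y - x)) * (exp (\<epsilon> * (y - x)) / \<epsilon>)"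
    proof (rule mult_left_mono)
      have "\<epsilon> * (y - x) \<le> exp (\<epsilon> * (y - x))" using exp_ge_add_one_self[of "\<epsilon> * (y - x)"] by linarith
      then show "y - x \<le> exp (\<epsilon> * (y - x)) / \<epsilon>" using \<epsilon> by (simp add: field_simps)
    qed (use C in auto)
    also have "\<dots> = C / \<epsilon> * exp (rate d * (y - x))" by (simp add: \<epsilon>(2) exp_add[symmetric] algebra_simps)
    also have "\<dots> \<le> (C / \<epsilon> + C) * exp (rate d * (y - x))" using C by (intro mult_right_mono) auto
    finally show "norm (green z x y) \<le> (C / \<epsilon> + C) * exp (rate d * (y - x))" .
  qed
qed

text \<open>The coefficient \<open>q\<close> decays only like \<open>1 / y\<^sup>2\<close>. The
  surplus \<open>\<tau> - rate d\<close> in the decay of \<open>r\<close> is spent on the same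
  factor, so that both coefficients fit one integrable majorant.\<close>

lemma coefficient_bound:
  assumes U: "admissible U c d Z"
  obtains C where "C > 0"
    "\<And>z y. z \<in> U \<Longrightarrow> 1 \<le> y \<Longrightarrow> norm (r y - q z y) \<le> C * (1 / y\<^sup>2)"
    "\<And>z y. z \<in> U \<Longrightarrow> 1 \<le> y \<Longrightarrow> norm (r y * amp z y) \<le> C * (1 / y\<^sup>2) * exp (- (rate d * y))"
proof -
  have sb: "slit_bound U c" and c: "c > 0" and d: "0 < d" "d < \<tau>"
    using U by (auto simp: admissible_def slit_bound_def)
  obtain A where A: "A \<ge> 0" "\<And>z x. z \<in> U \<Longrightarrow> x \<ge> 1 \<Longrightarrow> norm (amp z x - 1) \<le> A / x"
    using amp_bound[OF sb] by metis
  have R0: "R \<ge> 0"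
    using remainder[of 1] by (metis exp_gt_zero norm_ge_zero order_refl order_trans zero_le_mult_iff not_less)
  obtain C where C: "C > 0" "\<And>x. x \<ge> 0 \<Longrightarrow> (1 + x) ^ 2 \<le> C * exp ((\<tau> - rate d) * x)"
    using poly_times_exp_bounded[of "\<tau> - rate d" 2] d by (auto simp: rate_def)
  have rb: "norm (r y) \<le> R * C * (1 / y\<^sup>2) * exp (- (rate d * y))" if y: "y \<ge> 1" for y
  proof -
    have "y\<^sup>2 \<le> (1 + y)\<^sup>2" using y by (intro power_mono) auto
    also have "\<dots> \<le> C * exp ((\<tau> - rate d) * y)" using C(2)[of y] y by simp
    finally have "1 \<le> C * exp ((\<tau> - rate d) * y) * (1 / y\<^sup>2)" using y by (simp add: field_simps)
    from mult_left_mono[OF this, of "exp (- (\<tau> * y))"]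
    have "exp (- (\<tau> * y)) \<le> exp (- (\<tau> * y)) * (C * exp ((\<tau> - rate d) * y) * (1 / y\<^sup>2))"
      by (simp only: mult_1_right exp_ge_zero)
    also have "\<dots> = C * (1 / y\<^sup>2) * exp (- (rate d * y))"
    proof -
      have "exp (- (\<tau> * y)) * exp ((\<tau> - rate d) * y) = exp (- (rate d * y))"
        by (simp add: exp_add[symmetric] algebra_simps)
      then show ?thesis by (simp add: mult.assoc mult.left_commute[of "exp (- (\<tau> * y))"])
    qed
    finally have "R * exp (- (\<tau> * y)) \<le> R * (C * (1 / y\<^sup>2) * exp (- (rate d * y)))"
      by (rule mult_left_mono[OF _ R0])
    then show ?thesis using remainder[OF y] by (simp add: r_def mult_ac)
  qed
  show ?thesis
  proof (rule that[of "R * C * (1 + A) + R * C + Hc c + 1"])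
    show "0 < R * C * (1 + A) + R * C + Hc c + 1"
      using R0 C A Hc_nonneg[OF c] by (intro add_nonneg_pos add_nonneg_nonneg) auto
    fix z y assume z: "z \<in> U" and y: "(1::real) \<le> y"
    have y2: "0 \<le> 1 / y\<^sup>2" by simp
    have e1: "exp (- (rate d * y)) \<le> 1" using d y by (simp add: rate_def)
    have "norm (r y) \<le> R * C * (1 / y\<^sup>2) * 1"
      by (rule order_trans[OF rb[OF y] mult_left_mono[OF e1]]) (use R0 C in auto)
    moreover have "norm (q z y) \<le> Hc c * (1 / y\<^sup>2)" using q_bound[OF sb z, of y] y by simp
    ultimately have "norm (r y - q z y) \<le> (R * C + Hc c) * (1 / y\<^sup>2)"
      using norm_triangle_ineq4[of "r y" "q z y"] unfolding distrib_right by linarith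
    also have "\<dots> \<le> (R * C * (1 + A) + R * C + Hc c + 1) * (1 / y\<^sup>2)"
      using R0 C A by (intro mult_right_mono y2) auto
    finally show "norm (r y - q z y) \<le> (R * C * (1 + A) + R * C + Hc c + 1) * (1 / y\<^sup>2)" .
    have "norm (amp z y) \<le> 1 + norm (amp z y - 1)" using norm_triangle_ineq[of 1 "amp z y - 1"] by simp
    also have "\<dots> \<le> 1 + A"
      using A(2)[OF z y] divide_left_mono[of 1 y A] A(1) y by simp
    finally have "norm (r y * amp z y) \<le> (R * C * (1 / y\<^sup>2) * exp (- (rate d * y))) * (1 + A)"
      unfolding norm_mult using rb[OF y] R0 C by (intro mult_mono) auto
    also have "\<dots> = R * C * (1 + A) * (1 / y\<^sup>2 * exp (- (rate d * y)))" by simp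
    also have "\<dots> \<le> (R * C * (1 + A) + R * C + Hc c + 1) * (1 / y\<^sup>2 * exp (- (rate d * y)))"
      using R0 C Hc_nonneg[OF c] by (intro mult_right_mono) auto
    finally show "norm (r y * amp z y) \<le> (R * C * (1 + A) + R * C + Hc c + 1) * (1 / y\<^sup>2) * exp (- (rate d * y))"
      by (simp add: mult.assoc)
  qed
qed

text \<open>The functions \<open>1 / y\<^sup>2\<close> and
  \<open>1 / y\<^sup>2 * exp (l / y)\<close> have explicit primitives. The second is the kernel
  majorant times the weight of the next Volterra equation.\<close>

lemma inverse_square_integral:
  assumes "x \<ge> 1"
  shows "integrable (half_line x) (\<lambda>y. 1 / y\<^sup>2)" "(LINT y|half_line x. 1 / y\<^sup>2) = 1 / x"
    "l > 0 \<Longrightarrow> integrable (half_line x) (\<lambda>y. 1 / y\<^sup>2 * exp (l / y))"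
    "l > 0 \<Longrightarrow> (LINT y|half_line x. 1 / y\<^sup>2 * exp (l / y)) = (exp (l / x) - 1) / l"
proof -
  have li: "((\<lambda>y. a / y) \<longlongrightarrow> 0) at_top" for a :: real
    by (rule tendsto_divide_0[OF tendsto_const]) (simp add: filterlim_at_top_imp_at_infinity filterlim_ident)
  have d: "((\<lambda>y. - (1 / y)) has_real_derivative 1 / y\<^sup>2) (at y)" if "y \<ge> x" for y
    using that assms by (auto intro!: derivative_eq_intros simp: power2_eq_square)
  have l: "((\<lambda>y::real. - (1 / y)) \<longlongrightarrow> - 0) at_top" by (intro tendsto_minus li)
  have c: "continuous_on {x..} (\<lambda>y. 1 / y\<^sup>2)" using assms by (intro continuous_intros) auto
  show "integrable (half_line x) (\<lambda>y. 1 / y\<^sup>2)" "(LINT y|half_line x. 1 / y\<^sup>2) = 1 / x"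
    using half_line_FTC[OF d c _ l] by auto
  assume l0: "l > 0"
  have d2: "((\<lambda>y. - (exp (l / y) / l)) has_real_derivative 1 / y\<^sup>2 * exp (l / y)) (at y)" if "y \<ge> x" for y
    using that assms l0 by (auto intro!: derivative_eq_intros simp: power2_eq_square)
  have l2: "((\<lambda>y. - (exp (l / y) / l)) \<longlongrightarrow> - (exp 0 / l)) at_top"
    using l0 by (intro tendsto_intros li) auto
  have c2: "continuous_on {x..} (\<lambda>y. 1 / y\<^sup>2 * exp (l / y))"
    using assms by (intro continuous_intros) auto
  show "integrable (half_line x) (\<lambda>y. 1 / y\<^sup>2 * exp (l / y))"
    "(LINT y|half_line x. 1 / y\<^sup>2 * exp (l / y)) = (exp (l / x) - 1) / l"
    using half_line_FTC[OF d2 c2 _ l2] by (auto simp: diff_divide_distrib)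
qed

abbreviation "rho_integrand z \<equiv> \<lambda>x y. if x \<le> y then green z x y * (r y * amp z y) else 0"

abbreviation "rho_majorant C d \<equiv> \<lambda>x y. if x \<le> y then C * exp (- (rate d * x)) * (1 / y\<^sup>2) else 0"

abbreviation "rho_volterra_at z C d l \<equiv> volterra (half_line 1) (rho_kernel z) (rho_source z)
  (\<lambda>x y. if x \<le> y then C * exp (rate d * (y - x)) * (1 / y\<^sup>2) else 0) (\<lambda>y. exp (- (rate d * y) + l / y))"

text \<open>The factor \<open>exp (- (rate d * y))\<close> in the weight cancels the growth of the
  Green function. The factor \<open>exp (l / y)\<close> is the usual device for a kernel bounded by
  \<open>C / y\<^sup>2\<close>: its integral gains \<open>C / l\<close>, which is one half for
  \<open>l = 2 * C\<close>.\<close>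

lemma rho_volterra:
  assumes U: "admissible U c d Z"
  obtains C l G where "C > 0" "l > 0" "G \<ge> 0"
    "\<And>z. z \<in> U \<Longrightarrow> rho_volterra_at z C d l G"
    "\<And>z x y. z \<in> U \<Longrightarrow> 1 \<le> x \<Longrightarrow> 1 \<le> y \<Longrightarrow>
      norm (rho_integrand z x y)
        \<le> (rho_majorant C d x y)"
proof -
  note sb = admissible_slit[OF U]
  obtain C1 where C1: "C1 > 0"
    "\<And>z x y. z \<in> U \<Longrightarrow> 1 \<le> x \<Longrightarrow> x \<le> y \<Longrightarrow> norm (green z x y) \<le> C1 * exp (rate d * (y - x))"
    using green_bound[OF U] by metis
  obtain C2 where C2: "C2 > 0"
    "\<And>z y. z \<in> U \<Longrightarrow> 1 \<le> y \<Longrightarrow> norm (r y - q z y) \<le> C2 * (1 / y\<^sup>2)"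
    "\<And>z y. z \<in> U \<Longrightarrow> 1 \<le> y \<Longrightarrow> norm (r y * amp z y) \<le> C2 * (1 / y\<^sup>2) * exp (- (rate d * y))"
    using coefficient_bound[OF U] by metis
  define C where "C = C1 * C2"
  have C: "C > 0" using C1 C2 by (simp add: C_def)
  define l where "l = 2 * C"
  have l: "l > 0" using C by (simp add: l_def)
  let ?d = "rate d"
  have src: "norm (rho_integrand z x y)
        \<le> (rho_majorant C d x y)"
    if z: "z \<in> U" and x: "1 \<le> x" and y: "1 \<le> y" for z x y
  proof (cases "x \<le> y")
    case True
    have "norm (green z x y * (r y * amp z y)) \<le> (C1 * exp (?d * (y - x))) * (C2 * (1 / y\<^sup>2) * exp (- (?d * y)))"
      unfolding norm_mult[of "green z x y"]
      by (rule mult_mono[OF C1(2)[OF z x True] C2(3)[OF z y]]) (use C1 in auto)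
    also have "\<dots> = C * (1 / y\<^sup>2) * (exp (?d * (y - x)) * exp (- (?d * y)))" by (simp add: C_def)
    also have "exp (?d * (y - x)) * exp (- (?d * y)) = exp (- (?d * x))"
      by (simp add: exp_add[symmetric] algebra_simps)
    finally show ?thesis using True by (simp add: mult_ac)
  qed simp
  have tail_int: "integrable (half_line 1) (\<lambda>y. if x \<le> y then A * (1 / y\<^sup>2) else 0)"
    "(LINT y|half_line 1. (if x \<le> y then A * (1 / y\<^sup>2) else 0)) = A / x" if "x \<ge> 1" for x A :: real
    unfolding half_line_truncate(3,4)[OF that] integral_mult_right_zero inverse_square_integral(2)[OF that]
    by (intro integrable_mult_right inverse_square_integral that) simp
  have V: "rho_volterra_at z C d l C" if z: "z \<in> U" for z
  proof -
    interpret sigma_finite_measure "half_line 1" by (rule sigma_finite_half_line)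
    have [measurable]: "osc z \<in> half_meas" "osc_prim z \<in> half_meas"
      "r \<in> half_meas" "q z \<in> half_meas"
      by (intro continuous_borel_measurable_half_line osc_continuous osc_prim_continuous r_continuous q_continuous)+
    have "continuous_on {1..} (amp z)"
      unfolding continuous_on_eq_continuous_within
      by (intro ballI has_vector_derivative_continuous[OF amp_ode(1)[OF sb z]]) auto
    then have [measurable]: "amp z \<in> half_meas"
      by (rule continuous_borel_measurable_half_line)
    have "volterra_axioms (half_line 1) (rho_kernel z) (rho_source z)
      (\<lambda>x y. if x \<le> y then C * exp (?d * (y - x)) * (1 / y\<^sup>2) else 0)
      (\<lambda>y. exp (- (?d * y) + l / y)) C"
    proof (unfold_locales, goal_cases)
      case 1
      show ?case unfolding rho_kernel_def[abs_def] green_def by measurable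
    next
      case 2
      show ?case unfolding rho_source_def[abs_def] green_def by measurable
    next
      case (3 x y)
      show ?case
      proof (cases "x \<le> y")
        case True
        have "norm (green z x y * (r y - q z y)) \<le> (C1 * exp (?d * (y - x))) * (C2 * (1 / y\<^sup>2))"
          unfolding norm_mult
          by (rule mult_mono[OF C1(2)[OF z _ True] C2(2)[OF z]]) (use C1 3 in auto)
        then show ?thesis using True by (simp add: rho_kernel_def C_def mult_ac)
      qed (simp add: rho_kernel_def)
    next
      case (4 x)
      then have x: "x \<ge> 1" by simp
      have e: "(if x \<le> y then C * exp (?d * (y - x)) * (1 / y\<^sup>2) else 0) * exp (- (?d * y) + l / y)
          = (if x \<le> y then C * exp (- (?d * x)) * (1 / y\<^sup>2 * exp (l / y)) else 0)" for y
      proof -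
        have "exp (?d * (y - x)) * exp (- (?d * y) + l / y) = exp (- (?d * x)) * exp (l / y)"
          by (simp add: exp_add[symmetric] algebra_simps)
        then show ?thesis by (simp add: mult.assoc mult.left_commute)
      qed
      show ?case unfolding e half_line_truncate(3)[OF x]
        by (intro integrable_mult_right inverse_square_integral x l)
    next
      case (5 x)
      then have x: "x \<ge> 1" by simp
      have e: "(if x \<le> y then C * exp (?d * (y - x)) * (1 / y\<^sup>2) else 0) * exp (- (?d * y) + l / y)
          = (if x \<le> y then C * exp (- (?d * x)) * (1 / y\<^sup>2 * exp (l / y)) else 0)" for y
      proof -
        have "exp (?d * (y - x)) * exp (- (?d * y) + l / y) = exp (- (?d * x)) * exp (l / y)"
          by (simp add: exp_add[symmetric] algebra_simps)
        then show ?thesis by (simp add: mult.assoc mult.left_commute)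
      qed
      have "(LINT y|half_line 1. (if x \<le> y then C * exp (- (?d * x)) * (1 / y\<^sup>2 * exp (l / y)) else 0))
          = C * exp (- (?d * x)) * ((exp (l / x) - 1) / l)"
        unfolding half_line_truncate(4)[OF x] integral_mult_right_zero inverse_square_integral(4)[OF x l] ..
      also have "\<dots> = exp (- (?d * x)) * (exp (l / x) - 1) / 2" using C by (simp add: l_def)
      also have "\<dots> \<le> exp (- (?d * x)) * exp (l / x) / 2" by simp
      also have "\<dots> = exp (- (?d * x) + l / x) / 2" by (simp only: exp_add)
      finally show ?case unfolding e .
    next
      case (6 x)
      then have x: "x \<ge> 1" by simp
      have "norm (rho_source z x) \<le> (LINT y|half_line 1. norm (rho_integrand z x y))"
        unfolding rho_source_def by (rule integral_norm_bound)
      also have "\<dots> \<le> (LINT y|half_line 1. (rho_majorant C d x y))"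
      proof (rule integral_mono_AE'[OF tail_int(1)[OF x]])
        show "AE y in half_line 1. norm (rho_integrand z x y)
          \<le> (rho_majorant C d x y)"
          using src[OF z x] by (intro AE_I2) simp
        show "AE y in half_line 1. 0 \<le> (rho_majorant C d x y)"
          using C by (intro AE_I2) simp
      qed
      also have "\<dots> = C * exp (- (?d * x)) / x" by (rule tail_int(2)[OF x])
      also have "\<dots> \<le> C * exp (- (?d * x))" using x C by (simp add: divide_le_eq)
      also have "\<dots> \<le> C * exp (- (?d * x) + l / x)" using x C l by simp
      finally show ?case .
    qed (use C in auto)
    then show ?thesis by (intro volterra.intro sigma_finite_half_line)
  qed
  show ?thesis by (rule that[OF C l less_imp_le[OF C] V src])
qed

lemma osc_holomorphic: "0 \<notin> U \<Longrightarrow> (\<lambda>z. osc z y) holomorphic_on U"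
  unfolding osc_def al_def by (intro holomorphic_intros) auto

lemma osc_prim_holomorphic:
  assumes U: "admissible U c d Z" and y: "y \<ge> 1"
  shows "(\<lambda>z. osc_prim z y) holomorphic_on U"
  unfolding osc_prim_def
proof (rule holomorphic_on_integral[where k = "\<lambda>_. exp (2 * Z * y + 2 * (norm \<kappa> / c) * ln y)"])
  note sb = admissible_slit[OF U]
  have nz: "0 \<notin> U" using slit_bound_nonzero[OF sb] by auto
  show "open U" using sb by (simp add: slit_bound_def)
  show "(\<lambda>z. 1 / osc z s) holomorphic_on U" for s
    by (intro holomorphic_intros osc_holomorphic nz) simp
  show "(\<lambda>s. 1 / osc z s) \<in> borel_measurable (lebesgue_on {1..y})" for z
    by (rule borel_measurable_integrable[OF lebesgue_on_interval_integral(1)])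
      (rule continuous_on_subset[OF inverse_osc_continuous], auto)
  show "integrable (lebesgue_on {1..y}) (\<lambda>_. exp (2 * Z * y + 2 * (norm \<kappa> / c) * ln y))" by simp
  fix z s assume z: "z \<in> U" and "s \<in> space (lebesgue_on {1..y})"
  then have s: "1 \<le> s" "s \<le> y" by auto
  have Zb: "norm z \<le> Z" using U z by (simp add: admissible_def)
  have "norm (1 / osc z s) = exp (2 * Im z * s + 2 * Re (al z) * ln s)"
    by (simp add: osc_def norm_divide exp_minus[symmetric] flip: inverse_eq_divide)
  also have "\<dots> \<le> exp (2 * Z * y + 2 * (norm \<kappa> / c) * ln y)"
  proof -
    have "Im z * s \<le> Z * y"
    proof -
      have "Im z * s \<le> norm z * s" using s abs_Im_le_cmod[of z] by (intro mult_right_mono) auto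
      also have "\<dots> \<le> Z * y" using s Zb order_trans[OF norm_ge_zero Zb] by (intro mult_mono) auto
      finally show ?thesis .
    qed
    moreover have "Re (al z) * ln s \<le> (norm \<kappa> / c) * ln y"
    proof -
      have a: "norm (al z) \<le> norm \<kappa> / c" by (rule al_bound[OF sb z])
      have "Re (al z) * ln s \<le> norm (al z) * ln s" using s complex_Re_le_cmod by (intro mult_right_mono) auto
      also have "\<dots> \<le> (norm \<kappa> / c) * ln y"
        using s a order_trans[OF norm_ge_zero a] by (intro mult_mono) auto
      finally show ?thesis .
    qed
    ultimately show ?thesis by simp
  qed
  finally show "norm (1 / osc z s) \<le> exp (2 * Z * y + 2 * (norm \<kappa> / c) * ln y)" .
qed

lemma green_holomorphic:
  assumes U: "admissible U c d Z" and "x \<ge> 1" "y \<ge> 1"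
  shows "(\<lambda>z. green z x y) holomorphic_on U"
proof -
  have "0 \<notin> U" using U slit_bound_nonzero by (force simp: admissible_def)
  then show ?thesis unfolding green_def
    by (intro holomorphic_on_mult holomorphic_on_diff osc_holomorphic osc_prim_holomorphic[OF U] assms)
qed

end

section \<open>Differential equation and holomorphy of the corrected solution\<close>

context outgoing begin

lemma amp_continuous: "slit_bound U c \<Longrightarrow> z \<in> U \<Longrightarrow> continuous_on {1..} (amp z)"
  unfolding continuous_on_eq_continuous_within
  by (intro ballI has_vector_derivative_continuous[OF amp_ode(1)]) auto

lemma rho_bound:
  assumes U: "admissible U c d Z"
  obtains C where "C > 0" "\<And>z x. z \<in> U \<Longrightarrow> x \<ge> 1 \<Longrightarrow> norm (rho z x) \<le> C * exp (- (rate d * x))"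
    "\<And>z x. z \<in> U \<Longrightarrow> x \<ge> 1 \<Longrightarrow> norm (load z x) \<le> C * (1 / x\<^sup>2) * exp (- (rate d * x))"
proof -
  let ?d = "rate d"
  obtain C l G where V: "C > 0" "l > 0" "G \<ge> 0"
    "\<And>z. z \<in> U \<Longrightarrow> rho_volterra_at z C d l G"
    by (rule rho_volterra[OF U]) (rule that; assumption)
  obtain C2 where C2: "C2 > 0"
    "\<And>z y. z \<in> U \<Longrightarrow> 1 \<le> y \<Longrightarrow> norm (r y - q z y) \<le> C2 * (1 / y\<^sup>2)"
    "\<And>z y. z \<in> U \<Longrightarrow> 1 \<le> y \<Longrightarrow> norm (r y * amp z y) \<le> C2 * (1 / y\<^sup>2) * exp (- (?d * y))"
    by (rule coefficient_bound[OF U]) (rule that; assumption)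
  define D where "D = 2 * G * exp l"
  have D: "D \<ge> 0" using V by (simp add: D_def)
  have rho: "norm (rho z x) \<le> D * exp (- (?d * x))" if z: "z \<in> U" and x: "x \<ge> 1" for z x
  proof -
    have "norm (rho z x) \<le> 2 * G * exp (- (?d * x) + l / x)"
      unfolding rho_def using volterra.sol_bound[OF V(4)[OF z], of x] x by simp
    also have "\<dots> \<le> 2 * G * exp (- (?d * x) + l)"
      using V x divide_left_mono[of 1 x l] by (intro mult_left_mono) auto
    finally show ?thesis by (simp only: D_def exp_add mult_ac)
  qed
  show ?thesis
  proof (rule that[of "D + C2 * D + C2"])
    show "0 < D + C2 * D + C2" using D C2 by (simp add: add_nonneg_pos)
    fix z and x :: real assume z: "z \<in> U" and x: "x \<ge> 1"
    show "norm (rho z x) \<le> (D + C2 * D + C2) * exp (- (?d * x))"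
      using D C2 by (intro order_trans[OF rho[OF z x] mult_right_mono]) auto
    have "norm (load z x) \<le> norm (r x - q z x) * norm (rho z x) + norm (r x * amp z x)"
      unfolding load_def using norm_triangle_ineq[of "(r x - q z x) * rho z x" "r x * amp z x"]
      by (simp add: norm_mult)
    also have "\<dots> \<le> C2 * (1 / x\<^sup>2) * (D * exp (- (?d * x))) + C2 * (1 / x\<^sup>2) * exp (- (?d * x))"
      by (intro add_mono mult_mono C2 rho z x) (use C2 in auto)
    also have "\<dots> = (C2 * D + C2) * (1 / x\<^sup>2 * exp (- (?d * x)))"
      by (simp add: algebra_simps add_divide_distrib)
    also have "\<dots> \<le> (D + C2 * D + C2) * (1 / x\<^sup>2 * exp (- (?d * x)))"
      using D by (intro mult_right_mono) auto
    finally show "norm (load z x) \<le> (D + C2 * D + C2) * (1 / x\<^sup>2) * exp (- (?d * x))"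
      by (simp add: mult.assoc)
  qed
qed

lemma rho_meas:
  assumes U: "admissible U c d Z" and z: "z \<in> U"
  shows "rho z \<in> half_meas" "load z \<in> half_meas"
proof -
  show 1: "rho z \<in> half_meas"
    unfolding rho_def by (rule rho_volterra[OF U]) (rule volterra.sol_meas, blast intro: z)
  note sb = admissible_slit[OF U]
  have [measurable]: "r \<in> half_meas" "q z \<in> half_meas"
    "amp z \<in> half_meas"
    by (intro continuous_borel_measurable_half_line r_continuous q_continuous amp_continuous[OF sb z])+
  show "load z \<in> half_meas"
    unfolding load_def[abs_def] using 1 by measurable
qed

lemma green_meas: "green z x \<in> half_meas"
  unfolding green_def[abs_def]
  by (intro borel_measurable_times borel_measurable_diff borel_measurable_const
      continuous_borel_measurable_half_line osc_continuous osc_prim_continuous)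

text \<open>Source and kernel term carry the same Green function, so the Volterra equation collapses
  to one integral against \<open>load\<close>.\<close>

lemma rho_eq:
  assumes U: "admissible U c d Z" and z: "z \<in> U" and x: "x \<ge> 1"
  shows "rho z x = (LINT y|half_line x. green z x y * load z y)"
proof -
  let ?d = "rate d"
  note sb = admissible_slit[OF U]
  obtain C l G where V: "C > 0" "l > 0" "G \<ge> 0"
    "\<And>z. z \<in> U \<Longrightarrow> rho_volterra_at z C d l G"
    "\<And>z x y. z \<in> U \<Longrightarrow> 1 \<le> x \<Longrightarrow> 1 \<le> y \<Longrightarrow>
      norm (rho_integrand z x y)
        \<le> (rho_majorant C d x y)"
    by (rule rho_volterra[OF U]) (rule that; assumption)
  interpret volterra "half_line 1" "rho_kernel z" "rho_source z"
    "\<lambda>x y. if x \<le> y then C * exp (?d * (y - x)) * (1 / y\<^sup>2) else 0"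
    "\<lambda>y. exp (- (?d * y) + l / y)" G by (rule V(4)[OF z])
  have [measurable]: "green z x \<in> half_meas" "r \<in> half_meas"
    "amp z \<in> half_meas"
    by (intro green_meas continuous_borel_measurable_half_line r_continuous amp_continuous[OF sb z])+
  have i1: "integrable (half_line 1) (rho_integrand z x)"
  proof (rule integrable_le)
    show "integrable (half_line 1) (rho_majorant C d x)"
      unfolding half_line_truncate(3)[OF x] by (intro integrable_mult_right inverse_square_integral x)
    show "(rho_integrand z x) \<in> half_meas"
      by measurable
    show "AE y in half_line 1. norm (rho_integrand z x y)
        \<le> norm (rho_majorant C d x y)"
      by (intro AE_I2 order_trans[OF V(5)[OF z x]]) auto
  qed
  have i2: "integrable (half_line 1) (\<lambda>y. rho_kernel z x y * rho z y)"
    using sol_integrable[of x] x by (simp add: rho_def)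
  have "rho z x = rho_source z x + (LINT y|half_line 1. rho_kernel z x y * rho z y)"
    using sol_eq[of x] x by (simp add: rho_def)
  also have "\<dots> = (LINT y|half_line 1. (rho_integrand z x y) + rho_kernel z x y * rho z y)"
    unfolding rho_source_def using i1 i2 by simp
  also have "\<dots> = (LINT y|half_line 1. (if x \<le> y then green z x y * load z y else 0))"
    by (intro lint_cong refl) (auto simp: rho_kernel_def load_def algebra_simps)
  finally show ?thesis by (simp add: half_line_truncate(4)[OF x])
qed

lemma osc_prim_1 [simp]: "osc_prim z 1 = 0"
  by (simp add: osc_prim_integral)

text \<open>Growth \<open>exp (rate d * (y - x))\<close> against decay
  \<open>exp (- (rate d * y))\<close> leaves a factor that depends on \<open>x\<close> alone. The
  factor \<open>1 / y\<^sup>2\<close> then makes the integrals to infinity converge.\<close>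

lemma osc_load_bound:
  assumes U: "admissible U c d Z"
  obtains C where "C > 0"
    "\<And>z x y. z \<in> U \<Longrightarrow> 1 \<le> x \<Longrightarrow> x \<le> y \<Longrightarrow> norm (osc z y / osc z x * load z y) \<le> C * exp (- (rate d * x)) * (1 / y\<^sup>2)"
    "\<And>z x y. z \<in> U \<Longrightarrow> 1 \<le> x \<Longrightarrow> x \<le> y \<Longrightarrow> norm (green z x y * load z y) \<le> C * exp (- (rate d * x)) * (1 / y\<^sup>2)"
proof -
  let ?d = "rate d"
  obtain C1 where C1: "C1 > 0"
    "\<And>z x y. z \<in> U \<Longrightarrow> 1 \<le> x \<Longrightarrow> x \<le> y \<Longrightarrow> norm (green z x y) \<le> C1 * exp (?d * (y - x))"
    "\<And>z x y. z \<in> U \<Longrightarrow> 1 \<le> x \<Longrightarrow> x \<le> y \<Longrightarrow> norm (osc z y / osc z x) \<le> C1 * exp (?d * (y - x))"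
    by (rule green_bound[OF U]) (rule that; assumption)
  obtain C2 where C2: "C2 > 0"
    "\<And>z x. z \<in> U \<Longrightarrow> x \<ge> 1 \<Longrightarrow> norm (load z x) \<le> C2 * (1 / x\<^sup>2) * exp (- (?d * x))"
    by (rule rho_bound[OF U]) (rule that; assumption)
  have *: "norm (g * load z y) \<le> C1 * C2 * exp (- (?d * x)) * (1 / y\<^sup>2)"
    if "z \<in> U" "1 \<le> x" "x \<le> y" "norm g \<le> C1 * exp (?d * (y - x))" for z x y g
  proof -
    have "norm (g * load z y) \<le> C1 * exp (?d * (y - x)) * (C2 * (1 / y\<^sup>2) * exp (- (?d * y)))"
      unfolding norm_mult using that C1 C2 by (intro mult_mono) auto
    also have "\<dots> = C1 * C2 * (exp (?d * (y - x)) * exp (- (?d * y))) * (1 / y\<^sup>2)" by simp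
    also have "exp (?d * (y - x)) * exp (- (?d * y)) = exp (- (?d * x))"
      by (simp add: exp_add[symmetric] algebra_simps)
    finally show ?thesis .
  qed
  have pos: "C1 * C2 > 0" using C1(1) C2(1) by simp
  show ?thesis
    by (rule that[OF pos]; rule *; (assumption | rule C1))
qed

lemma load_integrable:
  assumes U: "admissible U c d Z" and z: "z \<in> U"
  shows "integrable (half_line 1) (\<lambda>y. osc z y * load z y)"
    "integrable (half_line 1) (\<lambda>y. osc_prim z y * (osc z y * load z y))"
proof -
  obtain C where C: "C > 0"
    "\<And>z x y. z \<in> U \<Longrightarrow> 1 \<le> x \<Longrightarrow> x \<le> y \<Longrightarrow> norm (osc z y / osc z x * load z y) \<le> C * exp (- (rate d * x)) * (1 / y\<^sup>2)"
    "\<And>z x y. z \<in> U \<Longrightarrow> 1 \<le> x \<Longrightarrow> x \<le> y \<Longrightarrow> norm (green z x y * load z y) \<le> C * exp (- (rate d * x)) * (1 / y\<^sup>2)"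
    by (rule osc_load_bound[OF U]) (rule that; assumption)
  have bint: "integrable (half_line 1) f"
    if "f \<in> half_meas" "\<And>y. y \<ge> 1 \<Longrightarrow> norm (f y) \<le> A * (1 / y\<^sup>2)" for f :: cfun and A
  proof (rule integrable_le[of _ "\<lambda>y. A * (1 / y\<^sup>2)"])
    show "integrable (half_line 1) (\<lambda>y. A * (1 / y\<^sup>2))"
      by (intro integrable_mult_right inverse_square_integral) simp
    show "AE y in half_line 1. norm (f y) \<le> norm (A * (1 / y\<^sup>2))"
      unfolding real_norm_def by (rule AE_I2, rule order_trans[OF that(2) abs_ge_self]) simp
  qed (rule that)
  have m: "osc z \<in> half_meas" "load z \<in> half_meas"
    by (intro continuous_borel_measurable_half_line osc_continuous, rule rho_meas[OF U z])
  have "integrable (half_line 1) (\<lambda>y. osc z y / osc z 1 * load z y)"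
    by (rule bint[of _ "C * exp (- (rate d * 1))"])
      (use C(2)[OF z, of 1] m in \<open>auto intro!: borel_measurable_times borel_measurable_divide\<close>)
  from integrable_mult_right[OF this, of "osc z 1"]
  show "integrable (half_line 1) (\<lambda>y. osc z y * load z y)" by (simp add: field_simps)
  have "integrable (half_line 1) (\<lambda>y. green z 1 y * load z y)"
    by (rule bint[of _ "C * exp (- (rate d * 1))"])
      (use C(3)[OF z, of 1] m green_meas in \<open>auto intro!: borel_measurable_times\<close>)
  then show "integrable (half_line 1) (\<lambda>y. osc_prim z y * (osc z y * load z y))"
    by (simp add: green_def mult_ac)
qed

text \<open>A bootstrap: \<open>rho\<close> is first written through tail integrals of merely
  integrable functions, which makes it continuous; then \<open>load\<close> is continuous, and the
  tail integrals become differentiable. In the derivative of \<open>rho\<close> the two terms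
  containing \<open>load\<close> cancel.\<close>

lemma rho_ode:
  assumes U: "admissible U c d Z" and z: "z \<in> U" and x: "x \<ge> 1"
  shows "(rho z has_vector_derivative rho' z x) (at x within {1..})"
    "(rho' z has_vector_derivative - (2 * (\<i> * z - al z / of_real x) * rho' z x) + load z x) (at x within {1..})"
proof -
  note sb = admissible_slit[OF U]
  let ?J0 = "\<lambda>x. LINT y|half_line x. osc z y * load z y"
  let ?J1 = "\<lambda>x. LINT y|half_line x. osc_prim z y * (osc z y * load z y)"
  note I = load_integrable[OF U z]
  have eq: "rho z x = ?J1 x - osc_prim z x * ?J0 x" if x: "x \<ge> 1" for x
  proof -
    have "rho z x = (LINT y|half_line x. osc_prim z y * (osc z y * load z y) - osc_prim z x * (osc z y * load z y))"
      unfolding rho_eq[OF U z x] by (simp add: green_def algebra_simps)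
    then show ?thesis
      using half_line_tail(1)[OF I(1) x] half_line_tail(1)[OF I(2) x] by simp
  qed
  have "continuous_on {1..} (\<lambda>x. ?J1 x - osc_prim z x * ?J0 x)"
    by (intro continuous_intros half_line_tail(3) I osc_prim_continuous)
  then have rc: "continuous_on {1..} (rho z)" by (rule continuous_on_eq) (simp add: eq)
  have lc: "continuous_on {1..} (load z)" unfolding load_def[abs_def]
    by (intro continuous_intros rc r_continuous q_continuous amp_continuous[OF sb z])
  have c0: "continuous_on {1..} (\<lambda>y. osc z y * load z y)"
    by (intro continuous_intros lc osc_continuous)
  have c1: "continuous_on {1..} (\<lambda>y. osc_prim z y * (osc z y * load z y))"
    by (intro continuous_intros c0 osc_prim_continuous)
  have d0: "(?J0 has_vector_derivative - (osc z x * load z x)) (at x within {1..})" if "x \<ge> 1" for x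
    by (rule half_line_tail(4)[OF I(1) c0 that])
  have d1: "(?J1 has_vector_derivative - (osc_prim z x * (osc z x * load z x))) (at x within {1..})" if "x \<ge> 1" for x
    by (rule half_line_tail(4)[OF I(2) c1 that])
  have "((\<lambda>x. ?J1 x - osc_prim z x * ?J0 x) has_vector_derivative
      - (osc_prim z x * (osc z x * load z x)) - (osc_prim z x * - (osc z x * load z x) + 1 / osc z x * ?J0 x)) (at x within {1..})"
    by (intro has_vector_derivative_diff has_vector_derivative_mult d0 d1 osc_prim_derivative x)
  then have "((\<lambda>x. ?J1 x - osc_prim z x * ?J0 x) has_vector_derivative rho' z x) (at x within {1..})"
    by (simp add: rho'_def)
  then show "(rho z has_vector_derivative rho' z x) (at x within {1..})"
    by (rule has_vector_derivative_transform[rotated 2]) (use eq x in auto)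
  let ?t = "2 * (\<i> * z - al z / of_real x)"
  have od: "(osc z has_vector_derivative ?t * osc z x) (at x within {1..})"
    using osc_derivative[of x z "{1..}"] x by (simp add: algebra_simps)
  have "((\<lambda>x. inverse (osc z x)) has_vector_derivative (?t * osc z x) * - (inverse (osc z x) ^ Suc (Suc 0))) (at x within {1..})"
    using field_vector_diff_chain_within[OF od DERIV_inverse[OF osc_nonzero]] by (simp add: o_def)
  from has_vector_derivative_mult[OF has_vector_derivative_minus[OF d0[OF x]] this]
  have "((\<lambda>x. - ?J0 x * inverse (osc z x)) has_vector_derivative
      - ?J0 x * ((?t * osc z x) * - (inverse (osc z x) ^ Suc (Suc 0))) + - (- (osc z x * load z x)) * inverse (osc z x))
      (at x within {1..})" .
  moreover have "- ?J0 x * ((?t * osc z x) * - (inverse (osc z x) ^ Suc (Suc 0))) + - (- (osc z x * load z x)) * inverse (osc z x)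
      = - (?t * rho' z x) + load z x"
  proof -
    have c: "osc z x * (inverse (osc z x) * w) = w" for w by (simp flip: mult.assoc)
    show ?thesis by (simp add: rho'_def divide_inverse mult_ac c)
  qed
  moreover have "rho' z = (\<lambda>x. - ?J0 x * inverse (osc z x))"
    by (simp add: rho'_def[abs_def] divide_inverse)
  ultimately show "(rho' z has_vector_derivative - (?t * rho' z x) + load z x) (at x within {1..})"
    by simp
qed

lemma rho'_bound:
  assumes U: "admissible U c d Z" and z: "z \<in> U"
  obtains C where "\<And>x. x \<ge> 1 \<Longrightarrow> norm (rho' z x) \<le> C"
proof -
  obtain C where C: "C > 0"
    "\<And>z x y. z \<in> U \<Longrightarrow> 1 \<le> x \<Longrightarrow> x \<le> y \<Longrightarrow> norm (osc z y / osc z x * load z y) \<le> C * exp (- (rate d * x)) * (1 / y\<^sup>2)"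
    by (rule osc_load_bound[OF U]) (rule that; assumption)
  have d: "rate d > 0" using U by (auto simp: admissible_def rate_def)
  show ?thesis
  proof (rule that)
    fix x :: real assume x: "x \<ge> 1"
    have "rho' z x = - (LINT y|half_line x. osc z y / osc z x * load z y)"
      unfolding rho'_def by (simp flip: integral_divide_zero)
    then have "norm (rho' z x) \<le> (LINT y|half_line x. norm (osc z y / osc z x * load z y))"
      using integral_norm_bound[of "half_line x" "\<lambda>y. osc z y / osc z x * load z y"] by simp
    also have "\<dots> \<le> (LINT y|half_line x. C * exp (- (rate d * x)) * (1 / y\<^sup>2))"
    proof (rule integral_mono_AE')
      show "integrable (half_line x) (\<lambda>y. C * exp (- (rate d * x)) * (1 / y\<^sup>2))"
        by (intro integrable_mult_right inverse_square_integral x)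
      show "AE y in half_line x. norm (osc z y / osc z x * load z y) \<le> C * exp (- (rate d * x)) * (1 / y\<^sup>2)"
        using C(2)[OF z x] by (intro AE_I2) simp
      show "AE y in half_line x. 0 \<le> C * exp (- (rate d * x)) * (1 / y\<^sup>2)"
        using C by (intro AE_I2) simp
    qed
    also have "\<dots> = C * exp (- (rate d * x)) * (1 / x)"
      unfolding integral_mult_right_zero inverse_square_integral(2)[OF x] ..
    also have "\<dots> \<le> C * 1 * 1"
      using C x d by (intro mult_mono) auto
    finally show "norm (rho' z x) \<le> C" by simp
  qed
qed

lemma rho_holomorphic:
  assumes U: "admissible U c d Z" and x: "x \<ge> 1"
  shows "(\<lambda>z. rho z x) holomorphic_on U"
proof -
  let ?d = "rate d"
  note sb = admissible_slit[OF U]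
  have o: "open U" using sb by (simp add: slit_bound_def)
  have nz: "0 \<notin> U" using slit_bound_nonzero[OF sb] by auto
  obtain C l G where V: "C > 0" "l > 0" "G \<ge> 0"
    "\<And>z. z \<in> U \<Longrightarrow> rho_volterra_at z C d l G"
    "\<And>z x y. z \<in> U \<Longrightarrow> 1 \<le> x \<Longrightarrow> 1 \<le> y \<Longrightarrow>
      norm (rho_integrand z x y)
        \<le> (rho_majorant C d x y)"
    by (rule rho_volterra[OF U]) (rule that; assumption)
  show ?thesis unfolding rho_def
  proof (rule volterra_sol_holomorphic[OF o V(4)])
    show "(\<lambda>z. rho_kernel z x y) holomorphic_on U"
      if "x \<in> space (half_line 1)" "y \<in> space (half_line 1)" for x y
    proof (cases "x \<le> y")
      case True
      then show ?thesis unfolding rho_kernel_def using that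
        by (auto intro!: holomorphic_on_mult holomorphic_on_diff holomorphic_on_const
            green_holomorphic[OF U] q_holomorphic[OF nz])
    qed (simp add: rho_kernel_def)
    show "(\<lambda>z. rho_source z x) holomorphic_on U" if "x \<in> space (half_line 1)" for x
      unfolding rho_source_def
    proof (rule holomorphic_on_integral[OF o])
      have x: "x \<ge> 1" using that by simp
      show "integrable (half_line 1) (rho_majorant C d x)"
        unfolding half_line_truncate(3)[OF x] by (intro integrable_mult_right inverse_square_integral x)
      show "norm (rho_integrand z x y)
        \<le> (rho_majorant C d x y)"
        if "z \<in> U" "y \<in> space (half_line 1)" for z y
        using V(5)[OF that(1) x] that by simp
      show "(\<lambda>z. rho_integrand z x y) holomorphic_on U"
        if "y \<in> space (half_line 1)" for y
        by (cases "x \<le> y") (use that x in \<open>auto intro!: holomorphic_on_mult holomorphic_on_const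
            green_holomorphic[OF U] amp_holomorphic[OF sb]\<close>)
      show "(rho_integrand z x) \<in> half_meas"
        if "z \<in> U" for z
      proof -
        have [measurable]: "green z x \<in> half_meas" "r \<in> half_meas"
          "amp z \<in> half_meas"
          by (intro green_meas continuous_borel_measurable_half_line r_continuous amp_continuous[OF sb that])+
        show ?thesis by measurable
      qed
    qed
  qed (use x in auto)
qed

lemma rho'_holomorphic:
  assumes U: "admissible U c d Z"
  shows "(\<lambda>z. rho' z 1) holomorphic_on U"
proof -
  note sb = admissible_slit[OF U]
  have o: "open U" using sb by (simp add: slit_bound_def)
  have nz: "0 \<notin> U" using slit_bound_nonzero[OF sb] by auto
  obtain C where C: "C > 0"
    "\<And>z x y. z \<in> U \<Longrightarrow> 1 \<le> x \<Longrightarrow> x \<le> y \<Longrightarrow> norm (osc z y / osc z x * load z y) \<le> C * exp (- (rate d * x)) * (1 / y\<^sup>2)"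
    by (rule osc_load_bound[OF U]) (rule that; assumption)
  have eq: "rho' z 1 = - (LINT y|half_line 1. osc z y / osc z 1 * load z y)" for z
    unfolding rho'_def by (simp flip: integral_divide_zero)
  have "(\<lambda>z. LINT y|half_line 1. osc z y / osc z 1 * load z y) holomorphic_on U"
  proof (rule holomorphic_on_integral[OF o])
    show "integrable (half_line 1) (\<lambda>y. C * exp (- (rate d * 1)) * (1 / y\<^sup>2))"
      by (intro integrable_mult_right inverse_square_integral) simp
    show "norm (osc z y / osc z 1 * load z y) \<le> C * exp (- (rate d * 1)) * (1 / y\<^sup>2)"
      if "z \<in> U" "y \<in> space (half_line 1)" for z y
      using C(2)[OF that(1), of 1 y] that by simp
    show "(\<lambda>y. osc z y / osc z 1 * load z y) \<in> half_meas" if "z \<in> U" for z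
      by (intro borel_measurable_times borel_measurable_divide borel_measurable_const rho_meas(2)[OF U that]
          continuous_borel_measurable_half_line osc_continuous)
    show "(\<lambda>z. osc z y / osc z 1 * load z y) holomorphic_on U" if "y \<in> space (half_line 1)" for y
      unfolding load_def using that
      by (intro holomorphic_on_mult holomorphic_on_divide holomorphic_on_add holomorphic_on_diff
          holomorphic_on_const osc_holomorphic[OF nz] q_holomorphic[OF nz] rho_holomorphic[OF U]
          amp_holomorphic[OF sb]) auto
  qed
  then show ?thesis unfolding eq by (rule holomorphic_on_minus)
qed

lemma jost_holomorphic:
  assumes U: "admissible U c d Z"
  shows "(\<lambda>z. jost z 1) holomorphic_on U" "(\<lambda>z. jost' z 1) holomorphic_on U"
proof -
  note sb = admissible_slit[OF U]
  have nz: "0 \<notin> U" using slit_bound_nonzero[OF sb] by auto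
  have e: "(\<lambda>z. exp (\<i> * z * of_real 1 - al z * of_real (ln 1))) holomorphic_on U"
    unfolding al_def using nz by (intro holomorphic_intros) auto
  have a: "(\<lambda>z. \<i> * z - al z / of_real 1) holomorphic_on U"
    unfolding al_def using nz by (intro holomorphic_intros) auto
  have ar: "(\<lambda>z. amp z 1 + rho z 1) holomorphic_on U"
    by (intro holomorphic_on_add amp_holomorphic[OF sb] rho_holomorphic[OF U]) auto
  show "(\<lambda>z. jost z 1) holomorphic_on U"
    unfolding jost_def by (rule holomorphic_on_mult[OF e ar])
  show "(\<lambda>z. jost' z 1) holomorphic_on U"
    unfolding jost'_def
    by (intro holomorphic_on_mult[OF e] holomorphic_on_add[OF _ holomorphic_on_mult[OF a ar]]
        holomorphic_on_add amp_holomorphic(2)[OF sb] rho'_holomorphic[OF U]) simp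
qed

text \<open>Product rule with the logarithmic derivative \<open>t x\<close> of the prefactor. The
  choice of \<open>al\<close> makes \<open>t x ^ 2\<close> contain \<open>\<kappa> / x\<close>, and
  the terms of \<open>q\<close> in \<open>1 / x\<close> and \<open>1 / x ^ 2\<close> are exactly
  what remains to be cancelled.\<close>

lemma jost_schroedinger:
  assumes U: "admissible U c d Z" and z: "z \<in> U"
  shows "schroedinger_sol V (z\<^sup>2) (jost z) (jost' z)"
  unfolding schroedinger_sol_def
proof (intro allI impI)
  fix x :: real assume x: "x \<ge> 1"
  note sb = admissible_slit[OF U]
  have z0: "z \<noteq> 0" by (rule slit_bound_nonzero[OF sb z])
  define e where "e x = exp (\<i> * z * of_real x - al z * of_real (ln x))" for x
  define t where "t x = \<i> * z - al z / of_real x" for x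
  define C where "C x = amp z x + rho z x" for x
  define C' where "C' x = amp' z x + rho' z x" for x
  have l: "((\<lambda>x. complex_of_real (ln x)) has_vector_derivative of_real (1 / x)) (at x within {1..})"
    by (intro has_vector_derivative_of_real DERIV_ln_divide[THEN has_field_derivative_at_within]) (use x in simp)
  have i: "((\<lambda>x. complex_of_real x) has_vector_derivative of_real 1) (at x within {1..})"
    by (intro has_vector_derivative_of_real DERIV_ident)
  have "((\<lambda>x. \<i> * z * of_real x - al z * of_real (ln x)) has_vector_derivative
      (\<i> * z * of_real 1 - al z * of_real (1 / x))) (at x within {1..})"
    by (intro has_vector_derivative_diff has_vector_derivative_mult_right l i)
  from field_vector_diff_chain_within[OF this DERIV_exp[THEN has_field_derivative_at_within]]
  have de: "(e has_vector_derivative t x * e x) (at x within {1..})"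
    by (simp add: e_def[abs_def] t_def o_def algebra_simps)
  have dt: "(t has_vector_derivative al z / of_real x ^ 2) (at x within {1..})"
  proof -
    have "((\<lambda>x. \<i> * z - al z * of_real (1 / x)) has_vector_derivative 0 - al z * of_real (- (1 / x ^ 2))) (at x within {1..})"
      by (intro has_vector_derivative_diff has_vector_derivative_const has_vector_derivative_mult_right
          has_vector_derivative_of_real)
        (use x in \<open>auto intro!: derivative_eq_intros simp: power2_eq_square\<close>)
    then show ?thesis by (simp add: t_def[abs_def])
  qed
  have dC: "(C has_vector_derivative C' x) (at x within {1..})"
    unfolding C_def[abs_def] C'_def
    by (intro has_vector_derivative_add amp_ode(1)[OF sb z] rho_ode(1)[OF U z x]) (use x in simp)
  have dC': "(C' has_vector_derivative - (2 * t x * C' x) + (r x - q z x) * C x) (at x within {1..})"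
  proof -
    have "(C' has_vector_derivative - (2 * (\<i> * z - al z / of_real x) * amp' z x + q z x * amp z x) +
        (- (2 * (\<i> * z - al z / of_real x) * rho' z x) + load z x)) (at x within {1..})"
      unfolding C'_def[abs_def]
      by (intro has_vector_derivative_add amp_ode(2)[OF sb z] rho_ode(2)[OF U z x]) (use x in simp)
    moreover have "- (2 * (\<i> * z - al z / of_real x) * amp' z x + q z x * amp z x) +
        (- (2 * (\<i> * z - al z / of_real x) * rho' z x) + load z x) = - (2 * t x * C' x) + (r x - q z x) * C x"
      by (simp add: C_def C'_def t_def load_def algebra_simps)
    ultimately show ?thesis by simp
  qed
  have j: "jost z = (\<lambda>x. e x * C x)" "jost' z = (\<lambda>x. e x * (C' x + t x * C x))"
    by (auto simp: jost_def jost'_def e_def t_def C_def C'_def fun_eq_iff)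
  have "(jost z has_vector_derivative e x * C' x + t x * e x * C x) (at x within {1..})"
    unfolding j by (rule has_vector_derivative_mult[OF de dC])
  moreover have "e x * C' x + t x * e x * C x = jost' z x" by (simp add: j algebra_simps)
  moreover have "(jost' z has_vector_derivative
      e x * (- (2 * t x * C' x) + (r x - q z x) * C x + (t x * C' x + al z / of_real x ^ 2 * C x))
        + t x * e x * (C' x + t x * C x)) (at x within {1..})"
    unfolding j by (intro has_vector_derivative_mult has_vector_derivative_add de dC dC' dt)
  moreover have "e x * (- (2 * t x * C' x) + (r x - q z x) * C x + (t x * C' x + al z / of_real x ^ 2 * C x))
        + t x * e x * (C' x + t x * C x) = (V x - z\<^sup>2) * jost z x"
  proof -
    have "2 * \<i> * z * al z = - \<kappa>" using z0 by (simp add: al_def)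
    then have "2 * (\<i> * z) * (al z / of_real x) = - \<kappa> / of_real x"
      by (simp add: field_simps)
    then have tt: "t x ^ 2 = - z\<^sup>2 + \<kappa> / of_real x + (al z)\<^sup>2 / of_real x ^ 2"
      by (simp add: t_def power2_diff power_mult_distrib power_divide)
    have rq: "r x - q z x = V x - \<kappa> / of_real x - ((al z)\<^sup>2 + al z) / of_real x ^ 2"
      by (simp add: r_def q_def)
    have "e x * (- (2 * t x * C' x) + (r x - q z x) * C x + (t x * C' x + al z / of_real x ^ 2 * C x))
        + t x * e x * (C' x + t x * C x) = (r x - q z x + al z / of_real x ^ 2 + t x ^ 2) * (e x * C x)"
      by (simp add: algebra_simps power2_eq_square)
    also have "r x - q z x + al z / of_real x ^ 2 + t x ^ 2 = V x - z\<^sup>2"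
      unfolding tt rq by (simp add: add_divide_distrib)
    finally show ?thesis by (simp add: j)
  qed
  ultimately show "(jost z has_vector_derivative jost' z x) (at x within {1..}) \<and>
      (jost' z has_vector_derivative (V x - z\<^sup>2) * jost z x) (at x within {1..})"
    by simp
qed

text \<open>For large x the amplitude is close to \<open>1\<close>, since \<open>amp\<close> tends
  to \<open>1\<close> and \<open>rho\<close> to \<open>0\<close>, and the exponential prefactor
  never vanishes.\<close>

lemma jost_nonzero:
  assumes U: "admissible U c d Z" and z: "z \<in> U"
  shows "\<exists>x\<ge>1. jost z x \<noteq> 0"
proof -
  note sb = admissible_slit[OF U]
  have d: "rate d > 0" using U by (auto simp: admissible_def rate_def)
  obtain A where A: "A \<ge> 0" "\<And>z x. z \<in> U \<Longrightarrow> x \<ge> 1 \<Longrightarrow> norm (amp z x - 1) \<le> A / x"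
    by (rule amp_bound[OF sb]) (rule that; assumption)
  obtain C where C: "C > 0" "\<And>z x. z \<in> U \<Longrightarrow> x \<ge> 1 \<Longrightarrow> norm (rho z x) \<le> C * exp (- (rate d * x))"
    by (rule rho_bound[OF U]) (rule that; assumption)
  have "((\<lambda>x. C * exp (- (rate d * x))) \<longlongrightarrow> C * 0) at_top"
    by (intro tendsto_mult tendsto_const filterlim_compose[OF exp_at_bot]
        filterlim_compose[OF filterlim_uminus_at_bot_at_top]
        filterlim_tendsto_pos_mult_at_top[OF tendsto_const d] filterlim_ident)
  moreover have "((\<lambda>x::real. A / x) \<longlongrightarrow> 0) at_top"
    by (rule tendsto_divide_0[OF tendsto_const]) (simp add: filterlim_at_top_imp_at_infinity filterlim_ident)
  ultimately have "((\<lambda>x. A / x + C * exp (- (rate d * x))) \<longlongrightarrow> 0) at_top"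
    using tendsto_add[of "\<lambda>x. A / x" 0 at_top "\<lambda>x. C * exp (- (rate d * x))" 0] by simp
  then have "eventually (\<lambda>x. A / x + C * exp (- (rate d * x)) < 1) at_top"
    by (rule order_tendstoD) simp
  then have "eventually (\<lambda>x. A / x + C * exp (- (rate d * x)) < 1 \<and> x \<ge> 1) at_top"
    using eventually_ge_at_top[of 1] by (rule eventually_conj)
  then obtain x where x: "A / x + C * exp (- (rate d * x)) < 1" "x \<ge> 1"
    unfolding eventually_at_top_linorder by (auto dest: spec[of _ "_ :: real"])
  have "norm ((amp z x - 1) + rho z x) < 1"
    using norm_triangle_ineq[of "amp z x - 1" "rho z x"] A(2)[OF z x(2)] C(2)[OF z x(2)] x(1) by linarith
  moreover have "amp z x - 1 + rho z x = -1" if "amp z x + rho z x = 0"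
    using that by (simp add: algebra_simps)
  ultimately have "amp z x + rho z x \<noteq> 0" by force
  then show ?thesis using x(2) by (auto simp: jost_def)
qed

text \<open>The prefactor decays like \<open>exp (- x)\<close> times a power of x; half of the
  exponential rate absorbs the power, and the amplitude and its derivative are bounded.\<close>

lemma jost_decay:
  assumes U: "admissible U c d Z" and z: "z \<in> U" and Im: "Im z \<ge> 1"
  obtains C where "\<And>x. x \<ge> 1 \<Longrightarrow> norm (jost z x) \<le> C * exp (- (x / 2))"
    "\<And>x. x \<ge> 1 \<Longrightarrow> norm (jost' z x) \<le> C * exp (- (x / 2))"
proof -
  note sb = admissible_slit[OF U]
  have d: "rate d > 0" using U by (auto simp: admissible_def rate_def)
  obtain A where A: "A \<ge> 0" "\<And>z x. z \<in> U \<Longrightarrow> x \<ge> 1 \<Longrightarrow> norm (amp z x - 1) \<le> A / x"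
    "\<And>z x. z \<in> U \<Longrightarrow> x \<ge> 1 \<Longrightarrow> norm (amp' z x) \<le> A / x"
    by (rule amp_bound[OF sb]) (rule that; assumption)
  obtain C where C: "C > 0" "\<And>z x. z \<in> U \<Longrightarrow> x \<ge> 1 \<Longrightarrow> norm (rho z x) \<le> C * exp (- (rate d * x))"
    by (rule rho_bound[OF U]) (rule that; assumption)
  obtain C' where C': "\<And>x. x \<ge> 1 \<Longrightarrow> norm (rho' z x) \<le> C'" by (rule rho'_bound[OF U z]) (rule that)
  define n where "n = nat \<lceil>norm (al z)\<rceil>"
  obtain B :: real where B: "B > 0" "\<And>x. x \<ge> 0 \<Longrightarrow> (1 + x) ^ n \<le> B * exp (1 / 2 * x)"
    using poly_times_exp_bounded[of "1 / 2" n] by auto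
  have ax: "A / x \<le> A" if "x \<ge> 1" for x using divide_left_mono[of 1 x A] A(1) that by simp
  have b1: "norm (amp z x + rho z x) \<le> 1 + A + C" if x: "x \<ge> 1" for x
  proof -
    have "C * exp (- (rate d * x)) \<le> C * 1" using C x d by (intro mult_left_mono) auto
    then have "norm (rho z x) \<le> C" using C(2)[OF z x] by linarith
    moreover have "norm (amp z x) \<le> 1 + A"
      using norm_triangle_ineq[of 1 "amp z x - 1"] A(2)[OF z x] ax[OF x] by simp
    ultimately show ?thesis using norm_triangle_ineq[of "amp z x" "rho z x"] by linarith
  qed
  have b2: "norm (amp' z x + rho' z x) \<le> A + C'" if x: "x \<ge> 1" for x
    using norm_triangle_ineq[of "amp' z x" "rho' z x"] A(3)[OF z x] ax[OF x] C'[OF x] by linarith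
  have b3: "norm (exp (\<i> * z * of_real x - al z * of_real (ln x))) \<le> B * exp (- (x / 2))" if x: "x \<ge> 1" for x
  proof -
    have "norm (exp (\<i> * z * of_real x - al z * of_real (ln x))) = exp (- (Im z * x) - Re (al z) * ln x)"
      by simp
    also have "\<dots> \<le> exp (- x + real n * ln (1 + x))"
    proof -
      have "1 * x \<le> Im z * x" using Im x by (intro mult_right_mono) auto
      moreover have "- Re (al z) * ln x \<le> real n * ln (1 + x)"
      proof (rule mult_mono)
        show "- Re (al z) \<le> real n"
          using abs_Re_le_cmod[of "al z"] real_nat_ceiling_ge[of "norm (al z)"] unfolding n_def by linarith
      qed (use x in auto)
      ultimately show ?thesis by simp
    qed
    also have "\<dots> = exp (- x) * (1 + x) ^ n"
      unfolding exp_add using x by (simp add: exp_of_nat_mult)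
    also have "\<dots> \<le> exp (- x) * (B * exp (1 / 2 * x))"
      using x by (intro mult_left_mono B) auto
    also have "\<dots> = B * exp (- (x / 2))" by (simp add: exp_add[symmetric] mult.left_commute)
    finally show ?thesis .
  qed
  define D where "D = (A + C') + (norm z + norm (al z)) * (1 + A + C) + (1 + A + C)"
  have C'0: "C' \<ge> 0" using C'[of 1] norm_ge_zero[of "rho' z 1"] by linarith
  show ?thesis
  proof (rule that[of "B * D"])
    fix x :: real assume x: "x \<ge> 1"
    have "norm (amp z x + rho z x) \<le> D"
      unfolding D_def using b1[OF x] A C C'0 by (smt (verit) mult_nonneg_nonneg norm_ge_zero)
    from mult_mono[OF b3[OF x] this]
    show "norm (jost z x) \<le> B * D * exp (- (x / 2))"
      using B by (simp add: jost_def norm_mult mult_ac)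
    have "norm (al z / of_real x) \<le> norm (al z)"
      using x mult_left_mono[of 1 x "norm (al z)"] by (simp add: norm_divide divide_le_eq)
    then have "norm (\<i> * z - al z / of_real x) \<le> norm z + norm (al z)"
      using norm_triangle_ineq4[of "\<i> * z" "al z / of_real x"] by (simp add: norm_mult)
    then have "norm ((\<i> * z - al z / of_real x) * (amp z x + rho z x)) \<le> (norm z + norm (al z)) * (1 + A + C)"
      unfolding norm_mult[of "\<i> * z - al z / of_real x"] by (intro mult_mono b1 x) auto
    then have "norm ((amp' z x + rho' z x) + (\<i> * z - al z / of_real x) * (amp z x + rho z x)) \<le> D"
      unfolding D_def
      using norm_triangle_ineq[of "amp' z x + rho' z x" "(\<i> * z - al z / of_real x) * (amp z x + rho z x)"]
        b2[OF x] A C by linarith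
    from mult_mono[OF b3[OF x] this]
    show "norm (jost' z x) \<le> B * D * exp (- (x / 2))"
      using B by (simp add: jost'_def norm_mult mult_ac)
  qed
qed

text \<open>Constants are uniform only on small \<open>admissible\<close> sets, whereas
  \<open>jost\<close> is defined without reference to such a set; hence the local statements combine
  without any gluing.\<close>

proposition jost_solution:
  assumes \<tau>: "\<tau> > 0"
  shows "(\<lambda>z. jost z 1) holomorphic_on M_region \<tau>" "(\<lambda>z. jost' z 1) holomorphic_on M_region \<tau>"
    "z \<in> M_region \<tau> \<Longrightarrow> schroedinger_sol V (z\<^sup>2) (jost z) (jost' z)"
    "z \<in> M_region \<tau> \<Longrightarrow> \<exists>x\<ge>1. jost z x \<noteq> 0"
    "z \<in> M_region \<tau> \<Longrightarrow> Im z \<ge> 1 \<Longrightarrow> \<exists>C. \<forall>x\<ge>1. norm (jost z x) \<le> C * exp (- (x / 2)) \<and>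
        norm (jost' z x) \<le> C * exp (- (x / 2))"
proof -
  have loc: "\<exists>e c d Z. e > 0 \<and> admissible (ball z e) c d Z" if "z \<in> M_region \<tau>" for z
    by (rule admissible_exists[OF that \<tau>]) blast
  have hol: "f holomorphic_on M_region \<tau>"
    if "\<And>U c d Z. admissible U c d Z \<Longrightarrow> f holomorphic_on U" for f
    unfolding holomorphic_on_def
  proof
    fix z assume "z \<in> M_region \<tau>"
    then obtain e c d Z where e: "e > 0" "admissible (ball z e) c d Z" using loc by blast
    have "f field_differentiable at z"
      using holomorphic_on_imp_differentiable_at[OF that[OF e(2)] open_ball] e(1) by simp
    then show "f field_differentiable at z within M_region \<tau>"
      by (rule field_differentiable_at_within)
  qed
  show "(\<lambda>z. jost z 1) holomorphic_on M_region \<tau>" "(\<lambda>z. jost' z 1) holomorphic_on M_region \<tau>"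
    by (rule hol, rule jost_holomorphic, assumption)+
  assume "z \<in> M_region \<tau>"
  then obtain e c d Z where e: "e > 0" "admissible (ball z e) c d Z" using loc by blast
  then have z: "z \<in> ball z e" by simp
  show "schroedinger_sol V (z\<^sup>2) (jost z) (jost' z)" by (rule jost_schroedinger[OF e(2) z])
  show "\<exists>x\<ge>1. jost z x \<noteq> 0" by (rule jost_nonzero[OF e(2) z])
  assume "Im z \<ge> 1"
  then show "\<exists>C. \<forall>x\<ge>1. norm (jost z x) \<le> C * exp (- (x / 2)) \<and>
        norm (jost' z x) \<le> C * exp (- (x / 2))"
    by (rule jost_decay[OF e(2) z]) blast
qed

end

section \<open>Smooth cutoff functions\<close>

text \<open>Smoothness of finite order, so that closure properties can be proved by induction on the
  order; smoothness itself offers no such induction.\<close>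

definition n_smooth :: "nat \<Rightarrow> cfun \<Rightarrow> bool" where
  "n_smooth n u \<longleftrightarrow> (\<forall>k<n. \<forall>x. (Dx UNIV ^^ k) u differentiable (at x))"

lemma smooth_on_UNIV_iff: "smooth_on UNIV u \<longleftrightarrow> (\<forall>n. n_smooth n u)"
  unfolding smooth_on_def n_smooth_def by (metis UNIV_I lessI)

lemma n_smooth_0 [simp]: "n_smooth 0 u"
  by (simp add: n_smooth_def)

lemma n_smooth_Suc_Dx:
  "n_smooth (Suc n) u \<longleftrightarrow> (\<forall>x. u differentiable (at x)) \<and> n_smooth n (Dx UNIV u)"
proof -
  have e: "(Dx UNIV ^^ k) (Dx UNIV u) = (Dx UNIV ^^ Suc k) u" for k
    by (simp add: funpow_swap1)
  show ?thesis
  proof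
    assume *: "n_smooth (Suc n) u"
    have "u differentiable (at x)" for x using *[unfolded n_smooth_def, rule_format, of 0 x] by simp
    moreover have "n_smooth n (Dx UNIV u)"
      unfolding n_smooth_def e using * unfolding n_smooth_def by blast
    ultimately show "(\<forall>x. u differentiable (at x)) \<and> n_smooth n (Dx UNIV u)" by blast
  next
    assume *: "(\<forall>x. u differentiable (at x)) \<and> n_smooth n (Dx UNIV u)"
    show "n_smooth (Suc n) u"
      unfolding n_smooth_def
    proof (intro allI impI)
      fix k x assume "k < Suc n"
      then show "(Dx UNIV ^^ k) u differentiable at x"
        using * e unfolding n_smooth_def by (cases k) auto
    qed
  qed
qed

lemma Dx_eq: "(\<And>x. (u has_vector_derivative u' x) (at x)) \<Longrightarrow> Dx UNIV u = (\<lambda>x. - \<i> * u' x)"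
  unfolding Dx_def by (auto simp: vector_derivative_at)

lemma n_smooth_cmult: "n_smooth n u \<Longrightarrow> n_smooth n (\<lambda>x. c * u x)"
proof (induction n arbitrary: u)
  case (Suc n)
  have d: "(u has_vector_derivative vector_derivative u (at x)) (at x)" for x
    using Suc.prems by (simp add: n_smooth_Suc_Dx vector_derivative_works)
  have d': "((\<lambda>x. c * u x) has_vector_derivative c * vector_derivative u (at x)) (at x)" for x
    by (rule has_vector_derivative_mult_right[OF d])
  have "Dx UNIV (\<lambda>x. c * u x) = (\<lambda>x. c * Dx UNIV u x)"
    unfolding Dx_eq[OF d'] by (simp add: Dx_def mult_ac)
  then show ?case
    using Suc d' by (auto simp: n_smooth_Suc_Dx differentiableI_vector)
qed simp

text \<open>Trades \<open>Dx\<close> for an ordinary derivative given by a witness; the stray factor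
  \<open>- \<i>\<close> is removed by closure under scalar multiples.\<close>

lemma n_smooth_Suc:
  "n_smooth (Suc n) u \<longleftrightarrow> (\<exists>u'. (\<forall>x. (u has_vector_derivative u' x) (at x)) \<and> n_smooth n u')"
proof
  assume "n_smooth (Suc n) u"
  then have d: "(u has_vector_derivative vector_derivative u (at x)) (at x)" and n: "n_smooth n (Dx UNIV u)" for x
    by (simp_all add: n_smooth_Suc_Dx vector_derivative_works)
  from n_smooth_cmult[OF n, of \<i>] have "n_smooth n (\<lambda>x. vector_derivative u (at x))"
    by (simp add: Dx_def)
  with d show "\<exists>u'. (\<forall>x. (u has_vector_derivative u' x) (at x)) \<and> n_smooth n u'"
    by (intro exI[of _ "\<lambda>x. vector_derivative u (at x)"] conjI allI)
next
  assume "\<exists>u'. (\<forall>x. (u has_vector_derivative u' x) (at x)) \<and> n_smooth n u'"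
  then obtain u' where u: "\<And>x. (u has_vector_derivative u' x) (at x)" "n_smooth n u'" by blast
  then show "n_smooth (Suc n) u"
    using n_smooth_cmult[OF u(2), of "- \<i>"]
    by (auto simp: n_smooth_Suc_Dx Dx_eq[OF u(1)] intro: differentiableI_vector)
qed

lemma n_smooth_SucI:
  "n_smooth n u' \<Longrightarrow> (\<And>x. (u has_vector_derivative u' x) (at x)) \<Longrightarrow> n_smooth (Suc n) u"
  unfolding n_smooth_Suc by (intro exI[of _ u']) simp

lemma n_smooth_mono: "n_smooth n u \<Longrightarrow> m \<le> n \<Longrightarrow> n_smooth m u"
  by (auto simp: n_smooth_def)

lemma n_smooth_const [simp]: "n_smooth n (\<lambda>x. c)"
proof (induction n arbitrary: c)
  case (Suc n)
  then show ?case unfolding n_smooth_Suc by (intro exI[of _ "\<lambda>_. 0"]) simp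
qed simp

lemma n_smooth_add: "n_smooth n u \<Longrightarrow> n_smooth n v \<Longrightarrow> n_smooth n (\<lambda>x. u x + v x)"
proof (induction n arbitrary: u v)
  case (Suc n)
  then obtain u' v' where "\<And>x. (u has_vector_derivative u' x) (at x)" "n_smooth n u'"
    "\<And>x. (v has_vector_derivative v' x) (at x)" "n_smooth n v'"
    unfolding n_smooth_Suc by blast
  then show ?case unfolding n_smooth_Suc
    by (intro exI[of _ "\<lambda>x. u' x + v' x"] conjI allI has_vector_derivative_add Suc.IH) auto
qed simp

lemma n_smooth_mult: "n_smooth n u \<Longrightarrow> n_smooth n v \<Longrightarrow> n_smooth n (\<lambda>x. u x * v x)"
proof (induction n arbitrary: u v)
  case (Suc n)
  then obtain u' v' where d: "\<And>x. (u has_vector_derivative u' x) (at x)" "n_smooth n u'"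
    "\<And>x. (v has_vector_derivative v' x) (at x)" "n_smooth n v'"
    unfolding n_smooth_Suc by blast
  have "n_smooth n u" "n_smooth n v" using Suc.prems by (auto intro: n_smooth_mono[of "Suc n"])
  with d have "n_smooth n (\<lambda>x. u x * v' x + u' x * v x)" by (intro n_smooth_add Suc.IH)
  moreover have "((\<lambda>x. u x * v x) has_vector_derivative u x * v' x + u' x * v x) (at x)" for x
    by (rule has_vector_derivative_mult[OF d(1,3)])
  ultimately show ?case by (rule n_smooth_SucI)
qed simp

lemma n_smooth_inverse: "n_smooth n u \<Longrightarrow> (\<And>x. u x \<noteq> 0) \<Longrightarrow> n_smooth n (\<lambda>x. inverse (u x))"
proof (induction n arbitrary: u)
  case (Suc n)
  then obtain u' where d: "\<And>x. (u has_vector_derivative u' x) (at x)" "n_smooth n u'"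
    unfolding n_smooth_Suc by blast
  have "n_smooth n (\<lambda>x. inverse (u x))"
    by (rule Suc.IH) (use Suc.prems in \<open>auto intro: n_smooth_mono[of "Suc n"]\<close>)
  with d have "n_smooth n (\<lambda>x. u' x * (- 1 * (inverse (u x) * inverse (u x))))"
    by (intro n_smooth_mult n_smooth_const)
  moreover have "((\<lambda>x. inverse (u x)) has_vector_derivative u' x * (- 1 * (inverse (u x) * inverse (u x)))) (at x)" for x
    using field_vector_diff_chain_at[OF d(1)[of x] DERIV_inverse[OF Suc.prems(2)[of x]]]
    by (simp add: o_def)
  ultimately show ?case by (rule n_smooth_SucI)
qed simp

lemma n_smooth_affine: "n_smooth n u \<Longrightarrow> n_smooth n (\<lambda>x. u (a * x + b))"
proof (induction n arbitrary: u)
  case (Suc n)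
  then obtain u' where d: "\<And>x. (u has_vector_derivative u' x) (at x)" "n_smooth n u'"
    unfolding n_smooth_Suc by blast
  have "((\<lambda>x. u (a * x + b)) has_vector_derivative of_real a * u' (a * x + b)) (at x)" for x
  proof -
    have "((\<lambda>x. a * x + b) has_vector_derivative a) (at x)"
      unfolding has_real_derivative_iff_has_vector_derivative[symmetric]
      by (auto intro!: derivative_eq_intros)
    from vector_diff_chain_at[OF this d(1)] show ?thesis by (simp add: o_def scaleR_conv_of_real)
  qed
  with n_smooth_cmult[OF Suc.IH[OF d(2)], of "of_real a"] show ?case
    by (rule n_smooth_SucI)
qed simp

section \<open>Smooth step and cutoff functions from \<open>exp (- (1 / x))\<close>\<close>

definition flat :: "real poly \<Rightarrow> real \<Rightarrow> real" where
  "flat p x = (if x > 0 then poly p (1 / x) * exp (- (1 / x)) else 0)"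

lemma poly_over_exp: "((\<lambda>t. poly p t * exp (- t)) \<longlongrightarrow> (0::real)) at_top"
proof -
  have "((\<lambda>t. \<Sum>i\<le>degree p. coeff p i * (t ^ i / exp t)) \<longlongrightarrow> (\<Sum>i\<le>degree p. coeff p i * 0)) at_top"
    by (intro tendsto_sum tendsto_mult tendsto_const tendsto_power_div_exp_0)
  then show ?thesis
    by (simp add: poly_altdef sum_distrib_right exp_minus divide_inverse mult.assoc)
qed

text \<open>The polynomial argument makes the class closed under differentiation: differentiating
  multiplies by the square of the variable \<open>1 / x\<close> and replaces \<open>p\<close> by
  \<open>p - pderiv p\<close>. At \<open>0\<close> the difference quotient is again a polynomial in
  \<open>1 / x\<close> times the exponential and tends to \<open>0\<close>.\<close>

lemma flat_derivative:
  "(flat p has_real_derivative flat ([:0, 0, 1:] * (p - pderiv p)) x) (at x)"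
proof -
  consider "x > 0" | "x < 0" | "x = 0" by linarith
  then show ?thesis
  proof cases
    case 1
    have "((\<lambda>x. poly p (1 / x) * exp (- (1 / x))) has_real_derivative
        flat ([:0, 0, 1:] * (p - pderiv p)) x) (at x)"
      using 1 by (auto intro!: derivative_eq_intros DERIV_chain'[where g = "poly p" and f = "\<lambda>x. 1 / x"] poly_DERIV
          simp: flat_def field_simps power2_eq_square)
    then show ?thesis
      by (rule has_field_derivative_transform_within_open[where S = "{0<..}"]) (use 1 in \<open>auto simp: flat_def\<close>)
  next
    case 2
    have "((\<lambda>x. 0) has_real_derivative flat ([:0, 0, 1:] * (p - pderiv p)) x) (at x)"
      using 2 by (auto simp: flat_def)
    then show ?thesis
      by (rule has_field_derivative_transform_within_open[where S = "{..<0}"]) (use 2 in \<open>auto simp: flat_def\<close>)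
  next
    case 3
    have r: "((\<lambda>h. flat p h / h) \<longlongrightarrow> 0) (at_right 0)"
    proof -
      have "((\<lambda>h::real. poly (pCons 0 p) (inverse h) * exp (- inverse h)) \<longlongrightarrow> 0) (at_right 0)"
        by (rule filterlim_compose[OF poly_over_exp filterlim_inverse_at_top_right])
      moreover have "eventually (\<lambda>h::real. poly (pCons 0 p) (inverse h) * exp (- inverse h) = flat p h / h) (at_right 0)"
        using eventually_at_right_less[of 0] by eventually_elim (simp add: flat_def divide_inverse)
      ultimately show ?thesis by (rule Lim_transform_eventually)
    qed
    have l: "((\<lambda>h. flat p h / h) \<longlongrightarrow> 0) (at_left 0)"
    proof (rule Lim_transform_eventually[OF tendsto_const])
      show "eventually (\<lambda>h. 0 = flat p h / h) (at_left 0)"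
        unfolding eventually_at_filter by (auto simp: flat_def)
    qed
    from filterlim_split_at[OF l r] show ?thesis using 3
      by (simp add: DERIV_def flat_def)
  qed
qed

lemma n_smooth_flat: "n_smooth n (\<lambda>x. complex_of_real (flat p x))"
proof (induction n arbitrary: p)
  case (Suc n)
  have "((\<lambda>x. complex_of_real (flat p x)) has_vector_derivative
      of_real (flat ([:0, 0, 1:] * (p - pderiv p)) x)) (at x)" for x
    by (rule has_vector_derivative_of_real[OF flat_derivative])
  with Suc show ?case by (rule n_smooth_SucI)
qed simp

definition smooth_step :: "real \<Rightarrow> real" where
  "smooth_step x = flat 1 x * inverse (flat 1 x + flat 1 (1 - x))"

lemma flat_1_nonneg: "flat 1 x \<ge> 0" and flat_1_pos: "x > 0 \<Longrightarrow> flat 1 x > 0"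
  and flat_1_zero: "x \<le> 0 \<Longrightarrow> flat 1 x = 0"
  by (auto simp: flat_def)

lemma flat_denominator_pos: "flat 1 x + flat 1 (1 - x) > 0"
  using flat_1_nonneg[of x] flat_1_nonneg[of "1 - x"] flat_1_pos[of x] flat_1_pos[of "1 - x"]
  by (cases "x > 0") auto

lemma smooth_step_values:
  "x \<le> 0 \<Longrightarrow> smooth_step x = 0" "x \<ge> 1 \<Longrightarrow> smooth_step x = 1" "0 \<le> smooth_step x" "smooth_step x \<le> 1"
proof -
  show "x \<le> 0 \<Longrightarrow> smooth_step x = 0" by (simp add: smooth_step_def flat_1_zero)
  show "x \<ge> 1 \<Longrightarrow> smooth_step x = 1" using flat_1_pos[of x] by (simp add: smooth_step_def flat_1_zero)
  show "0 \<le> smooth_step x"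
    unfolding smooth_step_def using flat_1_nonneg flat_denominator_pos[of x] by simp
  show "smooth_step x \<le> 1"
    unfolding smooth_step_def using flat_1_nonneg[of "1 - x"] flat_denominator_pos[of x]
    by (simp add: divide_le_eq flip: divide_inverse)
qed

lemma n_smooth_step: "n_smooth n (\<lambda>x. complex_of_real (smooth_step x))"
proof -
  have "n_smooth n (\<lambda>x. complex_of_real (flat 1 x) *
      inverse (complex_of_real (flat 1 x) + complex_of_real (flat 1 (- 1 * x + 1))))"
    by (intro n_smooth_mult n_smooth_inverse n_smooth_add n_smooth_flat
        n_smooth_affine[of n "\<lambda>x. complex_of_real (flat 1 x)" "-1" 1])
      (use flat_denominator_pos in \<open>auto simp flip: of_real_add simp: less_imp_neq[THEN not_sym]\<close>)
  then show ?thesis by (simp add: smooth_step_def)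
qed

lemma smooth_step_derivative:
  obtains s' C where "\<And>x. (smooth_step has_real_derivative s' x) (at x)"
    "\<And>x. x \<notin> {0..1} \<Longrightarrow> s' x = 0" "\<And>x. \<bar>s' x\<bar> \<le> C" "continuous_on UNIV s'"
proof -
  obtain v v2 where v: "\<And>x. ((\<lambda>x. complex_of_real (smooth_step x)) has_vector_derivative v x) (at x)"
    and v2: "\<And>x. (v has_vector_derivative v2 x) (at x)"
    using n_smooth_step[of "Suc (Suc 0)"] unfolding n_smooth_Suc by blast
  define s' where "s' x = Re (v x)" for x
  have d: "(smooth_step has_real_derivative s' x) (at x)" for x
    using bounded_linear.has_vector_derivative[OF bounded_linear_Re v[of x]]
    by (simp add: s'_def has_real_derivative_iff_has_vector_derivative)
  have "continuous_on UNIV v"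
    unfolding continuous_on_eq_continuous_within using has_vector_derivative_continuous[OF v2] by simp
  then have c: "continuous_on UNIV s'" unfolding s'_def[abs_def] by (intro continuous_intros)
  have z: "s' x = 0" if "x \<notin> {0..1}" for x
  proof -
    have "x < 0 \<or> x > 1" using that by auto
    then have "(smooth_step has_real_derivative 0) (at x)"
    proof
      assume "x < 0"
      then show ?thesis
        by (intro has_field_derivative_transform_within_open[OF DERIV_const[of 0], where S = "{..<0}"])
          (auto simp: smooth_step_values)
    next
      assume "x > 1"
      then show ?thesis
        by (intro has_field_derivative_transform_within_open[OF DERIV_const[of 1], where S = "{1<..}"])
          (auto simp: smooth_step_values)
    qed
    then show ?thesis using d DERIV_unique by blast
  qed
  have "compact (s' ` {0..1})"
    by (intro compact_continuous_image continuous_on_subset[OF c]) auto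
  then have "bounded (s' ` {0..1})" by (rule compact_imp_bounded)
  then obtain C where "\<forall>x\<in>s' ` {0..1}. norm x \<le> C"
    unfolding bounded_iff by blast
  then have C: "\<And>x. x \<in> {0..1} \<Longrightarrow> \<bar>s' x\<bar> \<le> C" by simp
  have "\<bar>s' x\<bar> \<le> C" for x
  proof (cases "x \<in> {0..1}")
    case False
    then show ?thesis using z[of x] C[of 0] by simp
  qed (rule C)
  then show ?thesis using that d z c by blast
qed

text \<open>For \<open>n \<ge> 2\<close> it rises from \<open>0\<close> to \<open>1\<close> between
  \<open>1 + 1 / n\<close> and \<open>1 + 2 / n\<close>, and falls back to \<open>0\<close> between
  \<open>n\<close> and \<open>n + 1\<close>; the support stays away from the boundary point
  \<open>1\<close>.\<close>

definition cutoff :: "nat \<Rightarrow> real \<Rightarrow> real" where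
  "cutoff n x = smooth_step (real n * (x - 1) - 1) * smooth_step (real n + 1 - x)"

lemma cutoff_01: "0 \<le> cutoff n x" "cutoff n x \<le> 1"
  unfolding cutoff_def using smooth_step_values(3,4) by (auto intro: mult_le_one)

lemma n_smooth_cutoff: "n_smooth k (\<lambda>x. complex_of_real (cutoff n x))"
proof -
  have "n_smooth k (\<lambda>x. complex_of_real (smooth_step (real n * x + (- real n - 1))) *
      complex_of_real (smooth_step ((- 1) * x + (real n + 1))))"
    by (intro n_smooth_mult n_smooth_affine[of k "\<lambda>x. complex_of_real (smooth_step x)"] n_smooth_step)
  then show ?thesis by (simp add: cutoff_def algebra_simps)
qed

lemma cutoff_support: "n \<ge> 1 \<Longrightarrow> x \<notin> {1 + 1 / real n..real n + 1} \<Longrightarrow> cutoff n x = 0"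
  by (auto simp: cutoff_def field_simps smooth_step_values)

text \<open>The two inequalities say that both steps have passed their transition at
  \<open>x\<close>, so that the derivative of the cutoff vanishes there as well.\<close>

lemma cutoff_eventually: "x > 1 \<Longrightarrow> eventually (\<lambda>n. cutoff n y = 1 \<and> real n * (x - 1) - 1 > 1 \<and> real n + 1 - x > 1) sequentially"
  if "y = x" for y
proof -
  assume x: "x > 1"
  obtain N where N: "real N > 2 / (x - 1) + x" using reals_Archimedean2 by blast
  have "cutoff n y = 1 \<and> real n * (x - 1) - 1 > 1 \<and> real n + 1 - x > 1" if "n \<ge> N" for n
  proof -
    have "real n > 2 / (x - 1) + x" using N that by linarith
    moreover have "2 / (x - 1) > 0" using x by simp
    ultimately have "real n > 2 / (x - 1)" "real n > x" using x by linarith+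
    then have "real n * (x - 1) > 2" "real n + 1 - x > 1" using x by (auto simp: pos_divide_less_eq)
    then show ?thesis using \<open>y = x\<close> by (simp add: cutoff_def smooth_step_values)
  qed
  then show ?thesis by (auto simp: eventually_sequentially)
qed

lemma test_funsI:
  assumes "\<And>n. n_smooth n \<phi>" "1 < a" "\<And>x. x \<notin> {a..b} \<Longrightarrow> \<phi> x = 0"
  shows "\<phi> \<in> test_funs"
proof -
  have "compact {a..b} \<and> {a..b} \<subseteq> {1<..} \<and> (\<forall>x. x \<notin> {a..b} \<longrightarrow> \<phi> x = 0)"
    using assms by auto
  then show ?thesis unfolding test_funs_def smooth_on_UNIV_iff using assms(1) by blast
qed

lemma test_funsE:
  assumes "\<phi> \<in> test_funs"
  obtains \<phi>' b where "\<And>x. (\<phi> has_vector_derivative \<phi>' x) (at x)" "Dx UNIV \<phi> = (\<lambda>x. - \<i> * \<phi>' x)"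
    "continuous_on UNIV \<phi>" "continuous_on UNIV \<phi>'" "b > 1" "\<phi> 1 = 0"
    "\<And>x. x \<ge> b \<Longrightarrow> \<phi> x = 0" "\<And>x. x \<ge> b \<Longrightarrow> \<phi>' x = 0"
proof -
  obtain K where K: "compact K" "K \<subseteq> {1<..}" "\<And>x. x \<notin> K \<Longrightarrow> \<phi> x = 0"
    and s: "\<And>n. n_smooth n \<phi>"
    using assms unfolding test_funs_def smooth_on_UNIV_iff by blast
  obtain v v2 where v: "\<And>x. (\<phi> has_vector_derivative v x) (at x)"
    and v2: "\<And>x. (v has_vector_derivative v2 x) (at x)"
    using s[of "Suc (Suc 0)"] unfolding n_smooth_Suc by blast
  obtain B where B: "\<And>x. x \<in> K \<Longrightarrow> \<bar>x\<bar> \<le> B"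
    using compact_imp_bounded[OF K(1)] by (auto simp: bounded_iff)
  define b where "b = max B 1 + 1"
  have z: "\<phi> x = 0" if "x > max B 1" for x using that B K(3) by (metis abs_ge_self le_max_iff_disj not_less order_trans)
  have "v x = 0" if "x \<ge> b" for x
  proof -
    have x: "x > max B 1" using that unfolding b_def by linarith
    have "(\<phi> has_vector_derivative 0) (at x)"
      by (rule has_vector_derivative_transform_within_open[OF has_vector_derivative_const, where S = "{max B 1<..}"])
        (use x z in auto)
    then show ?thesis using v vector_derivative_unique_at by blast
  qed
  moreover have "continuous_on UNIV \<phi>" "continuous_on UNIV v"
    unfolding continuous_on_eq_continuous_within
    using has_vector_derivative_continuous[OF v] has_vector_derivative_continuous[OF v2] by simp_all
  moreover have "1 \<notin> K" using K(2) by auto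
  ultimately show ?thesis
    using that[of v b] v Dx_eq[OF v] z K(3) by (auto simp: b_def)
qed

section \<open>Square integrable functions\<close>

lemma L2_integrable: "f \<in> L2 S \<Longrightarrow> integrable (lebesgue_on S) (\<lambda>x. (norm (f x))\<^sup>2)"
  and L2_meas: "f \<in> L2 S \<Longrightarrow> f \<in> borel_measurable (lebesgue_on S)"
  by (auto simp: L2_def)

abbreviation "norm2 \<equiv> L2_norm {1..}"
abbreviation "inner2 \<equiv> L2_inner {1..}"

lemma L2_norm_nonneg [simp]: "L2_norm S f \<ge> 0"
  by (simp add: L2_norm_def)

lemma L2_norm_square: "(L2_norm S f)\<^sup>2 = (LINT x|lebesgue_on S. (norm (f x))\<^sup>2)"
  by (simp add: L2_norm_def)

lemma L2_bound:
  assumes "f \<in> borel_measurable (lebesgue_on S)" "integrable (lebesgue_on S) g"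
    "AE x in lebesgue_on S. (norm (f x))\<^sup>2 \<le> g x"
  shows "f \<in> L2 S" "(L2_norm S f)\<^sup>2 \<le> (LINT x|lebesgue_on S. g x)"
proof -
  have *: "integrable (lebesgue_on S) (\<lambda>x. (norm (f x))\<^sup>2)"
  proof (rule integrable_le[OF assms(2)])
    show "(\<lambda>x. (norm (f x))\<^sup>2) \<in> borel_measurable (lebesgue_on S)" using assms(1) by measurable
    show "AE x in lebesgue_on S. norm ((norm (f x))\<^sup>2) \<le> norm (g x)"
      using assms(3) by eventually_elim auto
  qed
  then show "f \<in> L2 S" using assms(1) by (simp add: L2_def)
  show "(L2_norm S f)\<^sup>2 \<le> (LINT x|lebesgue_on S. g x)"
    unfolding L2_norm_square by (rule integral_mono_AE[OF * assms(2,3)])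
qed

lemma L2_cmult: "f \<in> L2 S \<Longrightarrow> (\<lambda>x. c * f x) \<in> L2 S" "L2_norm S (\<lambda>x. c * f x) = norm c * L2_norm S f"
  by (auto simp: L2_def L2_norm_def norm_mult power_mult_distrib real_sqrt_mult)

lemma norm_add_square_le: "(norm (a + b))\<^sup>2 \<le> 2 * (norm a)\<^sup>2 + 2 * (norm (b::complex))\<^sup>2"
proof -
  have "(norm (a + b))\<^sup>2 \<le> (norm a + norm b)\<^sup>2" by (intro power_mono norm_triangle_ineq) simp
  also have "\<dots> \<le> 2 * (norm a)\<^sup>2 + 2 * (norm b)\<^sup>2"
    using sum_squares_bound[of "norm a" "norm b"] by (simp add: power2_sum)
  finally show ?thesis .
qed

lemma L2_add: "f \<in> L2 S \<Longrightarrow> g \<in> L2 S \<Longrightarrow> (\<lambda>x. f x + g x) \<in> L2 S"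
  by (rule L2_bound(1)[where g = "\<lambda>x. 2 * (norm (f x))\<^sup>2 + 2 * (norm (g x))\<^sup>2"])
    (auto simp: L2_def norm_add_square_le)

lemma L2_diff: "f \<in> L2 S \<Longrightarrow> g \<in> L2 S \<Longrightarrow> (\<lambda>x. f x - g x) \<in> L2 S"
  using L2_add[of f S "\<lambda>x. - 1 * g x"] L2_cmult(1)[of g S "-1"] by simp

text \<open>Young's inequality with a free parameter gives integrability of the product and, with
  the parameter near the ratio of the norms, the Cauchy-Schwarz inequality.\<close>

lemma L2_product:
  assumes f: "f \<in> L2 S" and g: "g \<in> L2 S"
  shows "integrable (lebesgue_on S) (\<lambda>x. f x * cnj (g x))" "integrable (lebesgue_on S) (\<lambda>x. f x * g x)"
    "(LINT x|lebesgue_on S. norm (f x) * norm (g x)) \<le> L2_norm S f * L2_norm S g"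
proof -
  have [measurable]: "f \<in> borel_measurable (lebesgue_on S)" "g \<in> borel_measurable (lebesgue_on S)"
    using f g by (auto simp: L2_def)
  have [measurable]: "(\<lambda>x. cnj (g x)) \<in> borel_measurable (lebesgue_on S)"
    by (rule borel_measurable_continuous_on[where f = cnj]) (auto intro: continuous_intros)
  have young: "norm a * norm b \<le> (t * (norm a)\<^sup>2 + (norm b)\<^sup>2 / t) / 2" if "t > 0" for a b :: complex and t
  proof -
    have "0 \<le> (t * norm a - norm b)\<^sup>2" by simp
    then show ?thesis using that
      by (simp add: power2_diff power_mult_distrib field_simps power2_eq_square[of t])
  qed
  have i: "integrable (lebesgue_on S) (\<lambda>x. (t * (norm (f x))\<^sup>2 + (norm (g x))\<^sup>2 / t) / 2)" for t
    using L2_integrable[OF f] L2_integrable[OF g] by simp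
  have b: "integrable (lebesgue_on S) h"
    if "h \<in> borel_measurable (lebesgue_on S)" "\<And>x. norm (h x) \<le> norm (f x) * norm (g x)" for h :: cfun
  proof (rule integrable_le[OF i[of 1] that(1)])
    show "AE x in lebesgue_on S. norm (h x) \<le> norm ((1 * (norm (f x))\<^sup>2 + (norm (g x))\<^sup>2 / 1) / 2)"
      unfolding real_norm_def
      by (intro AE_I2 order_trans[OF that(2)] order_trans[OF young[of 1] abs_ge_self]) simp
  qed
  show "integrable (lebesgue_on S) (\<lambda>x. f x * cnj (g x))" "integrable (lebesgue_on S) (\<lambda>x. f x * g x)"
    by (rule b; simp add: norm_mult)+
  have n: "integrable (lebesgue_on S) (\<lambda>x. norm (f x) * norm (g x))"
    using integrable_norm[OF b[of "\<lambda>x. f x * g x"]] by (simp add: norm_mult)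
  define I where "I = (LINT x|lebesgue_on S. norm (f x) * norm (g x))"
  define A where "A = L2_norm S f"
  define B where "B = L2_norm S g"
  have AB: "A \<ge> 0" "B \<ge> 0" by (auto simp: A_def B_def)
  have main: "I \<le> (t * A\<^sup>2 + B\<^sup>2 / t) / 2" if "t > 0" for t
  proof -
    have "I \<le> (LINT x|lebesgue_on S. (t * (norm (f x))\<^sup>2 + (norm (g x))\<^sup>2 / t) / 2)"
      unfolding I_def by (rule integral_mono[OF n i]) (rule young[OF that])
    also have "\<dots> = (t * A\<^sup>2 + B\<^sup>2 / t) / 2"
      using L2_integrable[OF f] L2_integrable[OF g] by (simp add: A_def B_def L2_norm_square)
    finally show ?thesis .
  qed
  have "I \<le> A * B"
  proof (rule field_le_epsilon)
    fix e :: real assume e: "e > 0"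
    \<comment> \<open>The best parameter is \<open>B / A\<close>. Adding \<open>d\<close> to both
      norms keeps it meaningful when one of them is zero, at a cost of at most
      \<open>e\<close>.\<close>
    define d where "d = min 1 (e / (A + B + 1))"
    have d: "d > 0" "d \<le> 1" "d * (A + B + 1) \<le> e"
    proof -
      show "d > 0" "d \<le> 1" using e AB by (auto simp: d_def)
      have "d \<le> e / (A + B + 1)" by (simp add: d_def)
      then show "d * (A + B + 1) \<le> e"
        by (rule pos_le_divide_eq[THEN iffD1, rotated]) (use AB in simp)
    qed
    have pos: "A + d > 0" "B + d > 0" using AB d by auto
    have "I \<le> ((B + d) / (A + d) * A\<^sup>2 + B\<^sup>2 / ((B + d) / (A + d))) / 2" by (rule main) (use pos in simp)
    also have "\<dots> \<le> ((B + d) / (A + d) * (A + d)\<^sup>2 + (B + d)\<^sup>2 / ((B + d) / (A + d))) / 2"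
      using pos AB d by (intro divide_right_mono add_mono mult_left_mono power_mono) auto
    also have "\<dots> = (A + d) * (B + d)" using pos by (simp add: power2_eq_square)
    also have "\<dots> = A * B + d * (A + B + d)" by (simp add: algebra_simps)
    also have "\<dots> \<le> A * B + d * (A + B + 1)" using d by (intro add_left_mono mult_left_mono) auto
    also have "\<dots> \<le> A * B + e" using d by simp
    finally show "I \<le> A * B + e" .
  qed
  then show "(LINT x|lebesgue_on S. norm (f x) * norm (g x)) \<le> L2_norm S f * L2_norm S g"
    by (simp add: I_def A_def B_def)
qed

lemma L2_Cauchy_Schwarz:
  assumes "f \<in> L2 S" "g \<in> L2 S"
  shows "norm (L2_inner S f g) \<le> L2_norm S f * L2_norm S g"
  using integral_norm_bound[of "lebesgue_on S" "\<lambda>x. f x * cnj (g x)"] L2_product(3)[OF assms]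
  unfolding L2_inner_def norm_mult complex_mod_cnj by linarith

lemma L2_triangle:
  assumes f: "f \<in> L2 S" and g: "g \<in> L2 S"
  shows "L2_norm S (\<lambda>x. f x + g x) \<le> L2_norm S f + L2_norm S g"
proof (rule power2_le_imp_le)
  have n: "integrable (lebesgue_on S) (\<lambda>x. norm (f x) * norm (g x))"
    using integrable_norm[OF L2_product(2)[OF f g]] by (simp add: norm_mult)
  have i: "integrable (lebesgue_on S) (\<lambda>x. (norm (f x))\<^sup>2 + (norm (g x))\<^sup>2 + 2 * (norm (f x) * norm (g x)))"
    using n L2_integrable[OF f] L2_integrable[OF g] by simp
  have "(norm (f x + g x))\<^sup>2 \<le> (norm (f x))\<^sup>2 + (norm (g x))\<^sup>2 + 2 * (norm (f x) * norm (g x))" for x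
    using power_mono[OF norm_triangle_ineq[of "f x" "g x"], of 2] by (simp add: power2_sum)
  then have "(L2_norm S (\<lambda>x. f x + g x))\<^sup>2 \<le>
      (LINT x|lebesgue_on S. (norm (f x))\<^sup>2 + (norm (g x))\<^sup>2 + 2 * (norm (f x) * norm (g x)))"
    using L2_meas[OF L2_add[OF f g]] i by (intro L2_bound(2)) auto
  also have "\<dots> = (L2_norm S f)\<^sup>2 + (L2_norm S g)\<^sup>2 + 2 * (LINT x|lebesgue_on S. norm (f x) * norm (g x))"
    using n L2_integrable[OF f] L2_integrable[OF g] by (simp add: L2_norm_square)
  also have "\<dots> \<le> (L2_norm S f + L2_norm S g)\<^sup>2"
    using L2_product(3)[OF f g] by (simp add: power2_sum)
  finally show "(L2_norm S (\<lambda>x. f x + g x))\<^sup>2 \<le> (L2_norm S f + L2_norm S g)\<^sup>2" .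
qed simp

lemma L2_norm_cong_AE:
  assumes "f \<in> borel_measurable (lebesgue_on S)" "g \<in> borel_measurable (lebesgue_on S)"
    "AE x in lebesgue_on S. f x = g x"
  shows "L2_norm S f = L2_norm S g"
proof -
  have "(LINT x|lebesgue_on S. (norm (f x))\<^sup>2) = (LINT x|lebesgue_on S. (norm (g x))\<^sup>2)"
    by (rule integral_cong_AE) (use assms in \<open>auto intro: measurable_compose\<close>)
  then show ?thesis by (simp add: L2_norm_def)
qed

lemma L2_norm_zero_AE:
  assumes f: "f \<in> L2 S" and z: "L2_norm S f = 0"
  shows "AE x in lebesgue_on S. f x = 0"
proof -
  have "(LINT x|lebesgue_on S. (norm (f x))\<^sup>2) = 0" using z L2_norm_square[of S f] by simp
  then have "AE x in lebesgue_on S. (norm (f x))\<^sup>2 = 0"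
    using integral_nonneg_eq_0_iff_AE[OF L2_integrable[OF f]] by simp
  then show ?thesis by eventually_elim simp
qed

lemma L2_inner_diff:
  assumes "f \<in> L2 S" "g \<in> L2 S" "h \<in> L2 S"
  shows "L2_inner S (\<lambda>x. f x - g x) h = L2_inner S f h - L2_inner S g h"
    "L2_inner S h (\<lambda>x. f x - g x) = L2_inner S h f - L2_inner S h g"
  using L2_product(1)[OF assms(1,3)] L2_product(1)[OF assms(2,3)]
    L2_product(1)[OF assms(3,1)] L2_product(1)[OF assms(3,2)]
  by (simp_all add: L2_inner_def algebra_simps)

lemma L2_inner_add:
  assumes "f \<in> L2 S" "g \<in> L2 S" "h \<in> L2 S"
  shows "L2_inner S (\<lambda>x. f x + g x) h = L2_inner S f h + L2_inner S g h"
  using L2_product(1)[OF assms(1,3)] L2_product(1)[OF assms(2,3)]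
  by (simp add: L2_inner_def algebra_simps)

lemma L2_inner_cmult: "L2_inner S (\<lambda>x. c * f x) g = c * L2_inner S f g"
  unfolding L2_inner_def by (simp add: mult.assoc)

lemma L2_inner_self: "L2_inner S f f = of_real ((L2_norm S f)\<^sup>2)"
proof -
  have "L2_inner S f f = (LINT x|lebesgue_on S. complex_of_real ((norm (f x))\<^sup>2))"
    unfolding L2_inner_def by (simp only: complex_norm_square)
  also have "\<dots> = of_real (LINT x|lebesgue_on S. (norm (f x))\<^sup>2)"
    by (rule integral_complex_of_real)
  finally show ?thesis by (simp add: L2_norm_square)
qed

lemma cnj_meas: "g \<in> borel_measurable M \<Longrightarrow> (\<lambda>x. cnj (g x)) \<in> borel_measurable M"
  by (rule borel_measurable_continuous_on[where f = cnj]) (auto intro: continuous_intros)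

lemma L2_inner_cong_AE:
  assumes "f \<in> borel_measurable (lebesgue_on S)" "f' \<in> borel_measurable (lebesgue_on S)"
    "g \<in> borel_measurable (lebesgue_on S)" "g' \<in> borel_measurable (lebesgue_on S)"
    "AE x in lebesgue_on S. f x = f' x" "AE x in lebesgue_on S. g x = g' x"
  shows "L2_inner S f g = L2_inner S f' g'"
  unfolding L2_inner_def
proof (rule integral_cong_AE)
  show "AE x in lebesgue_on S. f x * cnj (g x) = f' x * cnj (g' x)"
    using assms(5,6) by eventually_elim simp
qed (use assms in \<open>auto intro!: borel_measurable_times cnj_meas\<close>)

lemma L2_continuous_compact_support:
  fixes f :: cfun
  assumes "continuous_on {1..} f" "\<And>x. x > b \<Longrightarrow> f x = 0" "\<And>x. 1 \<le> x \<Longrightarrow> x \<le> b \<Longrightarrow> norm (f x) \<le> B" "B \<ge> 0" "b \<ge> 1"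
  shows "f \<in> L2 {1..}" "(norm2 f)\<^sup>2 \<le> B\<^sup>2 * (b - 1)"
proof -
  have m: "f \<in> half_meas" by (rule continuous_borel_measurable_half_line[OF assms(1)])
  have i: "integrable (half_line 1) (\<lambda>y. if 1 \<le> y \<and> y \<le> b then B\<^sup>2 else 0)"
    "(LINT y|half_line 1. (if 1 \<le> y \<and> y \<le> b then B\<^sup>2 else 0)) = B\<^sup>2 * b - B\<^sup>2 * 1"
    by (rule half_line_interval_FTC[where F = "\<lambda>y. B\<^sup>2 * y"];
        use assms in \<open>auto intro!: derivative_eq_intros simp: has_real_derivative_iff_has_vector_derivative[symmetric]\<close>)+
  have "AE x in half_line 1. (norm (f x))\<^sup>2 \<le> (if 1 \<le> x \<and> x \<le> b then B\<^sup>2 else 0)"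
    using assms by (intro AE_I2) (auto intro!: power_mono)
  from L2_bound[OF m i(1) this] show "f \<in> L2 {1..}" "(norm2 f)\<^sup>2 \<le> B\<^sup>2 * (b - 1)"
    unfolding i(2) by (simp_all add: algebra_simps)
qed

lemma test_fun_L2:
  assumes "\<phi> \<in> test_funs"
  shows "\<phi> \<in> L2 {1..}" "Dx UNIV \<phi> \<in> L2 {1..}"
proof -
  have *: "f \<in> L2 {1..}" if "continuous_on UNIV f" "b > 1" "\<And>x. x \<ge> b \<Longrightarrow> f x = 0" for f :: cfun and b
  proof -
    have "compact (f ` {1..b})"
      by (intro compact_continuous_image continuous_on_subset[OF that(1)]) auto
    then obtain B where B: "\<And>x. x \<in> {1..b} \<Longrightarrow> norm (f x) \<le> B"
      using compact_imp_bounded by (fastforce simp: bounded_iff)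
    show ?thesis
      by (rule L2_continuous_compact_support(1)[of _ b B])
        (use that B B[of 1] order_trans[OF norm_ge_zero B[of 1]] in \<open>auto intro: continuous_on_subset\<close>)
  qed
  obtain \<phi>' b where p: "\<And>x. (\<phi> has_vector_derivative \<phi>' x) (at x)" "Dx UNIV \<phi> = (\<lambda>x. - \<i> * \<phi>' x)"
    "continuous_on UNIV \<phi>" "continuous_on UNIV \<phi>'" "b > 1" "\<phi> 1 = 0"
    "\<And>x. x \<ge> b \<Longrightarrow> \<phi> x = 0" "\<And>x. x \<ge> b \<Longrightarrow> \<phi>' x = 0"
    using test_funsE[OF assms] by blast
  show "\<phi> \<in> L2 {1..}" by (rule *[OF p(3,5,7)])
  show "Dx UNIV \<phi> \<in> L2 {1..}" unfolding p(2) by (rule L2_cmult(1)[OF *[OF p(4,5,8)]])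
qed

section \<open>Weak derivatives\<close>

text \<open>Integration by parts for a primitive of a merely integrable function; Fubini replaces
  differentiability almost everywhere.\<close>

lemma integral_by_parts_primitive:
  fixes a a' k :: cfun
  assumes x: "1 \<le> x" and a: "\<And>y. y \<in> {1..x} \<Longrightarrow> (a has_vector_derivative a' y) (at y within {1..x})"
    and a': "continuous_on {1..x} a'" and k: "integrable (lebesgue_on {1..x}) k"
  shows "integrable (lebesgue_on {1..x}) (\<lambda>y. a' y * integral {1..y} k)" "integrable (lebesgue_on {1..x}) (\<lambda>y. a y * k y)"
    "(LINT y|lebesgue_on {1..x}. a' y * integral {1..y} k) + (LINT y|lebesgue_on {1..x}. a y * k y) = a x * integral {1..x} k"
proof -
  let ?M = "lebesgue_on {1..x}"
  have sf: "sigma_finite_measure ?M"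
    by (rule sigma_finite_lebesgue_on) simp
  interpret M: sigma_finite_measure ?M by (rule sf)
  interpret P: pair_sigma_finite ?M ?M ..
  have ac: "continuous_on {1..x} a"
    unfolding continuous_on_eq_continuous_within using has_vector_derivative_continuous[OF a] by blast
  have meas: "f \<in> borel_measurable ?M" if "continuous_on {1..x} f" for f :: cfun
    by (rule borel_measurable_integrable[OF lebesgue_on_interval_integral(1)[OF that]])
  have [measurable]: "a' \<in> borel_measurable ?M" "a \<in> borel_measurable ?M" "k \<in> borel_measurable ?M"
    using meas[OF a'] meas[OF ac] borel_measurable_integrable[OF k] by auto
  have idm: "(\<lambda>y. y) \<in> borel_measurable ?M"
    by (rule measurable_restrict_space1, rule measurable_completion) simp
  have [measurable]: "fst \<in> borel_measurable (?M \<Otimes>\<^sub>M ?M)" "snd \<in> borel_measurable (?M \<Otimes>\<^sub>M ?M)"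
    by (rule measurable_compose[OF measurable_fst idm] measurable_compose[OF measurable_snd idm])+
  have ia: "integrable ?M a'" by (rule lebesgue_on_interval_integral(1)[OF a'])
  have sub: "integrable (lebesgue_on {1..y}) k" if "y \<in> {1..x}" for y
    by (rule integrable_lebesgue_on_subset[OF k]) (use that in auto)
  have restrict: "(LINT t|?M. (if t \<in> {c..d} then f t else 0)) = (LINT t|lebesgue_on {c..d}. f t)"
    if "1 \<le> c" "d \<le> x" for c d and f :: cfun
  proof -
    have e: "indicator {1..x} t *\<^sub>R (if t \<in> {c..d} then f t else 0) = indicator {c..d} t *\<^sub>R f t" for t
      using that by (auto simp: indicator_def)
    have R: "(LINT t|lebesgue_on S. h t) = (LINT t|lebesgue. indicator S t *\<^sub>R h t)"
      if "S \<in> sets lebesgue" for S and h :: cfun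
      using that by (intro integral_restrict_space) simp
    have "{1..x} \<in> sets lebesgue" "{c..d} \<in> sets lebesgue" by auto
    then show ?thesis by (simp only: R e)
  qed
  \<comment> \<open>The integrand on the triangle \<open>t \<le> y\<close>: integrating over t gives
    the primitive of \<open>k\<close>, integrating over y gives an increment of
    \<open>a\<close>.\<close>
  define H where "H y t = (if t \<le> y then a' y * k t else 0)" for y t
  have Hm: "case_prod H \<in> borel_measurable (?M \<Otimes>\<^sub>M ?M)" unfolding H_def[abs_def] by measurable
  have G: "integrable (?M \<Otimes>\<^sub>M ?M) (\<lambda>(y, t). a' y * k t)"
  proof (rule P.Fubini_integrable)
    show "(\<lambda>(y, t). a' y * k t) \<in> borel_measurable (?M \<Otimes>\<^sub>M ?M)" by measurable
    show "integrable ?M (\<lambda>y. LINT t|?M. norm (case (y, t) of (y, t) \<Rightarrow> a' y * k t))"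
      using integrable_norm[OF ia] by (simp add: norm_mult)
    show "AE y in ?M. integrable ?M (\<lambda>t. case (y, t) of (y, t) \<Rightarrow> a' y * k t)"
      using k by (intro AE_I2) auto
  qed
  have intH: "integrable (?M \<Otimes>\<^sub>M ?M) (case_prod H)"
    by (rule integrable_le[OF G Hm]) (auto simp: H_def)
  have in1: "(LINT t|?M. H y t) = a' y * integral {1..y} k" if y: "y \<in> {1..x}" for y
  proof -
    have "(LINT t|?M. H y t) = (LINT t|?M. (if t \<in> {1..y} then a' y * k t else 0))"
      by (intro lint_cong refl) (auto simp: H_def)
    also have "\<dots> = (LINT t|lebesgue_on {1..y}. a' y * k t)" using y by (intro restrict) auto
    also have "\<dots> = a' y * integral {1..y} k" using sub[OF y] by (simp add: lebesgue_integral_eq_integral)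
    finally show ?thesis .
  qed
  have in2: "(LINT y|?M. H y t) = (a x - a t) * k t" if t: "t \<in> {1..x}" for t
  proof -
    have c: "continuous_on {t..x} a'" by (rule continuous_on_subset[OF a']) (use t in auto)
    have "(LINT y|?M. H y t) = (LINT y|?M. (if y \<in> {t..x} then a' y * k t else 0))"
      by (intro lint_cong refl) (auto simp: H_def)
    also have "\<dots> = (LINT y|lebesgue_on {t..x}. a' y * k t)" using t by (intro restrict) auto
    also have "\<dots> = (LINT y|lebesgue_on {t..x}. a' y) * k t" by simp
    also have "(LINT y|lebesgue_on {t..x}. a' y) = integral {t..x} a'"
      by (rule lebesgue_on_interval_integral(2)[OF c])
    also have "\<dots> = a x - a t"
      using t by (intro integral_unique fundamental_theorem_of_calculus)
        (auto intro: has_vector_derivative_within_subset[OF a])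
    finally show ?thesis .
  qed
  show "integrable ?M (\<lambda>y. a' y * integral {1..y} k)"
    using P.integrable_fst[OF intH] by (rule Bochner_Integration.integrable_cong[THEN iffD1, rotated 2]) (auto simp: in1)
  have i2: "integrable ?M (\<lambda>t. (a x - a t) * k t)"
    using P.integrable_snd[OF intH] by (rule Bochner_Integration.integrable_cong[THEN iffD1, rotated 2]) (auto simp: in2)
  have "integrable ?M (\<lambda>t. a x * k t - (a x - a t) * k t)"
    by (intro Bochner_Integration.integrable_diff i2 integrable_mult_right k)
  then show i3: "integrable ?M (\<lambda>t. a t * k t)" by (simp add: algebra_simps)
  have "(LINT y|?M. a' y * integral {1..y} k) = (LINT y|?M. LINT t|?M. H y t)"
    by (intro lint_cong refl) (auto simp: in1)
  also have "\<dots> = (LINT t|?M. LINT y|?M. H y t)" by (rule P.Fubini_integral[OF intH, symmetric])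
  also have "\<dots> = (LINT t|?M. a x * k t - a t * k t)"
    by (intro lint_cong refl) (auto simp: in2 algebra_simps)
  also have "\<dots> = a x * integral {1..x} k - (LINT t|?M. a t * k t)"
    using i3 k by (simp add: lebesgue_integral_eq_integral)
  finally show "(LINT y|?M. a' y * integral {1..y} k) + (LINT y|?M. a y * k y) = a x * integral {1..x} k"
    by simp
qed

text \<open>Local absolute continuity in integrated form: \<open>g\<close> need not be continuous,
  so \<open>u\<close> may fail to be differentiable at single points.\<close>

definition primitive_of :: "cfun \<Rightarrow> cfun \<Rightarrow> bool" where
  "primitive_of u g \<longleftrightarrow> (\<forall>x\<ge>1. integrable (lebesgue_on {1..x}) g \<and> u x = u 1 + integral {1..x} g)"

lemma half_line_to_interval:
  fixes f :: cfun
  assumes "\<And>x. x > b \<Longrightarrow> f x = 0"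
  shows "(LINT x|half_line 1. f x) = (LINT x|lebesgue_on {1..b}. f x)"
proof -
  have "(LINT x|half_line 1. f x) = (LINT x|half_line 1. (if 1 \<le> x \<and> x \<le> b then f x else 0))"
    by (intro lint_cong refl) (use assms in auto)
  then show ?thesis by (simp add: half_line_truncate(2)[OF order_refl])
qed

lemma primitive_weak_derivative:
  assumes u: "primitive_of u g" and \<phi>: "\<phi> \<in> test_funs"
  shows "inner2 u (Dx UNIV \<phi>) = inner2 (\<lambda>x. - \<i> * g x) \<phi>"
proof -
  obtain \<phi>' b where p: "\<And>x. (\<phi> has_vector_derivative \<phi>' x) (at x)" "Dx UNIV \<phi> = (\<lambda>x. - \<i> * \<phi>' x)"
    "continuous_on UNIV \<phi>" "continuous_on UNIV \<phi>'" "b > 1" "\<phi> 1 = 0"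
    "\<And>x. x \<ge> b \<Longrightarrow> \<phi> x = 0" "\<And>x. x \<ge> b \<Longrightarrow> \<phi>' x = 0"
    using test_funsE[OF \<phi>] by blast
  have b: "1 \<le> b" using p(5) by simp
  let ?a = "\<lambda>x. cnj (\<phi> x)" and ?a' = "\<lambda>x. cnj (\<phi>' x)"
  have d: "(?a has_vector_derivative ?a' x) (at x within S)" for x S
    using bounded_linear.has_vector_derivative[OF bounded_linear_cnj p(1)] has_vector_derivative_at_within by blast
  have ca: "continuous_on {1..b} ?a'"
    by (intro continuous_intros continuous_on_subset[OF p(4)]) auto
  have g: "integrable (lebesgue_on {1..b}) g" using u b by (simp add: primitive_of_def)
  note ibp = integral_by_parts_primitive[OF b d ca g]
  \<comment> \<open>The boundary value \<open>u 1\<close> contributes nothing, because the test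
    function vanishes at both ends of the interval.\<close>
  have i1: "integrable (lebesgue_on {1..b}) ?a'" "(LINT x|lebesgue_on {1..b}. ?a' x) = 0"
  proof -
    show "integrable (lebesgue_on {1..b}) ?a'" by (rule lebesgue_on_interval_integral(1)[OF ca])
    have "integral {1..b} ?a' = ?a b - ?a 1"
      by (intro integral_unique fundamental_theorem_of_calculus b d)
    then show "(LINT x|lebesgue_on {1..b}. ?a' x) = 0"
      unfolding lebesgue_on_interval_integral(2)[OF ca] using p(5-7) by simp
  qed
  have "inner2 u (Dx UNIV \<phi>) = (LINT x|lebesgue_on {1..b}. u x * cnj (- \<i> * \<phi>' x))"
    unfolding L2_inner_def p(2) by (rule half_line_to_interval) (use p(8) in auto)
  also have "\<dots> = (LINT x|lebesgue_on {1..b}. \<i> * (u 1 * ?a' x + ?a' x * integral {1..x} g))"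
  proof (intro lint_cong refl)
    fix x assume "x \<in> space (lebesgue_on {1..b})"
    then have "u x = u 1 + integral {1..x} g"
      by (intro u[unfolded primitive_of_def, rule_format, THEN conjunct2]) simp
    then show "u x * cnj (- \<i> * \<phi>' x) = \<i> * (u 1 * ?a' x + ?a' x * integral {1..x} g)"
      by (simp add: algebra_simps)
  qed
  also have "\<dots> = \<i> * (LINT x|lebesgue_on {1..b}. ?a' x * integral {1..x} g)"
    using i1 ibp(1) by simp
  also have "\<dots> = - \<i> * (LINT x|lebesgue_on {1..b}. ?a x * g x)"
    using ibp(3) p(7)[of b] by (simp add: add_eq_0_iff)
  also have "\<dots> = (LINT x|lebesgue_on {1..b}. - \<i> * g x * cnj (\<phi> x))"
    by (simp add: mult_ac flip: integral_mult_right_zero)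
  also have "\<dots> = inner2 (\<lambda>x. - \<i> * g x) \<phi>"
    unfolding L2_inner_def by (rule half_line_to_interval[symmetric]) (use p(7) in auto)
  finally show ?thesis .
qed

text \<open>Weierstrass approximation is applied to the derivative, and \<open>Q\<close> is the
  primitive that vanishes at \<open>1\<close>. Thus a function vanishing at \<open>1\<close> is
  approximated together with its derivative.\<close>

lemma smooth_approximation:
  fixes g :: cfun
  assumes g: "continuous_on {1..b} g" and e: "e > 0"
  obtains Q Q' where "\<And>n. n_smooth n Q" "\<And>n. n_smooth n Q'" "\<And>x. (Q has_vector_derivative Q' x) (at x)" "Q 1 = 0"
    "\<And>x. x \<in> {1..b} \<Longrightarrow> norm (Q' x - g x) < e"
proof -
  have real: "\<exists>P P'. (\<forall>n. n_smooth n (\<lambda>x. complex_of_real (P x))) \<and> (\<forall>n. n_smooth n (\<lambda>x. complex_of_real (P' x))) \<and>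
      (\<forall>x. (P has_real_derivative P' x) (at x)) \<and> (\<forall>x\<in>{1..b}. \<bar>h x - P' x\<bar> < e / 2)"
    if h: "continuous_on {1..b} h" for h :: "real \<Rightarrow> real"
  proof -
    obtain p where p: "real_polynomial_function p" "\<And>x. x \<in> {1..b} \<Longrightarrow> \<bar>h x - p x\<bar> < e / 2"
      using Stone_Weierstrass_real_polynomial_function[OF _ h, of "e / 2"] e by auto
    obtain a n where a: "p = (\<lambda>x. \<Sum>i\<le>n. a i * x ^ i)"
      using p(1) by (auto simp: real_polynomial_function_iff_sum)
    define P where "P x = (\<Sum>i\<le>n. a i / real (Suc i) * x ^ Suc i)" for x
    have pow: "n_smooth k (\<lambda>x. complex_of_real (x ^ i))" for k i
    proof (induction i)
      case (Suc i)
      have id: "n_smooth k (\<lambda>x. complex_of_real x)"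
      proof (cases k)
        case (Suc j)
        then show ?thesis
          using has_vector_derivative_of_real[OF DERIV_ident]
          by (auto intro!: n_smooth_SucI[of j "\<lambda>_. 1"])
      qed simp
      from n_smooth_mult[OF id Suc] show ?case by simp
    qed simp
    have sum: "n_smooth k (\<lambda>x. complex_of_real (\<Sum>i\<le>m. c i * x ^ f i))" for k m c and f :: "nat \<Rightarrow> nat"
    proof (induction m)
      case 0
      then show ?case using n_smooth_cmult[OF pow, of k "of_real (c 0)" "f 0"] by simp
    next
      case (Suc m)
      from n_smooth_add[OF Suc n_smooth_cmult[OF pow, of k "of_real (c (Suc m))" "f (Suc m)"]]
      show ?case by simp
    qed
    have "(P has_real_derivative (\<Sum>i\<le>n. a i / real (Suc i) * (real (Suc i) * x ^ i))) (at x)" for x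
      unfolding P_def[abs_def]
      by (intro DERIV_sum DERIV_cmult) (use DERIV_pow[of "Suc _" x UNIV] in \<open>simp del: power_Suc of_nat_Suc\<close>)
    moreover have "(\<Sum>i\<le>n. a i / real (Suc i) * (real (Suc i) * x ^ i)) = p x" for x
      unfolding a by (intro sum.cong refl) (simp del: of_nat_Suc)
    ultimately have "\<And>x. (P has_real_derivative p x) (at x)" by simp
    moreover have "n_smooth k (\<lambda>x. complex_of_real (P x))" for k
      unfolding P_def by (rule sum)
    moreover have "n_smooth k (\<lambda>x. complex_of_real (p x))" for k
      unfolding a by (rule sum)
    ultimately show ?thesis using p(2) by blast
  qed
  have "continuous_on {1..b} (\<lambda>x. Re (g x))" "continuous_on {1..b} (\<lambda>x. Im (g x))"
    by (intro continuous_intros g)+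
  from real[OF this(1)] real[OF this(2)]
  obtain P P' S S' where P: "\<And>n. n_smooth n (\<lambda>x. complex_of_real (P x))" "\<And>n. n_smooth n (\<lambda>x. complex_of_real (P' x))"
      "\<And>x. (P has_real_derivative P' x) (at x)" "\<And>x. x\<in>{1..b} \<Longrightarrow> \<bar>Re (g x) - P' x\<bar> < e / 2"
    and S: "\<And>n. n_smooth n (\<lambda>x. complex_of_real (S x))" "\<And>n. n_smooth n (\<lambda>x. complex_of_real (S' x))"
      "\<And>x. (S has_real_derivative S' x) (at x)" "\<And>x. x\<in>{1..b} \<Longrightarrow> \<bar>Im (g x) - S' x\<bar> < e / 2"
    by blast
  define Q where "Q x = of_real (P x) + \<i> * of_real (S x) + (- (of_real (P 1) + \<i> * of_real (S 1)))" for x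
  define Q' where "Q' x = of_real (P' x) + \<i> * of_real (S' x)" for x
  show ?thesis
  proof (rule that[of Q Q'])
    show "n_smooth n Q" for n unfolding Q_def[abs_def]
      by (intro n_smooth_add n_smooth_cmult n_smooth_const P S)
    show "n_smooth n Q'" for n unfolding Q'_def[abs_def]
      by (intro n_smooth_add n_smooth_cmult P S)
    have "(Q has_vector_derivative of_real (P' x) + \<i> * of_real (S' x) + 0) (at x)" for x
      unfolding Q_def[abs_def]
      by (intro has_vector_derivative_add has_vector_derivative_mult_right has_vector_derivative_const
          has_vector_derivative_of_real P S)
    then show "(Q has_vector_derivative Q' x) (at x)" for x by (simp add: Q'_def)
    show "Q 1 = 0" by (simp add: Q_def)
    fix x assume x: "x \<in> {1..b}"
    have "norm (Q' x - g x) \<le> \<bar>Re (Q' x - g x)\<bar> + \<bar>Im (Q' x - g x)\<bar>" by (rule cmod_le)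
    also have "\<dots> < e" using P(4)[OF x] S(4)[OF x] by (simp add: Q'_def abs_minus_commute)
    finally show "norm (Q' x - g x) < e" .
  qed
qed

lemma test_fun_cutoff: "(\<And>n. n_smooth n Q) \<Longrightarrow> n \<ge> 1 \<Longrightarrow> (\<lambda>x. of_real (cutoff n x) * Q x) \<in> test_funs"
  by (rule test_funsI[where a = "1 + 1 / real n" and b = "real n + 1"])
    (auto intro: n_smooth_mult n_smooth_cutoff simp: cutoff_support)

lemma cutoff_continuous: "continuous_on S (cutoff n)"
proof -
  have "continuous_on UNIV smooth_step"
    by (rule smooth_step_derivative)
      (intro continuous_at_imp_continuous_on ballI DERIV_isCont)
  then have "continuous_on S (\<lambda>x. smooth_step (a * x + c))" for a c
    by (rule continuous_on_compose2) (auto intro!: continuous_intros)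
  from continuous_on_mult[OF this[of "real n" "- real n - 1"] this[of "-1" "real n + 1"]]
  show ?thesis unfolding cutoff_def[abs_def] by (simp add: algebra_simps)
qed

lemma cutoff_bounded_L2:
  assumes "n \<ge> 1" "continuous_on {1..} f" "\<And>x. x \<in> {1..real n + 1} \<Longrightarrow> norm (f x) \<le> e" "e \<ge> 0"
  shows "(\<lambda>x. of_real (cutoff n x) * f x) \<in> L2 {1..}"
    "norm2 (\<lambda>x. of_real (cutoff n x) * f x) \<le> e * sqrt (real n)"
proof -
  have c: "continuous_on {1..} (\<lambda>x. of_real (cutoff n x) * f x)"
    by (intro continuous_intros cutoff_continuous assms)
  have b: "norm (of_real (cutoff n x) * f x) \<le> e" if "1 \<le> x" "x \<le> real n + 1" for x
    using mult_mono[OF cutoff_01(2)[of n x] assms(3)[of x]] that assms(4) cutoff_01(1)[of n x]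
    by (simp add: norm_mult)
  have z: "of_real (cutoff n x) * f x = 0" if "x > real n + 1" for x
    using cutoff_support[OF assms(1), of x] that by simp
  have *: "(\<lambda>x. of_real (cutoff n x) * f x) \<in> L2 {1..}"
    "(norm2 (\<lambda>x. of_real (cutoff n x) * f x))\<^sup>2 \<le> e\<^sup>2 * ((real n + 1) - 1)"
    by (rule L2_continuous_compact_support[where b = "real n + 1" and B = e, OF c];
        use z b assms(4) in simp)+
  show "(\<lambda>x. of_real (cutoff n x) * f x) \<in> L2 {1..}" by (rule *)
  have "(norm2 (\<lambda>x. of_real (cutoff n x) * f x))\<^sup>2 \<le> (e * sqrt (real n))\<^sup>2"
    using *(2) by (simp add: power_mult_distrib)
  then show "norm2 (\<lambda>x. of_real (cutoff n x) * f x) \<le> e * sqrt (real n)"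
    by (rule power2_le_imp_le) (use assms in simp)
qed

text \<open>Orthogonality is extended from test functions to cutoffs of arbitrary continuous
  functions, and from there to a cutoff of a bounded multiple of \<open>d\<close> itself, which
  forces \<open>d\<close> to vanish.\<close>

lemma orthogonal_to_test_funs:
  assumes d: "d \<in> L2 {1..}" and orth: "\<And>\<phi>. \<phi> \<in> test_funs \<Longrightarrow> inner2 d \<phi> = 0"
  shows "AE x in half_line 1. d x = 0"
proof -
  have dm: "d \<in> half_meas" by (rule L2_meas[OF d])
  have cont: "inner2 d (\<lambda>x. of_real (cutoff n x) * \<psi> x) = 0"
    if n: "n \<ge> 1" and \<psi>: "continuous_on UNIV \<psi>" for n \<psi>
  proof -
    have "norm (inner2 d (\<lambda>x. of_real (cutoff n x) * \<psi> x)) \<le> 0"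
    proof (rule field_le_epsilon)
      fix e :: real assume e: "e > 0"
      define e' where "e' = e / (norm2 d * sqrt (real n) + 1)"
      have den: "norm2 d * sqrt (real n) + 1 > 0" by (simp add: add_nonneg_pos)
      have e': "e' > 0" using e den by (simp add: e'_def)
      have c1: "continuous_on {1..real n + 1} \<psi>" by (rule continuous_on_subset[OF \<psi>]) auto
      obtain Q Q' where Q: "\<And>k. n_smooth k Q'" "\<And>x. x \<in> {1..real n + 1} \<Longrightarrow> norm (Q' x - \<psi> x) < e'"
        by (rule smooth_approximation[OF c1 e']) (rule that; assumption)
      have cQ: "continuous_on UNIV Q'"
        using Q(1)[of "Suc 0"] unfolding n_smooth_Suc continuous_on_eq_continuous_within
        by (auto intro: has_vector_derivative_continuous)
      have c2: "continuous_on {1..} (\<lambda>x. \<psi> x - Q' x)"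
        by (intro continuous_intros continuous_on_subset[OF \<psi>] continuous_on_subset[OF cQ]) auto
      have cb: "norm (\<psi> x - Q' x) \<le> e'" if "x \<in> {1..real n + 1}" for x
        using Q(2)[OF that] by (simp add: norm_minus_commute)
      note A = cutoff_bounded_L2[OF n c2 cb less_imp_le[OF e']]
      have t: "(\<lambda>x. of_real (cutoff n x) * Q' x) \<in> test_funs" by (rule test_fun_cutoff[OF Q(1) n])
      obtain B where "\<forall>x\<in>\<psi> ` {1..real n + 1}. norm x \<le> B"
        using compact_imp_bounded[OF compact_continuous_image[OF c1]] unfolding bounded_iff by auto
      then have B: "\<And>x. x \<in> {1..real n + 1} \<Longrightarrow> norm (\<psi> x) \<le> B" by simp
      have \<psi>L: "(\<lambda>x. of_real (cutoff n x) * \<psi> x) \<in> L2 {1..}"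
        by (rule cutoff_bounded_L2(1)[OF n continuous_on_subset[OF \<psi>] B])
          (use B[of 1] norm_ge_zero[of "\<psi> 1"] in \<open>auto intro: order_trans[of 0 "norm (\<psi> 1)"]\<close>)
      have "inner2 d (\<lambda>x. of_real (cutoff n x) * \<psi> x) =
          inner2 d (\<lambda>x. of_real (cutoff n x) * (\<psi> x - Q' x))"
        using L2_inner_diff(2)[OF \<psi>L test_fun_L2(1)[OF t] d] orth[OF t] by (simp add: right_diff_distrib)
      then have "norm (inner2 d (\<lambda>x. of_real (cutoff n x) * \<psi> x)) \<le> norm2 d * (e' * sqrt (real n))"
        using L2_Cauchy_Schwarz[OF d A(1)] mult_left_mono[OF A(2), of "norm2 d"] by simp
      also have "\<dots> \<le> e' * (norm2 d * sqrt (real n) + 1)" using e' by (simp add: algebra_simps)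
      also have "\<dots> = e" using den by (simp add: e'_def)
      finally show "norm (inner2 d (\<lambda>x. of_real (cutoff n x) * \<psi> x)) \<le> 0 + e" by simp
    qed
    then show ?thesis by simp
  qed
  have "d measurable_on {1..}" using dm by (simp add: measurable_on_iff_borel_measurable)
  then obtain N g where N: "negligible N" "\<And>n. continuous_on UNIV (g n)"
    "\<And>x. x \<notin> N \<Longrightarrow> (\<lambda>n. g n x) \<longlonglongrightarrow> (if x \<in> {1..} then d x else 0)"
    unfolding measurable_on_def by blast
  have AEN: "AE x in half_line 1. x \<notin> N"
    using N(1) by (intro AE_restrict_space_iff[THEN iffD2])
      (auto simp: negligible_iff_null_sets intro: AE_I'[of N])
  \<comment> \<open>The map \<open>w / (1 + norm w)\<close> bounds the continuous approximations of
    \<open>d\<close> by \<open>1\<close>, so dominated convergence applies. The limit tests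
    \<open>d\<close> against \<open>d / (1 + norm d)\<close>, and the integrand is then
    nonnegative.\<close>
  define B where "B n x = g n x / of_real (1 + norm (g n x))" for n x
  define Bd where "Bd x = d x / of_real (1 + norm (d x))" for x
  have one: "complex_of_real (1 + norm w) \<noteq> 0" for w :: complex
    unfolding of_real_eq_0_iff using norm_ge_zero[of w] by linarith
  have le1: "norm (w / complex_of_real (1 + norm w)) \<le> 1" for w
  proof -
    have "norm (complex_of_real (1 + norm w)) = 1 + norm w"
      unfolding norm_of_real using norm_ge_zero[of w] by linarith
    moreover have "1 + norm w > 0" by (simp add: add_pos_nonneg)
    ultimately show ?thesis unfolding norm_divide by simp
  qed
  have "AE x in half_line 1. of_real (cutoff n x) * d x = 0" if n: "n \<ge> 1" for n
  proof -
    let ?cut = "\<lambda>x. complex_of_real (cutoff n x)"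
    have cutL: "(\<lambda>x. ?cut x * 1) \<in> L2 {1..}"
      by (rule cutoff_bounded_L2(1)[OF n, where e = 1]) auto
    have cB: "continuous_on UNIV (B k)" for k
      unfolding B_def[abs_def] by (intro continuous_intros N(2) ballI one)
    have cm: "?cut \<in> half_meas" using L2_meas[OF cutL] by simp
    have Bm: "B k \<in> half_meas" for k
      by (rule continuous_borel_measurable_half_line[OF continuous_on_subset[OF cB]]) simp
    have Bdm: "Bd \<in> half_meas"
      unfolding Bd_def[abs_def] using dm by measurable
    have "(\<lambda>k. LINT x|half_line 1. d x * cnj (?cut x * B k x)) \<longlonglongrightarrow> (LINT x|half_line 1. d x * cnj (?cut x * Bd x))"
    proof (rule integral_dominated_convergence)
      show "integrable (half_line 1) (\<lambda>x. norm (d x * (?cut x * 1)))"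
        by (rule integrable_norm[OF L2_product(2)[OF d cutL]])
      show "AE x in half_line 1. norm (d x * cnj (?cut x * B k x)) \<le> norm (d x * (?cut x * 1))" for k
      proof (rule AE_I2)
        fix x
        have "norm (B k x) \<le> 1"
          unfolding B_def by (rule le1)
        then show "norm (d x * cnj (?cut x * B k x)) \<le> norm (d x * (?cut x * 1))"
          unfolding norm_mult complex_mod_cnj by (intro mult_left_mono) auto
      qed
      show "AE x in half_line 1. (\<lambda>k. d x * cnj (?cut x * B k x)) \<longlonglongrightarrow> d x * cnj (?cut x * Bd x)"
        using AEN AE_space
      proof eventually_elim
        case (elim x)
        then have "(\<lambda>n. g n x) \<longlonglongrightarrow> d x" using N(3)[of x] by simp
        then show ?case unfolding B_def Bd_def
          by (intro tendsto_intros one)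
      qed
      show "(\<lambda>x. d x * cnj (?cut x * Bd x)) \<in> half_meas"
        by (intro borel_measurable_times cnj_meas dm cm Bdm)
      show "(\<lambda>x. d x * cnj (?cut x * B k x)) \<in> half_meas" for k
        by (intro borel_measurable_times cnj_meas dm cm Bm)
    qed
    moreover have "(LINT x|half_line 1. d x * cnj (?cut x * B k x)) = 0" for k
      using cont[OF n cB] by (simp add: L2_inner_def)
    ultimately have z: "(LINT x|half_line 1. d x * cnj (?cut x * Bd x)) = 0"
      using LIMSEQ_unique[OF _ tendsto_const] by simp
    define w where "w x = cutoff n x * ((norm (d x))\<^sup>2 / (1 + norm (d x)))" for x
    have w: "d x * cnj (?cut x * Bd x) = of_real (w x)" for x
      unfolding w_def Bd_def of_real_mult of_real_divide of_real_add complex_norm_square by simp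
    have wm: "integrable (half_line 1) w"
    proof -
      have "integrable (half_line 1) (\<lambda>x. complex_of_real (w x))"
      proof (rule integrable_le[OF integrable_norm[OF L2_product(2)[OF d cutL]]])
        show "(\<lambda>x. complex_of_real (w x)) \<in> half_meas"
          unfolding w[symmetric] by (intro borel_measurable_times cnj_meas dm cm Bdm)
        show "AE x in half_line 1. norm (complex_of_real (w x)) \<le> norm (norm (d x * (?cut x * 1)))"
        proof (rule AE_I2)
          fix x
          have "norm (Bd x) \<le> 1"
            unfolding Bd_def by (rule le1)
          then show "norm (complex_of_real (w x)) \<le> norm (norm (d x * (?cut x * 1)))"
            unfolding w[symmetric] norm_mult complex_mod_cnj by (simp add: mult_left_mono mult_left_le)
        qed
      qed
      then show ?thesis by (simp add: complex_of_real_integrable_eq)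
    qed
    have "(LINT x|half_line 1. complex_of_real (w x)) = 0" using z by (simp only: w)
    then have "(LINT x|half_line 1. w x) = 0" unfolding integral_complex_of_real by simp
    moreover have "AE x in half_line 1. 0 \<le> w x"
      by (intro AE_I2) (simp add: w_def cutoff_01)
    ultimately have "AE x in half_line 1. w x = 0"
      using integral_nonneg_eq_0_iff_AE[OF wm] by simp
    then show ?thesis
    proof eventually_elim
      case (elim x)
      have "1 + norm (d x) \<noteq> 0" using norm_ge_zero[of "d x"] by linarith
      then show ?case using elim by (auto simp: w_def)
    qed
  qed
  then have "AE x in half_line 1. \<forall>n. of_real (cutoff (Suc n) x) * d x = 0"
    by (subst AE_all_countable) auto
  moreover have "AE x in half_line 1. x \<noteq> 1"
    by (rule AE_restrict_space_iff[THEN iffD2]) (auto intro!: AE_I'[of "{1}"] simp: null_sets_completionI)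
  ultimately show ?thesis using AE_space
  proof eventually_elim
    case (elim x)
    then have "x > 1" by simp
    from cutoff_eventually[OF refl this] obtain N where "\<And>n. n \<ge> N \<Longrightarrow> cutoff n x = 1"
      by (auto simp: eventually_sequentially)
    then have "cutoff (Suc N) x = 1" by simp
    then show ?case using elim(1)[rule_format, of N] by simp
  qed
qed

section \<open>The Dirichlet Sobolev space\<close>

lemma has_weak_Dx_unique:
  assumes "has_weak_Dx u g" "has_weak_Dx u g'"
  shows "AE x in half_line 1. g x = g' x"
proof -
  have L: "g \<in> L2 {1..}" "g' \<in> L2 {1..}" using assms by (auto simp: has_weak_Dx_def)
  have "AE x in half_line 1. g x - g' x = 0"
  proof (rule orthogonal_to_test_funs[OF L2_diff[OF L]])
    fix \<phi> assume t: "\<phi> \<in> test_funs"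
    have "inner2 g \<phi> = inner2 g' \<phi>"
      using assms t unfolding has_weak_Dx_def by metis
    then show "inner2 (\<lambda>x. g x - g' x) \<phi> = 0"
      using L2_inner_diff(1)[OF L test_fun_L2(1)[OF t]] by simp
  qed
  then show ?thesis by eventually_elim simp
qed

lemma H1_weak_Dx: "u \<in> H1 \<Longrightarrow> has_weak_Dx u (weak_Dx u)"
  unfolding H1_def weak_Dx_def by (auto intro: someI[of "has_weak_Dx u"])

lemma H1_L2: "u \<in> H1 \<Longrightarrow> u \<in> L2 {1..}" "u \<in> H1 \<Longrightarrow> weak_Dx u \<in> L2 {1..}"
  using H1_weak_Dx[of u] by (auto simp: H1_def has_weak_Dx_def)

lemma H1_0_H1: "u \<in> H1_0 \<Longrightarrow> u \<in> H1"
  by (simp add: H1_0_def)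

lemma weak_Dx_AE: "u \<in> L2 {1..} \<Longrightarrow> has_weak_Dx u g \<Longrightarrow> AE x in half_line 1. weak_Dx u x = g x"
  by (rule has_weak_Dx_unique[OF H1_weak_Dx]) (auto simp: H1_def)

lemma has_weak_Dx_primitive: "primitive_of u g \<Longrightarrow> g \<in> L2 {1..} \<Longrightarrow> has_weak_Dx u (\<lambda>x. - \<i> * g x)"
  unfolding has_weak_Dx_def using primitive_weak_derivative L2_cmult(1) by blast

lemma has_weak_Dx_diff:
  assumes "u \<in> L2 {1..}" "v \<in> L2 {1..}" "has_weak_Dx u g" "has_weak_Dx v h"
  shows "has_weak_Dx (\<lambda>x. u x - v x) (\<lambda>x. g x - h x)"
  using assms unfolding has_weak_Dx_def by (auto simp: L2_diff L2_inner_diff test_fun_L2)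

lemma primitive_of_derivative:
  assumes d: "\<And>x. x \<ge> 1 \<Longrightarrow> (u has_vector_derivative g x) (at x within {1..})" and g: "continuous_on {1..} g"
  shows "primitive_of u g"
  unfolding primitive_of_def
proof (intro allI impI conjI)
  fix x :: real assume x: "1 \<le> x"
  have c: "continuous_on {1..x} g" by (rule continuous_on_subset[OF g]) auto
  show "integrable (lebesgue_on {1..x}) g" by (rule lebesgue_on_interval_integral(1)[OF c])
  have "(g has_integral u x - u 1) {1..x}"
    by (rule fundamental_theorem_of_calculus[OF x]) (auto intro!: has_vector_derivative_within_subset[OF d])
  then show "u x = u 1 + integral {1..x} g" by (simp add: integral_unique)
qed

lemma primitive_of_continuous: "primitive_of u g \<Longrightarrow> continuous_on {1..} u"
proof (rule continuous_on_half_line)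
  fix b :: real assume u: "primitive_of u g" and b: "1 < b"
  have "integrable (lebesgue_on {1..b}) g" using u b by (simp add: primitive_of_def)
  then have "g integrable_on {1..b}" by (auto intro: integrable_on_lebesgue_on)
  then have c: "continuous_on {1..b} (\<lambda>x. u 1 + integral {1..x} g)"
    by (intro continuous_intros indefinite_integral_continuous_1)
  show "continuous_on {1..b} u"
  proof (rule continuous_on_eq[OF c])
    show "u 1 + integral {1..x} g = u x" if "x \<in> {1..b}" for x
      by (rule u[unfolded primitive_of_def, rule_format, THEN conjunct2, symmetric]) (use that in simp)
  qed
qed

text \<open>Density of test functions: both sides are continuous in \<open>v\<close> for the Sobolev
  norm. The Dirichlet condition is carried by \<open>v\<close>, so \<open>w\<close> may have any
  boundary value.\<close>

lemma H1_0_weak_pairing: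
  assumes w: "has_weak_Dx w h" "w \<in> L2 {1..}" and v: "v \<in> H1_0"
  shows "inner2 w (weak_Dx v) = inner2 h v"
proof -
  have h: "h \<in> L2 {1..}" using w by (simp add: has_weak_Dx_def)
  note vL = H1_L2[OF H1_0_H1[OF v]]
  have "norm (inner2 w (weak_Dx v) - inner2 h v) \<le> 0"
  proof (rule field_le_epsilon)
    fix e :: real assume e: "e > 0"
    define e' where "e' = e / (norm2 w + norm2 h + 1)"
    have den: "norm2 w + norm2 h + 1 > 0" by (simp add: add_nonneg_pos)
    have e': "e' > 0" using e den by (simp add: e'_def)
    obtain \<phi> where \<phi>: "\<phi> \<in> test_funs" "norm2 (\<lambda>x. v x - \<phi> x) < e'"
      "norm2 (\<lambda>x. weak_Dx v x - Dx UNIV \<phi> x) < e'"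
      using v e' unfolding H1_0_def by blast
    note \<phi>L = test_fun_L2[OF \<phi>(1)]
    have "inner2 w (Dx UNIV \<phi>) = inner2 h \<phi>" using w \<phi>(1) by (simp add: has_weak_Dx_def)
    then have "inner2 w (weak_Dx v) - inner2 h v =
        inner2 w (\<lambda>x. weak_Dx v x - Dx UNIV \<phi> x) - inner2 h (\<lambda>x. v x - \<phi> x)"
      by (simp add: L2_inner_diff(2)[OF vL(2) \<phi>L(2) w(2)] L2_inner_diff(2)[OF vL(1) \<phi>L(1) h])
    also have "norm \<dots> \<le> norm2 w * e' + norm2 h * e'"
      using L2_Cauchy_Schwarz[OF w(2) L2_diff[OF vL(2) \<phi>L(2)]] L2_Cauchy_Schwarz[OF h L2_diff[OF vL(1) \<phi>L(1)]]
        mult_left_mono[OF less_imp_le[OF \<phi>(3)], of "norm2 w"]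
        mult_left_mono[OF less_imp_le[OF \<phi>(2)], of "norm2 h"]
      by (intro order_trans[OF norm_triangle_ineq4] add_mono) auto
    also have "\<dots> \<le> e' * (norm2 w + norm2 h + 1)" using e' by (simp add: algebra_simps)
    also have "\<dots> = e" using den by (simp add: e'_def)
    finally show "norm (inner2 w (weak_Dx v) - inner2 h v) \<le> 0 + e" by simp
  qed
  then show ?thesis by simp
qed

text \<open>The derivative is of order n only on a strip of width \<open>2 / n\<close> next to the
  boundary and bounded elsewhere. A function vanishing linearly at \<open>1\<close> therefore keeps
  a bounded product with it.\<close>

lemma cutoff_derivative:
  obtains c' C where "\<And>n x. (cutoff n has_real_derivative c' n x) (at x)" "C \<ge> 0"
    "\<And>n x. x \<le> 1 + 1 / real (Suc n) \<Longrightarrow> x \<le> real (Suc n) \<Longrightarrow> c' (Suc n) x = 0"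
    "\<And>n x. 1 \<le> x \<Longrightarrow> real (Suc n) * (x - 1) \<le> 2 \<Longrightarrow> \<bar>c' (Suc n) x\<bar> \<le> C * real (Suc n) + C"
    "\<And>n x. real (Suc n) * (x - 1) > 2 \<Longrightarrow> \<bar>c' (Suc n) x\<bar> \<le> C"
    "\<And>n x. real n * (x - 1) - 1 > 1 \<Longrightarrow> real n + 1 - x > 1 \<Longrightarrow> c' n x = 0"
    "\<And>n. continuous_on UNIV (c' n)"
proof -
  obtain s' C where s: "\<And>x. (smooth_step has_real_derivative s' x) (at x)"
    "\<And>x. x \<notin> {0..1} \<Longrightarrow> s' x = 0" "\<And>x. \<bar>s' x\<bar> \<le> C" "continuous_on UNIV s'"
    by (rule smooth_step_derivative) (rule that; assumption)
  define c' where "c' n x = real n * s' (real n * (x - 1) - 1) * smooth_step (real n + 1 - x)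
      + smooth_step (real n * (x - 1) - 1) * - s' (real n + 1 - x)" for n x
  have C: "C \<ge> 0" using s(3)[of 0] by linarith
  have d: "(cutoff n has_real_derivative c' n x) (at x)" for n x
  proof -
    have a: "((\<lambda>x. smooth_step (real n * (x - 1) - 1)) has_real_derivative s' (real n * (x - 1) - 1) * real n) (at x)"
      by (rule DERIV_chain'[OF _ s(1)]) (auto intro!: derivative_eq_intros)
    have b: "((\<lambda>x. smooth_step (real n + 1 - x)) has_real_derivative s' (real n + 1 - x) * - 1) (at x)"
      by (rule DERIV_chain'[OF _ s(1)]) (auto intro!: derivative_eq_intros)
    from DERIV_mult[OF a b] show ?thesis
      by (simp add: cutoff_def[abs_def] c'_def algebra_simps)
  qed
  \<comment> \<open>The derivative is known to vanish only outside the closed unit interval;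
    continuity carries this to the end points.\<close>
  have s0: "s' 0 = 0" "s' 1 = 0"
  proof -
    have lim: "(s' \<longlongrightarrow> s' a) (at a within S)" for a S
      using s(4) by (auto simp: continuous_on_def intro: tendsto_within_subset)
    have "(s' \<longlongrightarrow> 0) (at_left 0)"
      by (rule Lim_transform_eventually[OF tendsto_const]) (auto simp: eventually_at_filter s(2))
    then show "s' 0 = 0" using tendsto_unique[OF _ lim] trivial_limit_at_left_real by metis
    have "(s' \<longlongrightarrow> 0) (at_right 1)"
      by (rule Lim_transform_eventually[OF tendsto_const]) (auto simp: eventually_at_filter s(2))
    then show "s' 1 = 0" using tendsto_unique[OF _ lim] trivial_limit_at_right_real by metis
  qed
  have sz: "s' x = 0" if "x \<le> 0 \<or> x \<ge> 1" for x using s(2)[of x] s0 that by (cases "x = 0 \<or> x = 1") auto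
  have st: "\<bar>smooth_step x\<bar> \<le> 1" for x using smooth_step_values(3,4)[of x] by simp
  have b1: "\<bar>real n * s' y * smooth_step w\<bar> \<le> C * real n" for n y w
  proof -
    have "\<bar>s' y\<bar> * \<bar>smooth_step w\<bar> \<le> C * 1" using s(3)[of y] st[of w] C by (intro mult_mono) auto
    from mult_left_mono[OF this, of "real n"] show ?thesis by (simp add: abs_mult mult_ac)
  qed
  have b2: "\<bar>smooth_step w * - s' y\<bar> \<le> C" for y w
  proof -
    have "\<bar>smooth_step w\<bar> * \<bar>s' y\<bar> \<le> 1 * C" using s(3)[of y] st[of w] C by (intro mult_mono) auto
    then show ?thesis by (simp add: abs_mult)
  qed
  show ?thesis
  proof (rule that[of c' C])
    show "(cutoff n has_real_derivative c' n x) (at x)" for n x by (rule d)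
    show "C \<ge> 0" by (rule C)
    show "c' (Suc n) x = 0" if "x \<le> 1 + 1 / real (Suc n)" "x \<le> real (Suc n)" for n x
    proof -
      have "real (Suc n) * (x - 1) - 1 \<le> 0" using that(1) by (simp add: field_simps del: of_nat_Suc)
      then show ?thesis using that(2) by (simp add: c'_def sz smooth_step_values del: of_nat_Suc)
    qed
    show "\<bar>c' (Suc n) x\<bar> \<le> C * real (Suc n) + C" for n x
      unfolding c'_def using b1 b2 by (intro order_trans[OF abs_triangle_ineq] add_mono)
    show "\<bar>c' (Suc n) x\<bar> \<le> C" if "real (Suc n) * (x - 1) > 2" for n x
    proof -
      have "s' (real (Suc n) * (x - 1) - 1) = 0" using that by (intro sz) simp
      then show ?thesis unfolding c'_def using b2 by simp
    qed
    show "c' n x = 0" if "real n * (x - 1) - 1 > 1" "real n + 1 - x > 1" for n x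
      using that by (simp add: c'_def sz)
    show "continuous_on UNIV (c' n)" for n
    proof -
      have cs: "continuous_on UNIV (\<lambda>x. s' (f x))" if "continuous_on UNIV f" for f :: "real \<Rightarrow> real"
        by (rule continuous_on_compose2[OF s(4) that]) auto
      have sc: "continuous_on UNIV smooth_step"
        by (intro continuous_at_imp_continuous_on ballI DERIV_isCont[OF s(1)])
      have ss: "continuous_on UNIV (\<lambda>x. smooth_step (f x))" if "continuous_on UNIV f" for f :: "real \<Rightarrow> real"
        by (rule continuous_on_compose2[OF sc that]) auto
      show ?thesis unfolding c'_def[abs_def]
        by (intro continuous_on_add continuous_on_mult continuous_on_minus cs ss continuous_intros)
    qed
  qed
qed

lemma L2_norm_tendsto_zero:
  assumes meas: "\<And>n. f n \<in> half_meas" and w: "integrable (half_line 1) w"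
    and bound: "\<And>n x. x \<ge> 1 \<Longrightarrow> (norm (f n x))\<^sup>2 \<le> w x" and lim: "\<And>x. x > 1 \<Longrightarrow> (\<lambda>n. f n x) \<longlonglongrightarrow> 0"
  shows "\<And>n. f n \<in> L2 {1..}" "(\<lambda>n. norm2 (f n)) \<longlonglongrightarrow> 0"
proof -
  show "f n \<in> L2 {1..}" for n
    by (rule L2_bound(1)[OF meas w]) (use bound in \<open>auto intro!: AE_I2\<close>)
  have "AE x in half_line 1. x \<noteq> 1"
    by (rule AE_restrict_space_iff[THEN iffD2]) (auto intro!: AE_I'[of "{1}"] simp: null_sets_completionI)
  then have AE: "AE x in half_line 1. (\<lambda>n. (norm (f n x))\<^sup>2) \<longlonglongrightarrow> 0"
    using AE_space
  proof eventually_elim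
    case (elim x)
    then have "x > 1" by simp
    from tendsto_power[OF tendsto_norm[OF lim[OF this]], of 2] show ?case by simp
  qed
  have "(\<lambda>n. LINT x|half_line 1. (norm (f n x))\<^sup>2) \<longlonglongrightarrow> (LINT x|half_line 1. 0)"
  proof (rule integral_dominated_convergence[OF _ _ w AE])
    show "(\<lambda>x. (norm (f n x))\<^sup>2) \<in> half_meas" for n using meas[of n] by measurable
    show "AE x in half_line 1. norm ((norm (f n x))\<^sup>2) \<le> w x" for n
      using bound by (auto intro!: AE_I2)
  qed simp
  from tendsto_real_sqrt[OF this] show "(\<lambda>n. norm2 (f n)) \<longlonglongrightarrow> 0"
    by (simp add: L2_norm_def)
qed

text \<open>Approximation in two stages: first a cutoff, then a smooth function with a nearby
  derivative inside the cutoff. The critical term is the derivative of the cutoff times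
  \<open>u\<close>; as \<open>u 1 = 0\<close> and \<open>g\<close> is bounded near \<open>1\<close>,
  it stays bounded near the boundary, and dominated convergence removes it.\<close>

lemma H1_0_primitive:
  assumes u: "primitive_of u g" and g: "continuous_on {1..} g" and u1: "u 1 = 0"
    and uL: "u \<in> L2 {1..}" and gL: "g \<in> L2 {1..}"
  shows "u \<in> H1_0"
proof -
  have wk: "has_weak_Dx u (\<lambda>x. - \<i> * g x)" by (rule has_weak_Dx_primitive[OF u gL])
  have uH: "u \<in> H1" using uL wk by (auto simp: H1_def)
  have uc: "continuous_on {1..} u" by (rule primitive_of_continuous[OF u])
  have um: "u \<in> half_meas" and gm: "g \<in> half_meas"
    by (rule L2_meas[OF uL], rule L2_meas[OF gL])
  obtain c' C where c: "\<And>n x. (cutoff n has_real_derivative c' n x) (at x)" "C \<ge> 0"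
    "\<And>n x. x \<le> 1 + 1 / real (Suc n) \<Longrightarrow> x \<le> real (Suc n) \<Longrightarrow> c' (Suc n) x = 0"
    "\<And>n x. 1 \<le> x \<Longrightarrow> real (Suc n) * (x - 1) \<le> 2 \<Longrightarrow> \<bar>c' (Suc n) x\<bar> \<le> C * real (Suc n) + C"
    "\<And>n x. real (Suc n) * (x - 1) > 2 \<Longrightarrow> \<bar>c' (Suc n) x\<bar> \<le> C"
    "\<And>n x. real n * (x - 1) - 1 > 1 \<Longrightarrow> real n + 1 - x > 1 \<Longrightarrow> c' n x = 0"
    "\<And>n. continuous_on UNIV (c' n)"
    by (rule cutoff_derivative) (rule that; assumption)
  let ?cut = "\<lambda>n x. complex_of_real (cutoff (Suc n) x)"
  let ?cut' = "\<lambda>n x. complex_of_real (c' (Suc n) x)"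
  have cutm: "?cut n \<in> half_meas" for n
    by (intro continuous_borel_measurable_half_line continuous_intros cutoff_continuous)
  have cut'm: "?cut' n \<in> half_meas" for n
    by (intro continuous_borel_measurable_half_line continuous_intros continuous_on_subset[OF c(7)]) auto
  have lim1: "(\<lambda>n. h x * (1 - ?cut n x)) \<longlonglongrightarrow> 0" if "x > 1" for h :: cfun and x
  proof (rule tendsto_eventually)
    show "eventually (\<lambda>n. h x * (1 - ?cut n x) = 0) sequentially"
      using eventually_sequentially_Suc[THEN iffD2, OF cutoff_eventually[OF refl that]] by eventually_elim simp
  qed
  have near: "\<forall>h\<in>L2 {1..}. (\<lambda>n. norm2 (\<lambda>x. h x * (1 - ?cut n x))) \<longlonglongrightarrow> 0 \<and>
      (\<forall>n. (\<lambda>x. h x * (1 - ?cut n x)) \<in> L2 {1..})"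
  proof
    fix h assume h: "h \<in> L2 {1..}"
    have m: "(\<lambda>x. h x * (1 - ?cut n x)) \<in> half_meas" for n
      by (intro borel_measurable_times borel_measurable_diff borel_measurable_const L2_meas[OF h] cutm)
    have b: "(norm (h x * (1 - ?cut n x)))\<^sup>2 \<le> (norm (h x))\<^sup>2" for n x
    proof (rule power_mono)
      have "norm (1 - ?cut n x) = 1 - cutoff (Suc n) x"
      proof -
        have "1 - ?cut n x = complex_of_real (1 - cutoff (Suc n) x)" by simp
        then show ?thesis using cutoff_01[of "Suc n" x] by (simp only: norm_of_real)
      qed
      then show "norm (h x * (1 - ?cut n x)) \<le> norm (h x)"
        using cutoff_01[of "Suc n" x] by (simp add: norm_mult mult_left_le)
    qed simp
    show "(\<lambda>n. norm2 (\<lambda>x. h x * (1 - ?cut n x))) \<longlonglongrightarrow> 0 \<and>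
      (\<forall>n. (\<lambda>x. h x * (1 - ?cut n x)) \<in> L2 {1..})"
      using L2_norm_tendsto_zero[where f = "\<lambda>n x. h x * (1 - ?cut n x)", OF m L2_integrable[OF h] b lim1[of _ h]]
      by blast
  qed
  obtain G where "\<forall>x\<in>g ` {1..3}. norm x \<le> G"
    using compact_imp_bounded[OF compact_continuous_image[OF continuous_on_subset[OF g]], of "{1..3}"]
    unfolding bounded_iff by auto
  then have G: "norm (g x) \<le> G" if "x \<in> {1..3}" for x using that by blast
  have G0: "G \<ge> 0" by (rule order_trans[OF norm_ge_zero G[of 1]]) simp
  have u_near: "norm (u x) \<le> G * (x - 1)" if x: "1 \<le> x" "x \<le> 3" for x
  proof -
    have "u x = integral {1..x} g"
      using u[unfolded primitive_of_def, rule_format, THEN conjunct2, OF x(1)] u1 by simp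
    also have "norm \<dots> \<le> G * (x - 1)"
      by (rule integral_bound[OF x(1) continuous_on_subset[OF g]]) (use x G in auto)
    finally show ?thesis .
  qed
  \<comment> \<open>Near the boundary the product is at most
    \<open>(C * n + C) * (G * (x - 1))\<close> with \<open>n * (x - 1) \<le> 2\<close> and
    \<open>x \<le> 3\<close>, hence the constant \<open>4 * C * G\<close>.\<close>
  define w where "w x = 2 * (if 1 \<le> x \<and> x \<le> 3 then (4 * C * G)\<^sup>2 else 0) + 2 * (C\<^sup>2 * (norm (u x))\<^sup>2)" for x
  have wi: "integrable (half_line 1) w"
  proof -
    have "integrable (half_line 1) (\<lambda>x. if 1 \<le> x \<and> x \<le> 3 then (4 * C * G)\<^sup>2 else 0)"
      unfolding half_line_truncate(1)[OF order_refl] by simp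
    then show ?thesis unfolding w_def[abs_def] using L2_integrable[OF uL] by simp
  qed
  have m3: "(\<lambda>x. ?cut' n x * u x) \<in> half_meas" for n
    by (rule borel_measurable_times[OF cut'm um])
  have b3: "(norm (?cut' n x * u x))\<^sup>2 \<le> w x" if x: "x \<ge> 1" for n x
  proof (cases "real (Suc n) * (x - 1) > 2")
    case True
    have "norm (?cut' n x * u x) \<le> C * norm (u x)"
      unfolding norm_mult norm_of_real using c(5)[OF True] by (intro mult_right_mono) auto
    then have "(norm (?cut' n x * u x))\<^sup>2 \<le> (C * norm (u x))\<^sup>2" by (intro power_mono) auto
    also have "\<dots> \<le> w x" by (simp add: w_def power_mult_distrib)
    finally show ?thesis .
  next
    case False
    then have r: "real (Suc n) * (x - 1) \<le> 2" by simp
    have "1 * (x - 1) \<le> real (Suc n) * (x - 1)" using x by (intro mult_right_mono) auto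
    from order_trans[OF this r] have x3: "x \<le> 3" by simp
    have "norm (?cut' n x * u x) \<le> (C * real (Suc n) + C) * (G * (x - 1))"
      unfolding norm_mult norm_of_real using c(4)[OF x r] u_near[OF x x3] c(2) by (intro mult_mono) auto
    also have "\<dots> = C * G * (real (Suc n) * (x - 1) + (x - 1))" by (simp add: algebra_simps)
    also have "\<dots> \<le> C * G * 4" using r x3 c(2) G0 by (intro mult_left_mono) auto
    finally have "(norm (?cut' n x * u x))\<^sup>2 \<le> (4 * C * G)\<^sup>2" by (intro power_mono) (auto simp: mult_ac)
    also have "\<dots> \<le> w x" using x x3 by (simp add: w_def)
    finally show ?thesis .
  qed
  have l3: "(\<lambda>n. ?cut' n x * u x) \<longlonglongrightarrow> 0" if "x > 1" for x
  proof (rule tendsto_eventually)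
    show "eventually (\<lambda>n. ?cut' n x * u x = 0) sequentially"
      using eventually_sequentially_Suc[THEN iffD2, OF cutoff_eventually[OF refl that]]
      by eventually_elim (simp add: c(6))
  qed
  note T3 = L2_norm_tendsto_zero[where f = "\<lambda>n x. ?cut' n x * u x", OF m3 wi b3 l3]
  show ?thesis
    unfolding H1_0_def
  proof (intro CollectI conjI allI impI uH)
    fix \<epsilon> :: real assume \<epsilon>: "\<epsilon> > 0"
    have "eventually (\<lambda>n. norm2 (\<lambda>x. u x * (1 - ?cut n x)) < \<epsilon> / 5) sequentially"
      "eventually (\<lambda>n. norm2 (\<lambda>x. g x * (1 - ?cut n x)) < \<epsilon> / 5) sequentially"
      "eventually (\<lambda>n. norm2 (\<lambda>x. ?cut' n x * u x) < \<epsilon> / 5) sequentially"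
      using near[rule_format, OF uL] near[rule_format, OF gL] T3(2) \<epsilon> by (auto intro!: order_tendstoD(2))
    then have "eventually (\<lambda>n. norm2 (\<lambda>x. u x * (1 - ?cut n x)) < \<epsilon> / 5 \<and>
        norm2 (\<lambda>x. g x * (1 - ?cut n x)) < \<epsilon> / 5 \<and> norm2 (\<lambda>x. ?cut' n x * u x) < \<epsilon> / 5) sequentially"
      by eventually_elim auto
    then obtain n where n: "norm2 (\<lambda>x. u x * (1 - ?cut n x)) < \<epsilon> / 5"
        "norm2 (\<lambda>x. g x * (1 - ?cut n x)) < \<epsilon> / 5" "norm2 (\<lambda>x. ?cut' n x * u x) < \<epsilon> / 5"
      by (auto simp: eventually_sequentially)
    define m where "m = Suc n"
    define D where "D = C * real m + C"
    \<comment> \<open>The cutoff index is fixed at this point, so the accuracy of the smooth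
      approximation may depend on it. \<open>K\<close> dominates the loss in all three error terms:
      from the function, from its derivative, and from the derivative of the cutoff.\<close>
    define K where "K = (real m + 1) * (D + 1) * sqrt (real m + 1) + 1"
    have D: "D \<ge> 0" using c(2) by (simp add: D_def)
    have K: "K > 0" using D by (simp add: K_def add_nonneg_pos)
    define e where "e = \<epsilon> / 5 / K"
    have e: "e > 0" using \<epsilon> K by (simp add: e_def)
    have gc: "continuous_on {1..real m + 1} g" by (rule continuous_on_subset[OF g]) auto
    obtain Q Q' where Q: "\<And>n. n_smooth n Q" "\<And>n. n_smooth n Q'" "\<And>x. (Q has_vector_derivative Q' x) (at x)" "Q 1 = 0"
      "\<And>x. x \<in> {1..real m + 1} \<Longrightarrow> norm (Q' x - g x) < e"
      by (rule smooth_approximation[OF gc e]) (rule that; assumption)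
    have Qc: "continuous_on UNIV Q" "continuous_on UNIV Q'"
      using Q(3) Q(2)[of "Suc 0"] unfolding n_smooth_Suc continuous_on_eq_continuous_within
      by (auto intro: has_vector_derivative_continuous)
    have d1: "norm (g x - Q' x) \<le> e" if "x \<in> {1..real m + 1}" for x
      using Q(5)[OF that] by (simp add: norm_minus_commute)
    have d0: "norm (u x - Q x) \<le> e * (real m + 1)" if x: "x \<in> {1..real m + 1}" for x
    proof -
      have x1: "1 \<le> x" using x by simp
      have "u x = integral {1..x} g"
        using u[unfolded primitive_of_def, rule_format, THEN conjunct2, OF x1] u1 by simp
      moreover have "(Q' has_integral Q x - Q 1) {1..x}"
        by (rule fundamental_theorem_of_calculus[OF x1]) (rule has_vector_derivative_at_within[OF Q(3)])
      then have "Q x = integral {1..x} Q'" using Q(4) by (simp add: integral_unique)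
      moreover have gi: "g integrable_on {1..x}" "Q' integrable_on {1..x}"
        by (intro integrable_continuous_real continuous_on_subset[OF g] continuous_on_subset[OF Qc(2)]; auto)+
      ultimately have "u x - Q x = integral {1..x} (\<lambda>x. g x - Q' x)" by (simp add: integral_diff)
      also have "norm \<dots> \<le> e * (x - 1)"
        by (rule integral_bound[OF x1])
          (use x d1 in \<open>auto intro!: continuous_intros continuous_on_subset[OF g] continuous_on_subset[OF Qc(2)]\<close>)
      also have "\<dots> \<le> e * (real m + 1)" using x e by (intro mult_left_mono) auto
      finally show ?thesis .
    qed
    have m1: "m \<ge> 1" by (simp add: m_def)
    define \<phi> where "\<phi> x = complex_of_real (cutoff m x) * Q x" for x
    have \<phi>t: "\<phi> \<in> test_funs" unfolding \<phi>_def[abs_def] by (rule test_fun_cutoff[OF Q(1) m1])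
    have d\<phi>: "(\<phi> has_vector_derivative of_real (cutoff m x) * Q' x + of_real (c' m x) * Q x) (at x)" for x
      unfolding \<phi>_def[abs_def] by (intro has_vector_derivative_mult has_vector_derivative_of_real c(1) Q(3))
    have Dx\<phi>: "Dx UNIV \<phi> = (\<lambda>x. - \<i> * (of_real (cutoff m x) * Q' x + of_real (c' m x) * Q x))"
      by (rule Dx_eq[OF d\<phi>])
    have c'z: "c' m x = 0" if "x > real m + 1" for x
    proof -
      have "(cutoff m has_real_derivative 0) (at x)"
        by (rule has_field_derivative_transform_within_open[OF DERIV_const[of 0], where S = "{real m + 1<..}"])
          (use that cutoff_support[OF m1] in auto)
      then show ?thesis using c(1) DERIV_unique by blast
    qed
    have c'b: "\<bar>c' m x\<bar> \<le> D" if "x \<ge> 1" for x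
    proof (cases "real m * (x - 1) > 2")
      case True
      then show ?thesis using c(5)[of n x] c(2) unfolding m_def D_def by (simp add: add_increasing)
    qed (use c(4)[of x n] that in \<open>simp add: m_def D_def\<close>)
    let ?a = "\<lambda>x. complex_of_real (cutoff m x) * (u x - Q x)"
    let ?b = "\<lambda>x. complex_of_real (cutoff m x) * (g x - Q' x)"
    let ?c = "\<lambda>x. complex_of_real (c' m x) * (u x - Q x)"
    have sq: "sqrt (real m) \<le> sqrt (real m + 1)" by simp
    have Kb: "x * sqrt (real m + 1) * e \<le> \<epsilon> / 5" if "x \<le> (real m + 1) * (D + 1)" for x
    proof -
      have "x * sqrt (real m + 1) \<le> K"
        unfolding K_def by (rule order_trans[OF mult_right_mono[OF that]]) auto
      from mult_right_mono[OF this, of e] show ?thesis using e K by (simp add: e_def)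
    qed
    have ucQ: "continuous_on {1..} (\<lambda>x. u x - Q x)" "continuous_on {1..} (\<lambda>x. g x - Q' x)"
      by (intro continuous_intros uc g continuous_on_subset[OF Qc(1)] continuous_on_subset[OF Qc(2)]; auto)+
    have mD: "real m + 1 \<le> (real m + 1) * (D + 1)" "1 \<le> (real m + 1) * (D + 1)" "D * (real m + 1) \<le> (real m + 1) * (D + 1)"
      using D mult_left_mono[of 1 "D + 1" "real m + 1"] by (auto simp: algebra_simps)
    have aL: "?a \<in> L2 {1..}" "norm2 ?a \<le> \<epsilon> / 5"
    proof -
      have e': "e * (real m + 1) \<ge> 0" using e by simp
      note * = cutoff_bounded_L2[OF m1 ucQ(1) d0 e']
      show "?a \<in> L2 {1..}" by (rule *(1))
      have "norm2 ?a \<le> e * (real m + 1) * sqrt (real m + 1)"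
        by (rule order_trans[OF *(2) mult_left_mono[OF sq e']])
      then show "norm2 ?a \<le> \<epsilon> / 5" using Kb[OF mD(1)] by (simp add: mult_ac)
    qed
    have bL: "?b \<in> L2 {1..}" "norm2 ?b \<le> \<epsilon> / 5"
    proof -
      note * = cutoff_bounded_L2[OF m1 ucQ(2) d1 less_imp_le[OF e]]
      show "?b \<in> L2 {1..}" by (rule *(1))
      have "norm2 ?b \<le> e * sqrt (real m + 1)"
        by (rule order_trans[OF *(2) mult_left_mono[OF sq less_imp_le[OF e]]])
      then show "norm2 ?b \<le> \<epsilon> / 5" using Kb[OF mD(2)] by (simp add: mult_ac)
    qed
    have cL: "?c \<in> L2 {1..}" "norm2 ?c \<le> \<epsilon> / 5"
    proof -
      have B: "D * (e * (real m + 1)) \<ge> 0" using D e by simp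
      have cc: "continuous_on {1..} ?c"
        by (intro continuous_intros ucQ continuous_on_subset[OF c(7)]) auto
      have bb: "norm (?c x) \<le> D * (e * (real m + 1))" if "1 \<le> x" "x \<le> real m + 1" for x
        unfolding norm_mult norm_of_real using c'b[OF that(1)] d0[of x] that D by (intro mult_mono) auto
      have *: "?c \<in> L2 {1..}" "(norm2 ?c)\<^sup>2 \<le> (D * (e * (real m + 1)))\<^sup>2 * ((real m + 1) - 1)"
        by (rule L2_continuous_compact_support[where b = "real m + 1", OF cc]; use bb c'z B in simp)+
      show "?c \<in> L2 {1..}" by (rule *)
      have "(norm2 ?c)\<^sup>2 \<le> (D * (e * (real m + 1)) * sqrt (real m + 1))\<^sup>2"
        using order_trans[OF *(2) mult_left_mono[of "real m + 1 - 1" "real m + 1"]] by (simp add: power_mult_distrib)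
      then have "norm2 ?c \<le> D * (e * (real m + 1)) * sqrt (real m + 1)"
        by (rule power2_le_imp_le) (use B in simp)
      then show "norm2 ?c \<le> \<epsilon> / 5" using Kb[OF mD(3)] by (simp add: mult_ac)
    qed
    show "\<exists>\<phi>\<in>test_funs. norm2 (\<lambda>x. u x - \<phi> x) < \<epsilon> \<and>
        norm2 (\<lambda>x. weak_Dx u x - Dx UNIV \<phi> x) < \<epsilon>"
    proof (rule bexI[OF _ \<phi>t], intro conjI)
      have L: "(\<lambda>x. u x * (1 - ?cut n x)) \<in> L2 {1..}" "(\<lambda>x. g x * (1 - ?cut n x)) \<in> L2 {1..}"
        using near uL gL by auto
      have "(\<lambda>x. u x - \<phi> x) = (\<lambda>x. u x * (1 - ?cut n x) + ?a x)"
        by (auto simp: \<phi>_def m_def algebra_simps)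
      then have "norm2 (\<lambda>x. u x - \<phi> x) \<le> norm2 (\<lambda>x. u x * (1 - ?cut n x)) + norm2 ?a"
        using L2_triangle[OF L(1) aL(1)] by simp
      then show "norm2 (\<lambda>x. u x - \<phi> x) < \<epsilon>" using n(1) aL(2) \<epsilon> by linarith
      let ?h = "\<lambda>x. (g x * (1 - ?cut n x) + ?b x) + (?c x + (- 1) * (?cut' n x * u x))"
      have c'L: "(\<lambda>x. (- 1) * (?cut' n x * u x)) \<in> L2 {1..}" by (rule L2_cmult(1)[OF T3(1)])
      \<comment> \<open>The derivative error has four parts: the cutoff error of \<open>g\<close>,
        the approximation error of \<open>g\<close>, the approximation error of \<open>u\<close>
        against the derivative of the cutoff, and the critical term.\<close>
      have h: "- \<i> * g x - Dx UNIV \<phi> x = - \<i> * ?h x" for x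
        unfolding Dx\<phi> by (simp add: m_def algebra_simps)
      have hL: "?h \<in> L2 {1..}" by (intro L2_add L bL cL c'L)
      have wm: "weak_Dx u \<in> half_meas" by (rule L2_meas[OF H1_L2(2)[OF uH]])
      have Dm: "Dx UNIV \<phi> \<in> half_meas" by (rule L2_meas[OF test_fun_L2(2)[OF \<phi>t]])
      have "norm2 (\<lambda>x. weak_Dx u x - Dx UNIV \<phi> x) = norm2 (\<lambda>x. - \<i> * ?h x)"
      proof (rule L2_norm_cong_AE)
        show "(\<lambda>x. weak_Dx u x - Dx UNIV \<phi> x) \<in> half_meas" by (rule borel_measurable_diff[OF wm Dm])
        show "(\<lambda>x. - \<i> * ?h x) \<in> half_meas" by (rule L2_meas[OF L2_cmult(1)[OF hL]])
        show "AE x in half_line 1. weak_Dx u x - Dx UNIV \<phi> x = - \<i> * ?h x"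
          using weak_Dx_AE[OF uL wk] by eventually_elim (simp only: h[symmetric])
      qed
      also have "\<dots> = norm2 ?h" unfolding L2_cmult(2) by simp
      also have "\<dots> \<le> (norm2 (\<lambda>x. g x * (1 - ?cut n x)) + norm2 ?b) +
          (norm2 ?c + norm2 (\<lambda>x. (- 1) * (?cut' n x * u x)))"
        by (intro order_trans[OF L2_triangle] add_mono L2_triangle L2_add L bL cL c'L)
      also have "norm2 (\<lambda>x. (- 1) * (?cut' n x * u x)) = norm2 (\<lambda>x. ?cut' n x * u x)"
        unfolding L2_cmult(2) by simp
      finally show "norm2 (\<lambda>x. weak_Dx u x - Dx UNIV \<phi> x) < \<epsilon>"
        using n bL(2) cL(2) \<epsilon> by linarith
    qed
  qed
qed

text \<open>\<open>weak_Dx\<close> is a choice, so it respects differences only almost everywhere,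
  by uniqueness of weak derivatives.\<close>

lemma H1_0_diff:
  assumes u: "u \<in> H1_0" and v: "v \<in> H1_0"
  shows "(\<lambda>x. u x - v x) \<in> H1_0" "AE x in half_line 1. weak_Dx (\<lambda>x. u x - v x) x = weak_Dx u x - weak_Dx v x"
proof -
  note uL = H1_L2[OF H1_0_H1[OF u]] and vL = H1_L2[OF H1_0_H1[OF v]]
  note wu = H1_weak_Dx[OF H1_0_H1[OF u]] and wv = H1_weak_Dx[OF H1_0_H1[OF v]]
  have w: "has_weak_Dx (\<lambda>x. u x - v x) (\<lambda>x. weak_Dx u x - weak_Dx v x)"
    by (rule has_weak_Dx_diff[OF uL(1) vL(1) wu wv])
  have L: "(\<lambda>x. u x - v x) \<in> L2 {1..}" by (rule L2_diff[OF uL(1) vL(1)])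
  have H: "(\<lambda>x. u x - v x) \<in> H1" using w L by (auto simp: H1_def)
  show AE: "AE x in half_line 1. weak_Dx (\<lambda>x. u x - v x) x = weak_Dx u x - weak_Dx v x"
    by (rule weak_Dx_AE[OF L w])
  show "(\<lambda>x. u x - v x) \<in> H1_0"
    unfolding H1_0_def
  proof (intro CollectI conjI allI impI H)
    fix \<epsilon> :: real assume \<epsilon>: "\<epsilon> > 0"
    obtain \<phi> where \<phi>: "\<phi> \<in> test_funs" "norm2 (\<lambda>x. u x - \<phi> x) < \<epsilon> / 2"
      "norm2 (\<lambda>x. weak_Dx u x - Dx UNIV \<phi> x) < \<epsilon> / 2"
      using u \<epsilon> unfolding H1_0_def by (auto dest!: spec[of _ "\<epsilon> / 2"])
    obtain \<psi> where \<psi>: "\<psi> \<in> test_funs" "norm2 (\<lambda>x. v x - \<psi> x) < \<epsilon> / 2"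
      "norm2 (\<lambda>x. weak_Dx v x - Dx UNIV \<psi> x) < \<epsilon> / 2"
      using v \<epsilon> unfolding H1_0_def by (auto dest!: spec[of _ "\<epsilon> / 2"])
    note \<phi>L = test_fun_L2[OF \<phi>(1)] and \<psi>L = test_fun_L2[OF \<psi>(1)]
    have t: "(\<lambda>x. \<phi> x - \<psi> x) \<in> test_funs"
    proof -
      obtain K where K: "compact K" "K \<subseteq> {1<..}" "\<And>x. x \<notin> K \<Longrightarrow> \<phi> x = 0" "\<And>n. n_smooth n \<phi>"
        using \<phi>(1) unfolding test_funs_def smooth_on_UNIV_iff by blast
      obtain K' where K': "compact K'" "K' \<subseteq> {1<..}" "\<And>x. x \<notin> K' \<Longrightarrow> \<psi> x = 0" "\<And>n. n_smooth n \<psi>"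
        using \<psi>(1) unfolding test_funs_def smooth_on_UNIV_iff by blast
      have "n_smooth n (\<lambda>x. \<phi> x + (- 1) * \<psi> x)" for n by (intro n_smooth_add n_smooth_cmult K K')
      moreover have "compact (K \<union> K') \<and> K \<union> K' \<subseteq> {1<..} \<and> (\<forall>x. x \<notin> K \<union> K' \<longrightarrow> \<phi> x - \<psi> x = 0)"
        using K K' by auto
      ultimately show ?thesis unfolding test_funs_def smooth_on_UNIV_iff by auto
    qed
    have two: "norm2 (\<lambda>x. (a x - b x) - (c x - d x)) < \<epsilon>"
      if "a \<in> L2 {1..}" "b \<in> L2 {1..}" "c \<in> L2 {1..}" "d \<in> L2 {1..}"
        "norm2 (\<lambda>x. a x - c x) < \<epsilon> / 2" "norm2 (\<lambda>x. b x - d x) < \<epsilon> / 2" for a b c d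
    proof -
      have "(\<lambda>x. (a x - b x) - (c x - d x)) = (\<lambda>x. (a x - c x) + (- 1) * (b x - d x))" by auto
      then have "norm2 (\<lambda>x. (a x - b x) - (c x - d x)) \<le>
          norm2 (\<lambda>x. a x - c x) + norm2 (\<lambda>x. (- 1) * (b x - d x))"
        using L2_triangle[OF L2_diff[OF that(1,3)] L2_cmult(1)[OF L2_diff[OF that(2,4)], of "- 1"]] by simp
      also have "norm2 (\<lambda>x. (- 1) * (b x - d x)) = norm2 (\<lambda>x. b x - d x)"
        unfolding L2_cmult(2) by simp
      finally show ?thesis using that by linarith
    qed
    have Dt: "Dx UNIV (\<lambda>x. \<phi> x - \<psi> x) = (\<lambda>x. Dx UNIV \<phi> x - Dx UNIV \<psi> x)"
    proof -
      obtain \<phi>' where p: "\<And>x. (\<phi> has_vector_derivative \<phi>' x) (at x)"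
        by (rule test_funsE[OF \<phi>(1)]) (rule that; assumption)
      obtain \<psi>' where q: "\<And>x. (\<psi> has_vector_derivative \<psi>' x) (at x)"
        by (rule test_funsE[OF \<psi>(1)]) (rule that; assumption)
      show ?thesis
        unfolding Dx_eq[OF has_vector_derivative_diff[OF p q]] Dx_eq[OF p] Dx_eq[OF q]
        by (simp add: algebra_simps)
    qed
    show "\<exists>\<phi>\<in>test_funs. norm2 (\<lambda>x. (u x - v x) - \<phi> x) < \<epsilon> \<and>
        norm2 (\<lambda>x. weak_Dx (\<lambda>x. u x - v x) x - Dx UNIV \<phi> x) < \<epsilon>"
    proof (rule bexI[OF _ t], intro conjI)
      show "norm2 (\<lambda>x. (u x - v x) - (\<phi> x - \<psi> x)) < \<epsilon>"
        by (rule two[OF uL(1) vL(1) \<phi>L(1) \<psi>L(1) \<phi>(2) \<psi>(2)])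
      have "norm2 (\<lambda>x. weak_Dx (\<lambda>x. u x - v x) x - Dx UNIV (\<lambda>x. \<phi> x - \<psi> x) x)
          = norm2 (\<lambda>x. (weak_Dx u x - weak_Dx v x) - (Dx UNIV \<phi> x - Dx UNIV \<psi> x))"
      proof (rule L2_norm_cong_AE)
        show "(\<lambda>x. weak_Dx (\<lambda>x. u x - v x) x - Dx UNIV (\<lambda>x. \<phi> x - \<psi> x) x) \<in> half_meas"
          by (intro borel_measurable_diff L2_meas H1_L2(2)[OF H] test_fun_L2(2)[OF t])
        show "(\<lambda>x. (weak_Dx u x - weak_Dx v x) - (Dx UNIV \<phi> x - Dx UNIV \<psi> x)) \<in> half_meas"
          by (intro borel_measurable_diff L2_meas uL vL \<phi>L \<psi>L)
        show "AE x in half_line 1. weak_Dx (\<lambda>x. u x - v x) x - Dx UNIV (\<lambda>x. \<phi> x - \<psi> x) x =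
            (weak_Dx u x - weak_Dx v x) - (Dx UNIV \<phi> x - Dx UNIV \<psi> x)"
          using AE by eventually_elim (simp add: Dt)
      qed
      also have "\<dots> < \<epsilon>" by (rule two[OF uL(2) vL(2) \<phi>L(2) \<psi>L(2) \<phi>(3) \<psi>(3)])
      finally show "norm2 (\<lambda>x. weak_Dx (\<lambda>x. u x - v x) x - Dx UNIV (\<lambda>x. \<phi> x - \<psi> x) x) < \<epsilon>" .
    qed
  qed
qed

section \<open>Solvability of the Dirichlet problem\<close>

text \<open>Factor \<open>t - z\<^sup>2\<close> through the square root of t; each factor is at
  least as large as its imaginary part, which is \<open>Im z\<close> up to sign.\<close>

lemma dist_square_nonneg_axis:
  assumes "t \<ge> 0" "Im z \<ge> 0"
  shows "(Im z)\<^sup>2 \<le> norm (of_real t - z\<^sup>2)"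
proof -
  have f: "of_real t - z\<^sup>2 = (of_real (sqrt t) - z) * (of_real (sqrt t) + z)"
    using assms(1) by (simp add: algebra_simps power2_eq_square flip: of_real_mult)
  have "Im z \<le> norm (of_real (sqrt t) - z)" "Im z \<le> norm (of_real (sqrt t) + z)"
    using abs_Im_le_cmod[of "of_real (sqrt t) - z"] abs_Im_le_cmod[of "of_real (sqrt t) + z"] by auto
  then show ?thesis unfolding f norm_mult power2_eq_square[of "Im z"] using assms(2) by (auto intro!: mult_mono)
qed

lemma L2_restrict:
  assumes f: "f \<in> L2 {1..}"
  shows "f \<in> L2 {1..b}"
  using integrable_lebesgue_on_subset[OF L2_integrable[OF f], of "{1..b}"]
    measurable_restrict_mono[OF L2_meas[OF f], of "{1..b}"] by (auto simp: L2_def)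

lemma L2_interval_integrable:
  assumes f: "f \<in> L2 {1..}"
  shows "integrable (lebesgue_on {1..b}) f"
proof -
  have "(\<lambda>_. 1) \<in> L2 {1..b}" by (simp add: L2_def)
  from L2_product(2)[OF L2_restrict[OF f] this] show ?thesis by simp
qed

lemma L2_decay:
  assumes h: "continuous_on {1..} h" and n: "n \<ge> 1" and b: "\<And>x. x \<ge> n \<Longrightarrow> norm (h x) \<le> K * exp (- (x / 2))"
  shows "h \<in> L2 {1..}"
proof -
  obtain B where "\<forall>x\<in>h ` {1..n}. norm x \<le> B"
    using compact_imp_bounded[OF compact_continuous_image[OF continuous_on_subset[OF h]], of "{1..n}"]
    unfolding bounded_iff by auto
  then have B: "norm (h x) \<le> B" if "x \<in> {1..n}" for x using that by blast
  have K: "K \<ge> 0" using order_trans[OF norm_ge_zero b[of n]] by (simp add: zero_le_mult_iff)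
  have B0: "B \<ge> 0" by (rule order_trans[OF norm_ge_zero B[of 1]]) (use n in simp)
  define K' where "K' = K + B * exp (n / 2)"
  have b': "norm (h x) \<le> K' * exp (- (x / 2))" if x: "x \<ge> 1" for x
  proof (cases "x \<ge> n")
    case True
    have "K * exp (- (x / 2)) \<le> K' * exp (- (x / 2))" unfolding K'_def using B0 by (intro mult_right_mono) auto
    then show ?thesis using b[OF True] by linarith
  next
    case False
    have "B * 1 \<le> B * exp (n / 2 + - (x / 2))" using B0 False by (intro mult_left_mono) auto
    also have "\<dots> = B * exp (n / 2) * exp (- (x / 2))" by (simp only: exp_add mult.assoc)
    also have "\<dots> \<le> K' * exp (- (x / 2))" unfolding K'_def using K by (intro mult_right_mono) auto
    finally show ?thesis using B[of x] x False by simp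
  qed
  have d: "((\<lambda>x. - (K'\<^sup>2 * exp (- x))) has_real_derivative K'\<^sup>2 * exp (- x)) (at x)" for x
    by (auto intro!: derivative_eq_intros)
  have l: "((\<lambda>x. - (K'\<^sup>2 * exp (- x))) \<longlongrightarrow> - (K'\<^sup>2 * 0)) at_top"
    by (intro tendsto_minus tendsto_mult tendsto_const filterlim_compose[OF exp_at_bot] filterlim_uminus_at_bot_at_top)
  have i: "integrable (half_line 1) (\<lambda>x. K'\<^sup>2 * exp (- x))"
    by (rule half_line_FTC(1)[OF d _ _ l]) (auto intro!: continuous_intros)
  show ?thesis
  proof (rule L2_bound(1)[OF continuous_borel_measurable_half_line[OF h] i], rule AE_I2)
    fix x assume "x \<in> space (half_line 1)"
    then have "(norm (h x))\<^sup>2 \<le> (K' * exp (- (x / 2)))\<^sup>2" using b'[of x] by (intro power_mono) auto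
    also have "\<dots> = K'\<^sup>2 * exp (- x)" by (simp add: power_mult_distrib exp_double[symmetric])
    finally show "(norm (h x))\<^sup>2 \<le> K'\<^sup>2 * exp (- x)" .
  qed
qed

text \<open>Transfers uniform norm bounds to a pointwise limit; strong convergence of the
  approximating solutions is thereby avoided.\<close>

lemma L2_Fatou:
  assumes h: "\<And>n. h n \<in> L2 {1..}" "\<And>n. norm2 (h n) \<le> K" and m: "g \<in> half_meas"
    and lim: "\<And>x. x \<ge> 1 \<Longrightarrow> (\<lambda>n. h n x) \<longlonglongrightarrow> g x"
  shows "g \<in> L2 {1..}" "norm2 g \<le> K"
proof -
  have K: "K \<ge> 0" using order_trans[OF L2_norm_nonneg h(2)] .
  have n: "(\<integral>\<^sup>+x. ennreal ((norm (h n x))\<^sup>2) \<partial>half_line 1) \<le> ennreal (K\<^sup>2)" for n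
  proof -
    have "(\<integral>\<^sup>+x. ennreal ((norm (h n x))\<^sup>2) \<partial>half_line 1) = ennreal (LINT x|half_line 1. (norm (h n x))\<^sup>2)"
      by (rule nn_integral_eq_integral[OF L2_integrable[OF h(1)]]) simp
    also have "\<dots> \<le> ennreal (K\<^sup>2)"
      unfolding L2_norm_square[symmetric] by (intro ennreal_leI power_mono h) simp
    finally show ?thesis .
  qed
  have "(\<integral>\<^sup>+x. ennreal ((norm (g x))\<^sup>2) \<partial>half_line 1) = (\<integral>\<^sup>+x. liminf (\<lambda>n. ennreal ((norm (h n x))\<^sup>2)) \<partial>half_line 1)"
  proof (intro nn_integral_cong)
    fix x assume "x \<in> space (half_line 1)"
    then have "(\<lambda>n. ennreal ((norm (h n x))\<^sup>2)) \<longlonglongrightarrow> ennreal ((norm (g x))\<^sup>2)"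
      by (intro tendsto_ennrealI tendsto_power tendsto_norm lim) simp
    then show "ennreal ((norm (g x))\<^sup>2) = liminf (\<lambda>n. ennreal ((norm (h n x))\<^sup>2))"
      by (rule lim_imp_Liminf[OF trivial_limit_sequentially, symmetric])
  qed
  also have "\<dots> \<le> liminf (\<lambda>n. \<integral>\<^sup>+x. ennreal ((norm (h n x))\<^sup>2) \<partial>half_line 1)"
    by (rule nn_integral_liminf) (use L2_meas[OF h(1)] in measurable)
  also have "\<dots> \<le> ennreal (K\<^sup>2)"
    by (rule order_trans[OF Liminf_le_Limsup]) (auto intro!: Limsup_bounded always_eventually n)
  finally have le: "(\<integral>\<^sup>+x. ennreal ((norm (g x))\<^sup>2) \<partial>half_line 1) \<le> ennreal (K\<^sup>2)" .
  have mm: "(\<lambda>x. (norm (g x))\<^sup>2) \<in> half_meas" using m by measurable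
  have i: "integrable (half_line 1) (\<lambda>x. (norm (g x))\<^sup>2)"
    by (rule integrableI_nonneg[OF mm]) (use le in \<open>auto intro: le_less_trans\<close>)
  then show L: "g \<in> L2 {1..}" using m by (simp add: L2_def)
  have "ennreal (LINT x|half_line 1. (norm (g x))\<^sup>2) \<le> ennreal (K\<^sup>2)"
    using le nn_integral_eq_integral[OF i] by simp
  then have "(norm2 g)\<^sup>2 \<le> K\<^sup>2" by (simp add: L2_norm_square)
  then show "norm2 g \<le> K" by (rule power2_le_imp_le[OF _ K])
qed

section \<open>Energy estimates and variation of constants\<close>

context bounded_potential
begin

lemma V_mult_L2:
  assumes u: "u \<in> L2 {1..}"
  shows "(\<lambda>x. V x * u x) \<in> L2 {1..}" "norm2 (\<lambda>x. V x * u x) \<le> Vm * norm2 u"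
proof -
  have m: "(\<lambda>x. V x * u x) \<in> half_meas"
    by (rule borel_measurable_times[OF V_meas L2_meas[OF u]])
  have i: "integrable (half_line 1) (\<lambda>x. Vm\<^sup>2 * (norm (u x))\<^sup>2)" using L2_integrable[OF u] by simp
  have b: "AE x in half_line 1. (norm (V x * u x))\<^sup>2 \<le> Vm\<^sup>2 * (norm (u x))\<^sup>2"
    unfolding norm_mult power_mult_distrib
    by (rule AE_I2, intro mult_right_mono power_mono) (auto intro: V_bound)
  show "(\<lambda>x. V x * u x) \<in> L2 {1..}" by (rule L2_bound(1)[OF m i b])
  have "(norm2 (\<lambda>x. V x * u x))\<^sup>2 \<le> (Vm * norm2 u)\<^sup>2"
    using L2_bound(2)[OF m i b] by (simp add: L2_norm_square power_mult_distrib)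
  then show "norm2 (\<lambda>x. V x * u x) \<le> Vm * norm2 u"
    by (rule power2_le_imp_le) (simp add: Vm_nonneg)
qed

text \<open>From the integrated equation to the form sense. The equation says that the weak
  derivative of \<open>g\<close> is known, and pairing it with \<open>v\<close> in
  \<open>H1_0\<close> performs the integration by parts without a boundary term.\<close>

lemma solves_primitive:
  assumes u: "primitive_of u g" "u 1 = 0" "u \<in> L2 {1..}"
    and g: "primitive_of g (\<lambda>x. (V x - z) * u x - f x)" "g \<in> L2 {1..}" and f: "f \<in> L2 {1..}"
  shows "solves V z u f"
proof -
  let ?k = "\<lambda>x. (V x - z) * u x - f x"
  have gc: "continuous_on {1..} g" by (rule primitive_of_continuous[OF g(1)])
  have uH: "u \<in> H1_0" by (rule H1_0_primitive[OF u(1) gc u(2,3) g(2)])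
  have VuL: "(\<lambda>x. V x * u x) \<in> L2 {1..}" by (rule V_mult_L2[OF u(3)])
  have zuL: "(\<lambda>x. f x + z * u x) \<in> L2 {1..}" by (intro L2_add f L2_cmult(1) u)
  have k: "?k = (\<lambda>x. V x * u x - (f x + z * u x))" by (auto simp: algebra_simps)
  have kL: "?k \<in> L2 {1..}" unfolding k by (rule L2_diff[OF VuL zuL])
  have wg: "has_weak_Dx g (\<lambda>x. - \<i> * ?k x)" by (rule has_weak_Dx_primitive[OF g(1) kL])
  have igL: "(\<lambda>x. - \<i> * g x) \<in> L2 {1..}" by (rule L2_cmult(1)[OF g(2)])
  have wig: "has_weak_Dx (\<lambda>x. - \<i> * g x) (\<lambda>x. (- 1) * ?k x)"
    unfolding has_weak_Dx_def
  proof (intro conjI ballI)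
    show "(\<lambda>x. (- 1) * ?k x) \<in> L2 {1..}" by (rule L2_cmult(1)[OF kL])
    fix \<phi> assume "\<phi> \<in> test_funs"
    then have "inner2 g (Dx UNIV \<phi>) = inner2 (\<lambda>x. - \<i> * ?k x) \<phi>"
      using wg by (simp add: has_weak_Dx_def)
    then show "inner2 (\<lambda>x. - \<i> * g x) (Dx UNIV \<phi>) = inner2 (\<lambda>x. (- 1) * ?k x) \<phi>"
      unfolding L2_inner_cmult by (simp add: L2_inner_cmult mult.assoc[symmetric])
  qed
  have wu: "AE x in half_line 1. weak_Dx u x = - \<i> * g x"
    by (rule weak_Dx_AE[OF u(3) has_weak_Dx_primitive[OF u(1) g(2)]])
  have "form_Q V u v = inner2 (\<lambda>x. f x + z * u x) v" if v: "v \<in> H1_0" for v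
  proof -
    note vL = H1_L2[OF H1_0_H1[OF v]]
    have "inner2 (weak_Dx u) (weak_Dx v) = inner2 (\<lambda>x. - \<i> * g x) (weak_Dx v)"
      by (rule L2_inner_cong_AE[OF L2_meas[OF H1_L2(2)[OF H1_0_H1[OF uH]]] L2_meas[OF igL]
            L2_meas[OF vL(2)] L2_meas[OF vL(2)] wu]) simp
    also have "\<dots> = inner2 (\<lambda>x. (- 1) * ?k x) v" by (rule H1_0_weak_pairing[OF wig igL v])
    also have "\<dots> = - (inner2 (\<lambda>x. V x * u x) v - inner2 (\<lambda>x. f x + z * u x) v)"
      unfolding L2_inner_cmult k L2_inner_diff(1)[OF VuL zuL vL(1)] by simp
    finally show ?thesis by (simp add: form_Q_def)
  qed
  then show ?thesis using uH zuL by (simp add: solves_def P_graph_def)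
qed

text \<open>Test the form with \<open>u\<close> itself. Without V the identity involves
  \<open>a\<^sup>2 - z\<^sup>2 * n\<^sup>2\<close>, whose size is at least the square of
  \<open>Im z\<close> times \<open>n\<^sup>2\<close>; the complex potential is treated as a bounded
  perturbation.\<close>

lemma solves_estimate:
  assumes s: "solves V (z\<^sup>2) u f" and f: "f \<in> L2 {1..}" and Im: "Im z \<ge> 0"
  shows "((Im z)\<^sup>2 - Vm) * norm2 u \<le> norm2 f"
    "(norm2 (weak_Dx u))\<^sup>2 \<le> ((norm z)\<^sup>2 + Vm) * (norm2 u)\<^sup>2 + norm2 f * norm2 u"
proof -
  have uH: "u \<in> H1_0" and eq: "form_Q V u u = inner2 (\<lambda>x. f x + z\<^sup>2 * u x) u"
    using s by (auto simp: solves_def P_graph_def)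
  note uL = H1_L2[OF H1_0_H1[OF uH]]
  define n where "n = norm2 u"
  define a where "a = norm2 (weak_Dx u)"
  define F where "F = norm2 f"
  have n0: "n \<ge> 0" by (simp add: n_def)
  have "of_real (a\<^sup>2) + inner2 (\<lambda>x. V x * u x) u = inner2 f u + z\<^sup>2 * of_real (n\<^sup>2)"
    using eq unfolding form_Q_def L2_inner_add[OF f L2_cmult(1)[OF uL(1)] uL(1)] L2_inner_cmult L2_inner_self
    by (simp add: a_def n_def)
  then have e: "of_real (a\<^sup>2) - z\<^sup>2 * of_real (n\<^sup>2) = inner2 f u - inner2 (\<lambda>x. V x * u x) u"
    by (simp add: algebra_simps)
  have "norm (inner2 (\<lambda>x. V x * u x) u) \<le> (Vm * n) * n"
    using L2_Cauchy_Schwarz[OF V_mult_L2(1)[OF uL(1)] uL(1)] mult_right_mono[OF V_mult_L2(2)[OF uL(1)] n0]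
    by (simp add: n_def)
  moreover have "norm (inner2 f u) \<le> F * n"
    using L2_Cauchy_Schwarz[OF f uL(1)] by (simp add: F_def n_def)
  ultimately have b: "norm (of_real (a\<^sup>2) - z\<^sup>2 * of_real (n\<^sup>2)) \<le> F * n + Vm * n\<^sup>2"
    unfolding e using norm_triangle_ineq4[of "inner2 f u" "inner2 (\<lambda>x. V x * u x) u"]
    by (simp add: power2_eq_square mult.assoc)
  show "((Im z)\<^sup>2 - Vm) * norm2 u \<le> norm2 f"
  proof (cases "n = 0")
    case False
    then have np: "n > 0" using n0 by simp
    \<comment> \<open>Dividing by \<open>n\<^sup>2\<close> exhibits the distance from
      \<open>z\<^sup>2\<close> to the nonnegative number
      \<open>a\<^sup>2 / n\<^sup>2\<close>.\<close>
    have "of_real (a\<^sup>2) - z\<^sup>2 * of_real (n\<^sup>2) = of_real (n\<^sup>2) * (of_real (a\<^sup>2 / n\<^sup>2) - z\<^sup>2)"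
      using np by (simp add: field_simps)
    then have "norm (of_real (a\<^sup>2) - z\<^sup>2 * of_real (n\<^sup>2)) = n\<^sup>2 * norm (of_real (a\<^sup>2 / n\<^sup>2) - z\<^sup>2)"
      by (simp only: norm_mult norm_of_real abs_power2)
    moreover have "n\<^sup>2 * (Im z)\<^sup>2 \<le> n\<^sup>2 * norm (of_real (a\<^sup>2 / n\<^sup>2) - z\<^sup>2)"
      by (intro mult_left_mono dist_square_nonneg_axis Im) auto
    ultimately have "n\<^sup>2 * (Im z)\<^sup>2 \<le> F * n + Vm * n\<^sup>2" using b by linarith
    then have "n * (((Im z)\<^sup>2 - Vm) * n) \<le> n * F" by (simp add: power2_eq_square algebra_simps)
    then have "((Im z)\<^sup>2 - Vm) * n \<le> F" using np by simp
    then show ?thesis by (simp add: n_def F_def)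
  qed (simp add: n_def)
  have "a\<^sup>2 = norm (complex_of_real (a\<^sup>2))" by (simp only: norm_of_real abs_power2)
  also have "\<dots> \<le> norm (of_real (a\<^sup>2) - z\<^sup>2 * of_real (n\<^sup>2)) + norm (z\<^sup>2 * of_real (n\<^sup>2))"
    using norm_triangle_ineq[of "of_real (a\<^sup>2) - z\<^sup>2 * of_real (n\<^sup>2)" "z\<^sup>2 * of_real (n\<^sup>2)"] by simp
  also have "norm (z\<^sup>2 * of_real (n\<^sup>2)) = (norm z)\<^sup>2 * n\<^sup>2"
    by (simp only: norm_mult norm_of_real abs_power2 norm_power)
  finally show "(norm2 (weak_Dx u))\<^sup>2 \<le> ((norm z)\<^sup>2 + Vm) * (norm2 u)\<^sup>2 + norm2 f * norm2 u"
    using b by (simp add: a_def n_def F_def algebra_simps)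
qed

text \<open>The difference of two solutions solves the homogeneous problem, for which the energy
  estimate forces norm zero.\<close>

lemma solves_unique:
  assumes u: "solves V (z\<^sup>2) u f" and v: "solves V (z\<^sup>2) v f" and Im: "Im z \<ge> 0" "(Im z)\<^sup>2 > Vm"
  shows "eq_ae u v"
proof -
  have H: "u \<in> H1_0" "v \<in> H1_0" using u v by (auto simp: solves_def P_graph_def)
  note uL = H1_L2[OF H1_0_H1[OF H(1)]] and vL = H1_L2[OF H1_0_H1[OF H(2)]]
  have fuL: "(\<lambda>x. f x + z\<^sup>2 * u x) \<in> L2 {1..}" "(\<lambda>x. f x + z\<^sup>2 * v x) \<in> L2 {1..}"
    using u v by (auto simp: solves_def P_graph_def)
  let ?d = "\<lambda>x. u x - v x"
  note d = H1_0_diff[OF H]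
  have dL: "?d \<in> L2 {1..}" by (rule L2_diff[OF uL(1) vL(1)])
  have "form_Q V ?d w = inner2 (\<lambda>x. 0 + z\<^sup>2 * ?d x) w" if w: "w \<in> H1_0" for w
  proof -
    note wL = H1_L2[OF H1_0_H1[OF w]]
    have "inner2 (weak_Dx ?d) (weak_Dx w) = inner2 (\<lambda>x. weak_Dx u x - weak_Dx v x) (weak_Dx w)"
      by (rule L2_inner_cong_AE[OF L2_meas[OF H1_L2(2)[OF H1_0_H1[OF d(1)]]] L2_meas[OF L2_diff[OF uL(2) vL(2)]]
            L2_meas[OF wL(2)] L2_meas[OF wL(2)] d(2)]) simp
    also have "\<dots> = inner2 (weak_Dx u) (weak_Dx w) - inner2 (weak_Dx v) (weak_Dx w)"
      by (rule L2_inner_diff(1)[OF uL(2) vL(2) wL(2)])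
    moreover have "inner2 (\<lambda>x. V x * ?d x) w =
        inner2 (\<lambda>x. V x * u x) w - inner2 (\<lambda>x. V x * v x) w"
      using L2_inner_diff(1)[OF V_mult_L2(1)[OF uL(1)] V_mult_L2(1)[OF vL(1)] wL(1)]
      by (simp add: right_diff_distrib)
    moreover have "inner2 (\<lambda>x. 0 + z\<^sup>2 * ?d x) w =
        inner2 (\<lambda>x. f x + z\<^sup>2 * u x) w - inner2 (\<lambda>x. f x + z\<^sup>2 * v x) w"
      using L2_inner_diff(1)[OF fuL wL(1)] by (simp add: right_diff_distrib)
    moreover have "inner2 (\<lambda>x. f x + z\<^sup>2 * u x) w = form_Q V u w"
      "inner2 (\<lambda>x. f x + z\<^sup>2 * v x) w = form_Q V v w"
      using u v w by (auto simp: solves_def P_graph_def)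
    ultimately show ?thesis by (simp add: form_Q_def add_diff_add)
  qed
  moreover have "(\<lambda>x. 0 + z\<^sup>2 * ?d x) \<in> L2 {1..}" using L2_cmult(1)[OF dL] by simp
  ultimately have "solves V (z\<^sup>2) ?d (\<lambda>_. 0)" using d(1) by (simp add: solves_def P_graph_def)
  moreover have "(\<lambda>_. 0) \<in> L2 {1..}" "norm2 (\<lambda>_. 0) = 0" by (simp_all add: L2_def L2_norm_def)
  ultimately have "((Im z)\<^sup>2 - Vm) * norm2 ?d \<le> 0"
    using solves_estimate(1)[of z ?d "\<lambda>_. 0"] Im by simp
  then have "norm2 ?d = 0" using Im by (simp add: mult_le_0_iff order_antisym)
  from L2_norm_zero_AE[OF dL this] show ?thesis
    unfolding eq_ae_def by eventually_elim simp
qed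

definition sine_moment :: "complex \<Rightarrow> cfun \<Rightarrow> cfun" where
  "sine_moment z f x = integral {1..x} (\<lambda>y. sine z y * f y)"

definition cosine_moment :: "complex \<Rightarrow> cfun \<Rightarrow> cfun" where
  "cosine_moment z f x = integral {1..x} (\<lambda>y. cosine z y * f y)"

text \<open>Variation of constants for \<open>- u'' + V u - z\<^sup>2 u = f\<close> with
  \<open>u 1 = 0\<close> and free initial slope \<open>A\<close>.\<close>

definition forced :: "complex \<Rightarrow> complex \<Rightarrow> cfun \<Rightarrow> cfun" where
  "forced z A f x = sine z x * (A - cosine_moment z f x) + cosine z x * sine_moment z f x"

definition forced' :: "complex \<Rightarrow> complex \<Rightarrow> cfun \<Rightarrow> cfun" where
  "forced' z A f x = sine' z x * (A - cosine_moment z f x) + cosine' z x * sine_moment z f x"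

lemma forced_primitive:
  assumes f: "f \<in> L2 {1..}"
  shows "primitive_of (forced z A f) (forced' z A f)"
    "primitive_of (forced' z A f) (\<lambda>x. (V x - z\<^sup>2) * forced z A f x - f x)"
    "forced z A f 1 = 0" "forced' z A f 1 = A"
proof -
  let ?z = "z\<^sup>2"
  let ?F1 = "sine_moment z f" and ?F2 = "cosine_moment z f"
  note S = ivp_sol_schroedinger[of z 0 1] and C = ivp_sol_schroedinger[of z 1 0]
  note cS = schroedinger_sol_continuous[OF S] and cC = schroedinger_sol_continuous[OF C]
  have dS: "(sine z has_vector_derivative sine' z y) (at y within {1..x})"
    "(sine' z has_vector_derivative (V y - ?z) * sine z y) (at y within {1..x})"
    "(cosine z has_vector_derivative cosine' z y) (at y within {1..x})"
    "(cosine' z has_vector_derivative (V y - ?z) * cosine z y) (at y within {1..x})" if "y \<in> {1..x}" for x y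
    using S C that unfolding schroedinger_sol_def by (auto intro: has_vector_derivative_within_subset)
  have cV: "continuous_on {1..x} (\<lambda>y. (V y - ?z) * sine z y)" "continuous_on {1..x} (\<lambda>y. (V y - ?z) * cosine z y)"
    "continuous_on {1..x} (sine' z)" "continuous_on {1..x} (cosine' z)"
    "continuous_on {1..x} (sine z)" "continuous_on {1..x} (cosine z)" for x
    by (intro continuous_intros continuous_on_subset[OF cS(1)] continuous_on_subset[OF cC(1)]
        continuous_on_subset[OF cS(2)] continuous_on_subset[OF cC(2)] continuous_on_subset[OF continuous_V]; auto)+
  have fi: "integrable (lebesgue_on {1..x}) f" for x by (rule L2_interval_integrable[OF f])
  have init: "?F1 1 = 0" "?F2 1 = 0" by (auto simp: sine_moment_def cosine_moment_def)
  show f1: "forced z A f 1 = 0" "forced' z A f 1 = A"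
    by (simp_all add: forced_def forced'_def init ivp_initial)
  have sf: "integrable (lebesgue_on {1..x}) (\<lambda>y. sine z y * f y)" "integrable (lebesgue_on {1..x}) (\<lambda>y. cosine z y * f y)"
    if "1 \<le> x" for x
    by (rule integral_by_parts_primitive(2)[OF that dS(1) cV(3) fi] integral_by_parts_primitive(2)[OF that dS(3) cV(4) fi],
        assumption)+
  \<comment> \<open>The product rule for \<open>a * (A - F2) + c * F1\<close> in integrated form. It
    is used with the solutions and then with their derivatives: in the first case the coefficient of
    \<open>f\<close> vanishes, in the second it is the Wronskian up to sign.\<close>
  have gen: "integrable (lebesgue_on {1..x}) (\<lambda>y. (a' y * (A - ?F2 y) + c' y * ?F1 y) + (c y * sine z y - a y * cosine z y) * f y)"
    "a x * (A - ?F2 x) + c x * ?F1 x = (a 1 * A) + integral {1..x} (\<lambda>y. (a' y * (A - ?F2 y) + c' y * ?F1 y) + (c y * sine z y - a y * cosine z y) * f y)"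
    if x: "1 \<le> x" and a: "\<And>y. y \<in> {1..x} \<Longrightarrow> (a has_vector_derivative a' y) (at y within {1..x})" "continuous_on {1..x} a'"
      and c: "\<And>y. y \<in> {1..x} \<Longrightarrow> (c has_vector_derivative c' y) (at y within {1..x})" "continuous_on {1..x} c'"
    for a a' c c' x
  proof -
    note A1 = integral_by_parts_primitive[OF x a sf(2)[OF x], folded cosine_moment_def]
    note C1 = integral_by_parts_primitive[OF x c sf(1)[OF x], folded sine_moment_def]
    have ia: "integrable (lebesgue_on {1..x}) a'" "(LINT y|lebesgue_on {1..x}. a' y) = a x - a 1"
    proof -
      show "integrable (lebesgue_on {1..x}) a'" by (rule lebesgue_on_interval_integral(1)[OF a(2)])
      show "(LINT y|lebesgue_on {1..x}. a' y) = a x - a 1"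
        unfolding lebesgue_on_interval_integral(2)[OF a(2)]
        by (intro integral_unique fundamental_theorem_of_calculus x a)
    qed
    let ?h = "\<lambda>y. (a' y * A - (a' y * ?F2 y + a y * (cosine z y * f y))) + (c' y * ?F1 y + c y * (sine z y * f y))"
    have h: "(\<lambda>y. (a' y * (A - ?F2 y) + c' y * ?F1 y) + (c y * sine z y - a y * cosine z y) * f y) = ?h"
      by (auto simp: algebra_simps)
    have ih: "integrable (lebesgue_on {1..x}) ?h"
      by (intro Bochner_Integration.integrable_add Bochner_Integration.integrable_diff integrable_mult_left ia A1 C1)
    then show "integrable (lebesgue_on {1..x}) (\<lambda>y. (a' y * (A - ?F2 y) + c' y * ?F1 y) + (c y * sine z y - a y * cosine z y) * f y)"
      unfolding h .
    have "integral {1..x} ?h = (LINT y|lebesgue_on {1..x}. ?h y)"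
      by (rule lebesgue_integral_eq_integral[OF ih, symmetric]) simp
    also have "\<dots> = ((a x - a 1) * A - a x * ?F2 x) + c x * ?F1 x"
    proof -
      have "(LINT y|lebesgue_on {1..x}. ?h y) = ((LINT y|lebesgue_on {1..x}. a' y * A)
          - ((LINT y|lebesgue_on {1..x}. a' y * ?F2 y) + (LINT y|lebesgue_on {1..x}. a y * (cosine z y * f y))))
          + ((LINT y|lebesgue_on {1..x}. c' y * ?F1 y) + (LINT y|lebesgue_on {1..x}. c y * (sine z y * f y)))"
        using ia A1(1,2) C1(1,2) by simp
      also have "(LINT y|lebesgue_on {1..x}. a' y * ?F2 y) + (LINT y|lebesgue_on {1..x}. a y * (cosine z y * f y)) = a x * ?F2 x"
        by (rule A1(3))
      also have "(LINT y|lebesgue_on {1..x}. c' y * ?F1 y) + (LINT y|lebesgue_on {1..x}. c y * (sine z y * f y)) = c x * ?F1 x"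
        by (rule C1(3))
      finally show ?thesis using ia by simp
    qed
    finally show "a x * (A - ?F2 x) + c x * ?F1 x = (a 1 * A) + integral {1..x} (\<lambda>y. (a' y * (A - ?F2 y) + c' y * ?F1 y) + (c y * sine z y - a y * cosine z y) * f y)"
      unfolding h by (simp add: algebra_simps)
  qed
  show "primitive_of (forced z A f) (forced' z A f)"
    unfolding primitive_of_def
  proof (intro allI impI)
    fix x :: real assume x: "1 \<le> x"
    note G = gen[OF x dS(1) cV(3) dS(3) cV(4)]
    have e: "(\<lambda>y. (sine' z y * (A - ?F2 y) + cosine' z y * ?F1 y) + (cosine z y * sine z y - sine z y * cosine z y) * f y) = forced' z A f"
      by (auto simp: forced'_def fun_eq_iff)
    show "integrable (lebesgue_on {1..x}) (forced' z A f) \<and> forced z A f x = forced z A f 1 + integral {1..x} (forced' z A f)"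
      using G unfolding e f1 by (simp add: forced_def[of _ _ _ x] ivp_initial)
  qed
  show "primitive_of (forced' z A f) (\<lambda>x. (V x - ?z) * forced z A f x - f x)"
    unfolding primitive_of_def
  proof (intro allI impI)
    fix x :: real assume x: "1 \<le> x"
    note G = gen[OF x dS(2) cV(1) dS(4) cV(2)]
    have e: "((V y - ?z) * sine z y * (A - ?F2 y) + (V y - ?z) * cosine z y * ?F1 y) + (cosine' z y * sine z y - sine' z y * cosine z y) * f y
        = (V y - ?z) * forced z A f y - f y" if "y \<in> {1..x}" for y
    proof -
      have w: "cosine' z y * sine z y - sine' z y * cosine z y = - 1"
        using sine_cosine_wronskian[of y z] that by (simp add: algebra_simps)
      show ?thesis unfolding w by (simp add: forced_def algebra_simps)
    qed
    have i: "integrable (lebesgue_on {1..x}) (\<lambda>x. (V x - ?z) * forced z A f x - f x)"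
      using G(1) by (rule Bochner_Integration.integrable_cong[THEN iffD1, rotated 2]) (auto simp: e)
    moreover have "integral {1..x} (\<lambda>y. ((V y - ?z) * sine z y * (A - ?F2 y) + (V y - ?z) * cosine z y * ?F1 y) + (cosine' z y * sine z y - sine' z y * cosine z y) * f y)
        = integral {1..x} (\<lambda>y. (V y - ?z) * forced z A f y - f y)"
      by (rule Henstock_Kurzweil_Integration.integral_cong) (rule e)
    ultimately show "integrable (lebesgue_on {1..x}) (\<lambda>x. (V x - ?z) * forced z A f x - f x) \<and>
        forced' z A f x = forced' z A f 1 + integral {1..x} (\<lambda>x. (V x - ?z) * forced z A f x - f x)"
      using G(2) unfolding f1 by (simp add: forced'_def[of _ _ _ x] ivp_initial)
  qed
qed

lemma forced_solves:
  assumes "f \<in> L2 {1..}" "forced z A f \<in> L2 {1..}" "forced' z A f \<in> L2 {1..}"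
  shows "solves V (z\<^sup>2) (forced z A f) f"
  by (rule solves_primitive[OF forced_primitive(1)[OF assms(1)] forced_primitive(3)[OF assms(1)] assms(2)
      forced_primitive(2)[OF assms(1)] assms(3,1)])

end

section \<open>The resolvent high in the upper half-plane, from a decaying solution\<close>

locale decaying_solution = bounded_potential V Vm for V Vm +
  fixes z :: complex and U U' :: cfun and K :: real
  assumes U: "schroedinger_sol V (z\<^sup>2) U U'" and U_nonzero: "\<exists>x\<ge>1. U x \<noteq> 0"
    and decay: "x \<ge> 1 \<Longrightarrow> norm (U x) \<le> K * exp (- (x / 2))" "x \<ge> 1 \<Longrightarrow> norm (U' x) \<le> K * exp (- (x / 2))"
    and Im_nonneg: "Im z \<ge> 0" and Im_large: "(Im z)\<^sup>2 > Vm"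
begin

lemma U_continuous: "continuous_on {1..} U" "continuous_on {1..} U'"
  by (rule schroedinger_sol_continuous[OF U])+

lemma U_L2: "U \<in> L2 {1..}" "U' \<in> L2 {1..}"
  by (rule L2_decay[OF U_continuous(1), of 1 K]; simp add: decay)
    (rule L2_decay[OF U_continuous(2), of 1 K]; simp add: decay)

text \<open>If \<open>U 1\<close> were zero, \<open>U\<close> would lie in the domain of the
  Dirichlet operator and solve the homogeneous equation; the energy estimate would make it zero
  everywhere.\<close>

lemma U_1: "U 1 \<noteq> 0"
proof
  assume U1: "U 1 = 0"
  have p: "primitive_of U U'"
    by (rule primitive_of_derivative[OF _ U_continuous(2)]) (use U in \<open>simp add: schroedinger_sol_def\<close>)
  have p': "primitive_of U' (\<lambda>x. (V x - z\<^sup>2) * U x - 0)"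
    by (rule primitive_of_derivative)
      (use U in \<open>auto simp: schroedinger_sol_def intro!: continuous_intros continuous_V U_continuous\<close>)
  have z: "(\<lambda>_. 0) \<in> L2 {1..}" "norm2 (\<lambda>_. 0) = 0" by (simp_all add: L2_def L2_norm_def)
  have "solves V (z\<^sup>2) U (\<lambda>_. 0)" by (rule solves_primitive[OF p U1 U_L2(1) p' U_L2(2) z(1)])
  from solves_estimate(1)[OF this z(1) Im_nonneg]
  have n0: "norm2 U = 0" using Im_large z(2) by (simp add: mult_le_0_iff order_antisym)
  obtain x where x: "x \<ge> 1" "U x \<noteq> 0" using U_nonzero by blast
  have AE: "AE x in half_line 1. (norm (U x))\<^sup>2 = 0"
    using L2_norm_zero_AE[OF U_L2(1) n0] by eventually_elim simp
  \<comment> \<open>The interval reaches beyond \<open>x\<close> because it would be degenerate for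
    \<open>x = 1\<close>, and a single point carries no information about the integral.\<close>
  have c: "continuous_on {1..x + 1} (\<lambda>x. (norm (U x))\<^sup>2)"
    by (intro continuous_intros continuous_on_subset[OF U_continuous(1)]) auto
  have i: "integrable (lebesgue_on {1..x + 1}) (\<lambda>x. (norm (U x))\<^sup>2)"
    by (rule lebesgue_on_interval_integral(1)[OF c])
  have "(LINT y|lebesgue_on {1..x + 1}. (norm (U y))\<^sup>2) =
      (LINT y|half_line 1. (if 1 \<le> y \<and> y \<le> x + 1 then (norm (U y))\<^sup>2 else 0))"
    by (rule half_line_truncate(2)[OF order_refl, symmetric])
  also have "\<dots> = (LINT y|half_line 1. 0)"
  proof (rule integral_cong_AE)
    show "(\<lambda>y. if 1 \<le> y \<and> y \<le> x + 1 then (norm (U y))\<^sup>2 else 0) \<in> half_meas"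
      using i unfolding half_line_truncate(1)[OF order_refl, symmetric] by (rule borel_measurable_integrable)
    show "AE y in half_line 1. (if 1 \<le> y \<and> y \<le> x + 1 then (norm (U y))\<^sup>2 else 0) = 0"
      using AE by eventually_elim simp
  qed simp
  finally have "integral {1..x + 1} (\<lambda>x. (norm (U x))\<^sup>2) = 0"
    by (simp add: lebesgue_on_interval_integral(2)[OF c])
  then have "((\<lambda>x. (norm (U x))\<^sup>2) has_integral 0) (cbox 1 (x + 1))"
    using integrable_integral[OF integrable_continuous_real[OF c]] by simp
  then have "(norm (U x))\<^sup>2 = 0"
    by (rule has_integral_0_cbox_imp_0[rotated 2]) (use c x in auto)
  then show False using x by simp
qed

lemma U_span: "x \<ge> 1 \<Longrightarrow> U x = U 1 * cosine z x + U' 1 * sine z x"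
  "x \<ge> 1 \<Longrightarrow> U' x = U 1 * cosine' z x + U' 1 * sine' z x"
  by (erule sine_cosine_span(1)[OF U]) (erule sine_cosine_span(2)[OF U])

definition coeff :: "cfun \<Rightarrow> complex" where
  "coeff f = (LINT x|half_line 1. U x * f x) / U 1"

text \<open>The slope \<open>coeff f\<close> is the one for which the solution is a multiple of
  \<open>U\<close> beyond the support of \<open>f\<close>; any other slope would add a multiple of
  \<open>sine z\<close>. Decay of \<open>U\<close> then gives square integrability.\<close>

lemma forced_compact:
  assumes f: "f \<in> L2 {1..}" and n: "n \<ge> 1" and z: "\<And>x. x > n \<Longrightarrow> f x = 0"
  shows "solves V (z\<^sup>2) (forced z (coeff f) f) f" "forced z (coeff f) f \<in> L2 {1..}" "forced' z (coeff f) f \<in> L2 {1..}"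
proof -
  let ?A = "coeff f"
  have cS: "continuous_on {1..} (sine z)" "continuous_on {1..} (cosine z)"
    by (rule schroedinger_sol_continuous[OF ivp_sol_schroedinger])+
  have fi: "integrable (lebesgue_on {1..n}) f" by (rule L2_interval_integrable[OF f])
  have mi: "integrable (lebesgue_on {1..n}) (\<lambda>y. sine z y * f y)" "integrable (lebesgue_on {1..n}) (\<lambda>y. cosine z y * f y)"
  proof -
    have d: "(sine z has_vector_derivative sine' z y) (at y within {1..n})"
      "(cosine z has_vector_derivative cosine' z y) (at y within {1..n})" if "y \<in> {1..n}" for y
      using ivp_sol_schroedinger[of z 0 1] ivp_sol_schroedinger[of z 1 0] that unfolding schroedinger_sol_def
      by (auto intro: has_vector_derivative_within_subset)
    have c: "continuous_on {1..n} (sine' z)" "continuous_on {1..n} (cosine' z)"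
      by (rule continuous_on_subset[OF schroedinger_sol_continuous(2)[OF ivp_sol_schroedinger]], simp)+
    show "integrable (lebesgue_on {1..n}) (\<lambda>y. sine z y * f y)" "integrable (lebesgue_on {1..n}) (\<lambda>y. cosine z y * f y)"
      by (rule integral_by_parts_primitive(2)[OF n d(1) c(1) fi] integral_by_parts_primitive(2)[OF n d(2) c(2) fi], assumption)+
  qed
  have mom: "sine_moment z f x = sine_moment z f n" "cosine_moment z f x = cosine_moment z f n" if "x \<ge> n" for x
  proof -
    have "integral {1..x} (\<lambda>y. g y * f y) = integral {1..n} (\<lambda>y. g y * f y)" for g :: cfun
    proof -
      have "integral {1..x} (\<lambda>y. g y * f y) = integral {1..x} (\<lambda>y. if y \<in> {1..n} then g y * f y else 0)"
        by (rule Henstock_Kurzweil_Integration.integral_cong) (use z in auto)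
      also have "\<dots> = integral {1..n} (\<lambda>y. g y * f y)"
        unfolding integral_restrict_Int by (rule arg_cong[where f = "\<lambda>S. integral S _"]) (use that in auto)
      finally show ?thesis .
    qed
    then show "sine_moment z f x = sine_moment z f n" "cosine_moment z f x = cosine_moment z f n"
      by (auto simp: sine_moment_def cosine_moment_def)
  qed
  have A: "?A * U 1 = U 1 * cosine_moment z f n + U' 1 * sine_moment z f n"
  proof -
    have "?A * U 1 = (LINT x|lebesgue_on {1..n}. U x * f x)"
      unfolding coeff_def using U_1 half_line_to_interval[of n "\<lambda>x. U x * f x"] z by simp
    also have "\<dots> = (LINT x|lebesgue_on {1..n}. U 1 * (cosine z x * f x) + U' 1 * (sine z x * f x))"
    proof (intro lint_cong refl)
      fix x assume "x \<in> space (lebesgue_on {1..n})"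
      then have x: "x \<ge> 1" by simp
      show "U x * f x = U 1 * (cosine z x * f x) + U' 1 * (sine z x * f x)"
        unfolding U_span(1)[OF x] by (simp add: algebra_simps)
    qed
    also have "\<dots> = U 1 * cosine_moment z f n + U' 1 * sine_moment z f n"
      using mi by (simp add: sine_moment_def cosine_moment_def lebesgue_integral_eq_integral)
    finally show ?thesis .
  qed
  have A': "?A - cosine_moment z f n = U' 1 * sine_moment z f n / U 1"
    using A U_1 by (simp add: field_simps)
  have far: "forced z ?A f x = sine_moment z f n / U 1 * U x" "forced' z ?A f x = sine_moment z f n / U 1 * U' x" if "x \<ge> n" for x
    using that n U_1 unfolding forced_def forced'_def mom[OF that] A'
    by (simp_all add: U_span[of x] field_simps)
  define K' where "K' = norm (sine_moment z f n / U 1) * K"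
  have b: "norm (forced z ?A f x) \<le> K' * exp (- (x / 2))" "norm (forced' z ?A f x) \<le> K' * exp (- (x / 2))" if "x \<ge> n" for x
    unfolding far[OF that] norm_mult K'_def mult.assoc
    using that n by (auto intro!: mult_left_mono decay)
  have c: "continuous_on {1..} (forced z ?A f)" "continuous_on {1..} (forced' z ?A f)"
    by (rule primitive_of_continuous[OF forced_primitive(1)[OF f]] primitive_of_continuous[OF forced_primitive(2)[OF f]])+
  show L: "forced z ?A f \<in> L2 {1..}" "forced' z ?A f \<in> L2 {1..}"
    by (rule L2_decay[OF c(1) n b(1)] L2_decay[OF c(2) n b(2)], assumption)+
  show "solves V (z\<^sup>2) (forced z ?A f) f" by (rule forced_solves[OF f L])
qed

text \<open>Truncations of \<open>f\<close> fall under the compact case, and the energy estimate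
  bounds their solutions and derivatives uniformly. Slopes and moments converge at each point, so
  the bounds pass to the limit by Fatou.\<close>

lemma forced_general:
  assumes f: "f \<in> L2 {1..}"
  shows "solves V (z\<^sup>2) (forced z (coeff f) f) f"
    "norm2 (forced z (coeff f) f) \<le> norm2 f / ((Im z)\<^sup>2 - Vm)"
proof -
  define F where "F n x = (if x \<le> real n + 1 then f x else 0)" for n x
  have gap: "(Im z)\<^sup>2 - Vm > 0" using Im_large by simp
  have Fm: "F n \<in> half_meas" for n
  proof -
    have [measurable]: "f \<in> half_meas" by (rule L2_meas[OF f])
    have [measurable]: "(\<lambda>x. x) \<in> half_meas" by (rule borel_measurable_half_line) simp
    show ?thesis unfolding F_def[abs_def] by measurable
  qed
  have FL: "F n \<in> L2 {1..}" "norm2 (F n) \<le> norm2 f" for n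
  proof -
    have b: "AE x in half_line 1. (norm (F n x))\<^sup>2 \<le> (norm (f x))\<^sup>2" by (intro AE_I2) (simp add: F_def)
    show "F n \<in> L2 {1..}" by (rule L2_bound(1)[OF Fm L2_integrable[OF f] b])
    have "(norm2 (F n))\<^sup>2 \<le> (norm2 f)\<^sup>2"
      using L2_bound(2)[OF Fm L2_integrable[OF f] b] by (simp add: L2_norm_square)
    then show "norm2 (F n) \<le> norm2 f" by (rule power2_le_imp_le) simp
  qed
  let ?u = "\<lambda>n. forced z (coeff (F n)) (F n)" and ?u' = "\<lambda>n. forced' z (coeff (F n)) (F n)"
  let ?v = "forced z (coeff f) f" and ?v' = "forced' z (coeff f) f"
  have C: "solves V (z\<^sup>2) (?u n) (F n)" "?u n \<in> L2 {1..}" "?u' n \<in> L2 {1..}" for n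
    using forced_compact[OF FL(1)[of n], of "real n + 1"] by (auto simp: F_def)
  define N where "N = norm2 f / ((Im z)\<^sup>2 - Vm)"
  have N0: "N \<ge> 0" using gap by (simp add: N_def)
  have b1: "norm2 (?u n) \<le> N" for n
  proof -
    have "((Im z)\<^sup>2 - Vm) * norm2 (?u n) \<le> norm2 f"
      using solves_estimate(1)[OF C(1) FL(1) Im_nonneg] FL(2)[of n] by (rule order_trans)
    then show ?thesis unfolding N_def using gap by (simp add: pos_le_divide_eq mult.commute)
  qed
  define N' where "N' = sqrt (((norm z)\<^sup>2 + Vm) * N\<^sup>2 + norm2 f * N)"
  have b2: "norm2 (?u' n) \<le> N'" for n
  proof -
    have "norm2 (?u' n) = norm2 (\<lambda>x. - \<i> * ?u' n x)" unfolding L2_cmult(2) by simp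
    also have "\<dots> = norm2 (weak_Dx (?u n))"
    proof (rule L2_norm_cong_AE)
      have w: "has_weak_Dx (?u n) (\<lambda>x. - \<i> * ?u' n x)"
        by (rule has_weak_Dx_primitive[OF forced_primitive(1)[OF FL(1)] C(3)])
      show "(\<lambda>x. - \<i> * ?u' n x) \<in> half_meas" by (rule L2_meas[OF L2_cmult(1)[OF C(3)]])
      show "weak_Dx (?u n) \<in> half_meas"
        using C(1)[of n] by (intro L2_meas H1_L2(2) H1_0_H1) (simp add: solves_def P_graph_def)
      show "AE x in half_line 1. - \<i> * ?u' n x = weak_Dx (?u n) x"
        using weak_Dx_AE[OF C(2) w] by eventually_elim simp
    qed
    finally have e: "norm2 (?u' n) = norm2 (weak_Dx (?u n))" .
    have "(norm2 (?u' n))\<^sup>2 \<le> ((norm z)\<^sup>2 + Vm) * (norm2 (?u n))\<^sup>2 + norm2 (F n) * norm2 (?u n)"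
      unfolding e by (rule solves_estimate(2)[OF C(1) FL(1) Im_nonneg])
    also have "\<dots> \<le> ((norm z)\<^sup>2 + Vm) * N\<^sup>2 + norm2 f * N"
      using b1[of n] FL(2)[of n] Vm_nonneg by (intro add_mono mult_mono mult_left_mono power_mono) auto
    finally show ?thesis unfolding N'_def by (rule real_le_rsqrt)
  qed
  have UF: "integrable (half_line 1) (\<lambda>x. U x * f x)" by (rule L2_product(2)[OF U_L2(1) f])
  have "(\<lambda>n. LINT x|half_line 1. U x * F n x) \<longlonglongrightarrow> (LINT x|half_line 1. U x * f x)"
  proof (rule integral_dominated_convergence[OF _ _ integrable_norm[OF UF]])
    show "(\<lambda>x. U x * f x) \<in> half_meas" by (rule borel_measurable_integrable[OF UF])
    show "(\<lambda>x. U x * F n x) \<in> half_meas" for n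
      by (rule borel_measurable_times[OF L2_meas[OF U_L2(1)] Fm])
    show "AE x in half_line 1. norm (U x * F n x) \<le> norm (U x * f x)" for n
      by (intro AE_I2) (simp add: F_def)
    show "AE x in half_line 1. (\<lambda>n. U x * F n x) \<longlonglongrightarrow> U x * f x"
    proof (intro AE_I2 tendsto_eventually)
      fix x
      obtain N where "real N \<ge> x" using real_arch_simple by blast
      then have "U x * F n x = U x * f x" if "n \<ge> N" for n using that by (simp add: F_def)
      then show "eventually (\<lambda>n. U x * F n x = U x * f x) sequentially" by (auto simp: eventually_sequentially)
    qed
  qed
  then have clim: "(\<lambda>n. coeff (F n)) \<longlonglongrightarrow> coeff f"
    unfolding coeff_def by (intro tendsto_divide tendsto_const U_1)
  have ev: "eventually (\<lambda>n. sine_moment z (F n) x = sine_moment z f x \<and> cosine_moment z (F n) x = cosine_moment z f x) sequentially" for x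
  proof -
    obtain N where N: "real N \<ge> x" using real_arch_simple by blast
    have "sine_moment z (F n) x = sine_moment z f x \<and> cosine_moment z (F n) x = cosine_moment z f x" if "n \<ge> N" for n
      unfolding sine_moment_def cosine_moment_def
      by (intro conjI Henstock_Kurzweil_Integration.integral_cong) (use N that in \<open>auto simp: F_def\<close>)
    then show ?thesis by (auto simp: eventually_sequentially)
  qed
  have lim1: "(\<lambda>n. ?u n x) \<longlonglongrightarrow> ?v x" for x
  proof (rule Lim_transform_eventually)
    show "(\<lambda>n. sine z x * (coeff (F n) - cosine_moment z f x) + cosine z x * sine_moment z f x) \<longlonglongrightarrow> ?v x"
      unfolding forced_def by (intro tendsto_intros clim)
    show "eventually (\<lambda>n. sine z x * (coeff (F n) - cosine_moment z f x) + cosine z x * sine_moment z f x = ?u n x) sequentially"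
      using ev[of x] by eventually_elim (simp add: forced_def)
  qed
  have lim2: "(\<lambda>n. ?u' n x) \<longlonglongrightarrow> ?v' x" for x
  proof (rule Lim_transform_eventually)
    show "(\<lambda>n. sine' z x * (coeff (F n) - cosine_moment z f x) + cosine' z x * sine_moment z f x) \<longlonglongrightarrow> ?v' x"
      unfolding forced'_def by (intro tendsto_intros clim)
    show "eventually (\<lambda>n. sine' z x * (coeff (F n) - cosine_moment z f x) + cosine' z x * sine_moment z f x = ?u' n x) sequentially"
      using ev[of x] by eventually_elim (simp add: forced'_def)
  qed
  have m: "?v \<in> half_meas" "?v' \<in> half_meas"
    by (rule continuous_borel_measurable_half_line[OF primitive_of_continuous[OF forced_primitive(1)[OF f]]]
        continuous_borel_measurable_half_line[OF primitive_of_continuous[OF forced_primitive(2)[OF f]]])+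
  note L1 = L2_Fatou[OF C(2) b1 m(1) lim1]
  note L2' = L2_Fatou[OF C(3) b2 m(2) lim2]
  show "norm2 ?v \<le> norm2 f / ((Im z)\<^sup>2 - Vm)" using L1(2) by (simp add: N_def)
  show "solves V (z\<^sup>2) ?v f" by (rule forced_solves[OF f L1(1) L2'(1)])
qed

lemma invertible: "P_minus_invertible V (z\<^sup>2)"
  unfolding P_minus_invertible_def
proof (intro exI[of _ "1 / ((Im z)\<^sup>2 - Vm)"] ballI)
  fix f assume f: "f \<in> L2 {1..}"
  show "\<exists>u. solves V (z\<^sup>2) u f \<and> (\<forall>u'. solves V (z\<^sup>2) u' f \<longrightarrow> eq_ae u' u) \<and>
      norm2 u \<le> 1 / ((Im z)\<^sup>2 - Vm) * norm2 f"
    using forced_general[OF f] solves_unique[OF _ forced_general(1)[OF f] Im_nonneg Im_large]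
    by (intro exI[of _ "forced z (coeff f) f"]) simp
qed

lemma resolvent_eq: "f \<in> L2 {1..} \<Longrightarrow> eq_ae (forced z (coeff f) f) (resolvent V z f)"
  unfolding resolvent_def
  using solves_unique[OF forced_general(1)[of f] someI[where P = "\<lambda>u. solves V (z\<^sup>2) u f", OF forced_general(1)[of f]] Im_nonneg Im_large]
  by blast

end

section \<open>Integral operators with locally bounded kernels\<close>

definition kernel_op :: "(real \<Rightarrow> cfun) \<Rightarrow> cfun \<Rightarrow> cfun" where
  "kernel_op k f x = (LINT y|half_line 1. k x y * f y)"

definition loc_kernel :: "(real \<Rightarrow> cfun) \<Rightarrow> bool" where
  "loc_kernel k \<longleftrightarrow> case_prod k \<in> half_meas2 \<and>
     (\<forall>r>1. \<exists>C. \<forall>x\<in>{1..r}. \<forall>y\<in>{1..r}. norm (k x y) \<le> C)"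

definition loc_fun :: "cfun \<Rightarrow> bool" where
  "loc_fun u \<longleftrightarrow> u \<in> half_meas \<and> (\<forall>r>1. \<exists>C. \<forall>x\<in>{1..r}. norm (u x) \<le> C)"

lemma L2_bounded_interval:
  assumes g: "g \<in> half_meas" and s: "s > 1" and b: "\<And>x. x \<in> {1..s} \<Longrightarrow> norm (g x) \<le> K"
  shows "g \<in> L2 {1..s}" "L2_norm {1..s} g \<le> sqrt s * K"
proof -
  have K: "K \<ge> 0" by (rule order_trans[OF norm_ge_zero b[of 1]]) (use s in simp)
  have m: "g \<in> borel_measurable (lebesgue_on {1..s})" by (rule measurable_restrict_mono[OF g]) auto
  have c: "continuous_on {1..s} (\<lambda>_. K\<^sup>2)" by simp
  note i = lebesgue_on_interval_integral[OF c]
  have le: "AE x in lebesgue_on {1..s}. (norm (g x))\<^sup>2 \<le> K\<^sup>2"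
    by (rule AE_I2) (use b in \<open>auto intro!: power_mono\<close>)
  show "g \<in> L2 {1..s}" by (rule L2_bound(1)[OF m i(1) le])
  have "(L2_norm {1..s} g)\<^sup>2 \<le> (s - 1) * K\<^sup>2"
    using L2_bound(2)[OF m i(1) le] s unfolding i(2) by simp
  also have "\<dots> \<le> s * K\<^sup>2" by (intro mult_right_mono) auto
  also have "\<dots> = (sqrt s * K)\<^sup>2" using s by (simp add: power_mult_distrib)
  finally show "L2_norm {1..s} g \<le> sqrt s * K" by (rule power2_le_imp_le) (use K s in simp)
qed

lemma L2_supp_integrable:
  assumes f: "f \<in> L2_supp r" and r: "r > 1"
  shows "integrable (half_line 1) f" "(LINT y|half_line 1. norm (f y)) \<le> sqrt r * L2_norm {1..r} f"
proof -
  have fL: "f \<in> L2 {1..}" and z: "AE x in half_line 1. x > r \<longrightarrow> f x = 0" using f by (auto simp: L2_supp_def)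
  have m: "f \<in> half_meas" by (rule L2_meas[OF fL])
  have i: "integrable (half_line 1) (\<lambda>y. if 1 \<le> y \<and> y \<le> r then f y else 0)"
    unfolding half_line_truncate(1)[OF order_refl] by (rule L2_interval_integrable[OF fL])
  have e: "AE y in half_line 1. (if 1 \<le> y \<and> y \<le> r then f y else 0) = f y"
    using z AE_space by eventually_elim auto
  show fi: "integrable (half_line 1) f" by (rule integrable_cong_AE_imp[OF i m e])
  have "(LINT y|half_line 1. norm (f y)) = (LINT y|half_line 1. norm (if 1 \<le> y \<and> y \<le> r then f y else 0))"
  proof (rule integral_cong_AE)
    show "(\<lambda>y. norm (f y)) \<in> half_meas" using m by measurable
    show "(\<lambda>y. norm (if 1 \<le> y \<and> y \<le> r then f y else 0)) \<in> half_meas"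
      by (rule borel_measurable_integrable[OF integrable_norm[OF i]])
    show "AE y in half_line 1. norm (f y) = norm (if 1 \<le> y \<and> y \<le> r then f y else 0)"
      using e by eventually_elim simp
  qed
  also have "\<dots> = (LINT y|half_line 1. (if 1 \<le> y \<and> y \<le> r then norm (f y) else 0))"
    by (intro lint_cong refl) simp
  also have "\<dots> = (LINT y|lebesgue_on {1..r}. norm (f y) * norm (1::complex))"
    unfolding half_line_truncate(2)[OF order_refl] by simp
  also have "\<dots> \<le> L2_norm {1..r} f * L2_norm {1..r} (\<lambda>_. 1)"
    by (rule L2_product(3)[OF L2_restrict[OF fL] L2_bounded_interval(1)[OF _ r, where K = 1]]) auto
  also have "\<dots> \<le> L2_norm {1..r} f * (sqrt r * 1)"
    by (intro mult_left_mono L2_bounded_interval(2)[OF _ r]) auto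
  finally show "(LINT y|half_line 1. norm (f y)) \<le> sqrt r * L2_norm {1..r} f" by (simp add: mult.commute)
qed

lemma L2_compE:
  assumes "f \<in> L2_comp"
  obtains r where "r > 1" "f \<in> L2_supp r"
  using assms by (auto simp: L2_comp_def)

lemma L2_supp_mono: "f \<in> L2_supp r \<Longrightarrow> r \<le> s \<Longrightarrow> f \<in> L2_supp s"
  unfolding L2_supp_def by (auto elim: eventually_mono)

lemma L2_supp_meas: "f \<in> L2_supp r \<Longrightarrow> f \<in> half_meas"
  by (auto simp: L2_supp_def L2_def)

lemma kernel_measurable_section:
  assumes "case_prod k \<in> half_meas2" "x \<ge> 1"
  shows "k x \<in> half_meas"
  using measurable_compose[OF measurable_Pair1'[of x "half_line 1" "half_line 1"] assms(1)] assms(2) by simp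

lemma kernel_op_bound:
  assumes k: "case_prod k \<in> half_meas2"
    and C: "\<And>x y. x \<in> {1..r} \<Longrightarrow> y \<in> {1..r} \<Longrightarrow> norm (k x y) \<le> C"
    and f: "f \<in> L2_supp r" and r: "r > 1" and x: "x \<in> {1..r}"
  shows "integrable (half_line 1) (\<lambda>y. k x y * f y)" "norm (kernel_op k f x) \<le> C * (sqrt r * L2_norm {1..r} f)"
proof -
  note F = L2_supp_integrable[OF f r]
  have C0: "C \<ge> 0" by (rule order_trans[OF norm_ge_zero C[of 1 1]]) (use r in auto)
  have i: "integrable (half_line 1) (\<lambda>y. C * norm (f y))" by (rule integrable_mult_right[OF integrable_norm[OF F(1)]])
  have m: "(\<lambda>y. k x y * f y) \<in> half_meas"
    by (rule borel_measurable_times[OF kernel_measurable_section[OF k] L2_supp_meas[OF f]]) (use x in simp)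
  have z: "AE y in half_line 1. y > r \<longrightarrow> f y = 0" using f by (simp add: L2_supp_def)
  have b: "AE y in half_line 1. norm (k x y * f y) \<le> C * norm (f y)"
    using z AE_space
  proof eventually_elim
    case (elim y)
    then show ?case using C[OF x, of y] C0 by (cases "y > r") (auto simp: norm_mult intro!: mult_right_mono)
  qed
  have b': "AE y in half_line 1. norm (k x y * f y) \<le> norm (C * norm (f y))"
    using b C0 by simp
  show ki: "integrable (half_line 1) (\<lambda>y. k x y * f y)" by (rule integrable_le[OF i m b'])
  have "norm (kernel_op k f x) \<le> (LINT y|half_line 1. norm (k x y * f y))"
    unfolding kernel_op_def by (rule integral_norm_bound)
  also have "\<dots> \<le> (LINT y|half_line 1. C * norm (f y))"
    by (rule integral_mono_AE[OF integrable_norm[OF ki] i b])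
  also have "\<dots> \<le> C * (sqrt r * L2_norm {1..r} f)" using F(2) C0 by (simp add: mult_left_mono)
  finally show "norm (kernel_op k f x) \<le> C * (sqrt r * L2_norm {1..r} f)" .
qed

lemma kernel_op_integrable:
  assumes k: "loc_kernel k" and f: "f \<in> L2_comp" and x: "x \<ge> 1"
  shows "integrable (half_line 1) (\<lambda>y. k x y * f y)"
proof -
  obtain r where r: "r > 1" "f \<in> L2_supp r" by (rule L2_compE[OF f])
  have s: "max r x > 1" using r by simp
  obtain C where C: "\<And>x' y. x' \<in> {1..max r x} \<Longrightarrow> y \<in> {1..max r x} \<Longrightarrow> norm (k x' y) \<le> C"
    using k s unfolding loc_kernel_def by blast
  show ?thesis
    using k x by (intro kernel_op_bound(1)[OF _ C L2_supp_mono[OF r(2)] s]) (auto simp: loc_kernel_def)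
qed

lemma kernel_op_measurable:
  assumes k: "case_prod k \<in> half_meas2" and f: "f \<in> half_meas"
  shows "kernel_op k f \<in> half_meas"
  unfolding kernel_op_def[abs_def]
proof (rule sigma_finite_measure.borel_measurable_lebesgue_integral[OF sigma_finite_half_line])
  have "(\<lambda>p. case_prod k p * f (snd p)) \<in> half_meas2"
    by (rule borel_measurable_times[OF k measurable_compose[OF measurable_snd f]])
  then show "(\<lambda>(x, y). k x y * f y) \<in> half_meas2"
    by (simp add: case_prod_beta')
qed

lemma comp_loc_op_kernel:
  assumes k: "loc_kernel k"
  shows "comp_loc_op (kernel_op k)"
proof -
  have km: "case_prod k \<in> half_meas2" using k by (simp add: loc_kernel_def)
  have bd: "\<exists>C. \<forall>x\<in>{1..r}. \<forall>y\<in>{1..r}. norm (k x y) \<le> C" if "r > 1" for r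
    using k that by (simp add: loc_kernel_def)
  show ?thesis
    unfolding comp_loc_op_def
  proof (intro conjI ballI allI impI)
    fix f assume f: "f \<in> L2_comp"
    obtain r where r: "r > 1" "f \<in> L2_supp r" by (rule L2_compE[OF f])
    show "kernel_op k f \<in> L2_loc"
      unfolding L2_loc_def
    proof (rule INT_I)
      fix s :: real assume s: "s \<in> {1<..}"
      have t: "max r s > 1" using r by simp
      obtain C where C: "\<And>x y. x \<in> {1..max r s} \<Longrightarrow> y \<in> {1..max r s} \<Longrightarrow> norm (k x y) \<le> C" using bd[OF t] by blast
      show "kernel_op k f \<in> L2 {1..s}"
        by (rule L2_bounded_interval(1)[OF kernel_op_measurable[OF km L2_supp_meas[OF r(2)]] _
              kernel_op_bound(2)[OF km C L2_supp_mono[OF r(2)] t]]) (use s in auto)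
    qed
  next
    fix f g c assume f: "f \<in> L2_comp" and g: "g \<in> L2_comp"
    have "kernel_op k (\<lambda>x. f x + c * g x) x = kernel_op k f x + c * kernel_op k g x" if "x \<ge> 1" for x
    proof -
      have "kernel_op k (\<lambda>x. f x + c * g x) x = (LINT y|half_line 1. k x y * f y + c * (k x y * g y))"
        unfolding kernel_op_def by (simp add: algebra_simps)
      then show ?thesis
        using kernel_op_integrable[OF k f that] kernel_op_integrable[OF k g that] by (simp add: kernel_op_def)
    qed
    then show "eq_ae (kernel_op k (\<lambda>x. f x + c * g x)) (\<lambda>x. kernel_op k f x + c * kernel_op k g x)"
      unfolding eq_ae_def by (intro AE_I2) simp
  next
    fix r :: real assume r: "1 < r"
    obtain C where C: "\<And>x y. x \<in> {1..r} \<Longrightarrow> y \<in> {1..r} \<Longrightarrow> norm (k x y) \<le> C" using bd[OF r] by blast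
    have "L2_norm {1..r} (kernel_op k f) \<le> (sqrt r * C * sqrt r) * L2_norm {1..r} f" if f: "f \<in> L2_supp r" for f
      using L2_bounded_interval(2)[OF kernel_op_measurable[OF km L2_supp_meas[OF f]] r kernel_op_bound(2)[OF km C f r]]
      by (simp add: mult.assoc)
    then show "\<exists>C. \<forall>f\<in>L2_supp r. L2_norm {1..r} (kernel_op k f) \<le> C * L2_norm {1..r} f" by blast
  qed
qed

lemma loc_kernel_add:
  assumes "loc_kernel k" "loc_kernel l"
  shows "loc_kernel (\<lambda>x y. k x y + l x y)"
  unfolding loc_kernel_def
proof (intro conjI allI impI)
  show "(\<lambda>(x, y). k x y + l x y) \<in> half_meas2"
    using assms borel_measurable_add[of "case_prod k" _ "case_prod l"] by (auto simp: loc_kernel_def case_prod_beta')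
  fix r :: real assume "1 < r"
  then obtain C D where "\<forall>x\<in>{1..r}. \<forall>y\<in>{1..r}. norm (k x y) \<le> C" "\<forall>x\<in>{1..r}. \<forall>y\<in>{1..r}. norm (l x y) \<le> D"
    using assms unfolding loc_kernel_def by meson
  then show "\<exists>C. \<forall>x\<in>{1..r}. \<forall>y\<in>{1..r}. norm (k x y + l x y) \<le> C"
    by (intro exI[of _ "C + D"] ballI norm_triangle_mono) auto
qed

lemma measurable_product_kernel:
  fixes u v :: cfun
  assumes "u \<in> half_meas" "v \<in> half_meas"
  shows "(\<lambda>(x, y). u x * v y) \<in> half_meas2"
  unfolding case_prod_beta'
  by (rule borel_measurable_times[OF measurable_compose[OF measurable_fst assms(1)] measurable_compose[OF measurable_snd assms(2)]])

lemma loc_kernel_product: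
  assumes "loc_fun u" "loc_fun v"
  shows "loc_kernel (\<lambda>x y. u x * v y)"
  unfolding loc_kernel_def
proof (intro conjI allI impI)
  show "(\<lambda>(x, y). u x * v y) \<in> half_meas2"
    using assms by (intro measurable_product_kernel) (auto simp: loc_fun_def)
  fix r :: real assume r: "1 < r"
  then obtain C D where C: "\<forall>x\<in>{1..r}. norm (u x) \<le> C" and D: "\<forall>x\<in>{1..r}. norm (v x) \<le> D"
    using assms unfolding loc_fun_def by meson
  have "0 \<le> C" using C[rule_format, of 1] r by (intro order_trans[OF norm_ge_zero[of "u 1"]]) simp
  then show "\<exists>C. \<forall>x\<in>{1..r}. \<forall>y\<in>{1..r}. norm (u x * v y) \<le> C"
    using C D unfolding norm_mult by (intro exI[of _ "C * D"] ballI mult_mono) auto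
qed

text \<open>Finite sums of products, as an inductive predicate: finite rank and local boundedness
  follow by rule induction, and sums need no index sets.\<close>

inductive separable :: "(real \<Rightarrow> cfun) \<Rightarrow> bool" where
  product: "loc_fun u \<Longrightarrow> loc_fun v \<Longrightarrow> separable (\<lambda>x y. u x * v y)"
| add: "separable k \<Longrightarrow> separable l \<Longrightarrow> separable (\<lambda>x y. k x y + l x y)"

lemma separable_loc_kernel: "separable k \<Longrightarrow> loc_kernel k"
  by (induction rule: separable.induct) (auto intro: loc_kernel_add loc_kernel_product)

lemma finite_rank_add:
  assumes "finite_rank A" "finite_rank B" "\<And>f. f \<in> L2_comp \<Longrightarrow> eq_ae (C f) (\<lambda>x. A f x + B f x)"
  shows "finite_rank C"
proof -
  obtain S where S: "finite S" "S \<subseteq> L2_loc" "\<And>f. f \<in> L2_comp \<Longrightarrow> \<exists>c. eq_ae (A f) (\<lambda>x. \<Sum>b\<in>S. c b * b x)"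
    using assms(1) unfolding finite_rank_def by blast
  obtain T where T: "finite T" "T \<subseteq> L2_loc" "\<And>f. f \<in> L2_comp \<Longrightarrow> \<exists>c. eq_ae (B f) (\<lambda>x. \<Sum>b\<in>T. c b * b x)"
    using assms(2) unfolding finite_rank_def by blast
  show ?thesis
    unfolding finite_rank_def
  proof (intro exI[of _ "S \<union> T"] conjI ballI)
    fix f assume f: "f \<in> L2_comp"
    obtain c d where c: "eq_ae (A f) (\<lambda>x. \<Sum>b\<in>S. c b * b x)" and d: "eq_ae (B f) (\<lambda>x. \<Sum>b\<in>T. d b * b x)"
      using S(3)[OF f] T(3)[OF f] by blast
    \<comment> \<open>The two spanning sets may overlap, so coefficients are added on the
      intersection.\<close>
    let ?e = "\<lambda>b. (if b \<in> S then c b else 0) + (if b \<in> T then d b else 0)"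
    have s: "(\<Sum>b\<in>S \<union> T. ?e b * b x) = (\<Sum>b\<in>S. c b * b x) + (\<Sum>b\<in>T. d b * b x)" for x :: real
    proof -
      have "(\<Sum>b\<in>S \<union> T. ?e b * b x) = (\<Sum>b\<in>S \<union> T. (if b \<in> S then c b * b x else 0)) + (\<Sum>b\<in>S \<union> T. (if b \<in> T then d b * b x else 0))"
        unfolding sum.distrib[symmetric] by (intro sum.cong refl) (auto simp: algebra_simps)
      also have "(\<Sum>b\<in>S \<union> T. (if b \<in> S then c b * b x else 0)) = (\<Sum>b\<in>S. c b * b x)"
        using S(1) T(1) by (subst sum.inter_restrict[symmetric]) (auto intro!: sum.cong)
      also have "(\<Sum>b\<in>S \<union> T. (if b \<in> T then d b * b x else 0)) = (\<Sum>b\<in>T. d b * b x)"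
        using S(1) T(1) by (subst sum.inter_restrict[symmetric]) (auto intro!: sum.cong)
      finally show ?thesis .
    qed
    have "eq_ae (C f) (\<lambda>x. \<Sum>b\<in>S \<union> T. ?e b * b x)"
      using c d assms(3)[OF f] unfolding eq_ae_def s by eventually_elim simp
    then show "\<exists>c. eq_ae (C f) (\<lambda>x. \<Sum>b\<in>S \<union> T. c b * b x)" by (rule exI[of _ ?e])
  qed (use S T in auto)
qed

lemma kernel_op_add:
  assumes "loc_kernel k" "loc_kernel l" "f \<in> L2_comp" "x \<ge> 1"
  shows "kernel_op (\<lambda>x y. k x y + l x y) f x = kernel_op k f x + kernel_op l f x"
  using kernel_op_integrable[OF assms(1,3,4)] kernel_op_integrable[OF assms(2,3,4)]
  by (simp add: kernel_op_def distrib_right)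

lemma separable_finite_rank: "separable k \<Longrightarrow> finite_rank (kernel_op k)"
proof (induction rule: separable.induct)
  case (product u v)
  have e: "kernel_op (\<lambda>x y. u x * v y) f x = (LINT y|half_line 1. v y * f y) * u x" for f x
    unfolding kernel_op_def mult.assoc by (simp add: mult.commute[of _ "u x"])
  have "u \<in> L2_loc" unfolding L2_loc_def
  proof (rule INT_I)
    fix s :: real assume s: "s \<in> {1<..}"
    then obtain C where "\<forall>x\<in>{1..s}. norm (u x) \<le> C" using product(1) by (auto simp: loc_fun_def)
    then show "u \<in> L2 {1..s}"
      using product(1) s by (intro L2_bounded_interval(1)[where K = C]) (auto simp: loc_fun_def)
  qed
  then show ?case
    unfolding finite_rank_def ext[OF e]
  proof (intro exI[of _ "{u}"] conjI ballI)
    show "\<exists>c. eq_ae (\<lambda>x. (LINT y|half_line 1. v y * f y) * u x) (\<lambda>x. \<Sum>b\<in>{u}. c b * b x)" for f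
      by (rule exI[of _ "\<lambda>_. LINT y|half_line 1. v y * f y"]) (simp add: eq_ae_def)
  qed auto
next
  case (add k l)
  show ?case
    by (rule finite_rank_add[OF add.IH]) (use add in \<open>auto simp: eq_ae_def kernel_op_add separable_loc_kernel intro!: AE_I2\<close>)
qed

section \<open>Holomorphic and meromorphic families of kernels\<close>

definition fun_family :: "(complex \<Rightarrow> cfun) \<Rightarrow> complex set \<Rightarrow> bool" where
  "fun_family u U \<longleftrightarrow> (\<forall>z\<in>U. u z \<in> half_meas) \<and>
     (\<forall>x\<ge>1. (\<lambda>z. u z x) holomorphic_on U) \<and>
     (\<forall>r>1. \<exists>C. \<forall>z\<in>U. \<forall>x\<in>{1..r}. norm (u z x) \<le> C)"

text \<open>Conditions at fixed x and y that imply holomorphy in operator norm; the bound is uniform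
  in z so that Cauchy estimates hold uniformly in x and y.\<close>

definition kernel_family :: "(complex \<Rightarrow> real \<Rightarrow> cfun) \<Rightarrow> complex set \<Rightarrow> bool" where
  "kernel_family k U \<longleftrightarrow>
     (\<forall>z\<in>U. case_prod (k z) \<in> half_meas2) \<and>
     (\<forall>x\<ge>1. \<forall>y\<ge>1. (\<lambda>z. k z x y) holomorphic_on U) \<and>
     (\<forall>r>1. \<exists>C. \<forall>z\<in>U. \<forall>x\<in>{1..r}. \<forall>y\<in>{1..r}. norm (k z x y) \<le> C)"

lemma deriv_measurable:
  fixes F :: "complex \<Rightarrow> 'a \<Rightarrow> complex"
  assumes U: "open U" "z \<in> U" and F: "\<And>z. z \<in> U \<Longrightarrow> F z \<in> borel_measurable M"
    and hol: "\<And>x. x \<in> space M \<Longrightarrow> (\<lambda>z. F z x) holomorphic_on U"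
  shows "(\<lambda>x. deriv (\<lambda>z. F z x) z) \<in> borel_measurable M"
proof -
  obtain e where e: "e > 0" "ball z e \<subseteq> U" using openE[OF U] by blast
  define h where "h n = complex_of_real (e / (real n + 2))" for n
  have hU: "z + h n \<in> U" and h0: "h n \<noteq> 0" for n
  proof -
    have "norm (h n) = e / (real n + 2)" unfolding h_def norm_of_real using e(1) by simp
    also have "\<dots> < e" using e(1) by (simp add: pos_divide_less_eq algebra_simps add_pos_nonneg)
    finally have "z + h n \<in> ball z e" by (simp add: dist_norm)
    then show "z + h n \<in> U" using e(2) by blast
    have "real n + 2 \<noteq> 0" by linarith
    then show "h n \<noteq> 0" unfolding h_def of_real_eq_0_iff using e(1) by simp
  qed
  have "(\<lambda>n. e / (real n + 2)) \<longlonglongrightarrow> 0"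
    by (intro real_tendsto_divide_at_top[OF tendsto_const] filterlim_at_top_mono[OF filterlim_real_sequentially]) auto
  then have "h \<longlonglongrightarrow> of_real 0" unfolding h_def[abs_def] by (rule tendsto_of_real)
  then have lim: "filterlim h (at 0) sequentially" using h0 by (auto simp: filterlim_at)
  show ?thesis
  proof (rule borel_measurable_LIMSEQ_metric)
    show "(\<lambda>x. (F (z + h n) x - F z x) / h n) \<in> borel_measurable M" for n
      by (intro borel_measurable_divide borel_measurable_diff F hU U(2)) simp
    fix x assume "x \<in> space M"
    then have "((\<lambda>z. F z x) has_field_derivative deriv (\<lambda>z. F z x) z) (at z)"
      by (intro holomorphic_derivI[OF hol U])
    then have "((\<lambda>w. (F (z + w) x - F z x) / w) \<longlongrightarrow> deriv (\<lambda>z. F z x) z) (at 0)"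
      by (simp add: DERIV_def)
    then show "(\<lambda>n. (F (z + h n) x - F z x) / h n) \<longlonglongrightarrow> deriv (\<lambda>z. F z x) z"
      by (rule filterlim_compose[OF _ lim])
  qed
qed

lemma higher_deriv_bound:
  assumes hol: "f holomorphic_on ball z d" and d: "d > 0" and C: "\<And>w. w \<in> ball z d \<Longrightarrow> norm (f w) \<le> C"
  shows "norm ((deriv ^^ n) f z) \<le> fact n * C / (d / 2) ^ n"
proof (rule Cauchy_inequality)
  show "f holomorphic_on ball z (d / 2)" by (rule holomorphic_on_subset[OF hol]) (use d in auto)
  show "continuous_on (cball z (d / 2)) f"
    by (rule continuous_on_subset[OF holomorphic_on_imp_continuous_on[OF hol]]) (use d in auto)
  show "0 < d / 2" using d by simp
  fix w assume "norm (z - w) = d / 2"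
  then show "norm (f w) \<le> C" using d by (intro C) (simp add: dist_norm)
qed

text \<open>Second-order Taylor formula with Cauchy's bound for the second derivative. The constant
  depends only on \<open>C\<close> and \<open>d\<close>, hence not on further variables of a
  kernel.\<close>

lemma difference_quotient_estimate:
  assumes hol: "f holomorphic_on ball z d" and d: "d > 0" and C: "\<And>w. w \<in> ball z d \<Longrightarrow> norm (f w) \<le> C"
    and \<mu>: "\<mu> \<in> ball z (d / 2)" "\<mu> \<noteq> z"
  shows "norm ((f \<mu> - f z) / (\<mu> - z) - deriv f z) \<le> 2 * C / (d / 4)\<^sup>2 * norm (\<mu> - z)"
proof -
  let ?S = "ball z (d / 2)"
  have sub: "ball x (d / 2) \<subseteq> ball z d" if "x \<in> ?S" for x
  proof
    fix w assume "w \<in> ball x (d / 2)"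
    then show "w \<in> ball z d" using that dist_triangle[of z w x] by simp
  qed
  have S: "?S \<subseteq> ball z d" using d by auto
  have "norm ((deriv ^^ 0) f \<mu> - (\<Sum>i\<le>1. (deriv ^^ i) f z * (\<mu> - z) ^ i / fact i)) \<le> 2 * C / (d / 4)\<^sup>2 * norm (\<mu> - z) ^ Suc 1 / fact 1"
  proof (rule complex_Taylor[of ?S])
    fix i x assume x: "x \<in> ?S"
    have "(deriv ^^ i) f holomorphic_on ball z d" by (rule holomorphic_higher_deriv[OF hol open_ball])
    then have "((deriv ^^ i) f has_field_derivative deriv ((deriv ^^ i) f) x) (at x)"
      by (rule holomorphic_derivI[OF _ open_ball]) (use x S in blast)
    then show "((deriv ^^ i) f has_field_derivative (deriv ^^ Suc i) f x) (at x within ?S)"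
      by (simp add: has_field_derivative_at_within)
  next
    fix x assume x: "x \<in> ?S"
    have "norm ((deriv ^^ 2) f x) \<le> fact 2 * C / (d / 2 / 2) ^ 2"
      by (rule higher_deriv_bound[OF holomorphic_on_subset[OF hol sub[OF x]]]) (use d C sub[OF x] in auto)
    then show "norm ((deriv ^^ Suc 1) f x) \<le> 2 * C / (d / 4)\<^sup>2" by (simp add: numeral_2_eq_2)
  qed (use \<mu> d in auto)
  then have "norm (f \<mu> - (f z + deriv f z * (\<mu> - z))) \<le> 2 * C / (d / 4)\<^sup>2 * (norm (\<mu> - z) * norm (\<mu> - z))"
    by simp
  moreover have "(f \<mu> - f z) / (\<mu> - z) - deriv f z = (f \<mu> - (f z + deriv f z * (\<mu> - z))) / (\<mu> - z)"
    using \<mu>(2) by (simp add: field_simps)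
  ultimately show ?thesis using \<mu>(2) by (simp add: norm_divide pos_divide_le_eq mult.assoc)
qed

lemma kernel_family_loc_kernel: "kernel_family k U \<Longrightarrow> z \<in> U \<Longrightarrow> loc_kernel (k z)"
  unfolding kernel_family_def loc_kernel_def by blast

lemma fun_family_loc_fun: "fun_family u U \<Longrightarrow> z \<in> U \<Longrightarrow> loc_fun (u z)"
  unfolding fun_family_def loc_fun_def by blast

text \<open>The derivative operator has the derivative of the kernel as its kernel. The error kernel
  is O(|\<mu> - z|) uniformly on bounded squares, and a bounded kernel on such a square has small
  operator norm.\<close>

lemma kernel_family_holomorphic:
  assumes U: "open U" and k: "kernel_family k U"
  shows "holomorphic_family (\<lambda>z. kernel_op (k z)) U"
  unfolding holomorphic_family_def
proof (intro ballI conjI)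
  fix z assume z: "z \<in> U"
  show "comp_loc_op (kernel_op (k z))" by (rule comp_loc_op_kernel[OF kernel_family_loc_kernel[OF k z]])
  obtain d where d: "d > 0" "ball z d \<subseteq> U" using openE[OF U z] by blast
  have hol: "(\<lambda>z. k z x y) holomorphic_on ball z d" if "x \<ge> 1" "y \<ge> 1" for x y
    using k that by (intro holomorphic_on_subset[OF _ d(2)]) (auto simp: kernel_family_def)
  have bd: "\<exists>C. \<forall>\<mu>\<in>U. \<forall>x\<in>{1..r}. \<forall>y\<in>{1..r}. norm (k \<mu> x y) \<le> C" if "r > 1" for r
    using k that by (simp add: kernel_family_def)
  have km: "case_prod (k \<mu>) \<in> half_meas2" if "\<mu> \<in> U" for \<mu>
    using k that by (simp add: kernel_family_def)
  define D where "D x y = deriv (\<lambda>z. k z x y) z" for x y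
  have Dm: "case_prod D \<in> half_meas2"
  proof -
    have "(\<lambda>p. deriv (\<lambda>z. case_prod (k z) p) z) \<in> half_meas2"
      by (rule deriv_measurable[OF open_ball[of z d]]) (use d km hol in \<open>auto simp: space_pair_measure\<close>)
    then show ?thesis by (simp add: D_def case_prod_beta')
  qed
  have D: "loc_kernel D"
    unfolding loc_kernel_def
  proof (intro conjI allI impI Dm)
    fix r :: real assume "1 < r"
    from bd[OF this] obtain C where C: "\<And>\<mu> x y. \<mu> \<in> U \<Longrightarrow> x \<in> {1..r} \<Longrightarrow> y \<in> {1..r} \<Longrightarrow> norm (k \<mu> x y) \<le> C" by blast
    have "norm (D x y) \<le> fact 1 * C / (d / 2) ^ 1" if "x \<in> {1..r}" "y \<in> {1..r}" for x y
    proof -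
      have "norm ((deriv ^^ 1) (\<lambda>z. k z x y) z) \<le> fact 1 * C / (d / 2) ^ 1"
        by (rule higher_deriv_bound[OF hol d(1)]) (use that C d(2) in auto)
      then show ?thesis by (simp add: D_def)
    qed
    then show "\<exists>C. \<forall>x\<in>{1..r}. \<forall>y\<in>{1..r}. norm (D x y) \<le> C" by blast
  qed
  show "\<exists>A'. comp_loc_op A' \<and> (\<forall>r>1. \<forall>\<epsilon>>0. \<forall>\<^sub>F \<mu> in at z. \<forall>f\<in>L2_supp r.
      L2_norm {1..r} (\<lambda>x. (kernel_op (k \<mu>) f x - kernel_op (k z) f x) / (\<mu> - z) - A' f x) \<le> \<epsilon> * L2_norm {1..r} f)"
  proof (intro exI[of _ "kernel_op D"] conjI comp_loc_op_kernel D allI impI)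
    fix r \<epsilon> :: real assume r: "1 < r" and \<epsilon>: "0 < \<epsilon>"
    obtain C where C: "\<And>\<mu> x y. \<mu> \<in> U \<Longrightarrow> x \<in> {1..r} \<Longrightarrow> y \<in> {1..r} \<Longrightarrow> norm (k \<mu> x y) \<le> C"
      using bd[OF r] by blast
    define K where "K = 2 * C / (d / 4)\<^sup>2"
    have "C \<ge> 0" by (rule order_trans[OF norm_ge_zero C[OF z, of 1 1]]) (use r in auto)
    then have K: "K \<ge> 0" by (simp add: K_def)
    \<comment> \<open>The first entry keeps \<mu> in the disc of the quotient estimate; the summand
      \<open>1\<close> keeps the denominator of the second positive when \<open>K\<close> is
      zero.\<close>
    define \<delta> where "\<delta> = min (d / 2) (\<epsilon> / (K * r + 1))"
    have Kr: "K * r + 1 > 0" using K r by (simp add: add_nonneg_pos)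
    have main: "L2_norm {1..r} (\<lambda>x. (kernel_op (k \<mu>) f x - kernel_op (k z) f x) / (\<mu> - z) - kernel_op D f x) \<le> \<epsilon> * L2_norm {1..r} f"
      if \<mu>: "\<mu> \<noteq> z" "dist \<mu> z < \<delta>" and f: "f \<in> L2_supp r" for \<mu> f
    proof -
      let ?g = "\<lambda>x. (kernel_op (k \<mu>) f x - kernel_op (k z) f x) / (\<mu> - z) - kernel_op D f x"
      let ?q = "\<lambda>x y. (k \<mu> x y - k z x y) / (\<mu> - z) - D x y"
      have \<mu>b: "\<mu> \<in> ball z (d / 2)" using \<mu>(2) by (simp add: \<delta>_def dist_commute)
      then have \<mu>U: "\<mu> \<in> U" using d by (intro subsetD[OF d(2)]) auto
      have fm: "f \<in> half_meas" by (rule L2_supp_meas[OF f])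
      have fc: "f \<in> L2_comp" using f r by (auto simp: L2_comp_def)
      have gm: "?g \<in> half_meas"
        by (intro borel_measurable_diff borel_measurable_divide kernel_op_measurable km \<mu>U z Dm fm) simp_all
      have "(\<lambda>p. (case_prod (k \<mu>) p - case_prod (k z) p) / (\<mu> - z) - case_prod D p) \<in> half_meas2"
        by (intro borel_measurable_diff borel_measurable_divide km \<mu>U z Dm) simp_all
      then have qm: "case_prod ?q \<in> half_meas2" by (simp add: case_prod_beta')
      have qb: "norm (?q x y) \<le> K * norm (\<mu> - z)" if "x \<in> {1..r}" "y \<in> {1..r}" for x y
        unfolding D_def K_def
        by (rule difference_quotient_estimate[OF hol d(1) _ \<mu>b \<mu>(1)]) (use that C d(2) in auto)
      have e: "?g x = kernel_op ?q f x" if x: "x \<ge> 1" for x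
      proof -
        have "kernel_op ?q f x = (LINT y|half_line 1. (k \<mu> x y * f y - k z x y * f y) / (\<mu> - z) - D x y * f y)"
          unfolding kernel_op_def by (simp add: algebra_simps)
        then show ?thesis
          using kernel_op_integrable[OF kernel_family_loc_kernel[OF k \<mu>U] fc x]
            kernel_op_integrable[OF kernel_family_loc_kernel[OF k z] fc x] kernel_op_integrable[OF D fc x]
          by (simp add: kernel_op_def)
      qed
      have gb: "norm (?g x) \<le> K * norm (\<mu> - z) * (sqrt r * L2_norm {1..r} f)" if "x \<in> {1..r}" for x
        using kernel_op_bound(2)[OF qm qb f r that] e[of x] that by simp
      have "L2_norm {1..r} ?g \<le> sqrt r * (K * norm (\<mu> - z) * (sqrt r * L2_norm {1..r} f))"
        by (rule L2_bounded_interval(2)[OF gm r gb])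
      also have "\<dots> = (sqrt r * sqrt r) * (K * norm (\<mu> - z) * L2_norm {1..r} f)" by (simp only: mult_ac)
      also have "\<dots> = (K * r * norm (\<mu> - z)) * L2_norm {1..r} f" using r by simp
      also have "\<dots> \<le> \<epsilon> * L2_norm {1..r} f"
      proof (rule mult_right_mono)
        have "norm (\<mu> - z) \<le> \<epsilon> / (K * r + 1)" using \<mu>(2) by (simp add: \<delta>_def dist_norm)
        then have "norm (\<mu> - z) * (K * r + 1) \<le> \<epsilon>" using Kr by (simp add: pos_le_divide_eq)
        moreover have "norm (\<mu> - z) * (K * r + 1) = K * r * norm (\<mu> - z) + norm (\<mu> - z)"
          by (simp add: algebra_simps)
        moreover have "norm (\<mu> - z) \<ge> 0" by simp
        ultimately show "K * r * norm (\<mu> - z) \<le> \<epsilon>" by linarith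
      qed simp
      finally show ?thesis .
    qed
    have "\<delta> > 0" using d(1) \<epsilon> Kr by (simp add: \<delta>_def)
    then show "\<forall>\<^sub>F \<mu> in at z. \<forall>f\<in>L2_supp r.
        L2_norm {1..r} (\<lambda>x. (kernel_op (k \<mu>) f x - kernel_op (k z) f x) / (\<mu> - z) - kernel_op D f x) \<le> \<epsilon> * L2_norm {1..r} f"
      unfolding eventually_at using main by (intro exI[of _ \<delta>]) auto
  qed
qed

lemma kernel_family_add:
  assumes k: "kernel_family k U" and l: "kernel_family l U"
  shows "kernel_family (\<lambda>z x y. k z x y + l z x y) U"
  unfolding kernel_family_def
proof (intro conjI ballI allI impI)
  fix z assume "z \<in> U"
  then show "(\<lambda>(x, y). k z x y + l z x y) \<in> half_meas2"
    using loc_kernel_add[OF kernel_family_loc_kernel[OF k] kernel_family_loc_kernel[OF l]] by (simp add: loc_kernel_def)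
next
  fix x y :: real assume "1 \<le> x" "1 \<le> y"
  then show "(\<lambda>z. k z x y + l z x y) holomorphic_on U"
    using k l by (intro holomorphic_intros) (auto simp: kernel_family_def)
next
  fix r :: real assume "1 < r"
  then obtain C D where "\<forall>z\<in>U. \<forall>x\<in>{1..r}. \<forall>y\<in>{1..r}. norm (k z x y) \<le> C"
      "\<forall>z\<in>U. \<forall>x\<in>{1..r}. \<forall>y\<in>{1..r}. norm (l z x y) \<le> D"
    using k l unfolding kernel_family_def by meson
  then show "\<exists>C. \<forall>z\<in>U. \<forall>x\<in>{1..r}. \<forall>y\<in>{1..r}. norm (k z x y + l z x y) \<le> C"
    by (intro exI[of _ "C + D"] ballI norm_triangle_mono) auto
qed

lemma kernel_family_product:
  assumes u: "fun_family u U" and v: "fun_family v U"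
  shows "kernel_family (\<lambda>z x y. u z x * v z y) U"
  unfolding kernel_family_def
proof (intro conjI ballI allI impI)
  fix z assume "z \<in> U"
  then show "(\<lambda>(x, y). u z x * v z y) \<in> half_meas2"
    using u v by (intro measurable_product_kernel) (auto simp: fun_family_def)
next
  fix x y :: real assume "1 \<le> x" "1 \<le> y"
  then show "(\<lambda>z. u z x * v z y) holomorphic_on U"
    using u v by (intro holomorphic_intros) (auto simp: fun_family_def)
next
  fix r :: real assume r: "1 < r"
  then obtain C D where C: "\<forall>z\<in>U. \<forall>x\<in>{1..r}. norm (u z x) \<le> C" and D: "\<forall>z\<in>U. \<forall>x\<in>{1..r}. norm (v z x) \<le> D"
    using u v unfolding fun_family_def by meson
  have "norm (u z x * v z y) \<le> C * D" if "z \<in> U" "x \<in> {1..r}" "y \<in> {1..r}" for z x y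
    unfolding norm_mult using C D that order_trans[OF norm_ge_zero C[rule_format, OF that(1,2)]]
    by (intro mult_mono) auto
  then show "\<exists>C. \<forall>z\<in>U. \<forall>x\<in>{1..r}. \<forall>y\<in>{1..r}. norm (u z x * v z y) \<le> C" by blast
qed

lemma fun_family_const:
  assumes "loc_fun u" shows "fun_family (\<lambda>_. u) U"
  using assms by (auto simp: fun_family_def loc_fun_def)

section \<open>Difference quotients and Laurent expansions of product kernels\<close>

definition quotient_at :: "complex \<Rightarrow> (complex \<Rightarrow> cfun) \<Rightarrow> complex \<Rightarrow> cfun" where
  "quotient_at a u z x = (if z = a then deriv (\<lambda>z. u z x) a else (u z x - u a x) / (z - a))"

text \<open>Filling in the derivative removes the singularity. For the uniform bound, near the
  centre the mean value inequality and Cauchy's estimate are used; elsewhere the denominator is at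
  least half the radius.\<close>

lemma fun_family_quotient:
  assumes u: "fun_family u (ball a \<rho>)" and \<rho>: "\<rho> > 0"
  shows "fun_family (quotient_at a u) (ball a \<rho>)"
proof -
  have a: "a \<in> ball a \<rho>" using \<rho> by simp
  have m: "u z \<in> half_meas" if "z \<in> ball a \<rho>" for z using u that by (simp add: fun_family_def)
  have hol: "(\<lambda>z. u z x) holomorphic_on ball a \<rho>" if "x \<ge> 1" for x using u that by (simp add: fun_family_def)
  show ?thesis
    unfolding fun_family_def
  proof (intro conjI ballI allI impI)
    fix z assume z: "z \<in> ball a \<rho>"
    show "quotient_at a u z \<in> half_meas"
    proof (cases "z = a")
      case True
      have "(\<lambda>x. deriv (\<lambda>z. u z x) a) \<in> half_meas"
        by (rule deriv_measurable[OF open_ball a m]) (auto intro: hol)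
      then show ?thesis using True by (simp add: quotient_at_def[abs_def])
    next
      case False
      have "(\<lambda>x. (u z x - u a x) / (z - a)) \<in> half_meas"
        by (intro borel_measurable_divide borel_measurable_diff m z a) simp_all
      then show ?thesis using False by (simp add: quotient_at_def[abs_def])
    qed
  next
    fix x :: real assume "1 \<le> x"
    then show "(\<lambda>z. quotient_at a u z x) holomorphic_on ball a \<rho>"
      unfolding quotient_at_def by (intro pole_lemma hol) (use a in auto)
  next
    fix r :: real assume r: "1 < r"
    then obtain C where C: "\<And>z x. z \<in> ball a \<rho> \<Longrightarrow> x \<in> {1..r} \<Longrightarrow> norm (u z x) \<le> C"
      using u unfolding fun_family_def by blast
    have C0: "C \<ge> 0" by (rule order_trans[OF norm_ge_zero C[OF a, of 1]]) (use r in auto)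
    have der: "norm (deriv (\<lambda>z. u z x) s) \<le> 4 * C / \<rho>" if x: "x \<in> {1..r}" and s: "s \<in> ball a (\<rho> / 2)" for x s
    proof -
      have sub: "ball s (\<rho> / 2) \<subseteq> ball a \<rho>"
      proof
        fix w assume "w \<in> ball s (\<rho> / 2)"
        then show "w \<in> ball a \<rho>" using s dist_triangle[of a w s] by simp
      qed
      have "norm ((deriv ^^ 1) (\<lambda>z. u z x) s) \<le> fact 1 * C / (\<rho> / 2 / 2) ^ 1"
        by (rule higher_deriv_bound[OF holomorphic_on_subset[OF hol sub]]) (use x \<rho> C sub in auto)
      then show ?thesis by (simp add: mult.commute)
    qed
    have "norm (quotient_at a u z x) \<le> 4 * C / \<rho>" if z: "z \<in> ball a \<rho>" and x: "x \<in> {1..r}" for z x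
    proof (cases "z = a")
      case True
      then show ?thesis using der[OF x, of a] \<rho> by (simp add: quotient_at_def)
    next
      case False
      have "norm (u z x - u a x) \<le> 4 * C / \<rho> * norm (z - a)"
      proof (cases "z \<in> ball a (\<rho> / 2)")
        case True
        have d: "((\<lambda>z. u z x) has_field_derivative deriv (\<lambda>z. u z x) s) (at s within ball a (\<rho> / 2))"
          if "s \<in> ball a (\<rho> / 2)" for s
          by (rule has_field_derivative_at_within[OF holomorphic_derivI[OF hol open_ball]]) (use x that \<rho> in auto)
        show ?thesis
          by (rule field_differentiable_bound[OF convex_ball d der[OF x] True]) (use \<rho> in auto)
      next
        case False
        then have "\<rho> / 2 \<le> norm (z - a)" by (simp add: dist_norm norm_minus_commute)
        then have "4 * C / \<rho> * (\<rho> / 2) \<le> 4 * C / \<rho> * norm (z - a)" using C0 \<rho> by (intro mult_left_mono) auto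
        moreover have "4 * C / \<rho> * (\<rho> / 2) = C + C" using \<rho> by simp
        moreover have "norm (u z x - u a x) \<le> C + C"
          by (rule order_trans[OF norm_triangle_ineq4 add_mono[OF C[OF z x] C[OF a x]]])
        ultimately show ?thesis by linarith
      qed
      then show ?thesis using False by (simp add: quotient_at_def norm_divide pos_divide_le_eq)
    qed
    then show "\<exists>C. \<forall>z\<in>ball a \<rho>. \<forall>x\<in>{1..r}. norm (quotient_at a u z x) \<le> C" by blast
  qed
qed

lemma quotient_at: "z \<noteq> a \<Longrightarrow> u z x = u a x + (z - a) * quotient_at a u z x"
  by (simp add: quotient_at_def)

text \<open>The coefficients of the principal part are sums of products because the difference
  quotient of \<open>u z x * v z y\<close> is a sum of two products.\<close>

lemma product_laurent:
  assumes \<rho>: "\<rho> > 0"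
  shows "fun_family u (ball a \<rho>) \<Longrightarrow> fun_family v (ball a \<rho>) \<Longrightarrow>
    \<exists>k B. kernel_family k (ball a \<rho>) \<and> (\<forall>j. separable (B j)) \<and>
      (\<forall>z\<in>ball a \<rho> - {a}. \<forall>x y.
         u z x * v z y / (z - a) ^ J = k z x y + (\<Sum>j=1..J. B j x y / (z - a) ^ j))"
proof (induction J arbitrary: u v)
  case 0
  have a: "a \<in> ball a \<rho>" using \<rho> by simp
  show ?case
    by (intro exI[of _ "\<lambda>z x y. u z x * v z y"] exI[of _ "\<lambda>_ x y. u a x * v a y"] conjI allI
        kernel_family_product[OF 0] separable.product fun_family_loc_fun[OF 0(1) a] fun_family_loc_fun[OF 0(2) a]) simp
next
  case (Suc J)
  have a: "a \<in> ball a \<rho>" using \<rho> by simp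
  note u0 = fun_family_loc_fun[OF Suc.prems(1) a] and v0 = fun_family_loc_fun[OF Suc.prems(2) a]
  obtain k1 B1 where k1: "kernel_family k1 (ball a \<rho>)" "\<And>j. separable (B1 j)"
      "\<And>z x y. z \<in> ball a \<rho> - {a} \<Longrightarrow>
         quotient_at a u z x * v z y / (z - a) ^ J = k1 z x y + (\<Sum>j=1..J. B1 j x y / (z - a) ^ j)"
    using Suc.IH[OF fun_family_quotient[OF Suc.prems(1) \<rho>] Suc.prems(2)] by blast
  obtain k2 B2 where k2: "kernel_family k2 (ball a \<rho>)" "\<And>j. separable (B2 j)"
      "\<And>z x y. z \<in> ball a \<rho> - {a} \<Longrightarrow>
         u a x * quotient_at a v z y / (z - a) ^ J = k2 z x y + (\<Sum>j=1..J. B2 j x y / (z - a) ^ j)"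
    using Suc.IH[OF fun_family_const[OF u0] fun_family_quotient[OF Suc.prems(2) \<rho>]] by blast
  define B where "B j = (if j = Suc J then (\<lambda>x y. u a x * v a y) else (\<lambda>x y. B1 j x y + B2 j x y))" for j
  show ?case
  proof (intro exI[of _ "\<lambda>z x y. k1 z x y + k2 z x y"] exI[of _ B] conjI allI ballI kernel_family_add k1(1) k2(1))
    show "separable (B j)" for j
      using separable.product[OF u0 v0] separable.add[OF k1(2) k2(2)] by (simp add: B_def)
    fix z x y assume z: "z \<in> ball a \<rho> - {a}"
    let ?w = "z - a"
    have w: "?w \<noteq> 0" using z by simp
    \<comment> \<open>The discrete product rule: each difference quotient lowers the order of the
      pole by one, and the value at the centre gives the coefficient of highest order.\<close>
    have "u z x * v z y = u a x * v a y + ?w * (quotient_at a u z x * v z y + u a x * quotient_at a v z y)"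
    proof -
      have "u z x * v z y = (u a x + ?w * quotient_at a u z x) * v z y"
        using quotient_at[of z a u x] z by simp
      also have "\<dots> = u a x * v z y + ?w * (quotient_at a u z x * v z y)" by (simp add: algebra_simps)
      also have "u a x * v z y = u a x * (v a y + ?w * quotient_at a v z y)"
        using quotient_at[of z a v y] z by simp
      finally show ?thesis by (simp add: algebra_simps)
    qed
    moreover have "(A + ?w * (X + Y)) / ?w ^ Suc J = A / ?w ^ Suc J + (X / ?w ^ J + Y / ?w ^ J)" for A X Y
      using w by (simp add: add_divide_distrib distrib_left)
    ultimately have "u z x * v z y / ?w ^ Suc J = u a x * v a y / ?w ^ Suc J +
        (quotient_at a u z x * v z y / ?w ^ J + u a x * quotient_at a v z y / ?w ^ J)"
      by (simp only:)
    moreover have "(\<Sum>j=1..J. B j x y / ?w ^ j) = (\<Sum>j=1..J. B1 j x y / ?w ^ j) + (\<Sum>j=1..J. B2 j x y / ?w ^ j)"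
      unfolding sum.distrib[symmetric] by (intro sum.cong refl) (simp add: B_def add_divide_distrib)
    moreover have "B (Suc J) x y = u a x * v a y" by (simp add: B_def)
    ultimately show "u z x * v z y / ?w ^ Suc J = k1 z x y + k2 z x y + (\<Sum>j=1..Suc J. B j x y / ?w ^ j)"
      using k1(3)[OF z, of x y] k2(3)[OF z, of x y] by simp
  qed
qed

lemma meromorphic_family_kernelI:
  assumes "\<And>a. a \<in> \<Omega> \<Longrightarrow> \<exists>\<rho>>0. \<exists>J l B. kernel_family l (ball a \<rho>) \<and> (\<forall>j. separable (B j)) \<and>
      (\<forall>z\<in>ball a \<rho> - {a}. \<forall>x\<ge>1. \<forall>y\<ge>1. k z x y = l z x y + (\<Sum>j=1..J::nat. B j x y / (z - a) ^ j))"
  shows "meromorphic_family (\<lambda>z. kernel_op (k z)) \<Omega>"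
  unfolding meromorphic_family_def
proof (rule ballI)
  fix a assume "a \<in> \<Omega>"
  then obtain \<rho> J l B where \<rho>: "\<rho> > 0" and l: "kernel_family l (ball a \<rho>)" and B: "\<And>j. separable (B j)"
    and eq: "\<And>z x y. z \<in> ball a \<rho> - {a} \<Longrightarrow> x \<ge> 1 \<Longrightarrow> y \<ge> 1 \<Longrightarrow>
        k z x y = l z x y + (\<Sum>j=1..J::nat. B j x y / (z - a) ^ j)"
    using assms by meson
  have "kernel_op (k z) f x = kernel_op (l z) f x + (\<Sum>j=1..J. kernel_op (B j) f x / (z - a) ^ j)"
    if z: "z \<in> ball a \<rho> - {a}" and f: "f \<in> L2_comp" and x: "x \<ge> 1" for z f x
  proof -
    have "kernel_op (k z) f x = (LINT y|half_line 1. l z x y * f y + (\<Sum>j=1..J. B j x y * f y / (z - a) ^ j))"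
      unfolding kernel_op_def
      by (intro lint_cong refl) (use z x in \<open>simp add: eq distrib_right sum_distrib_right\<close>)
    moreover have "integrable (half_line 1) (\<lambda>y. l z x y * f y)"
      using z by (intro kernel_op_integrable[OF kernel_family_loc_kernel[OF l] f x]) simp
    moreover have "integrable (half_line 1) (\<lambda>y. B j x y * f y)" for j
      by (rule kernel_op_integrable[OF separable_loc_kernel[OF B] f x])
    ultimately show ?thesis by (simp add: kernel_op_def)
  qed
  then show "\<exists>\<rho>>0. \<exists>J A0 B. holomorphic_family A0 (ball a \<rho>) \<and>
      (\<forall>j\<in>{1..J::nat}. comp_loc_op (B j) \<and> finite_rank (B j)) \<and>
      (\<forall>z\<in>ball a \<rho> - {a}. \<forall>f\<in>L2_comp.
         eq_ae (kernel_op (k z) f) (\<lambda>x. A0 z f x + (\<Sum>j=1..J. B j f x / (z - a) ^ j)))"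
    using \<rho> kernel_family_holomorphic[OF open_ball l] B
    by (intro exI[of _ \<rho>] conjI exI[of _ J] exI[of _ "\<lambda>z. kernel_op (l z)"] exI[of _ "\<lambda>j. kernel_op (B j)"])
      (auto intro!: comp_loc_op_kernel separable_loc_kernel separable_finite_rank AE_I2 simp: eq_ae_def)
qed

section \<open>The continued resolvent\<close>

context bounded_potential
begin

lemma ivp_family: "fun_family (ivp_sol c d) (ball a \<rho>)"
  unfolding fun_family_def
proof (intro conjI ballI allI impI)
  fix z
  show "ivp_sol c d z \<in> half_meas"
    by (rule continuous_borel_measurable_half_line[OF schroedinger_sol_continuous(1)[OF ivp_sol_schroedinger]])
next
  fix x :: real assume "1 \<le> x"
  then show "(\<lambda>z. ivp_sol c d z x) holomorphic_on ball a \<rho>" by (rule ivp_sol_holomorphic)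
next
  fix r :: real assume "1 < r"
  let ?q = "1 + 2 * (Vm + (norm a + \<rho>)\<^sup>2 + 1)"
  have q: "?q \<ge> 0" using Vm_nonneg by (simp add: add_nonneg_nonneg)
  have "norm (ivp_sol c d z x) \<le> 2 * (norm c + norm d) * exp (?q * r)"
    if z: "z \<in> ball a \<rho>" and x: "x \<in> {1..r}" for z x
  proof -
    have "norm z \<le> norm a + \<rho>" using z norm_triangle_sub[of z a] by (simp add: dist_norm norm_minus_commute)
    then have "norm (ivp_sol c d z x) \<le> 2 * (norm c + norm d) * exp (?q * x)"
      using x by (intro ivp_sol_bound) auto
    also have "\<dots> \<le> 2 * (norm c + norm d) * exp (?q * r)"
      using q x by (intro mult_left_mono) (auto intro!: mult_left_mono)
    finally show ?thesis .
  qed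
  then show "\<exists>C. \<forall>z\<in>ball a \<rho>. \<forall>x\<in>{1..r}. norm (ivp_sol c d z x) \<le> C" by blast
qed

lemma ivp_loc_fun: "loc_fun (ivp_sol c d z)"
  by (rule fun_family_loc_fun[OF ivp_family[of c d z 1]]) simp

text \<open>A Green kernel that satisfies the Dirichlet condition and is entire in z, but uses
  \<open>cosine z\<close> instead of the decaying solution at the larger argument.\<close>

definition green_kernel :: "complex \<Rightarrow> real \<Rightarrow> cfun" where
  "green_kernel z x y = (if y \<le> x then cosine z x * sine z y else sine z x * cosine z y)"

lemma green_kernel_family: "kernel_family green_kernel (ball a \<rho>)"
proof -
  have k: "kernel_family (\<lambda>z x y. cosine z x * sine z y) (ball a \<rho>)"
    "kernel_family (\<lambda>z x y. sine z x * cosine z y) (ball a \<rho>)"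
    by (rule kernel_family_product[OF ivp_family ivp_family])+
  show ?thesis
    unfolding kernel_family_def
  proof (intro conjI ballI allI impI)
    fix z assume z: "z \<in> ball a \<rho>"
    have m: "(\<lambda>p. cosine z (fst p) * sine z (snd p)) \<in> half_meas2"
      "(\<lambda>p. sine z (fst p) * cosine z (snd p)) \<in> half_meas2"
      using k z by (auto simp: kernel_family_def case_prod_beta')
    \<comment> \<open>The indicator of the triangle is Borel on the plane; it combines two product
      kernels measurable only for the completed measures.\<close>
    let ?\<chi> = "\<lambda>p :: real \<times> real. (if snd p \<le> fst p then 1 else 0) :: complex"
    have "?\<chi> \<in> borel_measurable (borel \<Otimes>\<^sub>M borel)" by measurable
    from borel_measurable_half_line_pair[OF this]
    have i: "?\<chi> \<in> half_meas2" .
    have "(\<lambda>p. ?\<chi> p * (cosine z (fst p) * sine z (snd p)) + (1 - ?\<chi> p) * (sine z (fst p) * cosine z (snd p)))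
        \<in> half_meas2"
      by (rule borel_measurable_add[OF borel_measurable_times[OF i m(1)]
            borel_measurable_times[OF borel_measurable_diff[OF borel_measurable_const i] m(2)]])
    also have "(\<lambda>p. ?\<chi> p * (cosine z (fst p) * sine z (snd p)) + (1 - ?\<chi> p) * (sine z (fst p) * cosine z (snd p)))
        = case_prod (green_kernel z)"
      by (auto simp: green_kernel_def fun_eq_iff)
    finally show "case_prod (green_kernel z) \<in> half_meas2" .
  next
    fix x y :: real assume "1 \<le> x" "1 \<le> y"
    then show "(\<lambda>z. green_kernel z x y) holomorphic_on ball a \<rho>"
      using k by (cases "y \<le> x") (auto simp: green_kernel_def kernel_family_def)
  next
    fix r :: real assume r: "1 < r"
    then obtain C D where C: "\<forall>z\<in>ball a \<rho>. \<forall>x\<in>{1..r}. \<forall>y\<in>{1..r}. norm (cosine z x * sine z y) \<le> C"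
      and D: "\<forall>z\<in>ball a \<rho>. \<forall>x\<in>{1..r}. \<forall>y\<in>{1..r}. norm (sine z x * cosine z y) \<le> D"
      using k unfolding kernel_family_def by meson
    have "norm (green_kernel z x y) \<le> max C D" if "z \<in> ball a \<rho>" "x \<in> {1..r}" "y \<in> {1..r}" for z x y
      unfolding green_kernel_def
      using C[rule_format, OF that] D[rule_format, OF that] by (simp only: le_max_iff_disj split: if_split) blast
    then show "\<exists>C. \<forall>z\<in>ball a \<rho>. \<forall>x\<in>{1..r}. \<forall>y\<in>{1..r}. norm (green_kernel z x y) \<le> C" by blast
  qed
qed

text \<open>For \<open>m z = U' 1 / U 1\<close> the function \<open>cosine z + m z * sine z\<close>
  is \<open>U / U 1\<close>, so the kernel becomes \<open>sine z\<close> at the smaller argument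
  times the normalised decaying solution at the larger one.\<close>

definition continued_kernel :: "(complex \<Rightarrow> complex) \<Rightarrow> complex \<Rightarrow> real \<Rightarrow> cfun" where
  "continued_kernel m z x y = green_kernel z x y + m z * (sine z x * sine z y)"

lemma continued_kernel_meromorphic:
  assumes m: "\<And>a. a \<in> \<Omega> \<Longrightarrow> \<exists>\<rho>>0. \<exists>J h. h holomorphic_on ball a \<rho> \<and> (\<forall>z\<in>ball a \<rho> - {a}. m z = h z / (z - a) ^ J)"
  shows "meromorphic_family (\<lambda>z. kernel_op (continued_kernel m z)) \<Omega>"
proof (rule meromorphic_family_kernelI)
  fix a assume "a \<in> \<Omega>"
  then obtain \<rho> J h where \<rho>: "\<rho> > 0" and h: "h holomorphic_on ball a \<rho>"
    and mh: "\<And>z. z \<in> ball a \<rho> - {a} \<Longrightarrow> m z = h z / (z - a) ^ J"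
    using m by meson
  \<comment> \<open>On the smaller disc \<open>h\<close> is bounded, by compactness of its closure;
    the families ask for bounds uniform in z.\<close>
  let ?B = "ball a (\<rho> / 2)"
  have "continuous_on (cball a (\<rho> / 2)) h"
    by (rule continuous_on_subset[OF holomorphic_on_imp_continuous_on[OF h]]) (use \<rho> in auto)
  then have "bounded (h ` cball a (\<rho> / 2))" by (intro compact_imp_bounded compact_continuous_image) auto
  then obtain H where H: "\<And>z. z \<in> cball a (\<rho> / 2) \<Longrightarrow> norm (h z) \<le> H" unfolding bounded_iff by blast
  have u: "fun_family (\<lambda>z x. h z * sine z x) ?B"
    unfolding fun_family_def
  proof (intro conjI ballI allI impI)
    show "(\<lambda>x. h z * sine z x) \<in> half_meas" for z
      using ivp_loc_fun[of 0 1 z] by (intro borel_measurable_times) (auto simp: loc_fun_def)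
    show "(\<lambda>z. h z * sine z x) holomorphic_on ?B" if "1 \<le> x" for x
      by (intro holomorphic_on_mult holomorphic_on_subset[OF h] ivp_sol_holomorphic that) (use \<rho> in auto)
    fix r :: real assume r: "1 < r"
    obtain C where C: "\<And>z x. z \<in> ?B \<Longrightarrow> x \<in> {1..r} \<Longrightarrow> norm (sine z x) \<le> C"
      using ivp_family[of 0 1 a "\<rho> / 2"] r unfolding fun_family_def by blast
    have H0: "H \<ge> 0" by (rule order_trans[OF norm_ge_zero H[of a]]) (use \<rho> in simp)
    have "norm (h z * sine z x) \<le> H * C" if "z \<in> ?B" "x \<in> {1..r}" for z x
      unfolding norm_mult by (rule mult_mono[OF H C[OF that] H0]) (use that in auto)
    then show "\<exists>C. \<forall>z\<in>?B. \<forall>x\<in>{1..r}. norm (h z * sine z x) \<le> C" by blast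
  qed
  have \<rho>2: "\<rho> / 2 > 0" using \<rho> by simp
  from product_laurent[OF \<rho>2 u ivp_family[of 0 1], of J]
  obtain k B where k: "kernel_family k ?B" and B: "\<forall>j. separable (B j)"
    and eq: "\<forall>z\<in>?B - {a}. \<forall>x y. h z * sine z x * sine z y / (z - a) ^ J = k z x y + (\<Sum>j=1..J. B j x y / (z - a) ^ j)"
    by blast
  have e: "continued_kernel m z x y = (green_kernel z x y + k z x y) + (\<Sum>j=1..J. B j x y / (z - a) ^ j)"
    if z: "z \<in> ?B - {a}" for z x y
  proof -
    have "m z = h z / (z - a) ^ J" by (rule mh) (use z \<rho> in auto)
    then show ?thesis using eq z by (simp add: continued_kernel_def mult.assoc)
  qed
  show "\<exists>\<rho>>0. \<exists>J l B. kernel_family l (ball a \<rho>) \<and> (\<forall>j. separable (B j)) \<and>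
      (\<forall>z\<in>ball a \<rho> - {a}. \<forall>x\<ge>1. \<forall>y\<ge>1. continued_kernel m z x y = l z x y + (\<Sum>j=1..J::nat. B j x y / (z - a) ^ j))"
    using \<rho>2 B e kernel_family_add[OF green_kernel_family k]
    by (intro exI[of _ "\<rho> / 2"] conjI exI[of _ J] exI[of _ "\<lambda>z x y. green_kernel z x y + k z x y"] exI[of _ B]) auto
qed

end

context decaying_solution
begin

text \<open>Compact support of \<open>f\<close> lets its integrals against \<open>sine z\<close> and
  \<open>cosine z\<close> extend over the whole half-line, which expresses \<open>coeff f\<close>
  through \<open>m z\<close>. Splitting the kernel at \<open>y = x\<close> then reproduces the
  variation-of-constants formula.\<close>

lemma continued_kernel_resolvent:
  assumes m: "m z = U' 1 / U 1" and f: "f \<in> L2_comp"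
  shows "eq_ae (kernel_op (continued_kernel m z) f) (resolvent V z f)"
proof -
  have fL: "f \<in> L2 {1..}" using f by (auto simp: L2_comp_def L2_supp_def)
  have one: "loc_fun (\<lambda>_. 1)" by (auto simp: loc_fun_def)
  have S: "integrable (half_line 1) (\<lambda>y. sine z y * f y)" "integrable (half_line 1) (\<lambda>y. cosine z y * f y)"
    using kernel_op_integrable[OF loc_kernel_product[OF one ivp_loc_fun[of 0 1 z]] f order_refl]
      kernel_op_integrable[OF loc_kernel_product[OF one ivp_loc_fun[of 1 0 z]] f order_refl] by simp_all
  let ?cut = "\<lambda>x (g :: cfun) y. if 1 \<le> y \<and> y \<le> x then g y else 0"
  have cut: "integrable (half_line 1) (?cut x g)" "(LINT y|half_line 1. ?cut x g y) = integral {1..x} g"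
    if "integrable (half_line 1) g" for x g
  proof -
    have i: "integrable (lebesgue_on {1..x}) g" by (rule integrable_lebesgue_on_subset[OF that]) auto
    then show "integrable (half_line 1) (?cut x g)" by (simp only: half_line_truncate(1)[OF order_refl])
    show "(LINT y|half_line 1. ?cut x g y) = integral {1..x} g"
      unfolding half_line_truncate(2)[OF order_refl] by (rule lebesgue_integral_eq_integral[OF i]) simp
  qed
  let ?s = "\<lambda>y. sine z y * f y" and ?c = "\<lambda>y. cosine z y * f y"
  have A: "coeff f = (LINT y|half_line 1. ?c y) + m z * (LINT y|half_line 1. ?s y)"
  proof -
    have "(LINT y|half_line 1. U y * f y) = (LINT y|half_line 1. U 1 * ?c y + U' 1 * ?s y)"
    proof (intro lint_cong refl)
      fix y assume "y \<in> space (half_line 1)"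
      then have y: "y \<ge> 1" by simp
      show "U y * f y = U 1 * ?c y + U' 1 * ?s y" unfolding U_span(1)[OF y] by (simp add: algebra_simps)
    qed
    also have "\<dots> = U 1 * (LINT y|half_line 1. ?c y) + U' 1 * (LINT y|half_line 1. ?s y)"
      using S by simp
    finally show ?thesis using U_1 by (simp add: coeff_def m add_divide_distrib)
  qed
  have "kernel_op (continued_kernel m z) f x = forced z (coeff f) f x" if x: "x \<ge> 1" for x
  proof -
    have "kernel_op (continued_kernel m z) f x = (LINT y|half_line 1.
        cosine z x * ?cut x ?s y + sine z x * (?c y - ?cut x ?c y + m z * ?s y))"
      unfolding kernel_op_def
      by (intro lint_cong refl) (auto simp: continued_kernel_def green_kernel_def algebra_simps)
    also have "\<dots> = cosine z x * (LINT y|half_line 1. ?cut x ?s y) +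
        sine z x * ((LINT y|half_line 1. ?c y) - (LINT y|half_line 1. ?cut x ?c y) + m z * (LINT y|half_line 1. ?s y))"
    proof -
      note cs = cut(1)[OF S(1), of x] and cc = cut(1)[OF S(2), of x]
      have 1: "integrable (half_line 1) (\<lambda>y. cosine z x * ?cut x ?s y)" by (rule integrable_mult_right[OF cs])
      have 2: "integrable (half_line 1) (\<lambda>y. ?c y - ?cut x ?c y)" by (rule Bochner_Integration.integrable_diff[OF S(2) cc])
      have 3: "integrable (half_line 1) (\<lambda>y. m z * ?s y)" by (rule integrable_mult_right[OF S(1)])
      have 4: "integrable (half_line 1) (\<lambda>y. sine z x * (?c y - ?cut x ?c y + m z * ?s y))"
        by (rule integrable_mult_right[OF Bochner_Integration.integrable_add[OF 2 3]])
      show ?thesis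
        unfolding Bochner_Integration.integral_add[OF 1 4] integral_mult_right_zero
          Bochner_Integration.integral_add[OF 2 3] Bochner_Integration.integral_diff[OF S(2) cc] ..
    qed
    also have "\<dots> = forced z (coeff f) f x"
      unfolding cut(2)[OF S(1)] cut(2)[OF S(2)] A forced_def sine_moment_def cosine_moment_def by (simp add: algebra_simps)
    finally show ?thesis .
  qed
  then have "eq_ae (kernel_op (continued_kernel m z) f) (forced z (coeff f) f)"
    unfolding eq_ae_def by (intro AE_I2) simp
  with resolvent_eq[OF fL] show ?thesis unfolding eq_ae_def by eventually_elim simp
qed

end

lemma (in bounded_potential) resolvent_continuation:
  assumes m: "\<And>a. a \<in> \<Omega> \<Longrightarrow> \<exists>\<rho>>0. \<exists>J h. h holomorphic_on ball a \<rho> \<and> (\<forall>z\<in>ball a \<rho> - {a}. m z = h z / (z - a) ^ J)"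
    and U: "\<And>z. Im z > b \<Longrightarrow> z \<in> \<Omega> \<and> (\<exists>U U' K. decaying_solution V Vm z U U' K \<and> m z = U' 1 / U 1)"
  shows "resolvent_continues_meromorphically V \<Omega>"
  unfolding resolvent_continues_meromorphically_def
proof (intro exI conjI allI impI ballI)
  show "meromorphic_family (\<lambda>z. kernel_op (continued_kernel m z)) \<Omega>" by (rule continued_kernel_meromorphic[OF m])
  fix z assume z: "Im z > b"
  then obtain U U' K where D: "decaying_solution V Vm z U U' K" and mU: "m z = U' 1 / U 1" using U by blast
  show "z \<in> \<Omega>" using U[OF z] by simp
  show "P_minus_invertible V (z\<^sup>2)" by (rule decaying_solution.invertible[OF D])
  fix f assume "f \<in> L2_comp"
  then show "eq_ae (kernel_op (continued_kernel m z) f) (resolvent V z f)"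
    by (rule decaying_solution.continued_kernel_resolvent[where m = m, OF D mU])
qed

section \<open>Gluing the quotients over the regions\<close>

lemma open_M_region: "open (M_region t)"
proof -
  have "closed {z. Re z = 0 \<and> Im z \<le> 0}"
    by (intro closed_Collect_conj closed_Collect_eq closed_Collect_le continuous_intros)
  moreover have "open {z. Im z > - t / 2}" by (rule open_halfspace_Im_gt)
  ultimately show ?thesis unfolding M_region_def neg_imag_axis_def by (rule open_Diff[rotated])
qed

text \<open>The region is starlike about \<open>\<i>\<close>: a segment from \<open>\<i>\<close>
  meets the imaginary axis away from \<open>\<i>\<close> only if its other end is on that axis, and
  that end is then in the upper half.\<close>

lemma connected_M_region:
  assumes t: "t > 0"
  shows "connected (M_region t)"
proof (rule starlike_imp_connected, unfold starlike_def, intro bexI[of _ \<i>] ballI subsetI)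
  fix z w assume z: "z \<in> M_region t" and w: "w \<in> closed_segment \<i> z"
  obtain s where s: "0 \<le> s" "s \<le> 1" "w = (1 - s) *\<^sub>R \<i> + s *\<^sub>R z" using w unfolding in_segment by blast
  have re: "Re w = s * Re z" and im: "Im w = (1 - s) + s * Im z" using s(3) by auto
  show "w \<in> M_region t"
  proof (cases "s = 1")
    case False
    then have s1: "s < 1" using s by simp
    have "s * (- t / 2) \<le> s * Im z" using z s by (intro mult_left_mono) (auto simp: M_region_def)
    moreover have "s * (- t / 2) \<ge> - t / 2" using t s by simp
    ultimately have 1: "Im w > - t / 2" using im s1 by linarith
    have "\<not> (Re w = 0 \<and> Im w \<le> 0)"
    proof
      assume h: "Re w = 0 \<and> Im w \<le> 0"
      then have "s \<noteq> 0" using im by auto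
      then have rz: "Re z = 0" using h re by simp
      then have "Im z > 0" using z by (simp add: M_region_def neg_imag_axis_def)
      then have "s * Im z \<ge> 0" using s by simp
      then show False using h im s1 by simp
    qed
    then show ?thesis using 1 by (simp add: M_region_def neg_imag_axis_def)
  qed (use s z in simp)
qed (use t in \<open>simp add: M_region_def neg_imag_axis_def\<close>)

lemma M_region_mono: "s \<le> t \<Longrightarrow> M_region s \<subseteq> M_region t"
  by (auto simp: M_region_def)

lemma upper_half_plane_M_region: "t > 0 \<Longrightarrow> Im z > 0 \<Longrightarrow> z \<in> M_region t"
  by (auto simp: M_region_def neg_imag_axis_def)

text \<open>The cross-multiplied identity has no poles, so it spreads from the upper half-plane over
  the smaller of two regions, which is connected. Dividing by nonzero values then makes the
  quotients agree.\<close>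

lemma glue_quotients:
  fixes p q :: "real \<Rightarrow> complex \<Rightarrow> complex"
  assumes T: "\<And>t. t \<in> T \<Longrightarrow> t > 0" and b: "b \<ge> 0"
    and hol: "\<And>t. t \<in> T \<Longrightarrow> p t holomorphic_on M_region t" "\<And>t. t \<in> T \<Longrightarrow> q t holomorphic_on M_region t"
    and eq: "\<And>s t z. s \<in> T \<Longrightarrow> t \<in> T \<Longrightarrow> Im z > b \<Longrightarrow> q s z * p t z = q t z * p s z"
  obtains m where "\<And>t z. t \<in> T \<Longrightarrow> z \<in> M_region t \<Longrightarrow> p t z \<noteq> 0 \<Longrightarrow> m z = q t z / p t z"
proof -
  have cross: "q s z * p t z = q t z * p s z"
    if s: "s \<in> T" and t: "t \<in> T" and z: "z \<in> M_region s" "z \<in> M_region t" for s t z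
  proof -
    let ?M = "M_region (min s t)"
    have sub: "?M \<subseteq> M_region s" "?M \<subseteq> M_region t" by (auto intro!: M_region_mono)
    have "\<i> * of_real (b + 1) \<in> {z. Im z > b}" by simp
    then have ne: "{z. Im z > b} \<noteq> {}" by blast
    have up: "{z. Im z > b} \<subseteq> ?M"
      using T[OF s] T[OF t] b by (auto intro!: upper_half_plane_M_region)
    show ?thesis
    proof (rule analytic_continuation_open[where f = "\<lambda>z. q s z * p t z" and g = "\<lambda>z. q t z * p s z",
          OF open_halfspace_Im_gt[of b] open_M_region[of "min s t"] ne connected_M_region up])
      show "0 < min s t" using T[OF s] T[OF t] by simp
      show "(\<lambda>z. q s z * p t z) holomorphic_on ?M" "(\<lambda>z. q t z * p s z) holomorphic_on ?M"
        by (intro holomorphic_on_mult holomorphic_on_subset[OF hol(1)[OF s] sub(1)] holomorphic_on_subset[OF hol(1)[OF t] sub(2)]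
            holomorphic_on_subset[OF hol(2)[OF s] sub(1)] holomorphic_on_subset[OF hol(2)[OF t] sub(2)])+
      show "z \<in> ?M" using z by (auto simp: M_region_def min_def)
    qed (use eq[OF s t] in simp)
  qed
  \<comment> \<open>At each point the quotient is taken from any index whose denominator does not
    vanish there; different indices give the same value.\<close>
  define P where "P z t \<longleftrightarrow> t \<in> T \<and> z \<in> M_region t \<and> p t z \<noteq> 0" for z t
  define m where "m z = q (SOME t. P z t) z / p (SOME t. P z t) z" for z
  show ?thesis
  proof (rule that[of m])
    fix t z assume t: "t \<in> T" and z: "z \<in> M_region t" and p: "p t z \<noteq> 0"
    then have "P z (SOME t. P z t)" by (intro someI[of "P z" t]) (simp add: P_def)
    then have s: "(SOME t. P z t) \<in> T" "z \<in> M_region (SOME t. P z t)" "p (SOME t. P z t) z \<noteq> 0" by (simp_all add: P_def)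
    show "m z = q t z / p t z"
      unfolding m_def using cross[OF s(1) t s(2) z] s(3) p by (simp add: frac_eq_eq)
  qed
qed

text \<open>A zero of \<open>p\<close> has finite order because \<open>p\<close> is not identically
  zero on the connected region; that order is the exponent \<open>J\<close>, and the nonvanishing
  cofactor goes into \<open>h\<close>.\<close>

lemma quotient_local_form:
  assumes t: "t > 0" and p: "p holomorphic_on M_region t" and q: "q holomorphic_on M_region t"
    and nz: "c \<in> M_region t" "p c \<noteq> 0" and a: "a \<in> M_region t"
  obtains \<rho> J h where "\<rho> > 0" "ball a \<rho> \<subseteq> M_region t" "h holomorphic_on ball a \<rho>"
    "\<And>z. z \<in> ball a \<rho> - {a} \<Longrightarrow> p z \<noteq> 0 \<and> q z / p z = h z / (z - a) ^ J"
proof (cases "p a = 0")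
  case True
  have nc: "\<not> p constant_on M_region t" using True nz a unfolding constant_on_def by metis
  show ?thesis
  proof (rule holomorphic_factor_zero_nonconstant[OF p open_M_region connected_M_region[OF t] a True nc])
    fix g r n assume g: "0 < r" "ball a r \<subseteq> M_region t" "g holomorphic_on ball a r"
      "\<And>w. w \<in> ball a r \<Longrightarrow> p w = (w - a) ^ n * g w" "\<And>w. w \<in> ball a r \<Longrightarrow> g w \<noteq> 0"
    have "(\<lambda>z. q z / g z) holomorphic_on ball a r"
      using g(5) by (intro holomorphic_on_divide holomorphic_on_subset[OF q g(2)] g(3))
    moreover have "p z \<noteq> 0 \<and> q z / p z = q z / g z / (z - a) ^ n" if "z \<in> ball a r - {a}" for z
      using that g(4)[of z] g(5)[of z] by (simp add: mult.commute)
    ultimately show ?thesis using g(1,2) by (rule that[rotated 2])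
  qed
next
  case False
  have "isCont p a"
    using holomorphic_on_imp_continuous_on[OF p] open_M_region[of t] a by (simp add: continuous_on_eq_continuous_at)
  then obtain e where e: "e > 0" "\<And>z. dist a z < e \<Longrightarrow> p z \<noteq> 0" using continuous_at_avoid[where f = p and x = a and a = 0] False by blast
  obtain d where d: "d > 0" "ball a d \<subseteq> M_region t" using openE[OF open_M_region a] by blast
  have "(\<lambda>z. q z / p z) holomorphic_on ball a (min d e)"
    using d(2) e(2) by (intro holomorphic_on_divide holomorphic_on_subset[OF q] holomorphic_on_subset[OF p]) auto
  then show ?thesis
    using d e by (intro that[of "min d e" "\<lambda>z. q z / p z" 0]) auto
qed

text \<open>The Wronskian is constant and tends to zero at infinity, hence vanishes at
  \<open>1\<close>. This lets outgoing solutions from different truncations be compared.\<close>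

lemma decaying_solutions_dependent:
  assumes U: "schroedinger_sol V z U U'" and W: "schroedinger_sol V z W W'"
    and dU: "\<And>x. x \<ge> 1 \<Longrightarrow> norm (U x) \<le> C * exp (- (x / 2)) \<and> norm (U' x) \<le> C * exp (- (x / 2))"
    and dW: "\<And>x. x \<ge> 1 \<Longrightarrow> norm (W x) \<le> D * exp (- (x / 2)) \<and> norm (W' x) \<le> D * exp (- (x / 2))"
  shows "U' 1 * W 1 = W' 1 * U 1"
proof -
  have zero: "((\<lambda>x. exp (- (x / 2))) \<longlongrightarrow> (0::real)) at_top" by real_asymp
  have lim: "(f \<longlongrightarrow> 0) at_top" if "\<And>x. x \<ge> 1 \<Longrightarrow> norm (f x) \<le> K * exp (- (x / 2))" for f :: cfun and K
  proof (rule Lim_null_comparison)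
    show "((\<lambda>x. K * exp (- (x / 2))) \<longlongrightarrow> 0) at_top" using tendsto_mult_right_zero[OF zero] .
    show "eventually (\<lambda>x. norm (f x) \<le> K * exp (- (x / 2))) at_top"
      using eventually_ge_at_top[of 1] by eventually_elim (rule that)
  qed
  have "((\<lambda>x. U x * W' x - U' x * W x) \<longlongrightarrow> 0 * 0 - 0 * 0) at_top"
    by (intro tendsto_diff tendsto_mult lim[of U C] lim[of U' C] lim[of W D] lim[of W' D]) (simp_all add: dU dW)
  moreover have "eventually (\<lambda>x. U x * W' x - U' x * W x = U 1 * W' 1 - U' 1 * W 1) at_top"
    using eventually_ge_at_top[of 1] by eventually_elim (rule wronskian_constant[OF U W])
  ultimately have "((\<lambda>x::real. U 1 * W' 1 - U' 1 * W 1) \<longlongrightarrow> 0) at_top"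
    by (simp add: tendsto_cong)
  then have "U 1 * W' 1 - U' 1 * W 1 = 0" by (simp add: tendsto_const_iff)
  then show ?thesis by (simp add: algebra_simps)
qed

text \<open>The threshold \<open>1 + Vm\<close> serves two purposes: \<open>Im z \<ge> 1\<close>
  gives the decay, and the square of \<open>Im z\<close>, being at least \<open>Im z\<close>,
  exceeds \<open>Vm\<close> as the energy estimate demands.\<close>

lemma jost_data:
  assumes V: "bounded_potential V Vm" "\<And>x. x \<ge> 1 \<Longrightarrow> V x = inverse (of_real x) * W (1 / x)"
    and W: "W \<in> gevrey 2 \<sigma>" and t: "0 < t" "t < \<sigma>"
  shows "\<exists>p q. p holomorphic_on M_region t \<and> q holomorphic_on M_region t \<and>
    (\<forall>z. Im z > 1 + Vm \<longrightarrow> (\<exists>U U' K. decaying_solution V Vm z U U' K \<and> p z = U 1 \<and> q z = U' 1))"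
proof -
  obtain b \<kappa> B R where G: "b \<in> borel_measurable borel" "B \<ge> 0"
    "\<And>t. t \<ge> 0 \<Longrightarrow> norm (b t) \<le> B" "\<And>t. t \<ge> 0 \<Longrightarrow> norm (b t - \<kappa>) \<le> B * t"
    "\<And>x. x \<ge> 1 \<Longrightarrow> norm (V x - laplace b x) \<le> R * exp (- (t * x))"
    by (rule gevrey_decomposition[OF W t V(2)]) ((assumption | (rule that; assumption))+)
  interpret outgoing b \<kappa> B V Vm t R
    using V(1) G by (intro outgoing.intro laplace_potential.intro outgoing_axioms.intro)
  note J = jost_solution[OF t(1)]
  have "\<exists>U U' K. decaying_solution V Vm z U U' K \<and> jost z 1 = U 1 \<and> jost' z 1 = U' 1" if z: "Im z > 1 + Vm" for z
  proof -
    have im: "Im z \<ge> 1" using z Vm_nonneg by simp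
    then have M: "z \<in> M_region t" using t by (intro upper_half_plane_M_region) auto
    obtain C where C: "\<forall>x\<ge>1. norm (jost z x) \<le> C * exp (- (x / 2)) \<and> norm (jost' z x) \<le> C * exp (- (x / 2))"
      using J(5)[OF M im] by blast
    have "Im z * 1 \<le> Im z * Im z" using im by (intro mult_left_mono) auto
    then have sq: "(Im z)\<^sup>2 > Vm" using z by (simp add: power2_eq_square)
    have "decaying_solution V Vm z (jost z) (jost' z) C"
      using J(3)[OF M] J(4)[OF M] C im sq bounded_potential_axioms
      by (intro decaying_solution.intro decaying_solution_axioms.intro) auto
    then show ?thesis by blast
  qed
  then show ?thesis using J(1,2)
    by (intro exI[of _ "\<lambda>z. jost z 1"] exI[of _ "\<lambda>z. jost' z 1"]) blast
qed

lemma gevrey_bounded_potential: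
  assumes V: "\<And>x. x \<ge> 1 \<Longrightarrow> V x = inverse (of_real x) * W (1 / x)" and W: "W \<in> gevrey 2 \<sigma>" "\<sigma> > 0"
  obtains Vm where "bounded_potential V Vm"
proof -
  obtain D C where D: "D 0 = W" "C \<ge> 0"
    "\<And>n x. x \<in> {0..1} \<Longrightarrow> (D n has_vector_derivative D (Suc n) x) (at x within {0..1})"
    "\<And>n x. x \<in> {0..1} \<Longrightarrow> norm (D n x) \<le> C / \<sigma> ^ n * (fact n)\<^sup>2"
    by (rule gevrey_derivatives[OF W]) (rule that; assumption)
  have c: "continuous_on {0..1} W"
    unfolding continuous_on_eq_continuous_within D(1)[symmetric] using has_vector_derivative_continuous[OF D(3)] by blast
  have "bounded_potential V C"
  proof
    have "continuous_on {1..} (\<lambda>x::real. W (1 / x))"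
      by (rule continuous_on_compose2[OF c]) (auto intro!: continuous_intros)
    then have "continuous_on {1..} (\<lambda>x. inverse (complex_of_real x) * W (1 / x))"
      by (intro continuous_intros) auto
    then show "continuous_on {1..} V" by (rule continuous_on_eq) (simp add: V)
    fix x :: real assume x: "1 \<le> x"
    have "norm (W (1 / x)) \<le> C" using D(4)[of "1 / x" 0] x by (simp add: D(1))
    moreover have "norm (inverse (complex_of_real x)) \<le> 1" using x by (simp add: norm_inverse inverse_le_1_iff)
    ultimately have "norm (inverse (complex_of_real x)) * norm (W (1 / x)) \<le> 1 * C" by (intro mult_mono) auto
    then show "norm (V x) \<le> C" by (simp add: V[OF x] norm_mult)
  qed
  then show ?thesis by (rule that)
qed

text \<open>A solution continued up to \<open>M_region t\<close> is available for each \<open>t < \<sigma>\<close> separately; the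
  quotients \<open>U' 1 / U 1\<close> agree high in the upper half-plane and hence everywhere.\<close>

lemma gevrey_resolvent_continuation:
  assumes V: "\<And>x. x \<ge> 1 \<Longrightarrow> V x = inverse (of_real x) * W (1 / x)"
    and T: "T \<noteq> {}" "\<And>t. t \<in> T \<Longrightarrow> t > 0" "\<And>t. t \<in> T \<Longrightarrow> \<exists>\<sigma>>t. W \<in> gevrey 2 \<sigma>"
  shows "resolvent_continues_meromorphically V (\<Union>t\<in>T. M_region t)"
proof -
  obtain t0 where t0: "t0 \<in> T" using T(1) by blast
  obtain \<sigma>0 where \<sigma>0: "\<sigma>0 > t0" "W \<in> gevrey 2 \<sigma>0" using T(3)[OF t0] by blast
  have "\<sigma>0 > 0" using \<sigma>0(1) T(2)[OF t0] by simp
  from gevrey_bounded_potential[OF V \<sigma>0(2) this] obtain Vm where bp: "bounded_potential V Vm" by blast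
  interpret bounded_potential V Vm by (rule bp)
  define good where "good t p q \<longleftrightarrow> p holomorphic_on M_region t \<and> q holomorphic_on M_region t \<and>
    (\<forall>z. Im z > 1 + Vm \<longrightarrow> (\<exists>U U' K. decaying_solution V Vm z U U' K \<and> p z = U 1 \<and> q z = U' 1))" for t p q
  have "\<forall>t\<in>T. \<exists>p q. good t p q"
    unfolding good_def using jost_data[OF bp V] T(2,3) by meson
  then obtain p q where pq: "\<And>t. t \<in> T \<Longrightarrow> good t (p t) (q t)" by metis
  have hol: "p t holomorphic_on M_region t" "q t holomorphic_on M_region t" if "t \<in> T" for t
    using pq[OF that] by (auto simp: good_def)
  have dec: "\<exists>U U' K. decaying_solution V Vm z U U' K \<and> p t z = U 1 \<and> q t z = U' 1" if "t \<in> T" "Im z > 1 + Vm" for t z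
    using pq[OF that(1)] that(2) by (auto simp: good_def)
  have nz: "p t z \<noteq> 0" if "t \<in> T" "Im z > 1 + Vm" for t z
    using dec[OF that] decaying_solution.U_1 by metis
  have eq: "q s z * p t z = q t z * p s z" if s: "s \<in> T" and t: "t \<in> T" and z: "Im z > 1 + Vm" for s t z
  proof -
    obtain U U' K where U: "decaying_solution V Vm z U U' K" "p s z = U 1" "q s z = U' 1" using dec[OF s z] by blast
    obtain Y Y' L where Y: "decaying_solution V Vm z Y Y' L" "p t z = Y 1" "q t z = Y' 1" using dec[OF t z] by blast
    show ?thesis
      unfolding U(2,3) Y(2,3)
      by (rule decaying_solutions_dependent[OF decaying_solution.U[OF U(1)] decaying_solution.U[OF Y(1)], of K L])
        (simp_all add: decaying_solution.decay[OF U(1)] decaying_solution.decay[OF Y(1)])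
  qed
  have b0: "1 + Vm \<ge> 0" using Vm_nonneg by simp
  obtain m where m: "\<And>t z. t \<in> T \<Longrightarrow> z \<in> M_region t \<Longrightarrow> p t z \<noteq> 0 \<Longrightarrow> m z = q t z / p t z"
    by (rule glue_quotients[OF T(2) b0 hol eq]) (assumption | blast)+
  \<comment> \<open>A point of every region at which no denominator vanishes; it shows that the
    zeros of \<open>p t\<close> have finite order.\<close>
  define c where "c = \<i> * complex_of_real (2 + Vm)"
  have c: "Im c > 1 + Vm" by (simp add: c_def)
  have up: "z \<in> M_region t" if "t \<in> T" "Im z > 1 + Vm" for t z
    using that T(2) Vm_nonneg by (intro upper_half_plane_M_region) auto
  show ?thesis
  proof (rule resolvent_continuation[where m = m and b = "1 + Vm"])
    fix a assume "a \<in> (\<Union>t\<in>T. M_region t)"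
    then obtain t where t: "t \<in> T" and a: "a \<in> M_region t" by blast
    obtain \<rho> J h where \<rho>: "\<rho> > 0" "ball a \<rho> \<subseteq> M_region t" "h holomorphic_on ball a \<rho>"
      and h: "\<And>z. z \<in> ball a \<rho> - {a} \<Longrightarrow> p t z \<noteq> 0 \<and> q t z / p t z = h z / (z - a) ^ J"
      by (rule quotient_local_form[OF T(2)[OF t] hol[OF t] up[OF t c] nz[OF t c] a]) (rule that; assumption)
    have "m z = h z / (z - a) ^ J" if "z \<in> ball a \<rho> - {a}" for z
      using m[OF t, of z] h[OF that] \<rho>(2) that by auto
    then show "\<exists>\<rho>>0. \<exists>J h. h holomorphic_on ball a \<rho> \<and> (\<forall>z\<in>ball a \<rho> - {a}. m z = h z / (z - a) ^ J)"
      using \<rho> by blast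
  next
    fix z assume z: "Im z > 1 + Vm"
    have "m z = q t0 z / p t0 z" by (rule m[OF t0 up[OF t0 z] nz[OF t0 z]])
    then show "z \<in> (\<Union>t\<in>T. M_region t) \<and> (\<exists>U U' K. decaying_solution V Vm z U U' K \<and> m z = U' 1 / U 1)"
      using dec[OF t0 z] up[OF t0 z] t0 by (metis UN_I)
  qed
qed

theorem mainTheorem1:
  fixes V W :: "real \<Rightarrow> complex"
  assumes "\<And>x. x \<ge> 1 \<Longrightarrow> V x = inverse (of_real x) * W (1 / x)"
  shows "(\<forall>\<sigma>>0. W \<in> gevrey 2 \<sigma> \<longrightarrow>
            resolvent_continues_meromorphically V (M_region \<sigma>)) \<and>
         (W \<in> beurling_gevrey 2 \<longrightarrow>
            resolvent_continues_meromorphically V (- neg_imag_axis))"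
proof (intro conjI allI impI)
  fix \<sigma> :: real assume \<sigma>: "\<sigma> > 0" and W: "W \<in> gevrey 2 \<sigma>"
  \<comment> \<open>The bound on \<open>Im z\<close> in the region is strict, so every point is
    already reached by some rate below \<open>\<sigma>\<close>.\<close>
  have "(\<Union>t\<in>{0<..<\<sigma>}. M_region t) = M_region \<sigma>"
  proof (intro equalityI subsetI)
    fix z assume z: "z \<in> M_region \<sigma>"
    obtain t where t: "max 0 (- 2 * Im z) < t" "t < \<sigma>"
      using dense[of "max 0 (- 2 * Im z)" \<sigma>] \<sigma> z by (auto simp: M_region_def)
    then have "z \<in> M_region t" using z by (auto simp: M_region_def)
    then show "z \<in> (\<Union>t\<in>{0<..<\<sigma>}. M_region t)" using t by auto
  qed (auto simp: M_region_def)
  moreover have "resolvent_continues_meromorphically V (\<Union>t\<in>{0<..<\<sigma>}. M_region t)"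
    using \<sigma> W by (intro gevrey_resolvent_continuation[OF assms]) auto
  ultimately show "resolvent_continues_meromorphically V (M_region \<sigma>)" by simp
next
  assume W: "W \<in> beurling_gevrey 2"
  have "(\<Union>t\<in>{0<..}. M_region t) = - neg_imag_axis"
  proof (intro equalityI subsetI)
    fix z assume z: "z \<in> - neg_imag_axis"
    have "z \<in> M_region (2 * \<bar>Im z\<bar> + 1)" using z by (auto simp: M_region_def)
    then show "z \<in> (\<Union>t\<in>{0<..}. M_region t)" by (intro UN_I[of "2 * \<bar>Im z\<bar> + 1"]) auto
  qed (auto simp: M_region_def)
  moreover have "resolvent_continues_meromorphically V (\<Union>t\<in>{0<..}. M_region t)"
  \<comment> \<open>Every rate is available here, since the class with parameter
    \<open>t + 1\<close> contains \<open>W\<close>.\<close>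
  proof (rule gevrey_resolvent_continuation[OF assms])
    fix t :: real assume "t \<in> {0<..}"
    then have "W \<in> gevrey 2 (t + 1)" using W by (auto simp: beurling_gevrey_def)
    then show "\<exists>\<sigma>>t. W \<in> gevrey 2 \<sigma>" by (intro exI[of _ "t + 1"]) simp
  qed auto
  ultimately show "resolvent_continues_meromorphically V (- neg_imag_axis)" by simp
qed

end
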